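(* Let $m\ge 1$ and $p,q\ge 1$ be integers. A connected $m$-colored quiver $Q$ is mutation equivalent to (a quiver isomorphic to) $\widetilde{A}_{p,q}$ if and only if $Q$ belongs to the class $\mathcal{Q}^m_{p,q}$.
   Context: **Colored quivers.** Fix an integer $m\ge 1$. An $m$-colored quiver $Q$ is a finite quiver with vertex set $Q_0$ in which every arrow carries a color in $\{0,1,\dots,m\}$; $q_{ij}^{(c)}$ is the number of arrows $i\to j$ of color $c$. All $m$-colored quivers are assumed to have no loops ($q_{ii}^{(c)}=0$), to be monochromatic (if $q_{ij}^{(c)}\ne 0$ then $q_{ij}^{(c')}=0$ for all $c'\neq c$) and skew-symmetric ($q_{ij}^{(c)}=q_{ji}^{(m-c)}$). So arrows come in opposite pairs of colors $c$ and $m-c$; the underlying graph is obtained by replacing each such pair by one edge. Specifying "an arrow $i\to j$ of color $c$" implicitly specifies the opposite arrow $j\to i$ of color $m-c$. Two vertices are neighbors if there are arrows between them. $Q$ is simple if $\sum_c q_{ij}^{(c)}\le 1$ for all $i\ne j$. $\overline{ij}$ denotes the color of the arrow(s) $i\to j$. A cycle $(x_1x_2\cdots x_k)$ consists of arrows $x_1\to x_2\to\cdots\to x_k\to x_1$ with distinct $x_i$, and $\overline{(x_1\cdots x_k)}$ is the sum of their colors. $Q[I]$ is the induced subquiver on $I\subseteq Q_0$. A hole is a set of at least four vertices inducing a subquiver whose underlying graph is a cycle. A clique is a set of pairwise neighboring vertices (identified with the induced subquiver). A triangle is a 3-element clique; a triangle $(xyz)$ is $m$-admissible if $\overline{xy}+\overline{yz}+\overline{zx}\in\{m-1,2m+1\}$.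 **Mutation.** The mutation $\mu_j(Q)$ at a vertex $j$ is obtained by: (1) for each pair of arrows $i\xrightarrow{(c)}j\xrightarrow{(0)}k$ with $i\ne k$ and $c$ any color, add an arrow $i\to k$ of color $c$ and an arrow $k\to i$ of color $m-c$; (2) if between two vertices there are now arrows (in the same direction) of two different colors, cancel equal numbers of arrows of each color until the quiver is monochromatic; (3) add $1$ to the color of each arrow ending at $j$ and subtract $1$ from the color of each arrow starting at $j$, modulo $m+1$. Two quivers are mutation equivalent if one is obtained from the other by a finite sequence of mutations; quivers are considered up to relabelling of vertices. **The quiver $\widetilde A_{p,q}$** ($p,q\ge1$): vertices $1,\dots,p+q$, with arrows of color $0$: $1\to2\to\cdots\to p\to p+1$ ($p$ arrows) and $1\to p+q\to p+q-1\to\cdots\to p+2\to p+1$ ($q$ arrows), together with the opposite arrows of color $m$. (For $p=q=1$: two parallel arrows $1\to 2$ of color $0$.) **The class $\mathcal{Q}^m_n$**: connected simple $m$-colored quivers with $n$ vertices and no holes such that (i) for every vertex $v$ with $z\ge1$ neighbors there are cliques $\mathcal C$ and $\mathcal B$, of sizes $r,k\le m+2$, with $\mathcal C\cap\mathcal B=\{v\}$, $r+k=z+2$ (so the neighbors of $v$ are exactly the vertices of $(\mathcal C\cup\mathcal B)\setminus\{v\}$), and no arrows between $\mathcal C\setminus\{v\}$ and $\mathcal B\setminus\{v\}$; (ii) every triangle is $m$-admissible. **The class $\mathcal{Q}^m_{p,q}$.** A cycle $(a_1\cdots a_l)$ is $(l,h)$-central if $h$ is an integer with $0<h<l$ and $\overline{(a_1\cdots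 a_l)}=h\cdot m$. $\mathcal{Q}^m_{p,q}$ is the class of connected $m$-colored quivers $Q$ with $p+q$ vertices such that: (a) There is a unique set of vertices $\{a_1,\dots,a_l\}$, $l\ge2$ (the central vertices), such that $Q[a_1,\dots,a_l]$ is a cycle $\Delta=\Delta_l^m=(a_1\cdots a_l)$ that is $(l,h)$-central for some $h$; for $l=2$ this means that $a_1,a_2$ are joined by two parallel pairs of opposite arrows (then $h=1$). (b) If $l=2$, then $q_{a_1a_2}^{(c)}=q_{a_2a_1}^{(m-c)}=2$ for some $c$, and for every other pair of distinct vertices there is at most one arrow from the first to the second. If $l\ge3$, $Q$ is simple. (c) If $l\le 3$, $Q$ has no holes; if $l\ge4$, the only hole of $Q$ is $\{a_1,\dots,a_l\}$. (d) For every vertex $v$ with $z\ge1$ neighbors there are cliques $\mathcal C,\mathcal B$ of sizes $r,k$ with $1\le r,k\le m+2$ and $v\in\mathcal C\cap\mathcal B$, whose union is $v$ together with all its neighbors. If $l\geq 3$ or $v$ is not central, then $\mathcal C\cap\mathcal B=\{v\}$, $z=r+k-2$, and there are no arrows between $u\in\mathcal C\setminus\{v\}$ and $w\in\mathcal B\setminus\{v\}$, except when $l=3$ and $\{u,v,w\}=\{a_1,a_2,a_3\}$. If $l=2$ and $v\in\{a_1,a_2\}$, then $\mathcal C\cap\mathcal B=\{a_1,a_2\}$, $z=r+k-3$, and there are no arrows between $\mathcal C\setminus\{a_1,a_2\}$ and $\mathcal B\setminus\{a_1,a_2\}$. (e) For each arrow $\alpha_i:a_i\to a_{i+1}$ of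 $\Delta$ (indices mod $l$) there is a unique maximal clique $D_i\supseteq\{a_i,a_{i+1}\}$ (other than $\{a_1,a_2,a_3\}$ if $l=3$), and it has size at most $m+2$; for $l=2$, $D_1,D_2$ are the two cliques in (d) at the central vertices, each regarded as containing one of the two parallel pairs of arrows, $D_1$ corresponding to $\alpha_1:a_1\to a_2$ and $D_2$ to $\alpha_2:a_2\to a_1$. $D_i$ is called a boundary subquiver (it may be just $\{a_i,a_{i+1}\}$). (f) Every triangle is $m$-admissible, except $\Delta_3^m$ if $l=3$. (g) The vertices in $D_i\setminus\{a_i,a_{i+1}\}$ are called peripheral; $W$ is the set of all peripheral vertices. Each $w\in W$ lies in $D_i$ for a unique $i$; put $T_w=(a_i\,a_{i+1}\,w)$. Let $W_p=\{w\in W:\overline{T_w}=m-1\}$ and $W_q=\{w\in W:\overline{T_w}=2m+1\}$. Removing from $Q$ all arrows of all $D_i$ and all central vertices leaves a disjoint union $\bigsqcup_{w\in W}Q_w$ of connected quivers with $w\in Q_w$ and $Q_w\in\mathcal{Q}^m_{n_w}$, where $n_w=|(Q_w)_0|$. With $x_p=\sum_{w\in W_p}n_w$ and $x_q=\sum_{w\in W_q}n_w$, one has $p=l-h+x_p$ and $q=h+x_q$, for a suitable choice of the direction of $\Delta$ (reversing it replaces $h$ by $l-h$ and interchanges $W_p$ and $W_q$).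
   Formalization: "Mutation equivalent" is taken to mean that each quiver is obtained from the other by a finite sequence of mutations; with only one direction required the claim fails, since mutation is not invertible on arbitrary m-colored quivers. *)

theory Defs
  imports Main
begin

text \<open>\<open>arr Q i j c\<close> is the number of arrows \<open>i \<rightarrow> j\<close> of color \<open>c\<close>.\<close>

record 'a cquiver =
  verts :: "'a set"
  arr :: "'a \<Rightarrow> 'a \<Rightarrow> nat \<Rightarrow> nat"

definition colored_quiver :: "nat \<Rightarrow> 'a cquiver \<Rightarrow> bool" where
  "colored_quiver m Q \<longleftrightarrow>
     finite (verts Q) \<and>
     (\<forall>i j c. arr Q i j c \<noteq> 0 \<longrightarrow> i \<in> verts Q \<and> j \<in> verts Q \<and> c \<le> m) \<and>
     (\<forall>i c. arr Q i i c = 0) \<and>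
     (\<forall>i j c c'. arr Q i j c \<noteq> 0 \<and> c' \<noteq> c \<longrightarrow> arr Q i j c' = 0) \<and>
     (\<forall>i j c. c \<le> m \<longrightarrow> arr Q i j c = arr Q j i (m - c))"

definition mult :: "nat \<Rightarrow> 'a cquiver \<Rightarrow> 'a \<Rightarrow> 'a \<Rightarrow> nat" where
  "mult m Q i j = (\<Sum>c\<le>m. arr Q i j c)"

definition simple :: "nat \<Rightarrow> 'a cquiver \<Rightarrow> bool" where
  "simple m Q \<longleftrightarrow> (\<forall>i\<in>verts Q. \<forall>j\<in>verts Q. i \<noteq> j \<longrightarrow> mult m Q i j \<le> 1)"

definition neighbor :: "'a cquiver \<Rightarrow> 'a \<Rightarrow> 'a \<Rightarrow> bool" where
  "neighbor Q i j \<longleftrightarrow> (\<exists>c. arr Q i j c \<noteq> 0)"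

definition neighbors :: "'a cquiver \<Rightarrow> 'a \<Rightarrow> 'a set" where
  "neighbors Q v = {u \<in> verts Q. neighbor Q v u}"

text \<open>Meaningful only when \<open>i\<close> and \<open>j\<close> are neighbors; the color is then unique, because
  quivers are monochromatic.\<close>

definition color :: "'a cquiver \<Rightarrow> 'a \<Rightarrow> 'a \<Rightarrow> nat" where
  "color Q i j = (THE c. arr Q i j c \<noteq> 0)"

definition component :: "'a cquiver \<Rightarrow> 'a \<Rightarrow> 'a set" where
  "component Q v = {u \<in> verts Q. (neighbor Q)\<^sup>*\<^sup>* v u}"

definition connected_quiver :: "'a cquiver \<Rightarrow> bool" where
  "connected_quiver Q \<longleftrightarrow>
     verts Q \<noteq> {} \<and> (\<forall>u\<in>verts Q. \<forall>v\<in>verts Q. (neighbor Q)\<^sup>*\<^sup>* u v)"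

definition induced :: "'a cquiver \<Rightarrow> 'a set \<Rightarrow> 'a cquiver" where
  "induced Q I =
     \<lparr>verts = I, arr = (\<lambda>i j c. if i \<in> I \<and> j \<in> I then arr Q i j c else 0)\<rparr>"

definition cyc_next :: "'a list \<Rightarrow> nat \<Rightarrow> 'a" where
  "cyc_next xs i = xs ! (Suc i mod length xs)"

text \<open>The underlying graph of the subquiver induced on \<open>set xs\<close> is the cycle \<open>xs\<close>
  (with at least three vertices): one edge between cyclically consecutive vertices, none between
  the others.\<close>

definition induces_cycle :: "nat \<Rightarrow> 'a cquiver \<Rightarrow> 'a list \<Rightarrow> bool" where
  "induces_cycle m Q xs \<longleftrightarrow>
     3 \<le> length xs \<and> distinct xs \<and> set xs \<subseteq> verts Q \<and>
     (\<forall>i<length xs. \<forall>j<length xs.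
        mult m Q (xs ! i) (xs ! j) =
          (if j = Suc i mod length xs \<or> i = Suc j mod length xs then 1 else 0))"

definition hole :: "nat \<Rightarrow> 'a cquiver \<Rightarrow> 'a set \<Rightarrow> bool" where
  "hole m Q S \<longleftrightarrow> 4 \<le> card S \<and> (\<exists>xs. set xs = S \<and> induces_cycle m Q xs)"

definition clique :: "'a cquiver \<Rightarrow> 'a set \<Rightarrow> bool" where
  "clique Q C \<longleftrightarrow> C \<subseteq> verts Q \<and> (\<forall>u\<in>C. \<forall>v\<in>C. u \<noteq> v \<longrightarrow> neighbor Q u v)"

definition triangle_color :: "'a cquiver \<Rightarrow> 'a \<Rightarrow> 'a \<Rightarrow> 'a \<Rightarrow> nat" where
  "triangle_color Q x y z = color Q x y + color Q y z + color Q z x"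

definition triangle :: "'a cquiver \<Rightarrow> 'a \<Rightarrow> 'a \<Rightarrow> 'a \<Rightarrow> bool" where
  "triangle Q x y z \<longleftrightarrow> card {x, y, z} = 3 \<and> clique Q {x, y, z}"

definition admissible :: "nat \<Rightarrow> 'a cquiver \<Rightarrow> 'a \<Rightarrow> 'a \<Rightarrow> 'a \<Rightarrow> bool" where
  "admissible m Q x y z \<longleftrightarrow> triangle_color Q x y z \<in> {m - 1, 2 * m + 1}"

text \<open>Mutation at \<open>j\<close>. \<open>new_arrows m Q j i k c\<close> counts the arrows \<open>i \<rightarrow> k\<close> of color \<open>c\<close> added
  because of paths \<open>i \<rightarrow> j \<rightarrow> k\<close> (first summand) and, as opposite arrows, because of paths
  \<open>k \<rightarrow> j \<rightarrow> i\<close> (second summand).\<close>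

definition new_arrows :: "nat \<Rightarrow> 'a cquiver \<Rightarrow> 'a \<Rightarrow> 'a \<Rightarrow> 'a \<Rightarrow> nat \<Rightarrow> nat" where
  "new_arrows m Q j i k c =
     (if c \<le> m \<and> i \<noteq> k
      then arr Q i j c * arr Q j k 0 + arr Q k j (m - c) * arr Q j i 0 else 0)"

text \<open>Cancelling equal numbers of arrows of two different colors until one color is left.\<close>

definition cancel :: "nat \<Rightarrow> (nat \<Rightarrow> nat) \<Rightarrow> nat \<Rightarrow> nat" where
  "cancel m f c = f c - (\<Sum>t\<in>{..m} - {c}. f t)"

text \<open>The added arrows \<open>i \<rightarrow> k\<close> have two colors only if \<open>arr Q i j m\<close> and \<open>arr Q j k 0\<close> are both
  nonzero; then equal numbers of colors \<open>m\<close> and \<open>0\<close> have been added. These are cancelled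
  first, so that at most two colors compete in the second cancellation. If the arrows already
  present have one of the colors of the added ones, a single cancellation gives the same result.\<close>

definition arrows_cancelled :: "nat \<Rightarrow> 'a cquiver \<Rightarrow> 'a \<Rightarrow> 'a \<Rightarrow> 'a \<Rightarrow> nat \<Rightarrow> nat" where
  "arrows_cancelled m Q j i k =
     cancel m (\<lambda>c. arr Q i k c + cancel m (new_arrows m Q j i k) c)"

text \<open>Adding 1 to the colors modulo \<open>m + 1\<close> means that the new number for \<open>c\<close> is the old
  number for \<open>c - 1 \<equiv> c + m\<close>.\<close>

definition mutate :: "nat \<Rightarrow> 'a \<Rightarrow> 'a cquiver \<Rightarrow> 'a cquiver" where
  "mutate m j Q =
     \<lparr>verts = verts Q,
      arr = (\<lambda>i k c.
        if c > m then 0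
        else if k = j then arrows_cancelled m Q j i k ((c + m) mod (m + 1))
        else if i = j then arrows_cancelled m Q j i k ((c + 1) mod (m + 1))
        else arrows_cancelled m Q j i k c)\<rparr>"

definition obtained_by_mutations :: "nat \<Rightarrow> 'a cquiver \<Rightarrow> 'a cquiver \<Rightarrow> bool" where
  "obtained_by_mutations m = (\<lambda>Q R. \<exists>j\<in>verts Q. R = mutate m j Q)\<^sup>*\<^sup>*"

text \<open>Mutation is not injective on arbitrary colored quivers (cancellation can lose the color
  of an arrow), so reachability alone is not a symmetric relation. On quivers
  obtained from \<open>A_tilde\<close> mutation at a vertex is periodic of period \<open>m + 1\<close>, so there each
  mutation can be undone by further mutations.\<close>

definition mutation_equivalent :: "nat \<Rightarrow> 'a cquiver \<Rightarrow> 'a cquiver \<Rightarrow> bool" where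
  "mutation_equivalent m Q R \<longleftrightarrow>
     obtained_by_mutations m Q R \<and> obtained_by_mutations m R Q"

definition quiver_iso :: "'a cquiver \<Rightarrow> 'b cquiver \<Rightarrow> bool" where
  "quiver_iso Q R \<longleftrightarrow>
     (\<exists>f. bij_betw f (verts Q) (verts R) \<and>
          (\<forall>i\<in>verts Q. \<forall>j\<in>verts Q. \<forall>c. arr Q i j c = arr R (f i) (f j) c))"

text \<open>Number of color 0 arrows \<open>i \<rightarrow> k\<close>: along \<open>1 \<rightarrow> 2 \<rightarrow> \<dots> \<rightarrow> p + 1\<close> and along
  \<open>1 \<rightarrow> p + q \<rightarrow> p + q - 1 \<rightarrow> \<dots> \<rightarrow> p + 1\<close>. Both summands are 1 for \<open>i = 1\<close>, \<open>k = 2\<close> if \<open>p = q = 1\<close>.\<close>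

definition A_tilde_arrows :: "nat \<Rightarrow> nat \<Rightarrow> nat \<Rightarrow> nat \<Rightarrow> nat" where
  "A_tilde_arrows p q i k =
     (if 1 \<le> i \<and> i \<le> p \<and> k = i + 1 then 1 else 0) +
     (if (i = 1 \<and> k = p + q) \<or> (p + 1 \<le> k \<and> k < p + q \<and> i = k + 1) then 1 else 0)"

definition A_tilde :: "nat \<Rightarrow> nat \<Rightarrow> nat \<Rightarrow> nat cquiver" where
  "A_tilde m p q =
     \<lparr>verts = {1..p + q},
      arr = (\<lambda>i k c. (if c = 0 then A_tilde_arrows p q i k else 0) +
                     (if c = m then A_tilde_arrows p q k i else 0))\<rparr>"

text \<open>\<open>class_A m n\<close> is \<open>\<Q>\<^sup>m\<^sub>n\<close>.\<close>

definition class_A :: "nat \<Rightarrow> nat \<Rightarrow> 'a cquiver set" where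
  "class_A m n = {Q.
     colored_quiver m Q \<and> connected_quiver Q \<and> simple m Q \<and> card (verts Q) = n \<and>
     (\<forall>S. \<not> hole m Q S) \<and>
     (\<forall>v\<in>verts Q. card (neighbors Q v) \<ge> 1 \<longrightarrow>
        (\<exists>C B. clique Q C \<and> clique Q B \<and> card C \<le> m + 2 \<and> card B \<le> m + 2 \<and>
           C \<inter> B = {v} \<and> card C + card B = card (neighbors Q v) + 2 \<and>
           (\<forall>u\<in>C - {v}. \<forall>w\<in>B - {v}. \<not> neighbor Q u w))) \<and>
     (\<forall>x y z. triangle Q x y z \<longrightarrow> admissible m Q x y z)}"

text \<open>The cycle \<open>(a\<^sub>1 \<dots> a\<^sub>l)\<close> is the list \<open>xs\<close>, with \<open>a\<^sub>1\<close> at index 0.\<close>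

definition central :: "nat \<Rightarrow> 'a cquiver \<Rightarrow> 'a list \<Rightarrow> nat \<Rightarrow> bool" where
  "central m Q xs h \<longleftrightarrow>
     0 < h \<and> h < length xs \<and> (\<Sum>i<length xs. color Q (xs ! i) (cyc_next xs i)) = h * m"

definition central_cycle :: "nat \<Rightarrow> 'a cquiver \<Rightarrow> 'a list \<Rightarrow> nat \<Rightarrow> bool" where
  "central_cycle m Q xs h \<longleftrightarrow>
     2 \<le> length xs \<and> central m Q xs h \<and>
     (if length xs = 2
      then distinct xs \<and> set xs \<subseteq> verts Q \<and> mult m Q (xs ! 0) (xs ! 1) = 2
      else induces_cycle m Q xs)"

text \<open>The two cliques required at a vertex \<open>v\<close>, where \<open>S\<close> is the set of central vertices.\<close>

definition vertex_cliques :: "nat \<Rightarrow> 'a cquiver \<Rightarrow> 'a set \<Rightarrow> 'a \<Rightarrow> 'a set \<Rightarrow> 'a set \<Rightarrow> bool" where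
  "vertex_cliques m Q S v C B \<longleftrightarrow>
     clique Q C \<and> clique Q B \<and>
     1 \<le> card C \<and> card C \<le> m + 2 \<and> 1 \<le> card B \<and> card B \<le> m + 2 \<and>
     v \<in> C \<inter> B \<and> C \<union> B = insert v (neighbors Q v) \<and>
     (if card S \<ge> 3 \<or> v \<notin> S
      then C \<inter> B = {v} \<and> card (neighbors Q v) + 2 = card C + card B \<and>
           (\<forall>u\<in>C - {v}. \<forall>w\<in>B - {v}. neighbor Q u w \<longrightarrow> card S = 3 \<and> {u, v, w} = S)
      else C \<inter> B = S \<and> card (neighbors Q v) + 3 = card C + card B \<and>
           (\<forall>u\<in>C - S. \<forall>w\<in>B - S. \<not> neighbor Q u w))"

text \<open>If \<open>l = 3\<close>, maximality is understood among the cliques other than the central triangle, so that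
  \<open>{a\<^sub>i, a\<^sub>i\<^sub>+\<^sub>1}\<close> can be a boundary clique.\<close>

definition boundary_candidate :: "'a cquiver \<Rightarrow> 'a list \<Rightarrow> nat \<Rightarrow> 'a set \<Rightarrow> bool" where
  "boundary_candidate Q xs i C \<longleftrightarrow>
     clique Q C \<and> {xs ! i, cyc_next xs i} \<subseteq> C \<and> \<not> (length xs = 3 \<and> C = set xs)"

definition max_boundary_clique :: "'a cquiver \<Rightarrow> 'a list \<Rightarrow> nat \<Rightarrow> 'a set \<Rightarrow> bool" where
  "max_boundary_clique Q xs i C \<longleftrightarrow>
     boundary_candidate Q xs i C \<and> (\<forall>C'. boundary_candidate Q xs i C' \<longrightarrow> \<not> C \<subset> C')"

text \<open>\<open>D i\<close> is the boundary clique of the arrow \<open>xs ! i \<rightarrow> cyc_next xs i\<close>. For \<open>l = 2\<close>, which of the two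
  cliques belongs to which arrow is a choice; exchanging them amounts to reversing the
  central cycle.\<close>

definition boundary_cliques :: "nat \<Rightarrow> 'a cquiver \<Rightarrow> 'a list \<Rightarrow> (nat \<Rightarrow> 'a set) \<Rightarrow> bool" where
  "boundary_cliques m Q xs D \<longleftrightarrow>
     (if length xs = 2 then \<forall>v\<in>set xs. vertex_cliques m Q (set xs) v (D 0) (D 1)
      else \<forall>i<length xs. (\<exists>!C. max_boundary_clique Q xs i C) \<and>
             max_boundary_clique Q xs i (D i) \<and> card (D i) \<le> m + 2)"

definition peripheral_at :: "'a list \<Rightarrow> (nat \<Rightarrow> 'a set) \<Rightarrow> nat \<Rightarrow> 'a set" where
  "peripheral_at xs D i = D i - {xs ! i, cyc_next xs i}"

definition peripheral :: "'a list \<Rightarrow> (nat \<Rightarrow> 'a set) \<Rightarrow> 'a set" where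
  "peripheral xs D = (\<Union>i<length xs. peripheral_at xs D i)"

text \<open>For \<open>s = m - 1\<close> and \<open>s = 2 * m + 1\<close> these are the sets \<open>W\<^sub>p\<close> and \<open>W\<^sub>q\<close>.\<close>

definition peripheral_of_color ::
    "'a cquiver \<Rightarrow> 'a list \<Rightarrow> (nat \<Rightarrow> 'a set) \<Rightarrow> nat \<Rightarrow> 'a set" where
  "peripheral_of_color Q xs D s =
     {w. \<exists>i<length xs. w \<in> peripheral_at xs D i \<and>
           triangle_color Q (xs ! i) (cyc_next xs i) w = s}"

definition remove_boundary :: "'a cquiver \<Rightarrow> 'a list \<Rightarrow> (nat \<Rightarrow> 'a set) \<Rightarrow> 'a cquiver" where
  "remove_boundary Q xs D =
     induced
       (Q\<lparr>arr := (\<lambda>u v c. if \<exists>i<length xs. u \<in> D i \<and> v \<in> D i then 0 else arr Q u v c)\<rparr>)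
       (verts Q - set xs)"

definition decomposition ::
    "nat \<Rightarrow> nat \<Rightarrow> nat \<Rightarrow> 'a cquiver \<Rightarrow> 'a list \<Rightarrow> nat \<Rightarrow> (nat \<Rightarrow> 'a set) \<Rightarrow> bool" where
  "decomposition m p q Q xs h D \<longleftrightarrow>
     (let W = peripheral xs D;
          R = remove_boundary Q xs D;
          n = (\<lambda>w. card (component R w))
      in (\<forall>w\<in>W. \<exists>!i. i < length xs \<and> w \<in> D i) \<and>
         verts R = (\<Union>w\<in>W. component R w) \<and>
         (\<forall>w\<in>W. w \<in> component R w) \<and>
         (\<forall>w\<in>W. \<forall>w'\<in>W. w \<noteq> w' \<longrightarrow> component R w \<inter> component R w' = {}) \<and>
         (\<forall>w\<in>W. induced R (component R w) \<in> class_A m (n w)) \<and>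
         p = length xs - h + (\<Sum>w\<in>peripheral_of_color Q xs D (m - 1). n w) \<and>
         q = h + (\<Sum>w\<in>peripheral_of_color Q xs D (2 * m + 1). n w))"

text \<open>\<open>class_A_tilde m p q\<close> is \<open>\<Q>\<^sup>m\<^sub>p\<^sub>,\<^sub>q\<close>. The existential quantifier over \<open>xs\<close> includes the choice of the
  direction of the central cycle.\<close>

definition class_A_tilde :: "nat \<Rightarrow> nat \<Rightarrow> nat \<Rightarrow> 'a cquiver set" where
  "class_A_tilde m p q = {Q.
     colored_quiver m Q \<and> connected_quiver Q \<and> card (verts Q) = p + q \<and>
     (\<exists>!S. \<exists>xs h. set xs = S \<and> central_cycle m Q xs h) \<and>
     (\<exists>xs h D. central_cycle m Q xs h \<and>
        (if length xs = 2
         then (\<exists>c\<le>m. arr Q (xs ! 0) (xs ! 1) c = 2 \<and> arr Q (xs ! 1) (xs ! 0) (m - c) = 2) \<and>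
              (\<forall>u\<in>verts Q. \<forall>v\<in>verts Q. u \<noteq> v \<and> {u, v} \<noteq> set xs \<longrightarrow> mult m Q u v \<le> 1)
         else simple m Q) \<and>
        (\<forall>S. hole m Q S \<longleftrightarrow> length xs \<ge> 4 \<and> S = set xs) \<and>
        (\<forall>v\<in>verts Q. card (neighbors Q v) \<ge> 1 \<longrightarrow>
           (\<exists>C B. vertex_cliques m Q (set xs) v C B)) \<and>
        boundary_cliques m Q xs D \<and>
        (\<forall>x y z. triangle Q x y z \<and> \<not> (length xs = 3 \<and> {x, y, z} = set xs) \<longrightarrow>
           admissible m Q x y z) \<and>
        decomposition m p q Q xs h D)}"

end

theory Submission
  imports Defs
begin

text \<open>The quivers in question are dual to dissections of an annulus with \<open>m * p\<close> and \<open>m * q\<close> marked points on its two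
  boundary circles into polygons with \<open>m + 2\<close> edges: vertices are the arcs of the dissection, and the color of an arrow
  is the number of edges between two arcs in a common polygon. Only the combinatorics of a dissection is
  needed. Its dual graph is connected with as many edges as nodes, hence has a single cycle, and two numbers
  counted along this cycle and on the trees attached to it must equal \<open>m * p\<close> and \<open>m * q\<close>. Mutation at \<open>v\<close> rotates the arc
  \<open>v\<close>, which preserves both numbers and is undone by further rotations. Rotating suitable arcs, all arcs are
  brought onto the cycle, and then the colors along the cycle are sorted into \<open>q\<close> times \<open>m\<close> followed by \<open>p\<close> times \<open>0\<close>;
  this quiver is \<open>A_tilde m p q\<close>. So the mutation class consists of the quivers of dissections with these numbers.
  These form \<open>class_A_tilde m p q\<close>: the polygons are the cliques at the vertices, those on the cycle are the
  boundary cliques, and since any cycle of the dual graph is the central one, there are no other holes.\<close>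

section \<open>Spanning trees and unicyclic graphs\<close>

text \<open>Why the two numbers equal \<open>m * p\<close> and \<open>m * q\<close>: an edge in the
  interval of a central polygon towards one circle is a boundary edge or an arc, and an arc with
  both ends on that circle replaces this one edge by the \<open>m + 1\<close> further edges of the
  polygon behind it. So the boundary edges of the circle number the sizes of its intervals plus
  \<open>m\<close> for each such arc. The constants of admissibility have the same origin: three
  edges of a polygon with \<open>m + 2\<close> edges leave \<open>m - 1\<close> others when passed
  in cyclic order, and \<open>2 * m + 1\<close> are counted when the polygon is gone around twice.
  The delicate point is that two arcs may bound the same two polygons. Then there is a double arrow,
  and both pairs of halves must give the same color, or the quiver would not be monochromatic. This
  follows by divisibility from the two counts.\<close>

definition adj :: "('e \<times> bool \<Rightarrow> 'n) \<Rightarrow> 'e set \<Rightarrow> 'n \<Rightarrow> 'n \<Rightarrow> bool" where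
  "adj en E a b \<longleftrightarrow> (\<exists>e\<in>E. \<exists>d. a = en (e, d) \<and> b = en (e, \<not> d))"

abbreviation linked :: "('e \<times> bool \<Rightarrow> 'n) \<Rightarrow> 'e set \<Rightarrow> 'n \<Rightarrow> 'n \<Rightarrow> bool" where
  "linked en E \<equiv> (adj en E)\<^sup>*\<^sup>*"

lemma adj_sym: "adj en E a b \<Longrightarrow> adj en E b a"
  unfolding adj_def
proof (elim bexE exE)
  fix e d assume "e \<in> E" "a = en (e, d) \<and> b = en (e, \<not> d)"
  then show "\<exists>e\<in>E. \<exists>d. b = en (e, d) \<and> a = en (e, \<not> d)" by (intro bexI[of _ e] exI[of _ "\<not> d"]) auto
qed

lemma linked_sym: "linked en E a b \<Longrightarrow> linked en E b a"
  by (induction rule: rtranclp_induct) (auto intro: converse_rtranclp_into_rtranclp adj_sym)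

lemma linked_mono: "linked en E a b \<Longrightarrow> E \<subseteq> E' \<Longrightarrow> linked en E' a b"
proof (induction rule: rtranclp_induct)
  case (step b c)
  then have "adj en E' b c" by (auto simp: adj_def)
  with step show ?case by (meson rtranclp.rtrancl_into_rtrancl)
qed simp

lemma linked_edge: "e \<in> E \<Longrightarrow> linked en E (en (e, d)) (en (e, d'))"
proof (cases "d = d'")
  case False
  then have "d' = (\<not> d)" by auto
  moreover assume "e \<in> E"
  ultimately have "adj en E (en (e, d)) (en (e, d'))" unfolding adj_def by (intro bexI[of _ e] exI[of _ d]) auto
  then show ?thesis ..
qed simp

text \<open>Every passage through \<open>y\<close> in a path is replaced by a detour between the two
  ends of \<open>y\<close>.\<close>

lemma linked_remove:
  assumes "linked en (E - {y}) (en (y, d)) (en (y, \<not> d))" and "linked en E a b"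
  shows "linked en (E - {y}) a b"
  using assms(2)
proof (induction rule: rtranclp_induct)
  case (step b c)
  then obtain e d' where e: "e \<in> E" "b = en (e, d')" "c = en (e, \<not> d')" by (auto simp: adj_def)
  have "linked en (E - {y}) b c"
  proof (cases "e = y")
    case True
    then show ?thesis using assms(1) linked_sym[OF assms(1)] e by (cases "d' = d") auto
  next
    case False
    then show ?thesis using e linked_edge[of e "E - {y}" en d' "\<not> d'"] by auto
  qed
  with step show ?case by simp
qed simp

text \<open>Breadth-first search from \<open>r\<close>: every other node selects an edge to a node closer to \<open>r\<close>.\<close>

lemma spanning_tree:
  assumes "finite N" "r \<in> N" and link: "\<And>a. a \<in> N \<Longrightarrow> linked en E r a"
    and ends: "\<And>e d. e \<in> E \<Longrightarrow> en (e, d) \<in> N"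
  obtains T where "T \<subseteq> E" "card T + 1 = card N" "\<And>a. a \<in> N \<Longrightarrow> linked en T r a"
proof -
  define D where "D a = (LEAST n. (adj en E ^^ n) r a)" for a
  have D: "(adj en E ^^ D a) r a" if "a \<in> N" for a
    using link[OF that] unfolding D_def rtranclp_power by (rule LeastI_ex)
  have Dle: "D a \<le> n" if "(adj en E ^^ n) r a" for a n
    unfolding D_def using that by (rule Least_le)
  have "\<exists>e\<in>E. \<exists>d. en (e, d) = a \<and> D (en (e, \<not> d)) + 1 = D a" if a: "a \<in> N - {r}" for a
  proof -
    have "D a \<noteq> 0" using D[of a] a by (intro notI) auto
    then obtain k where k: "D a = Suc k" by (cases "D a") auto
    then obtain b where b: "(adj en E ^^ k) r b" "adj en E b a" using D[of a] a by auto
    then obtain e d where e: "e \<in> E" "b = en (e, d)" "a = en (e, \<not> d)" by (auto simp: adj_def)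
    then have "b \<in> N" using ends by auto
    then have "(adj en E ^^ Suc (D b)) r a" using D[of b] b by auto
    then have "D a \<le> Suc (D b)" by (rule Dle)
    moreover have "D b \<le> k" using b Dle by auto
    ultimately have "D b + 1 = D a" using k by auto
    then show ?thesis using e by (intro bexI[of _ e] exI[of _ "\<not> d"]) auto
  qed
  then obtain t where t: "\<And>a. a \<in> N - {r} \<Longrightarrow> t a \<in> E \<and> (\<exists>d. en (t a, d) = a \<and> D (en (t a, \<not> d)) + 1 = D a)"
    by metis
  \<comment> \<open>If two nodes selected the same edge from its two ends, each would be strictly
    closer to \<open>r\<close> than the other.\<close>
  have "inj_on t (N - {r})"
  proof (rule inj_onI)
    fix a a' assume a: "a \<in> N - {r}" "a' \<in> N - {r}" and eq: "t a = t a'"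
    obtain d where d: "en (t a, d) = a" "D (en (t a, \<not> d)) + 1 = D a" using t[OF a(1)] by auto
    obtain d' where d': "en (t a, d') = a'" "D (en (t a, \<not> d')) + 1 = D a'" using t[OF a(2)] eq by auto
    show "a = a'"
    proof (cases "d = d'")
      case False
      then have "d' = (\<not> d)" by auto
      then show ?thesis using d d' by auto
    qed (use d d' in auto)
  qed
  then have "card (t ` (N - {r})) = card (N - {r})" by (rule card_image)
  moreover have "linked en (t ` (N - {r})) r a" if "a \<in> N" for a
    using that
  proof (induction "D a" arbitrary: a rule: less_induct)
    case less
    show ?case
    proof (cases "a = r")
      case False
      with less.prems have a: "a \<in> N - {r}" by auto
      obtain d where d: "en (t a, d) = a" "D (en (t a, \<not> d)) + 1 = D a" using t[OF a] by auto
      have "linked en (t ` (N - {r})) r (en (t a, \<not> d))"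
        using less.hyps[of "en (t a, \<not> d)"] d ends t[OF a] by auto
      moreover have "linked en (t ` (N - {r})) (en (t a, \<not> d)) (en (t a, d))"
        using a by (intro linked_edge) auto
      ultimately show ?thesis using d by simp
    qed simp
  qed
  moreover have "t ` (N - {r}) \<subseteq> E" using t by auto
  moreover have "card (N - {r}) + 1 = card N" using card_Suc_Diff1[OF assms(1,2)] by simp
  ultimately show ?thesis using that[of "t ` (N - {r})"] by simp
qed

text \<open>Edges are abstract and \<open>en\<close> returns their two ends, so that parallel edges
  are possible: two arcs may bound the same two polygons.\<close>

locale dual_graph =
  fixes en :: "'e \<times> bool \<Rightarrow> 'n" and E :: "'e set" and N :: "'n set"
  assumes finite_E: "finite E" and N_def: "N = en ` (E \<times> UNIV)" and nonempty: "E \<noteq> {}"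
    and conn: "\<And>a b. a \<in> N \<Longrightarrow> b \<in> N \<Longrightarrow> linked en E a b"
begin

lemma finite_N: "finite N" unfolding N_def using finite_E by auto

lemma end_in_N: "e \<in> E \<Longrightarrow> en (e, d) \<in> N" unfolding N_def by auto

text \<open>A spanning tree inside \<open>E'\<close> already has \<open>card N - 1\<close>
  edges.\<close>

lemma card_N_le:
  assumes "E' \<subseteq> E" "\<And>a b. a \<in> N \<Longrightarrow> b \<in> N \<Longrightarrow> linked en E' a b"
  shows "card N \<le> card E' + 1"
proof -
  obtain e where "e \<in> E" using nonempty by auto
  then have r: "en (e, True) \<in> N" by (rule end_in_N)
  obtain T where T: "T \<subseteq> E'" "card T + 1 = card N"
    using spanning_tree[OF finite_N r, of en E'] assms r end_in_N by (metis (no_types, lifting) subset_iff)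
  then have "card T \<le> card E'" using assms(1) finite_E by (meson card_mono finite_subset)
  then show ?thesis using T by simp
qed

text \<open>An orientation of \<open>Y\<close> in which every node is entered as often as it is
  left. Balance at the nodes stands in for the notion of a cycle: it needs no cyclic ordering of the
  edges and can be read off the faces of a configuration.\<close>

definition circulation :: "'e set \<Rightarrow> ('e \<Rightarrow> bool) \<Rightarrow> bool" where
  "circulation Y s \<longleftrightarrow> Y \<subseteq> E \<and> Y \<noteq> {} \<and>
     (\<forall>n. card {y \<in> Y. en (y, s y) = n} = card {y \<in> Y. en (y, \<not> s y) = n})"

lemma circulation_balanced:
  assumes "circulation Y s"
  shows "card {y \<in> Y. en (y, s y) \<in> M} = card {y \<in> Y. en (y, \<not> s y) \<in> M}"
proof -
  have fin: "finite Y" using assms finite_E by (auto simp: circulation_def intro: finite_subset)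
  \<comment> \<open>Only ends of edges in \<open>Y\<close> contribute; the intersection makes the
    sum over the nodes of \<open>M\<close> finite.\<close>
  let ?M = "M \<inter> en ` (Y \<times> UNIV)"
  have finM: "finite ?M" using fin by auto
  have *: "card {y \<in> Y. en (y, f y) \<in> M} = (\<Sum>n\<in>?M. card {y \<in> Y. en (y, f y) = n})" for f
  proof -
    have "{y \<in> Y. en (y, f y) \<in> M} = (\<Union>n\<in>?M. {y \<in> Y. en (y, f y) = n})" by auto
    also have "card \<dots> = (\<Sum>n\<in>?M. card {y \<in> Y. en (y, f y) = n})"
      using fin finM by (intro card_UN_disjoint) auto
    finally show ?thesis .
  qed
  show ?thesis unfolding *[of s] *[of "\<lambda>y. \<not> s y"] using assms by (simp add: circulation_def)
qed

text \<open>A cut argument. Let \<open>?R\<close> be the set of nodes reachable from one end of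
  \<open>y\<close> without using \<open>y\<close>. Every other edge of \<open>Y\<close> has both
  ends in \<open>?R\<close> or none, so if the other end of \<open>y\<close> were outside,
  \<open>y\<close> alone would violate the balance over \<open>?R\<close>.\<close>

lemma circulation_link:
  assumes c: "circulation Y s" and y: "y \<in> Y" and E': "Y \<subseteq> E'"
  shows "linked en (E' - {y}) (en (y, d)) (en (y, \<not> d))"
proof -
  let ?R = "{n. linked en (E' - {y}) (en (y, \<not> s y)) n}"
  have "en (y, s y) \<in> ?R"
  proof (rule ccontr)
    assume no: "en (y, s y) \<notin> ?R"
    have sub: "{z \<in> Y. en (z, s z) \<in> ?R} \<subseteq> {z \<in> Y. en (z, \<not> s z) \<in> ?R}"
    proof safe
      fix z assume z: "z \<in> Y" "linked en (E' - {y}) (en (y, \<not> s y)) (en (z, s z))"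
      then have "z \<noteq> y" using no by auto
      then have "linked en (E' - {y}) (en (z, s z)) (en (z, \<not> s z))" using z E' by (intro linked_edge) auto
      then show "linked en (E' - {y}) (en (y, \<not> s y)) (en (z, \<not> s z))" using z by simp
    qed
    have "y \<in> {z \<in> Y. en (z, \<not> s z) \<in> ?R}" "y \<notin> {z \<in> Y. en (z, s z) \<in> ?R}" using y no by auto
    then have "{z \<in> Y. en (z, s z) \<in> ?R} \<subset> {z \<in> Y. en (z, \<not> s z) \<in> ?R}" using sub by blast
    moreover have "finite {z \<in> Y. en (z, \<not> s z) \<in> ?R}"
      using c finite_E by (auto simp: circulation_def intro: finite_subset)
    ultimately have "card {z \<in> Y. en (z, s z) \<in> ?R} < card {z \<in> Y. en (z, \<not> s z) \<in> ?R}"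
      by (rule psubset_card_mono[rotated])
    then show False using circulation_balanced[OF c, of ?R] by simp
  qed
  then have *: "linked en (E' - {y}) (en (y, \<not> s y)) (en (y, s y))" by simp
  show ?thesis using * linked_sym[OF *] by (cases "d = s y") auto
qed

end

section \<open>Connected graphs with as many edges as nodes\<close>

locale unicyclic = dual_graph +
  assumes card_eq: "card N = card E"
begin

text \<open>If \<open>e\<close> were outside \<open>Y\<close>, deleting \<open>e\<close> and then an
  edge of \<open>Y\<close> would leave the graph connected with only \<open>card N - 2\<close>
  edges.\<close>

lemma bridge:
  assumes c: "circulation Y s" and e: "e \<in> E" and l: "linked en (E - {e}) (en (e, d)) (en (e, \<not> d))"
  shows "e \<in> Y"
proof (rule ccontr)
  assume "e \<notin> Y"
  obtain y where y: "y \<in> Y" using c by (auto simp: circulation_def)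
  have sub: "Y \<subseteq> E - {e}" using c \<open>e \<notin> Y\<close> by (auto simp: circulation_def)
  have 1: "linked en (E - {e}) a b" if "a \<in> N" "b \<in> N" for a b
    using linked_remove[OF l] conn that by auto
  have 2: "linked en (E - {e} - {y}) a b" if "a \<in> N" "b \<in> N" for a b
    using linked_remove[OF circulation_link[OF c y sub]] 1 that by auto
  have "card N \<le> card (E - {e} - {y}) + 1" by (rule card_N_le) (use 2 in auto)
  moreover have "card (E - {e} - {y}) < card (E - {e})" using y sub finite_E by (intro psubset_card_mono) auto
  moreover have "card (E - {e}) < card E" using e finite_E by (intro psubset_card_mono) auto
  ultimately show False using card_eq by simp
qed

text \<open>Every circulation consists exactly of the edges that are not bridges.\<close>

lemma circulation_unique:
  assumes "circulation Y s" "circulation Y' s'"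
  shows "Y = Y'"
  using bridge[OF assms(1)] bridge[OF assms(2)] circulation_link[OF assms(1)] circulation_link[OF assms(2)] assms
  unfolding circulation_def by (metis subset_antisym subset_iff)

text \<open>The edges of \<open>Y\<close> that are linked to \<open>y\<close> inside
  \<open>Y\<close> form a circulation themselves, hence by uniqueness all of
  \<open>Y\<close>.\<close>

lemma circulation_linked:
  assumes c: "circulation Y s" and y: "y \<in> Y" "y' \<in> Y"
  shows "linked en Y (en (y, d)) (en (y', d'))"
proof -
  let ?Z = "{z \<in> Y. linked en Y (en (y, d)) (en (z, True))}"
  have end_iff: "linked en Y (en (y, d)) (en (z, True)) \<longleftrightarrow> linked en Y (en (y, d)) (en (z, b))" if "z \<in> Y" for z b
    using linked_edge[OF that] by (meson rtranclp_trans)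
  have eq: "{z \<in> ?Z. en (z, f z) = n} = (if linked en Y (en (y, d)) n then {z \<in> Y. en (z, f z) = n} else {})" for f n
    using end_iff by auto
  have "linked en Y (en (y, d)) (en (y, True))" using y by (intro linked_edge)
  then have "?Z \<noteq> {}" using y by auto
  then have "circulation ?Z s"
    using c unfolding circulation_def eq eq[of "\<lambda>z. \<not> s z"] by auto
  then have "?Z = Y" by (rule circulation_unique[OF _ c])
  then show ?thesis using y end_iff by blast
qed

text \<open>A closed trail, oriented as it is run through, is a circulation; uniqueness does the
  rest. Nodes may be repeated, only the edges have to be distinct.\<close>

lemma closed_trail:
  assumes c: "circulation Y s" and xs: "distinct xs" "xs \<noteq> []" "set xs \<subseteq> E"
    and tr: "\<And>i. i < length xs \<Longrightarrow> en (xs ! i, \<not> bs i) = en (xs ! (Suc i mod length xs), bs (Suc i mod length xs))"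
  shows "set xs = Y"
proof -
  let ?k = "length xs"
  \<comment> \<open>The orientation is given per index; since the edges are distinct it can be
    transferred to the edges.\<close>
  obtain s' where s': "\<And>i. i < ?k \<Longrightarrow> s' (xs ! i) = bs i"
  proof
    fix i assume "i < ?k"
    then show "(\<lambda>x. bs (THE i. i < ?k \<and> xs ! i = x)) (xs ! i) = bs i"
      using xs(1) by (auto simp: nth_eq_iff_index_eq intro!: arg_cong[of _ _ bs] the_equality)
  qed
  have k: "?k > 0" using xs by auto
  have inj: "inj_on (\<lambda>i. xs ! i) A" if "A \<subseteq> {..<?k}" for A
    using xs(1) that by (auto simp: inj_on_def nth_eq_iff_index_eq subset_iff)
  have sets: "{y \<in> set xs. P y} = (\<lambda>i. xs ! i) ` {i. i < ?k \<and> P (xs ! i)}" for P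
    by (auto simp: in_set_conv_nth)
  have card: "card {y \<in> set xs. P y} = card {i. i < ?k \<and> P (xs ! i)}" for P
    unfolding sets by (rule card_image) (auto intro: inj)
  let ?g = "\<lambda>i. Suc i mod ?k"
  have g: "bij_betw ?g {..<?k} {..<?k}"
  proof (rule bij_betw_imageI)
    show "inj_on ?g {..<?k}"
      by (rule inj_onI) (auto simp: mod_Suc split: if_splits)
    then show "?g ` {..<?k} = {..<?k}" using k by (intro endo_inj_surj) auto
  qed
  have "card {y \<in> set xs. en (y, s' y) = n} = card {y \<in> set xs. en (y, \<not> s' y) = n}" for n
  proof -
    let ?A = "{i. i < ?k \<and> en (xs ! i, bs i) = n}" and ?B = "{i. i < ?k \<and> en (xs ! i, \<not> bs i) = n}"
    \<comment> \<open>The node where the trail leaves edge \<open>i\<close> is the node where it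
      enters edge \<open>?g i\<close>, so the cyclic shift matches the two counts.\<close>
    have "?g ` ?B = ?A"
    proof
      show "?g ` ?B \<subseteq> ?A" using tr k by auto
      show "?A \<subseteq> ?g ` ?B"
      proof
        fix i assume i: "i \<in> ?A"
        then have "i \<in> ?g ` {..<?k}" using g by (simp add: bij_betw_def)
        then obtain j where "j < ?k" "i = ?g j" by auto
        then show "i \<in> ?g ` ?B" using i tr by auto
      qed
    qed
    moreover have "inj_on ?g ?B" using g by (auto simp: bij_betw_def intro: inj_on_subset)
    ultimately have "card ?A = card ?B" using card_image[of ?g ?B] by simp
    moreover have "{i. i < ?k \<and> en (xs ! i, s' (xs ! i)) = n} = ?A" "{i. i < ?k \<and> en (xs ! i, \<not> s' (xs ! i)) = n} = ?B"
      using s' by auto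
    ultimately show ?thesis by (simp only: card)
  qed
  then have "circulation (set xs) s'" using xs by (auto simp: circulation_def)
  then show ?thesis by (rule circulation_unique[OF _ c])
qed

end

section \<open>Configurations\<close>

declare split_paired_All [simp del] split_paired_Ex [simp del]

definition oth :: "'a \<times> bool \<Rightarrow> 'a \<times> bool" where
  "oth h = (fst h, \<not> snd h)"

lemma oth_simps [simp]: "oth (v, b) = (v, \<not> b)" "oth (oth h) = h" "fst (oth h) = fst h" "oth h \<noteq> h" "h \<noteq> oth h"
  by (auto simp: oth_def prod_eq_iff)

text \<open>An arc \<open>v\<close> of the dissection has two sides \<open>(v, True)\<close> and \<open>(v, False)\<close>, its halves; \<open>face\<close> is the polygon on
  that side. For halves in the same polygon \<open>hue\<close> is the number of edges strictly between them (it is junk for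
  other halves). If an arc has both ends on one boundary circle of the annulus, then both of its halves
  carry that circle as \<open>lbl\<close>; if it joins the two circles, the values of \<open>lbl\<close> at its halves differ and
  orient the central cycle.\<close>

record ('a, 'f) conf =
  face :: "'a \<times> bool \<Rightarrow> 'f"
  hue :: "'a \<times> bool \<Rightarrow> 'a \<times> bool \<Rightarrow> nat"
  lbl :: "'a \<times> bool \<Rightarrow> bool"

definition halves :: "'a set \<Rightarrow> ('a \<times> bool) set" where
  "halves V = V \<times> UNIV"

lemma in_halves [simp]: "(v, b) \<in> halves V \<longleftrightarrow> v \<in> V" "oth h \<in> halves V \<longleftrightarrow> h \<in> halves V"
  by (cases h; auto simp: halves_def oth_def)+

lemma halves_fst: "h \<in> halves V \<longleftrightarrow> fst h \<in> V"
  by (cases h) auto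

text \<open>The number of edges strictly between the edges \<open>a\<close> and \<open>b\<close> of a polygon with edges \<open>0, \<dots>, m + 1\<close>.\<close>

definition gap :: "nat \<Rightarrow> nat \<Rightarrow> nat \<Rightarrow> nat" where
  "gap m a b = (if a < b then b - a - 1 else m + 1 + b - a)"

text \<open>A polygon off the central cycle: all of its arcs have both ends on the circle
  \<open>t\<close>.\<close>

definition pure_face :: "'a set \<Rightarrow> ('a, 'f) conf \<Rightarrow> 'f \<Rightarrow> bool \<Rightarrow> bool" where
  "pure_face V K F t \<longleftrightarrow> (\<forall>h\<in>halves V. face K h = F \<longrightarrow> lbl K h = t \<and> lbl K (oth h) = t)"

text \<open>The arcs joining the two boundary circles separate \<open>F\<close> into an interval of edges for each circle.\<close>

definition central_face :: "'a set \<Rightarrow> ('a, 'f) conf \<Rightarrow> 'f \<Rightarrow> 'a \<times> bool \<Rightarrow> 'a \<times> bool \<Rightarrow> bool" where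
  "central_face V K F e u \<longleftrightarrow> e \<in> halves V \<and> u \<in> halves V \<and> face K e = F \<and> face K u = F \<and>
     lbl K e \<and> \<not> lbl K (oth e) \<and> \<not> lbl K u \<and> lbl K (oth u) \<and>
     (\<forall>h\<in>halves V. face K h = F \<and> h \<noteq> e \<and> h \<noteq> u \<longrightarrow>
        lbl K (oth h) = lbl K h \<and> (lbl K h \<longleftrightarrow> hue K e u < hue K e h))"

definition ok_face :: "'a set \<Rightarrow> ('a, 'f) conf \<Rightarrow> 'f \<Rightarrow> bool" where
  "ok_face V K F \<longleftrightarrow> (\<exists>t. pure_face V K F t) \<or> (\<exists>e u. central_face V K F e u)"

text \<open>At most one pair \<open>(e, u)\<close> contributes, so these sums are the sizes of the two intervals.\<close>

definition wt :: "'a set \<Rightarrow> ('a, 'f) conf \<Rightarrow> 'f \<Rightarrow> nat" where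
  "wt V K F = (\<Sum>(e, u)\<in>{(e, u). central_face V K F e u}. hue K e u)"

definition wb :: "'a set \<Rightarrow> ('a, 'f) conf \<Rightarrow> 'f \<Rightarrow> nat" where
  "wb V K F = (\<Sum>(e, u)\<in>{(e, u). central_face V K F e u}. hue K u e)"

definition side :: "('a, 'f) conf \<Rightarrow> bool \<Rightarrow> 'a \<Rightarrow> bool" where
  "side K t v \<longleftrightarrow> lbl K (v, True) = t \<and> lbl K (v, False) = t"

definition spine :: "'a set \<Rightarrow> ('a, 'f) conf \<Rightarrow> 'a set" where
  "spine V K = {v \<in> V. lbl K (v, True) \<noteq> lbl K (v, False)}"

definition next_half :: "'a set \<Rightarrow> ('a, 'f) conf \<Rightarrow> 'a \<times> bool \<Rightarrow> 'a \<times> bool \<Rightarrow> bool" where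
  "next_half V K h x \<longleftrightarrow> x \<in> halves V \<and> x \<noteq> h \<and> face K x = face K h \<and> hue K h x = 0"

text \<open>The ends of the arc \<open>v\<close> move one step along the two polygons at \<open>v\<close>, so that the next arc of either
  polygon passes to the other one.\<close>

definition flip :: "nat \<Rightarrow> 'a set \<Rightarrow> 'a \<Rightarrow> ('a, 'f) conf \<Rightarrow> ('a, 'f) conf" where
  "flip m V v K = \<lparr>
     face = (\<lambda>h. if fst h = v then face K h
        else if next_half V K (v, True) h then face K (v, False)
        else if next_half V K (v, False) h then face K (v, True) else face K h),
     hue = (\<lambda>h h'.
        if fst h = v then
          (if fst h' = v then hue K h h' else if next_half V K (oth h) h' then m else hue K h h' - 1)
        else if fst h' = v then (if next_half V K (oth h') h then 0 else hue K h h' + 1)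
        else if next_half V K (v, True) h' then hue K h (v, False)
        else if next_half V K (v, False) h' then hue K h (v, True)
        else if next_half V K (v, True) h then hue K (v, False) h'
        else if next_half V K (v, False) h then hue K (v, True) h'
        else hue K h h'),
     lbl = (\<lambda>h. if fst h = v then lbl K h \<noteq> (\<exists>y. next_half V K (oth h) y \<and> lbl K y \<noteq> lbl K (oth y))
        else lbl K h)\<rparr>"

text \<open>Exchanges the two boundary circles and thus \<open>p\<close> and \<open>q\<close>. This
  symmetry halves the case distinctions on labels.\<close>

definition reflect :: "('a, 'f) conf \<Rightarrow> ('a, 'f) conf" where
  "reflect K = K\<lparr>lbl := \<lambda>h. \<not> lbl K h\<rparr>"

lemma reflect_simps [simp]:
  "face (reflect K) = face K" "hue (reflect K) = hue K" "lbl (reflect K) h = (\<not> lbl K h)"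
  "reflect (reflect K) = K"
  by (simp_all add: reflect_def)

lemma next_half_reflect [simp]: "next_half V (reflect K) = next_half V K"
  by (auto simp: next_half_def fun_eq_iff)

lemma flip_reflect: "flip m V v (reflect K) = reflect (flip m V v K)"
proof -
  have "lbl (flip m V v (reflect K)) h = lbl (reflect (flip m V v K)) h" for h
  proof -
    have "(lbl (reflect K) y \<noteq> lbl (reflect K) (oth y)) = (lbl K y \<noteq> lbl K (oth y))" for y by auto
    then show ?thesis
      unfolding reflect_simps(3) flip_def conf.select_convs next_half_reflect by (cases "fst h = v") auto
  qed
  then have "lbl (flip m V v (reflect K)) = lbl (reflect (flip m V v K))" ..
  moreover have "face (flip m V v (reflect K)) = face (reflect (flip m V v K))"
    "hue (flip m V v (reflect K)) = hue (reflect (flip m V v K))"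
    by (simp_all only: flip_def conf.select_convs next_half_reflect reflect_simps)
  ultimately show ?thesis by (intro conf.equality) simp_all
qed

lemma pure_reflect [simp]: "pure_face V (reflect K) F t \<longleftrightarrow> pure_face V K F (\<not> t)"
  by (auto simp: pure_face_def)

lemma side_reflect [simp]: "side (reflect K) t v \<longleftrightarrow> side K (\<not> t) v"
  by (auto simp: side_def)

text \<open>Local conditions only: skew symmetry and admissibility of triples inside one face. They
  suffice to place the halves of a face at distinct edges of a polygon with \<open>m + 2\<close>
  edges.\<close>

locale coloring =
  fixes m :: nat and V :: "'a set" and K :: "('a, 'f) conf"
  assumes m_pos: "1 \<le> m" and finite_V: "finite V"
    and hue_sum: "\<And>h h'. h \<in> halves V \<Longrightarrow> h' \<in> halves V \<Longrightarrow> face K h = face K h' \<Longrightarrow> h \<noteq> h' \<Longrightarrow>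
      hue K h h' + hue K h' h = m"
    and hue_tri: "\<And>h h' k. h \<in> halves V \<Longrightarrow> h' \<in> halves V \<Longrightarrow> k \<in> halves V \<Longrightarrow>
      face K h = face K h' \<Longrightarrow> face K h' = face K k \<Longrightarrow> h \<noteq> h' \<Longrightarrow> h' \<noteq> k \<Longrightarrow> k \<noteq> h \<Longrightarrow>
      hue K h h' + hue K h' k + hue K k h = m - 1 \<or> hue K h h' + hue K h' k + hue K k h = 2 * m + 1"
begin

definition place :: "'a \<times> bool \<Rightarrow> 'a \<times> bool \<Rightarrow> nat" where
  "place h k = (if k = h then 0 else hue K h k + 1)"

text \<open>With \<open>h\<close> at position 0, the triple condition on \<open>h\<close>,
  \<open>k\<close>, \<open>k'\<close> leaves a single possible value for the hue from
  \<open>k\<close> to \<open>k'\<close>, namely the gap between their positions. It also excludes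
  equal positions, because hues are at most \<open>m\<close>.\<close>

lemma place_props:
  assumes "h \<in> halves V" "k \<in> halves V" "k' \<in> halves V" "face K k = face K h" "face K k' = face K h" "k \<noteq> k'"
  shows "place h k \<noteq> place h k'" "place h k \<le> m + 1" "hue K k k' = gap m (place h k) (place h k')"
proof -
  have s: "hue K h k + hue K k h = m" if "k \<noteq> h" using hue_sum[of h k] assms that by auto
  have s': "hue K h k' + hue K k' h = m" if "k' \<noteq> h" using hue_sum[of h k'] assms that by auto
  have s'': "hue K k k' + hue K k' k = m" using hue_sum[of k k'] assms by auto
  show "place h k \<le> m + 1" using s by (auto simp: place_def)
  have tri: "hue K h k + hue K k k' + hue K k' h = m - 1 \<or> hue K h k + hue K k k' + hue K k' h = 2 * m + 1"
    if "k \<noteq> h" "k' \<noteq> h" using hue_tri[of h k k'] assms that by auto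
  have "hue K h k \<noteq> hue K h k' \<and> hue K k k' = gap m (place h k) (place h k')" if "k \<noteq> h" "k' \<noteq> h"
    using s[OF that(1)] s'[OF that(2)] s'' tri[OF that] m_pos that unfolding gap_def place_def by (auto split: if_splits)
  then show "place h k \<noteq> place h k'" "hue K k k' = gap m (place h k) (place h k')"
    using assms(6) s s' by (auto simp: place_def gap_def)
qed

lemma next_half_unique:
  assumes "h \<in> halves V" "next_half V K h x" "next_half V K h x'"
  shows "x = x'"
  using place_props(1)[of h x x'] assms by (auto simp: next_half_def place_def)

lemma hue_le: "h \<in> halves V \<Longrightarrow> h' \<in> halves V \<Longrightarrow> face K h = face K h' \<Longrightarrow> h \<noteq> h' \<Longrightarrow> hue K h h' \<le> m"
  using hue_sum by fastforce

text \<open>\<open>e\<close> and \<open>u\<close> are the only halves of the face whose label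
  differs from that of the opposite half, and their own labels tell them apart.\<close>

lemma central_unique:
  assumes "central_face V K F e u" "central_face V K F e' u'"
  shows "e = e' \<and> u = u'"
  using assms unfolding central_face_def by metis

lemma wt_central: "central_face V K F e u \<Longrightarrow> wt V K F = hue K e u"
  and wb_central: "central_face V K F e u \<Longrightarrow> wb V K F = hue K u e"
proof -
  assume c: "central_face V K F e u"
  then have "{(e, u). central_face V K F e u} = {(e, u)}" by (auto dest: central_unique simp del: split_paired_All split_paired_Ex)
  then show "wt V K F = hue K e u" "wb V K F = hue K u e" by (simp_all add: wt_def wb_def)
qed

lemma pure_not_central: "pure_face V K F t \<Longrightarrow> \<not> central_face V K F e u"
  by (auto simp: pure_face_def central_face_def)

lemma wt_pure [simp]: "pure_face V K F t \<Longrightarrow> wt V K F = 0" "pure_face V K F t \<Longrightarrow> wb V K F = 0"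
  using pure_not_central by (simp_all add: wt_def wb_def)

text \<open>The halves that come after \<open>u\<close> when counted from \<open>e\<close> are those
  that come before \<open>e\<close> when counted from \<open>u\<close>.\<close>

lemma central_reflect1:
  assumes "central_face V K F e u"
  shows "central_face V (reflect K) F u e"
proof -
  have *: "hue K e u < hue K e h \<longleftrightarrow> \<not> hue K u e < hue K u h"
    if "h \<in> halves V" "face K h = F" "h \<noteq> e" "h \<noteq> u" for h
  proof -
    have eu: "e \<in> halves V" "u \<in> halves V" "face K e = F" "face K u = F" "e \<noteq> u"
      using assms by (auto simp: central_face_def)
    have "hue K u e = gap m (place e u) (place e e)" "hue K u h = gap m (place e u) (place e h)"
      "place e u \<noteq> place e h" "place e u \<le> m + 1" "place e h \<le> m + 1"
      using place_props[of e u e] place_props[of e u h] place_props[of e h u] eu that by auto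
    then show ?thesis using that eu by (auto simp: place_def gap_def split: if_splits)
  qed
  show ?thesis using assms * unfolding central_face_def by simp
qed

lemma coloring_reflect: "coloring m V (reflect K)"
  using m_pos finite_V hue_sum hue_tri by unfold_locales auto

end

lemma central_reflect:
  assumes "coloring m V K"
  shows "central_face V (reflect K) F u e \<longleftrightarrow> central_face V K F e u"
  using coloring.central_reflect1[OF assms] coloring.central_reflect1[OF coloring.coloring_reflect[OF assms]]
  by (metis reflect_simps(4))

lemma wt_reflect:
  assumes "coloring m V K"
  shows "wt V (reflect K) F = wb V K F" "wb V (reflect K) F = wt V K F"
proof -
  interpret coloring m V K by fact
  interpret R: coloring m V "reflect K" by (rule coloring_reflect)
  show "wt V (reflect K) F = wb V K F" "wb V (reflect K) F = wt V K F"
  proof (atomize (full), cases "\<exists>e u. central_face V K F e u")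
    case True
    then obtain e u where c: "central_face V K F e u" by auto
    then show "wt V (reflect K) F = wb V K F \<and> wb V (reflect K) F = wt V K F"
      using R.wt_central[OF central_reflect1[OF c]] R.wb_central[OF central_reflect1[OF c]] wt_central wb_central
      by simp
  next
    case False
    then have "{(e, u). central_face V K F e u} = {}" "{(e, u). central_face V (reflect K) F e u} = {}"
      using central_reflect[OF assms] by (auto simp del: split_paired_All split_paired_Ex)
    then show "wt V (reflect K) F = wb V K F \<and> wb V (reflect K) F = wt V K F"
      by (simp only: wt_def wb_def sum.empty simp_thms)
  qed
qed

lemma ok_reflect:
  assumes "coloring m V K"
  shows "ok_face V (reflect K) F \<longleftrightarrow> ok_face V K F"
proof -
  have "(\<exists>t. pure_face V K F (\<not> t)) \<longleftrightarrow> (\<exists>t. pure_face V K F t)"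
    by (auto intro: exI[of _ "\<not> t" for t])
  moreover have "(\<exists>e u. central_face V (reflect K) F e u) \<longleftrightarrow> (\<exists>e u. central_face V K F e u)"
    using central_reflect[OF assms, of F] by blast
  ultimately show ?thesis by (simp add: ok_face_def)
qed

lemma corner:
  assumes "coloring m V K" "ok_face V K (face K h)" "h \<in> halves V" "next_half V K h y"
  shows "lbl K y = lbl K (oth h)"
proof -
  interpret coloring m V K by fact
  have y: "y \<in> halves V" "y \<noteq> h" "face K y = face K h" "hue K h y = 0" using assms(4) by (auto simp: next_half_def)
  from assms(2) consider t where "pure_face V K (face K h) t" | e u where "central_face V K (face K h) e u"
    by (auto simp: ok_face_def)
  then show ?thesis
  proof cases
    case 1
    then show ?thesis using assms y by (auto simp: pure_face_def)
  next
    case 2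
    have eu: "e \<in> halves V" "u \<in> halves V" "face K e = face K h" "face K u = face K h" "e \<noteq> u"
      using 2 by (auto simp: central_face_def)
    have pl: "a \<noteq> b \<longrightarrow> place e a \<noteq> place e b \<and> place e a \<le> m + 1 \<and> hue K a b = gap m (place e a) (place e b)"
      if "a \<in> halves V" "b \<in> halves V" "face K a = face K h" "face K b = face K h" for a b
      using place_props[of e a b] that eu by auto
    have hy: "place e h \<noteq> place e y" "place e h \<le> m + 1" "gap m (place e h) (place e y) = 0"
      using pl[of h y] y assms by auto
    have step: "place e y = Suc (place e h) \<or> place e h = m + 1 \<and> place e y = 0"
      using hy pl[of y h] y assms by (auto simp: gap_def split: if_splits)
    have inj: "a \<noteq> b \<longrightarrow> place e a \<noteq> place e b" if "a \<in> halves V" "b \<in> halves V" "face K a = face K h" "face K b = face K h" for a b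
      using pl that by auto
    have oth: "(lbl K a \<longleftrightarrow> place e u < place e a) \<and> lbl K (oth a) = lbl K a"
      if "a \<in> halves V" "face K a = face K h" "a \<noteq> e" "a \<noteq> u" for a
      using 2 that eu by (auto simp: central_face_def place_def)
    have ends: "lbl K e" "\<not> lbl K (oth e)" "\<not> lbl K u" "lbl K (oth u)" using 2 by (auto simp: central_face_def)
    have e0: "place e a = 0 \<longleftrightarrow> a = e" for a by (auto simp: place_def)
    consider "h = e" | "h = u" | "h \<noteq> e" "h \<noteq> u" by auto
    then show ?thesis
    proof cases
      case 1
      then have "place e y = 1" using step e0[of h] by auto
      moreover have "place e u \<noteq> 0" using e0[of u] eu by blast
      ultimately have "y \<noteq> u \<Longrightarrow> \<not> lbl K y" using oth[of y] y 1 by auto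
      then show ?thesis using 1 ends by blast
    next
      case h: 2
      have "y \<noteq> e \<Longrightarrow> place e y = Suc (place e u)" using step e0[of y] h by blast
      then have "y \<noteq> e \<Longrightarrow> lbl K y" using oth[of y] y h by auto
      then show ?thesis using h ends by blast
    next
      case h: 3
      have "place e h \<noteq> place e u" using inj[of h u] h assms eu by auto
      have oh: "(lbl K h \<longleftrightarrow> place e u < place e h) \<and> lbl K (oth h) = lbl K h" using oth[of h] h assms by blast
      show ?thesis
      proof (cases "y = e")
        case True
        then have "place e h = m + 1" using step e0[of y] by force
        moreover have "place e u \<le> m + 1" using pl[of u e] eu by blast
        ultimately have "place e u < place e h" using \<open>place e h \<noteq> place e u\<close> by linarith
        then show ?thesis using oh True ends by blast
      next
        case False
        then have Sy: "place e y = Suc (place e h)" using step e0[of y] by blast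
        show ?thesis
        proof (cases "y = u")
          case True
          then have "place e h < place e u" using Sy by simp
          then show ?thesis using True oh ends by auto
        next
          case yu: False
          then have "(lbl K y \<longleftrightarrow> place e u < place e y)" using oth[of y] False y by blast
          moreover have "place e u < place e y \<longleftrightarrow> place e u < place e h" using Sy \<open>place e h \<noteq> place e u\<close> by linarith
          ultimately show ?thesis using oh by blast
        qed
      qed
    qed
  qed
qed

text \<open>The conditions \<open>no_loop\<close>, \<open>conn\<close> and \<open>card_faces\<close>
  make the dual graph unicyclic. \<open>wt_sum\<close> and \<open>wb_sum\<close> count the boundary
  edges of the circle \<open>False\<close> and of the circle \<open>True\<close>. Positivity of both
  totals is kept as part of the invariant: it excludes an extreme color 0 or \<open>2 * m\<close>
  around a spine of two arcs and gives the strict bounds on \<open>h\<close> in a central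
  cycle.\<close>

locale annulus = coloring m V K for m and V :: "'a set" and K :: "('a, 'f) conf" +
  fixes p q :: nat
  assumes no_loop: "\<And>v. v \<in> V \<Longrightarrow> face K (v, True) \<noteq> face K (v, False)"
    and conn: "\<And>a b. a \<in> face K ` halves V \<Longrightarrow> b \<in> face K ` halves V \<Longrightarrow> linked (face K) V a b"
    and card_faces: "card (face K ` halves V) = card V"
    and ok: "\<And>F. F \<in> face K ` halves V \<Longrightarrow> ok_face V K F"
    and card_V: "card V = p + q"
    and wt_sum: "(\<Sum>F\<in>face K ` halves V. wt V K F) + m * card {v \<in> V. side K False v} = m * q"
    and wb_sum: "(\<Sum>F\<in>face K ` halves V. wb V K F) + m * card {v \<in> V. side K True v} = m * p"
    and wt_pos: "0 < (\<Sum>F\<in>face K ` halves V. wt V K F)"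
    and wb_pos: "0 < (\<Sum>F\<in>face K ` halves V. wb V K F)"
begin

lemma V_nonempty: "V \<noteq> {}"
  using wt_pos by (auto simp: halves_def)

lemma face_in: "h \<in> halves V \<Longrightarrow> face K h \<in> face K ` halves V"
  by auto

lemma no_loop': "v \<in> V \<Longrightarrow> face K (v, b) \<noteq> face K (v, \<not> b)"
  using no_loop[of v] by (cases b) auto

sublocale unicyclic "face K" V "face K ` halves V"
  using finite_V V_nonempty conn card_faces by unfold_locales (auto simp: halves_def)

lemma faceE:
  assumes "h \<in> halves V"
  obtains t where "pure_face V K (face K h) t" | e u where "central_face V K (face K h) e u"
  using ok[OF face_in[OF assms]] by (auto simp: ok_face_def)

text \<open>For an arc of the spine this selects the half that is the \<open>u\<close> of its
  central face; the other half is the \<open>e\<close> of the central face on the other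
  side.\<close>

definition exit_half :: "'a \<Rightarrow> bool" where
  "exit_half v = (\<not> lbl K (v, True))"

lemma exit_half: "v \<in> spine V K \<Longrightarrow> \<not> lbl K (v, exit_half v) \<and> lbl K (v, \<not> exit_half v)"
  by (cases "lbl K (v, True)") (auto simp: exit_half_def spine_def)

lemma in_spineI: "h \<in> halves V \<Longrightarrow> lbl K h \<noteq> lbl K (oth h) \<Longrightarrow> fst h \<in> spine V K"
  by (cases h, rename_tac v b, case_tac b) (auto simp: spine_def)

lemma spine_lbl: "v \<in> spine V K \<Longrightarrow> lbl K (v, b) \<noteq> lbl K (v, \<not> b)"
  by (cases b) (auto simp: spine_def)

lemma not_spine_lbl: "v \<in> V \<Longrightarrow> v \<notin> spine V K \<Longrightarrow> lbl K (v, b) = lbl K (v, b')"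
  by (cases b; cases b') (auto simp: spine_def)

lemma central_in_spine: "central_face V K F e u \<Longrightarrow> fst e \<in> spine V K \<and> fst u \<in> spine V K"
  using in_spineI by (auto simp: central_face_def)

text \<open>The two halves of a spine arc have different labels, which a pure face forbids and a
  central face allows only for \<open>e\<close> and \<open>u\<close>.\<close>

lemma spine_central:
  assumes "h \<in> halves V" "fst h \<in> spine V K"
  obtains e u where "central_face V K (face K h) e u" "h = e \<or> h = u"
  using assms(1)
proof (cases rule: faceE)
  case (1 t)
  then show ?thesis using assms spine_lbl[of "fst h" "snd h"] by (auto simp: pure_face_def oth_def)
next
  case (2 e u)
  then have "h = e \<or> h = u"
    using assms spine_lbl[of "fst h" "snd h"] by (auto simp: central_face_def oth_def)
  then show ?thesis using that 2 by blast
qed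

lemma central_not_in_other:
  "central_face V K F e u \<Longrightarrow> h \<in> halves V \<Longrightarrow> face K h = F \<Longrightarrow> fst h \<in> spine V K \<Longrightarrow> h = e \<or> h = u"
  using spine_central central_unique by metis

lemma exists_central: "\<exists>F\<in>face K ` halves V. \<exists>e u. central_face V K F e u"
proof (rule ccontr)
  assume "\<not> ?thesis"
  then have "\<forall>F\<in>face K ` halves V. \<exists>t. pure_face V K F t" using ok unfolding ok_face_def by blast
  then have "wt V K F = 0" if "F \<in> face K ` halves V" for F   proof -
    have "\<exists>t. pure_face V K F t" using \<open>\<forall>F\<in>face K ` halves V. \<exists>t. pure_face V K F t\<close> that by (rule bspec)
    then show ?thesis by (elim exE) (rule wt_pure)
  qed
  then show False using wt_pos by simp
qed

text \<open>A central face contains one entry \<open>e\<close> and one exit \<open>u\<close>, a pure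
  face contains no spine arc at all; so every node is balanced.\<close>

lemma spine_circulation: "circulation (spine V K) exit_half"
proof -
  have "card {y \<in> spine V K. face K (y, exit_half y) = F} = card {y \<in> spine V K. face K (y, \<not> exit_half y) = F}" for F
  proof (cases "\<exists>e u. central_face V K F e u")
    case True
    then obtain e u where c: "central_face V K F e u" by auto
    have V: "y \<in> spine V K \<Longrightarrow> y \<in> V" for y by (auto simp: spine_def)
    have y1: "y = fst u" if "y \<in> spine V K" "face K (y, exit_half y) = F" for y
      using central_not_in_other[OF c, of "(y, exit_half y)"] that exit_half V c by (auto simp: central_face_def)
    have y2: "y = fst e" if "y \<in> spine V K" "face K (y, \<not> exit_half y) = F" for y
      using central_not_in_other[OF c, of "(y, \<not> exit_half y)"] that exit_half V c by (auto simp: central_face_def)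
    have s: "fst e \<in> spine V K" "fst u \<in> spine V K" using central_in_spine[OF c] by auto
    have ue: "u = (fst u, exit_half (fst u))" "e = (fst e, \<not> exit_half (fst e))"
    proof -
      have "h = (fst h, exit_half (fst h)) \<longleftrightarrow> \<not> lbl K h" if "fst h \<in> spine V K" for h
        using exit_half[OF that] by (cases h, rename_tac a b, case_tac "b = exit_half a") auto
      moreover have "h = (fst h, \<not> exit_half (fst h)) \<longleftrightarrow> lbl K h" if "fst h \<in> spine V K" for h
        using exit_half[OF that] by (cases h, rename_tac a b, case_tac "b = exit_half a") auto
      ultimately show "u = (fst u, exit_half (fst u))" "e = (fst e, \<not> exit_half (fst e))"
        using s c unfolding central_face_def by blast+
    qed
    have "face K u = face K (fst u, exit_half (fst u))" "face K e = face K (fst e, \<not> exit_half (fst e))"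
      by (rule arg_cong[OF ue(1)], rule arg_cong[OF ue(2)])
    then have "face K (fst u, exit_half (fst u)) = F" "face K (fst e, \<not> exit_half (fst e)) = F"
      using c by (simp_all add: central_face_def)
    then have "fst u \<in> {y \<in> spine V K. face K (y, exit_half y) = F}"
      "fst e \<in> {y \<in> spine V K. face K (y, \<not> exit_half y) = F}" using s by blast+
    then have "{y \<in> spine V K. face K (y, exit_half y) = F} = {fst u}"
      "{y \<in> spine V K. face K (y, \<not> exit_half y) = F} = {fst e}" using y1 y2 by blast+
    then show ?thesis by simp
  next
    case False
    then have "face K (y, b) \<noteq> F" if "y \<in> spine V K" for y b
      using spine_central[of "(y, b)"] that by (auto simp: spine_def)
    then have "{y \<in> spine V K. face K (y, exit_half y) = F} = {}"
      "{y \<in> spine V K. face K (y, \<not> exit_half y) = F} = {}" by blast+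
    then show ?thesis by (simp only:)
  qed
  moreover have "spine V K \<noteq> {}" using exists_central central_in_spine by blast
  ultimately show ?thesis by (auto simp: circulation_def spine_def)
qed

text \<open>The source of all statements about double arrows, central triangles and induced cycles:
  whatever closes up in the dual graph uses exactly the spine.\<close>

lemmas trail_spine = closed_trail[OF spine_circulation]

lemma two_faces:
  assumes "u \<in> V" "v \<in> V" "u \<noteq> v" "face K (u, a) = face K (v, b)" "face K (u, \<not> a) = face K (v, \<not> b)"
  shows "spine V K = {u, v}"
proof -
  have "set [u, v] = spine V K"
    by (rule trail_spine[of _ "\<lambda>i. if i = 0 then a else \<not> b"]) (use assms in \<open>auto simp: less_Suc_eq\<close>)
  then show ?thesis by auto
qed

lemma triangle_faces:
  assumes "u \<in> V" "v \<in> V" "w \<in> V" "card {u, v, w} = 3"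
    "face K (u, \<not> a) = face K (v, b)" "face K (v, \<not> b) = face K (w, c)" "face K (w, \<not> c) = face K (u, a)"
  shows "spine V K = {u, v, w}"
proof -
  have d: "u \<noteq> v" "v \<noteq> w" "u \<noteq> w" using assms(4) by (auto simp: card_insert_if split: if_splits)
  have "set [u, v, w] = spine V K"
  proof (rule trail_spine[of _ "\<lambda>i. if i = 0 then a else if i = 1 then b else c"])
    fix i assume "i < length [u, v, w]"
    then consider "i = 0" | "i = 1" | "i = 2" by fastforce
    then show "face K ([u, v, w] ! i, \<not> (if i = 0 then a else if i = 1 then b else c)) =
      face K ([u, v, w] ! (Suc i mod length [u, v, w]),
        if Suc i mod length [u, v, w] = 0 then a else if Suc i mod length [u, v, w] = 1 then b else c)"
      using assms(5-7) by cases simp_all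
  qed (use assms(1-3) d in auto)
  then show ?thesis by auto
qed

lemma spine_ends_linked:
  assumes "h \<in> halves V" "h' \<in> halves V" "fst h \<in> spine V K" "fst h' \<in> spine V K"
  shows "linked (face K) (spine V K) (face K h) (face K h')"
  using circulation_linked[OF spine_circulation assms(3,4), of "snd h" "snd h'"] by simp

text \<open>If both faces of \<open>v\<close> were central, the spine would link them without
  \<open>v\<close>; then \<open>v\<close> is no bridge and belongs to the spine.\<close>

lemma not_two_central:
  assumes "v \<in> V" "v \<notin> spine V K" "central_face V K (face K (v, b)) e u"
  shows "\<exists>t. pure_face V K (face K (v, \<not> b)) t"
proof (rule ccontr)
  assume "\<not> ?thesis"
  then obtain e' u' where c: "central_face V K (face K (v, \<not> b)) e' u'"
    using faceE[of "(v, \<not> b)"] assms in_halves(1) by metis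
  have "linked (face K) (spine V K) (face K e) (face K e')"
    using spine_ends_linked[of e e'] central_in_spine[OF c] central_in_spine[OF assms(3)] c assms(3)
    by (simp add: central_face_def)
  then have "linked (face K) (V - {v}) (face K (v, b)) (face K (v, \<not> b))"
    using assms c by (auto elim!: linked_mono simp: central_face_def spine_def)
  then show False using bridge[OF spine_circulation assms(1)] assms by blast
qed

lemma sum_two_faces:
  assumes v: "v \<in> V" and z: "\<And>F. F \<in> face K ` halves V \<Longrightarrow> F \<noteq> face K (v, b) \<Longrightarrow> F \<noteq> face K (v, \<not> b) \<Longrightarrow> g F = 0"
  shows "(\<Sum>F\<in>face K ` halves V. g F) = g (face K (v, b)) + (g (face K (v, \<not> b)) :: nat)"
proof -
  have "(\<Sum>F\<in>face K ` halves V. g F) = (\<Sum>F\<in>{face K (v, b), face K (v, \<not> b)}. g F)"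
    using v z finite_V by (intro sum.mono_neutral_right) (auto simp: halves_def)
  then show ?thesis using no_loop'[OF v, of b] by simp
qed

text \<open>Two arcs that share both faces form the whole spine; the total weight is then a multiple of
  \<open>m\<close> strictly between \<open>0\<close> and \<open>2 * m\<close>.\<close>

lemma two_faces_hue:
  assumes u: "u \<in> V" and v: "v \<in> V" and uv: "u \<noteq> v" and f: "face K (u, a) = face K (v, b)" "face K (u, \<not> a) = face K (v, \<not> b)"
  shows "hue K (v, b) (u, a) = hue K (v, \<not> b) (u, \<not> a)"
proof -
  have s: "spine V K = {u, v}" using two_faces[OF u v uv f] .
  obtain e1 u1 where c1: "central_face V K (face K (v, b)) e1 u1" "(v, b) = e1 \<or> (v, b) = u1"
    by (rule spine_central[of "(v, b)"]) (use s v in auto)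
  obtain e2 u2 where c2: "central_face V K (face K (v, \<not> b)) e2 u2" "(v, \<not> b) = e2 \<or> (v, \<not> b) = u2"
    by (rule spine_central[of "(v, \<not> b)"]) (use s v in auto)
  have u1: "(u, a) = e1 \<or> (u, a) = u1" using central_not_in_other[OF c1(1), of "(u, a)"] u f s by auto
  have u2: "(u, \<not> a) = e2 \<or> (u, \<not> a) = u2" using central_not_in_other[OF c2(1), of "(u, \<not> a)"] u f s by auto
  have z: "wt V K F = 0 \<and> wb V K F = 0" if F: "F \<in> face K ` halves V" "F \<noteq> face K (v, b)" "F \<noteq> face K (v, \<not> b)" for F
  proof -
    have "\<not> central_face V K F e u'" for e u'
    proof
      assume c: "central_face V K F e u'"
      then have "fst e = u \<or> fst e = v" using central_in_spine[OF c] s by auto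
      then have "e \<in> {(u, a), (u, \<not> a), (v, b), (v, \<not> b)}" by (cases e) auto
      then show False using c F f by (auto simp: central_face_def)
    qed
    then have "{(e, u'). central_face V K F e u'} = {}" by auto
    then show ?thesis by (simp only: wt_def wb_def sum.empty simp_thms)
  qed
  have S: "(\<Sum>F\<in>face K ` halves V. wt V K F) = hue K e1 u1 + hue K e2 u2"
    using sum_two_faces[OF v, of b "wt V K"] z wt_central[OF c1(1)] wt_central[OF c2(1)] by simp
  have B: "(\<Sum>F\<in>face K ` halves V. wb V K F) = hue K u1 e1 + hue K u2 e2"
    using sum_two_faces[OF v, of b "wb V K"] z wb_central[OF c1(1)] wb_central[OF c2(1)] by simp
  have m1: "hue K e1 u1 + hue K u1 e1 = m" "hue K e2 u2 + hue K u2 e2 = m"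
    using hue_sum[of e1 u1] hue_sum[of e2 u2] c1(1) c2(1) by (auto simp: central_face_def)
  have dv: "m dvd (\<Sum>F\<in>face K ` halves V. wt V K F)"
    using wt_sum by (metis dvd_add_left_iff dvd_triv_left)
  then obtain k where k: "hue K e1 u1 + hue K e2 u2 = m * k" using S by auto
  have "0 < m * k" "m * k < 2 * m" using k S B wt_pos wb_pos m1 by linarith+
  then have "k = 1" using m_pos by (cases k) auto
  then have e: "hue K e1 u1 + hue K e2 u2 = m" using k by simp
  have l1: "lbl K (v, b) \<noteq> lbl K (v, \<not> b)" using spine_lbl[of v b] s by auto
  \<comment> \<open>\<open>v\<close> is the \<open>e\<close> of one face and the \<open>u\<close> of
    the other. So the claim compares \<open>hue K e1 u1\<close> with \<open>hue K u2 e2\<close>, or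
    the same with the two faces exchanged, and both agree because the hues from \<open>e\<close> to
    \<open>u\<close> add up to \<open>m\<close>.\<close>
  show ?thesis
    using c1 c2 u1 u2 uv e m1 l1 by (auto simp: central_face_def)
qed

lemma annulus_reflect: "annulus m V (reflect K) q p"
proof -
  interpret R: coloring m V "reflect K" by (rule coloring_reflect)
  note W = wt_reflect[OF coloring_axioms]
  show ?thesis
  proof unfold_locales
    fix F assume "F \<in> face (reflect K) ` halves V"
    then show "ok_face V (reflect K) F" using ok ok_reflect[OF coloring_axioms] by simp
  qed (use no_loop conn card_faces card_V wt_sum wb_sum wt_pos wb_pos W in auto)
qed

end

section \<open>Flips\<close>

text \<open>Three positions in cyclic order leave \<open>m + 2 - 3\<close> edges; in the opposite
  order the polygon is passed twice, which gives \<open>2 * (m + 2) - 3\<close>.\<close>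

lemma gap_tri:
  assumes "a \<noteq> b" "b \<noteq> c" "c \<noteq> a" "a \<le> m + 1" "b \<le> m + 1" "c \<le> m + 1" "1 \<le> m"
  shows "gap m a b + gap m b c + gap m c a = m - 1 \<or> gap m a b + gap m b c + gap m c a = 2 * m + 1"
  using assms by (cases "a < b"; cases "b < c"; cases "c < a"; simp add: gap_def; linarith)

text \<open>Seen from \<open>e\<close>, three edges lie on the same side of \<open>u\<close>: the
  arc \<open>v\<close> before the flip, \<open>v\<close> after it, and the arc arriving at position
  \<open>m + 1\<close>. The old numbering has \<open>e\<close> at \<open>a + 1\<close>, the new one
  at \<open>a\<close>, with \<open>v\<close> at 0 in both.\<close>

lemma gap_less:
  assumes "a \<noteq> c" "0 < a" "0 < c" "a \<le> m" "c \<le> m"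
  shows "gap m a c < gap m (a + 1) 0 \<longleftrightarrow> a < c" "gap m a c < gap m a 0 \<longleftrightarrow> a < c"
    "gap m a c < gap m a (m + 1) \<longleftrightarrow> a < c"
  using assms by (auto simp: gap_def)

lemma gap_less':
  assumes "a \<noteq> x" "0 < a" "0 < x" "a \<le> m" "x \<le> m"
  shows "gap m a 0 < gap m a x \<longleftrightarrow> m - a < gap m a x"
  using assms by (auto simp: gap_def)

text \<open>What has to be verified at the two faces of \<open>v\<close>. The last two conjuncts
  preserve positivity: a total weight can drop only when \<open>v\<close> becomes an arc on the side
  of the corresponding circle.\<close>

definition flip_ok :: "nat \<Rightarrow> 'a set \<Rightarrow> 'a \<Rightarrow> ('a, 'f) conf \<Rightarrow> bool \<Rightarrow> bool" where
  "flip_ok m V v K b \<longleftrightarrow> (let K' = flip m V v K; F = face K (v, b); G = face K (v, \<not> b) in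
    ok_face V K' F \<and> ok_face V K' G \<and>
    wt V K' F + wt V K' G + m * of_bool (side K' False v) = wt V K F + wt V K G + m * of_bool (side K False v) \<and>
    wb V K' F + wb V K' G + m * of_bool (side K' True v) = wb V K F + wb V K G + m * of_bool (side K True v) \<and>
    (side K' False v \<and> \<not> side K False v \<longrightarrow> 0 < wt V K' F + wt V K' G) \<and>
    (side K' True v \<and> \<not> side K True v \<longrightarrow> 0 < wb V K' F + wb V K' G))"

lemma flip_ok_swap: "flip_ok m V v K (\<not> b) \<longleftrightarrow> flip_ok m V v K b"
  by (auto simp: flip_ok_def Let_def add.commute)

lemma flip_ok_reflect:
  assumes "coloring m V K" "coloring m V (flip m V v K)"
  shows "flip_ok m V v (reflect K) b \<longleftrightarrow> flip_ok m V v K b"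
  unfolding flip_ok_def Let_def flip_reflect
  by (auto simp: wt_reflect[OF assms(1)] wt_reflect[OF assms(2)] ok_reflect[OF assms(2)])

lemma centralD:
  assumes "central_face V K G e u"
  shows "e \<in> halves V" "u \<in> halves V" "face K e = G" "face K u = G" "lbl K e" "\<not> lbl K (oth e)"
    "\<not> lbl K u" "lbl K (oth u)" "e \<noteq> u"
    and "h \<in> halves V \<Longrightarrow> face K h = G \<Longrightarrow> h \<noteq> e \<Longrightarrow> h \<noteq> u \<Longrightarrow>
        lbl K (oth h) = lbl K h \<and> (lbl K h \<longleftrightarrow> hue K e u < hue K e h)"
  using assms unfolding central_face_def by (blast, blast, blast, blast, blast, blast, blast, blast, blast, blast)

section \<open>Faces, hues and labels after one flip\<close>

locale flipping = annulus m V K p q for m and V :: "'a set" and K :: "('a, 'f) conf" and p q +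
  fixes v :: 'a
  assumes v_in: "v \<in> V"
begin

abbreviation "K' \<equiv> flip m V v K"
abbreviation "F b \<equiv> face K (v, b)"
abbreviation "nxt b \<equiv> next_half V K (v, b)"
text \<open>The arc next to \<open>v\<close> in the face \<open>F b\<close> joins the two circles,
  so the end of \<open>v\<close> that slides along it changes circle.\<close>

definition "turn b \<longleftrightarrow> (\<exists>x. nxt b x \<and> lbl K x \<noteq> lbl K (oth x))"

lemma flipping_reflect: "flipping m V (reflect K) q p v"
  using annulus_reflect v_in by (simp add: flipping_def flipping_axioms_def)

lemma F_neq: "F b \<noteq> F (\<not> b)"
  using no_loop'[OF v_in] .

lemma nxtD: "nxt b x \<Longrightarrow> x \<in> halves V \<and> fst x \<noteq> v \<and> face K x = F b \<and> hue K (v, b) x = 0"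
  using F_neq[of b] by (cases x) (auto simp: next_half_def)

lemma nxt_not: "nxt b x \<Longrightarrow> \<not> nxt (\<not> b) x"
  using nxtD F_neq by metis

lemma nxt_unique: "nxt b x \<Longrightarrow> nxt b x' \<Longrightarrow> x = x'"
  using next_half_unique[of "(v, b)"] v_in by simp

lemma face'_v [simp]: "face K' (v, b) = F b"
  by (simp add: flip_def)

lemma face'_move: "nxt b h \<Longrightarrow> face K' h = F (\<not> b)"
  using nxtD[of b h] nxt_not[of b h] by (cases b) (auto simp: flip_def)

lemma face'_other: "\<not> nxt True h \<Longrightarrow> \<not> nxt False h \<Longrightarrow> face K' h = face K h"
  by (auto simp: flip_def)

lemma face'_cases:
  obtains b where "nxt b h" "face K' h = F (\<not> b)" | "\<And>b. \<not> nxt b h" "face K' h = face K h"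
  using face'_move face'_other by (metis (full_types))

lemma face'_F:
  assumes "h \<in> halves V" "face K' h = F b"
  obtains "h = (v, b)" | "fst h \<noteq> v" "face K h = F b" "\<not> nxt b h" "\<not> nxt (\<not> b) h" | "nxt (\<not> b) h" "fst h \<noteq> v"
proof (cases rule: face'_cases[of h])
  case (1 c)
  then have "c = (\<not> b)" using assms F_neq[of b] by (cases c; cases b) auto
  then show ?thesis using 1 that(3) nxtD by auto
next
  case 2
  then have fh: "face K h = F b" using assms by simp
  show ?thesis
  proof (cases "fst h = v")
    case True
    then have "h = (v, b) \<or> h = (v, \<not> b)" by (cases h) auto
    then have "h = (v, b)" using fh F_neq[of b] by auto
    then show ?thesis using that(1) by simp
  next
    case False
    then show ?thesis using that(2) 2 fh by simp
  qed
qed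

lemma face'_not_F:
  assumes "face K' h = G" "\<And>b. G \<noteq> F b"
  shows "face K h = G" "fst h \<noteq> v" "\<And>b. \<not> nxt b h"
proof -
  show 1: "\<not> nxt b h" for b using assms face'_move by metis
  then show "face K h = G" using assms(1) face'_other by metis
  then show "fst h \<noteq> v" using assms(2)[of "snd h"] by (cases h) auto
qed

lemma face'_eq_iff:
  assumes "\<And>b. G \<noteq> F b"
  shows "face K' h = G \<longleftrightarrow> face K h = G"
proof
  assume h: "face K h = G"
  then have "\<not> nxt b h" for b using nxtD assms by metis
  then show "face K' h = G" using face'_other h by simp
qed (rule face'_not_F[OF _ assms])

text \<open>Positions in the new polygon, again with \<open>v\<close> at 0. Since \<open>v\<close>
  has advanced by one edge, the halves that stay move from position
  \<open>hue K (v, b) h + 1\<close> to \<open>hue K (v, b) h\<close>, and the half arriving from the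
  other face takes the last position \<open>m + 1\<close>.\<close>

definition slot :: "bool \<Rightarrow> 'a \<times> bool \<Rightarrow> nat" where
  "slot b h = (if h = (v, b) then 0 else if nxt (\<not> b) h then m + 1 else hue K (v, b) h)"

lemma hue_v_pos: "fst h \<noteq> v \<Longrightarrow> h \<in> halves V \<Longrightarrow> face K h = F b \<Longrightarrow> \<not> nxt b h \<Longrightarrow> 0 < hue K (v, b) h"
  by (auto simp: next_half_def)

lemma hue_v_sum: "fst h \<noteq> v \<Longrightarrow> h \<in> halves V \<Longrightarrow> face K h = F b \<Longrightarrow> hue K (v, b) h + hue K h (v, b) = m"
  using hue_sum[of "(v, b)" h] v_in by (cases "(v, b) = h") auto

lemma hue_v_gap:
  assumes "h \<in> halves V" "h' \<in> halves V" "face K h = F b" "face K h' = F b" "fst h \<noteq> v" "fst h' \<noteq> v" "h \<noteq> h'"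
  shows "hue K (v, b) h \<noteq> hue K (v, b) h'" "hue K h h' = gap m (hue K (v, b) h) (hue K (v, b) h')"
proof -
  have "h \<noteq> (v, b)" "h' \<noteq> (v, b)" using assms by auto
  then show "hue K (v, b) h \<noteq> hue K (v, b) h'" "hue K h h' = gap m (hue K (v, b) h) (hue K (v, b) h')"
    using place_props[of "(v, b)" h h'] assms v_in by (auto simp: place_def gap_def)
qed

lemma hue'_simps:
  assumes "fst h \<noteq> v" "fst h' \<noteq> v"
  shows "nxt (\<not> b) h \<Longrightarrow> hue K' (v, b) h = m" "nxt (\<not> b) h \<Longrightarrow> hue K' h (v, b) = 0"
    "\<not> nxt (\<not> b) h \<Longrightarrow> hue K' (v, b) h = hue K (v, b) h - 1" "\<not> nxt (\<not> b) h \<Longrightarrow> hue K' h (v, b) = hue K h (v, b) + 1"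
    "nxt b h' \<Longrightarrow> \<not> nxt (\<not> b) h \<Longrightarrow> hue K' h h' = hue K h (v, \<not> b)"
    "nxt b h \<Longrightarrow> \<not> nxt b h' \<Longrightarrow> \<not> nxt (\<not> b) h' \<Longrightarrow> hue K' h h' = hue K (v, \<not> b) h'"
    "(\<And>c. \<not> nxt c h) \<Longrightarrow> (\<And>c. \<not> nxt c h') \<Longrightarrow> hue K' h h' = hue K h h'"
  using assms nxt_not[of b h'] nxt_not[of b h] by (cases b; auto simp: flip_def)+

lemma slot_le: "h \<in> halves V \<Longrightarrow> face K' h = F b \<Longrightarrow> slot b h \<le> m + 1"
proof -
  assume h: "h \<in> halves V" "face K' h = F b"
  show ?thesis using hue_v_sum[of h b] h by (cases rule: face'_F[OF h]) (auto simp: slot_def)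
qed

lemma slot_inj:
  assumes "h \<in> halves V" "h' \<in> halves V" "face K' h = F b" "face K' h' = F b" "h \<noteq> h'"
  shows "slot b h \<noteq> slot b h'"
proof -
  have 0: "0 < slot b k" "nxt (\<not> b) k \<or> slot b k \<le> m" if "k \<in> halves V" "face K' k = F b" "k \<noteq> (v, b)" for k
    using that(2) hue_v_pos[of k b] hue_v_sum[of k b] that by (cases rule: face'_F[OF that(1,2)]; auto simp: slot_def)+
  show ?thesis
  proof (cases "h = (v, b) \<or> h' = (v, b)")
    case True
    then show ?thesis using 0(1)[of h] 0(1)[of h'] assms by (auto simp: slot_def)
  next
    case False
    then show ?thesis
      using 0(2)[of h] 0(2)[of h'] assms nxt_unique[of "\<not> b" h h'] hue_v_gap(1)[of h h' b]
      by (cases rule: face'_F[OF assms(1,3)]; cases rule: face'_F[OF assms(2,4)]) (auto simp: slot_def)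
  qed
qed

text \<open>This is the justification of the case distinction for hues in \<open>flip\<close>: in
  each case the value is a gap between positions of one polygon. The conditions on the new hues then
  follow from those on \<open>gap\<close>.\<close>

lemma hue'_slot:
  assumes "h \<in> halves V" "h' \<in> halves V" "face K' h = F b" "face K' h' = F b" "h \<noteq> h'"
  shows "hue K' h h' = gap m (slot b h) (slot b h')"
proof (cases rule: face'_F[OF assms(1,3)])
  case h: 1
  show ?thesis
  proof (cases rule: face'_F[OF assms(2,4)])
    case 2
    then show ?thesis using h hue_v_pos[of h' b] assms hue'_simps(3)[of h' h' b] by (auto simp: slot_def gap_def)
  next
    case 3
    then show ?thesis using h hue'_simps(1)[of h' h' b] by (auto simp: slot_def gap_def)
  qed (use h assms in simp)
next
  case h: 2
  show ?thesis
  proof (cases rule: face'_F[OF assms(2,4)])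
    case 1
    then show ?thesis using h hue_v_sum[of h b] assms hue'_simps(4)[of h h b] by (auto simp: slot_def gap_def)
  next
    case 2
    then have "\<not> nxt c h" "\<not> nxt c h'" for c using h by (cases "c = b"; simp)+
    then have "hue K' h h' = hue K h h'" using hue'_simps(7)[of h h'] 2 h by blast
    then show ?thesis using hue_v_gap(2)[of h h' b] 2 h assms by (auto simp: slot_def)
  next
    case 3
    then have "hue K' h h' = hue K h (v, b)" using hue'_simps(5)[of h h' "\<not> b"] h by simp
    then show ?thesis using 3 h hue_v_sum[of h b] assms by (auto simp: slot_def gap_def)
  qed
next
  case h: 3
  show ?thesis
  proof (cases rule: face'_F[OF assms(2,4)])
    case 1
    then show ?thesis using h hue'_simps(2)[of h h b] by (auto simp: slot_def gap_def)
  next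
    case 2
    then have "hue K' h h' = hue K (v, b) h'" using hue'_simps(6)[of h h' "\<not> b"] h by simp
    then show ?thesis using 2 h hue_v_sum[of h' b] assms by (auto simp: slot_def gap_def)
  next
    case 3
    then show ?thesis using h nxt_unique assms by blast
  qed
qed

lemma coloring': "coloring m V K'"
proof unfold_locales
  fix h h' assume h: "h \<in> halves V" "h' \<in> halves V" "face K' h = face K' h'" "h \<noteq> h'"
  show "hue K' h h' + hue K' h' h = m"
  proof (cases "\<exists>b. face K' h = F b")
    case True
    then obtain b where b: "face K' h = F b" by auto
    then show ?thesis
      using hue'_slot[of h h' b] hue'_slot[of h' h b] slot_inj[of h h' b] slot_le[of h b] slot_le[of h' b] h m_pos
      by (auto simp: gap_def split: if_splits)
  next
    case False
    then show ?thesis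
      using face'_not_F[of h "face K' h"] face'_not_F[of h' "face K' h"] h hue_sum hue'_simps(7)[of h h'] hue'_simps(7)[of h' h]
      by simp
  qed
next
  fix h h' k assume h: "h \<in> halves V" "h' \<in> halves V" "k \<in> halves V" "face K' h = face K' h'" "face K' h' = face K' k"
    "h \<noteq> h'" "h' \<noteq> k" "k \<noteq> h"
  show "hue K' h h' + hue K' h' k + hue K' k h = m - 1 \<or> hue K' h h' + hue K' h' k + hue K' k h = 2 * m + 1"
  proof (cases "\<exists>b. face K' h = F b")
    case True
    then obtain b where b: "face K' h = F b" by auto
    have "hue K' h h' = gap m (slot b h) (slot b h')" "hue K' h' k = gap m (slot b h') (slot b k)"
      "hue K' k h = gap m (slot b k) (slot b h)" "slot b h \<noteq> slot b h'" "slot b h' \<noteq> slot b k" "slot b k \<noteq> slot b h"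
      "slot b h \<le> m + 1" "slot b h' \<le> m + 1" "slot b k \<le> m + 1"
      using h b slot_le[of _ b] by (simp_all add: hue'_slot slot_inj)
    then show ?thesis using gap_tri m_pos by presburger
  next
    case False
    then show ?thesis
      using face'_not_F[of h "face K' h"] face'_not_F[of h' "face K' h"] face'_not_F[of k "face K' h"] h
        hue_tri[of h h' k] hue'_simps(7)[of h h'] hue'_simps(7)[of h' k] hue'_simps(7)[of k h]
      by simp
  qed
qed (use m_pos finite_V in auto)

sublocale new: coloring m V K' by (rule coloring')

lemma faces': "face K' ` halves V = face K ` halves V"
proof
  show "face K' ` halves V \<subseteq> face K ` halves V"
  proof
    fix G assume "G \<in> face K' ` halves V"
    then obtain h where "h \<in> halves V" "G = face K' h" by auto
    then show "G \<in> face K ` halves V" using v_in by (cases rule: face'_cases[of h]) (auto intro!: face_in)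
  qed
  show "face K ` halves V \<subseteq> face K' ` halves V"
  proof
    fix G assume G: "G \<in> face K ` halves V"
    show "G \<in> face K' ` halves V"
    proof (cases "\<exists>b. G = F b")
      case True
      then show ?thesis using v_in face'_v by (metis image_eqI in_halves(1))
    next
      case False
      obtain h where h: "h \<in> halves V" "G = face K h" using G by auto
      then have "face K' h = G" using False face'_eq_iff[of G h] by auto
      then show ?thesis using h(1) by (metis image_eqI)
    qed
  qed
qed

text \<open>A half that changes its face moves between the two faces of \<open>v\<close>, and these
  remain linked by \<open>v\<close>.\<close>

lemma conn':
  assumes "a \<in> face K' ` halves V" "c \<in> face K' ` halves V"
  shows "linked (face K') V a c"
proof -
  have Fs: "linked (face K') V (F b) (F b')" for b b'
    using linked_edge[OF v_in, of "face K'" b b'] by simp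
  have half: "linked (face K') V (face K h) (face K' h)" if "h \<in> halves V" for h
  proof (cases rule: face'_cases[of h])
    case (1 b)
    then show ?thesis using nxtD Fs by metis
  qed simp
  have "linked (face K') V a c" if "linked (face K) V a c" for a c
    using that
  proof (induction rule: rtranclp_induct)
    case (step x y)
    then obtain e d where e: "e \<in> V" "x = face K (e, d)" "y = face K (e, \<not> d)" by (auto simp: adj_def)
    have "linked (face K') V (face K' (e, d)) (face K' (e, \<not> d))" using e by (intro linked_edge)
    then have "linked (face K') V x y"
      using half[of "(e, d)"] linked_sym[OF half[of "(e, \<not> d)"]] e by (meson in_halves(1) rtranclp_trans)
    with step show ?case by simp
  qed simp
  then show ?thesis using conn assms faces' by simp
qed

text \<open>A loop could arise only if one half of \<open>u\<close> moves into the face where the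
  other half already lies. Then \<open>u\<close> and \<open>v\<close> share both faces, and by
  equality of the two hues the other half of \<open>u\<close> is next to \<open>v\<close> as well
  and moves away.\<close>

lemma no_loop_flip: "u \<in> V \<Longrightarrow> face K' (u, True) \<noteq> face K' (u, False)"
proof
  assume u: "u \<in> V" and eq: "face K' (u, True) = face K' (u, False)"
  have uv: "u \<noteq> v" using eq F_neq[of True] by auto
  have *: False if "nxt b (u, c)" "face K' (u, \<not> c) = face K' (u, c)" for b c
  proof (cases "nxt (\<not> b) (u, \<not> c)")
    case True
    then show ?thesis using that F_neq[of b] face'_move[of b "(u, c)"] face'_move[of "\<not> b" "(u, \<not> c)"] by simp
  next
    case False
    have "\<not> nxt b (u, \<not> c)" using nxt_unique[OF that(1)] by auto
    with False have "face K' (u, \<not> c) = face K (u, \<not> c)" by (cases b) (auto intro: face'_other)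
    then have f: "face K (u, \<not> c) = F (\<not> b)" "face K (u, c) = F b" using that face'_move nxtD[OF that(1)] by auto
    then have "hue K (v, \<not> b) (u, \<not> c) = 0"
      using two_faces_hue[OF u v_in uv, of c b] nxtD[OF that(1)] by simp
    then show ?thesis using False f u uv by (auto simp: next_half_def)
  qed
  show False
  proof (cases rule: face'_cases[of "(u, True)"])
    case 1
    then show ?thesis using *[of _ True] eq by auto
  next
    case T: 2
    show ?thesis
    proof (cases rule: face'_cases[of "(u, False)"])
      case 1
      then show ?thesis using *[of _ False] eq by auto
    next
      case 2
      then show ?thesis using T no_loop[OF u] eq by simp
    qed
  qed
qed

text \<open>The edge \<open>(v, b)\<close> starts where \<open>(v, \<not> b)\<close> ends. This end
  slides along the arc following \<open>(v, \<not> b)\<close>, so the label changes exactly if that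
  arc joins the two circles.\<close>

lemma lbl'_v: "lbl K' (v, b) \<longleftrightarrow> lbl K (v, b) \<noteq> turn (\<not> b)"
  by (simp add: flip_def turn_def)

lemma lbl'_other [simp]: "fst h \<noteq> v \<Longrightarrow> lbl K' h = lbl K h"
  by (simp add: flip_def)

lemma pure'I:
  assumes "\<And>h. h \<in> halves V \<Longrightarrow> fst h \<noteq> v \<Longrightarrow> face K h = F b \<Longrightarrow> \<not> nxt b h \<Longrightarrow> lbl K h = t \<and> lbl K (oth h) = t"
    and "\<And>y. nxt (\<not> b) y \<Longrightarrow> lbl K y = t \<and> lbl K (oth y) = t"
    and "lbl K' (v, b) = t \<and> lbl K' (v, \<not> b) = t"
  shows "pure_face V K' (F b) t"
  unfolding pure_face_def
proof (intro ballI impI)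
  fix h assume h: "h \<in> halves V" "face K' h = F b"
  show "lbl K' h = t \<and> lbl K' (oth h) = t"
    by (cases rule: face'_F[OF h]) (use assms h in auto)
qed

text \<open>The new face contains halves that stay, the half arriving at position
  \<open>m + 1\<close>, and \<open>v\<close> at position 0; the last three assumptions treat these
  kinds in this order.\<close>

lemma central'I:
  assumes eu: "e \<in> halves V" "u \<in> halves V" "face K' e = F b" "face K' u = F b"
      "lbl K' e" "\<not> lbl K' (oth e)" "\<not> lbl K' u" "lbl K' (oth u)"
    and 1: "\<And>h. h \<in> halves V \<Longrightarrow> fst h \<noteq> v \<Longrightarrow> face K h = F b \<Longrightarrow> \<not> nxt b h \<Longrightarrow> h \<noteq> e \<Longrightarrow> h \<noteq> u \<Longrightarrow>
      lbl K (oth h) = lbl K h \<and> (lbl K h \<longleftrightarrow> gap m (slot b e) (slot b u) < gap m (slot b e) (hue K (v, b) h))"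
    and 2: "\<And>y. nxt (\<not> b) y \<Longrightarrow> y \<noteq> e \<Longrightarrow> y \<noteq> u \<Longrightarrow>
      lbl K (oth y) = lbl K y \<and> (lbl K y \<longleftrightarrow> gap m (slot b e) (slot b u) < gap m (slot b e) (m + 1))"
    and 3: "(v, b) \<noteq> e \<Longrightarrow> (v, b) \<noteq> u \<Longrightarrow>
      lbl K' (v, \<not> b) = lbl K' (v, b) \<and> (lbl K' (v, b) \<longleftrightarrow> gap m (slot b e) (slot b u) < gap m (slot b e) 0)"
  shows "central_face V K' (F b) e u"
proof -
  have neq: "e \<noteq> u" using eu by auto
  have "lbl K' (oth h) = lbl K' h \<and> (lbl K' h \<longleftrightarrow> hue K' e u < hue K' e h)"
    if h: "h \<in> halves V" "face K' h = F b" "h \<noteq> e" "h \<noteq> u" for h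
  proof -
    have *: "hue K' e u = gap m (slot b e) (slot b u)" "hue K' e h = gap m (slot b e) (slot b h)"
      using hue'_slot eu h neq by auto
    show ?thesis
    proof (cases rule: face'_F[OF h(1,2)])
      case a: 1
      then show ?thesis using 3 * h by (simp add: slot_def)
    next
      case a: 2
      then have "slot b h = hue K (v, b) h" by (auto simp: slot_def)
      then show ?thesis using 1[of h] a * h by simp
    next
      case a: 3
      then have "slot b h = m + 1" by (auto simp: slot_def)
      then show ?thesis using 2[of h] a * h by simp
    qed
  qed
  then show ?thesis using eu unfolding central_face_def by blast
qed

lemma corner_v: "nxt b y \<Longrightarrow> lbl K y = lbl K (v, \<not> b)"
  using corner[OF coloring_axioms ok[OF face_in], of "(v, b)" y] v_in by simp

lemma not_turn: "\<not> turn b \<Longrightarrow> nxt b y \<Longrightarrow> lbl K (oth y) = lbl K y"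
  by (auto simp: turn_def)

lemma place_v: "place (v, b) h = (if h = (v, b) then 0 else hue K (v, b) h + 1)"
  by (simp add: place_def)

lemma old_hue:
  assumes "h \<in> halves V" "h' \<in> halves V" "face K h = F b" "face K h' = F b" "h \<noteq> h'"
  shows "hue K h h' = gap m (place (v, b) h) (place (v, b) h')"
  using place_props(3)[of "(v, b)" h h'] assms v_in by auto

lemma slot_old: "h \<in> halves V \<Longrightarrow> face K h = F b \<Longrightarrow> fst h \<noteq> v \<Longrightarrow> slot b h = hue K (v, b) h"
  using nxtD[of "\<not> b" h] F_neq[of b] by (auto simp: slot_def)

lemma slot_v [simp]: "slot b (v, b) = 0"
  by (simp add: slot_def)

lemma slot_new: "nxt (\<not> b) y \<Longrightarrow> slot b y = m + 1"
  using nxtD[of "\<not> b" y] by (auto simp: slot_def)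

lemma face'_old: "h \<in> halves V \<Longrightarrow> face K h = F b \<Longrightarrow> \<not> nxt b h \<Longrightarrow> face K' h = F b"
  using nxtD[of "\<not> b" h] F_neq[of b] face'_other[of h] by (cases b) auto

lemma not_v: "h \<in> halves V \<Longrightarrow> face K h = F b \<Longrightarrow> h \<noteq> (v, b) \<Longrightarrow> fst h \<noteq> v"
  using F_neq[of b] by (cases h, rename_tac a c, case_tac "c = b") auto

lemma wt_new: "central_face V K' (F b) e u \<Longrightarrow> wt V K' (F b) = gap m (slot b e) (slot b u) \<and>
    wb V K' (F b) = gap m (slot b u) (slot b e)"
  using new.wt_central[of "F b" e u] new.wb_central[of "F b" e u] hue'_slot[of e u b] hue'_slot[of u e b]
  by (auto simp: central_face_def)

text \<open>No arc joining the circles is next to \<open>v\<close>, so \<open>e\<close> and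
  \<open>u\<close> stay in place. The arriving arc carries the label of \<open>v\<close> and sits
  beside it, hence in the same interval.\<close>

lemma plain_side_face:
  assumes s: "lbl K (v, b) = lbl K (v, \<not> b)" and t: "\<not> turn b" "\<not> turn (\<not> b)"
  shows "ok_face V K' (F b) \<and> wt V K' (F b) = wt V K (F b) \<and> wb V K' (F b) = wb V K (F b)"
proof -
  have l: "lbl K' (v, b) = lbl K (v, b)" "lbl K' (v, \<not> b) = lbl K (v, b)" using s t by (simp_all add: lbl'_v)
  have y: "lbl K y = lbl K (v, b) \<and> lbl K (oth y) = lbl K (v, b)" if "nxt (\<not> b) y" for y
    using corner_v[OF that] not_turn[OF t(2) that] by simp
  have "(v, b) \<in> halves V" using v_in by simp
  then show ?thesis
  proof (cases rule: faceE)
    case (1 t)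
    then have "lbl K (v, b) = t" using v_in by (auto simp: pure_face_def)
    then have "pure_face V K' (F b) t" using 1 y l by (intro pure'I) (auto simp: pure_face_def)
    then show ?thesis using 1 by (auto simp: ok_face_def)
  next
    case (2 e u)
    note eu = centralD(1-9)[OF 2] and rest = centralD(10)[OF 2]
    have nv: "e \<noteq> (v, b)" "u \<noteq> (v, b)" using eu s by auto
    then have nv': "fst e \<noteq> v" "fst u \<noteq> v" using not_v eu by auto
    \<comment> \<open>If \<open>e\<close> or \<open>u\<close> were next to \<open>v\<close>, the end
      of \<open>v\<close> would turn.\<close>
    have nn: "\<not> nxt b e" "\<not> nxt b u" using not_turn[OF t(1)] eu by blast+
    have pos: "0 < hue K (v, b) e" "0 < hue K (v, b) u" using hue_v_pos nv' eu nn by auto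
    have le: "hue K (v, b) e \<le> m" "hue K (v, b) u \<le> m" using hue_v_sum nv' eu by fastforce+
    have hv: "hue K e (v, b) = gap m (hue K (v, b) e + 1) 0" using old_hue[of e "(v, b)" b] eu nv v_in by (auto simp: place_v)
    have hg: "hue K e h = gap m (hue K (v, b) e) (hue K (v, b) h)" "hue K (v, b) e \<noteq> hue K (v, b) h"
      if "h \<in> halves V" "face K h = F b" "fst h \<noteq> v" "h \<noteq> e" for h
      using hue_v_gap[of e h b] eu nv' that by auto
    have sl: "slot b e = hue K (v, b) e" "slot b u = hue K (v, b) u" using slot_old eu nv' by auto
    have vl: "lbl K (v, b) \<longleftrightarrow> gap m (hue K (v, b) e) (hue K (v, b) u) < gap m (hue K (v, b) e + 1) 0"
      using rest[of "(v, b)"] v_in nv hv hg[of u] eu nv' by auto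
    have gl: "gap m (hue K (v, b) e) (hue K (v, b) u) < gap m (hue K (v, b) e + 1) 0 \<longleftrightarrow> hue K (v, b) e < hue K (v, b) u"
      "gap m (hue K (v, b) e) (hue K (v, b) u) < gap m (hue K (v, b) e) 0 \<longleftrightarrow> hue K (v, b) e < hue K (v, b) u"
      "gap m (hue K (v, b) e) (hue K (v, b) u) < gap m (hue K (v, b) e) (m + 1) \<longleftrightarrow> hue K (v, b) e < hue K (v, b) u"
      using gap_less[of "hue K (v, b) e" "hue K (v, b) u" m] pos le hg(2)[of u] eu nv' by simp_all
    have c: "central_face V K' (F b) e u"
    proof (rule central'I)
      fix h assume h: "h \<in> halves V" "fst h \<noteq> v" "face K h = F b" "h \<noteq> e" "h \<noteq> u"
      show "lbl K (oth h) = lbl K h \<and> (lbl K h \<longleftrightarrow> gap m (slot b e) (slot b u) < gap m (slot b e) (hue K (v, b) h))"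
        using rest[of h] h hg(1)[of h] hg(1)[of u] eu nv' sl by simp
    next
      fix y' assume "nxt (\<not> b) y'"
      then show "lbl K (oth y') = lbl K y' \<and> (lbl K y' \<longleftrightarrow> gap m (slot b e) (slot b u) < gap m (slot b e) (m + 1))"
        using y[of y'] vl gl sl by simp
    next
      show "lbl K' (v, \<not> b) = lbl K' (v, b) \<and> (lbl K' (v, b) \<longleftrightarrow> gap m (slot b e) (slot b u) < gap m (slot b e) 0)"
        using l vl gl sl by simp
    qed (use eu nn nv' face'_old in auto)
    have "wt V K' (F b) = wt V K (F b) \<and> wb V K' (F b) = wb V K (F b)"
      using wt_new[OF c] wt_central[OF 2] wb_central[OF 2] sl hg(1)[of u] hue_v_gap(2)[of u e b] eu nv' by simp
    then show ?thesis using c by (auto simp: ok_face_def)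
  qed
qed

lemma side_iff: "side K t v \<longleftrightarrow> lbl K (v, b) = t \<and> lbl K (v, \<not> b) = t"
  by (cases b) (auto simp: side_def)

lemma side'_iff: "side K' t v \<longleftrightarrow> lbl K' (v, b) = t \<and> lbl K' (v, \<not> b) = t"
  by (cases b) (auto simp: side_def)

lemma entryE:
  assumes "lbl K (v, b)" "\<not> lbl K (v, \<not> b)"
  obtains u where "central_face V K (F b) (v, b) u"
proof -
  have "(v, b) \<in> halves V" using v_in by simp
  moreover have "fst (v, b) \<in> spine V K" using assms v_in in_spineI[of "(v, b)"] by simp
  ultimately show ?thesis
  proof (rule spine_central)
    fix e u assume c: "central_face V K (F b) e u" "(v, b) = e \<or> (v, b) = u"
    then have "central_face V K (F b) (v, b) u" using centralD(7)[OF c(1)] assms by auto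
    then show ?thesis by (rule that)
  qed
qed

lemma exitE:
  assumes "\<not> lbl K (v, b)" "lbl K (v, \<not> b)"
  obtains e where "central_face V K (F b) e (v, b)"
proof -
  have "(v, b) \<in> halves V" using v_in by simp
  moreover have "fst (v, b) \<in> spine V K" using assms v_in in_spineI[of "(v, b)"] by simp
  ultimately show ?thesis
  proof (rule spine_central)
    fix e u assume c: "central_face V K (F b) e u" "(v, b) = e \<or> (v, b) = u"
    then have "central_face V K (F b) e (v, b)" using centralD(5)[OF c(1)] assms by auto
    then show ?thesis by (rule that)
  qed
qed

lemma plain_side:
  assumes "lbl K (v, b) = lbl K (v, \<not> b)" "\<not> turn b" "\<not> turn (\<not> b)"
  shows "flip_ok m V v K b"
  using plain_side_face[of b] plain_side_face[of "\<not> b"] assms side_iff[of _ b] side'_iff[of _ b] lbl'_v[of b] lbl'_v[of "\<not> b"]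
  by (simp add: flip_ok_def)

text \<open>Both ends of \<open>v\<close> advance by one edge along their circles. In
  \<open>F b\<close> the interval of \<open>False\<close> loses one edge and that of
  \<open>True\<close> gains one; in the other face it is the other way round.\<close>

lemma plain_spine:
  assumes l: "lbl K (v, b)" "\<not> lbl K (v, \<not> b)" and t: "\<not> turn b" "\<not> turn (\<not> b)"
  shows "flip_ok m V v K b"
proof -
  obtain u where cu: "central_face V K (F b) (v, b) u" using entryE l .
  obtain e where ce: "central_face V K (F (\<not> b)) e (v, \<not> b)" using exitE[of "\<not> b"] l by auto
  note U = centralD(1-9)[OF cu] and Ur = centralD(10)[OF cu]
  note E = centralD(1-9)[OF ce] and Er = centralD(10)[OF ce]
  have l': "lbl K' (v, b)" "\<not> lbl K' (v, \<not> b)" using l t by (simp_all add: lbl'_v)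
  have n: "\<not> nxt b u" "\<not> nxt (\<not> b) e" using not_turn[OF t(1)] not_turn[OF t(2)] U E by blast+
  have nv: "fst u \<noteq> v" "fst e \<noteq> v" using not_v U E by auto
  define a c where "a = hue K (v, \<not> b) e" and "c = hue K (v, b) u"
  have p: "0 < a" "0 < c" using hue_v_pos nv n U E by (auto simp: a_def c_def)
  have s: "c + hue K u (v, b) = m" "a + hue K e (v, \<not> b) = m" using hue_v_sum nv U E by (auto simp: a_def c_def)
  have sl: "slot b u = c" "slot (\<not> b) e = a" using slot_old nv U E by (auto simp: a_def c_def)
  have hv: "hue K e (v, \<not> b) = m - a" using s by simp
  have 1: "central_face V K' (F b) (v, b) u"
  proof (rule central'I)
    fix h assume h: "h \<in> halves V" "fst h \<noteq> v" "face K h = F b" "\<not> nxt b h" "h \<noteq> u"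
    then have "h \<noteq> (v, b)" by auto
    then have "lbl K (oth h) = lbl K h \<and> (lbl K h \<longleftrightarrow> c < hue K (v, b) h)" using Ur[of h] h c_def by auto
    then show "lbl K (oth h) = lbl K h \<and> (lbl K h \<longleftrightarrow> gap m (slot b (v, b)) (slot b u) < gap m (slot b (v, b)) (hue K (v, b) h))"
      using hue_v_pos[of h b] h sl p by (auto simp: gap_def)
  next
    fix y assume y: "nxt (\<not> b) y"
    then show "lbl K (oth y) = lbl K y \<and> (lbl K y \<longleftrightarrow> gap m (slot b (v, b)) (slot b u) < gap m (slot b (v, b)) (m + 1))"
      using not_turn[OF t(2) y] corner_v[OF y] l sl p s by (auto simp: gap_def)
  qed (use U l' n nv face'_old in auto)
  have 2: "central_face V K' (F (\<not> b)) e (v, \<not> b)"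
  proof (rule central'I)
    fix h assume h: "h \<in> halves V" "fst h \<noteq> v" "face K h = F (\<not> b)" "\<not> nxt (\<not> b) h" "h \<noteq> e"
    have "hue K e h = gap m a (hue K (v, \<not> b) h)" "hue K (v, \<not> b) h \<noteq> a" "hue K (v, \<not> b) h \<le> m"
      using hue_v_gap[of e h "\<not> b"] h E nv a_def hue_v_sum[of h "\<not> b"] by auto
    moreover have "h \<noteq> (v, \<not> b)" using h by auto
    ultimately show "lbl K (oth h) = lbl K h \<and> (lbl K h \<longleftrightarrow> gap m (slot (\<not> b) e) (slot (\<not> b) (v, \<not> b)) < gap m (slot (\<not> b) e) (hue K (v, \<not> b) h))"
      using Er[of h] h gap_less'[of a "hue K (v, \<not> b) h" m] hue_v_pos[of h "\<not> b"] sl p s hv by simp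
  next
    fix y assume y: "nxt (\<not> \<not> b) y"
    then show "lbl K (oth y) = lbl K y \<and> (lbl K y \<longleftrightarrow> gap m (slot (\<not> b) e) (slot (\<not> b) (v, \<not> b)) < gap m (slot (\<not> b) e) (m + 1))"
      using not_turn[of b y] corner_v[of b y] l t sl p s by (auto simp: gap_def)
  qed (use E l' n nv face'_old v_in in auto)
  show ?thesis
    using wt_new[OF 1] wt_new[OF 2] wt_central[OF cu] wb_central[OF cu] wt_central[OF ce] wb_central[OF ce] sl p s
      side_iff[of _ b] side'_iff[of _ b] l l' 1 2 a_def c_def
    by (auto simp: flip_ok_def Let_def ok_face_def gap_def)
qed

text \<open>One end of \<open>v\<close> passes along \<open>x\<close> to the other circle, so
  \<open>v\<close> joins the spine. The central cycle now also runs through the formerly pure face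
  behind \<open>v\<close>, whose interval towards \<open>True\<close> consists of all
  \<open>m\<close> edges other than \<open>x\<close> and \<open>v\<close>. This replaces the summand
  \<open>m\<close> that \<open>v\<close> contributed as a side arc. The pure face also shows that
  the other end does not turn.\<close>

lemma turn_side:
  assumes l: "lbl K (v, b) = lbl K (v, \<not> b)" and x: "nxt b x" "lbl K x" "\<not> lbl K (oth x)"
  shows "flip_ok m V v K b"
proof -
  note x' = nxtD[OF x(1)]
  have lv: "lbl K (v, b)" "lbl K (v, \<not> b)" using corner_v[OF x(1)] x l by auto
  have "fst x \<in> spine V K" using in_spineI[of x] x x' by auto
  then obtain e u where c0: "central_face V K (face K x) e u" "x = e \<or> x = u" using spine_central x' by blast
  then have cu: "central_face V K (F b) x u" using centralD(7)[OF c0(1)] x x' by auto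
  note U = centralD(1-9)[OF cu] and Ur = centralD(10)[OF cu]
  have "v \<notin> spine V K" using spine_lbl[of v b] lv by auto
  then obtain t where "pure_face V K (F (\<not> b)) t" using not_two_central[of v b x u] cu v_in by auto
  then have P: "pure_face V K (F (\<not> b)) True" using lv v_in by (auto simp: pure_face_def)
  have y: "lbl K y \<and> lbl K (oth y)" if "nxt (\<not> b) y" for y using P nxtD[OF that] by (auto simp: pure_face_def)
  have t: "turn b" "\<not> turn (\<not> b)" using x y by (auto simp: turn_def)
  have l': "lbl K' (v, b)" "\<not> lbl K' (v, \<not> b)" using lv t by (simp_all add: lbl'_v)
  have nu: "\<not> nxt b u" using nxt_unique[OF x(1)] U by blast
  have "u \<noteq> (v, b)" using U lv by auto
  then have nv: "fst u \<noteq> v" using not_v U by auto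
  define c where "c = hue K (v, b) u"
  have p: "0 < c" using hue_v_pos nv nu U by (auto simp: c_def)
  have s: "c + hue K u (v, b) = m" using hue_v_sum nv U by (auto simp: c_def)
  have sl: "slot b u = c" "slot (\<not> b) x = m + 1" using slot_old nv U x slot_new[of "\<not> b" x] by (auto simp: c_def)
  have hx: "hue K x h = hue K (v, b) h - 1" "hue K h x = m + 1 - hue K (v, b) h" "0 < hue K (v, b) h" "hue K (v, b) h \<le> m"
    if "h \<in> halves V" "fst h \<noteq> v" "face K h = F b" "h \<noteq> x" for h
  proof -
    have "\<not> nxt b h" using nxt_unique[OF x(1)] that by blast
    then show "0 < hue K (v, b) h" "hue K (v, b) h \<le> m" using hue_v_pos[of h b] hue_v_sum[of h b] that by auto
    then show "hue K x h = hue K (v, b) h - 1" "hue K h x = m + 1 - hue K (v, b) h"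
      using hue_v_gap(2)[of x h b] hue_v_gap(2)[of h x b] that x' by (auto simp: gap_def)
  qed
  have 1: "central_face V K' (F b) (v, b) u"
  proof (rule central'I)
    fix h assume h: "h \<in> halves V" "fst h \<noteq> v" "face K h = F b" "\<not> nxt b h" "h \<noteq> u"
    moreover have "h \<noteq> x" using h x by auto
    ultimately show "lbl K (oth h) = lbl K h \<and> (lbl K h \<longleftrightarrow> gap m (slot b (v, b)) (slot b u) < gap m (slot b (v, b)) (hue K (v, b) h))"
      using Ur[of h] hx[of h] hx[of u] U nv sl p c_def by (auto simp: gap_def)
  next
    fix y' assume "nxt (\<not> b) y'"
    then show "lbl K (oth y') = lbl K y' \<and> (lbl K y' \<longleftrightarrow> gap m (slot b (v, b)) (slot b u) < gap m (slot b (v, b)) (m + 1))"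
      using y[of y'] sl p s by (auto simp: gap_def)
  qed (use U l' nu nv face'_old v_in in auto)
  have 2: "central_face V K' (F (\<not> b)) x (v, \<not> b)"
  proof (rule central'I)
    fix h assume h: "h \<in> halves V" "fst h \<noteq> v" "face K h = F (\<not> b)" "\<not> nxt (\<not> b) h"
    then show "lbl K (oth h) = lbl K h \<and> (lbl K h \<longleftrightarrow> gap m (slot (\<not> b) x) (slot (\<not> b) (v, \<not> b)) < gap m (slot (\<not> b) x) (hue K (v, \<not> b) h))"
      using P hue_v_pos[of h "\<not> b"] hue_v_sum[of h "\<not> b"] sl by (auto simp: gap_def pure_face_def)
  next
    fix y' assume "nxt (\<not> \<not> b) y'" "y' \<noteq> x"
    then show "lbl K (oth y') = lbl K y' \<and> (lbl K y' \<longleftrightarrow> gap m (slot (\<not> b) x) (slot (\<not> b) (v, \<not> b)) < gap m (slot (\<not> b) x) (m + 1))"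
      using nxt_unique[OF x(1)] by simp
  qed (use x x' l' v_in face'_move[OF x(1)] in auto)
  show ?thesis
    using wt_new[OF 1] wt_new[OF 2] wt_central[OF cu] wb_central[OF cu] P hx[of u] sl p s
      side_iff[of _ b] side'_iff[of _ b] lv l' 1 2 c_def U nv
    by (auto simp: flip_ok_def Let_def ok_face_def gap_def)
qed

text \<open>The reverse of the previous situation: \<open>v\<close> leaves the spine and
  \<open>F b\<close> becomes pure. Its interval of \<open>m\<close> edges turns into the summand
  \<open>m\<close> of a side arc. The remaining weight \<open>a\<close> is positive because
  \<open>e\<close> is not next to \<open>v\<close>.\<close>

lemma turn_spine:
  assumes l: "lbl K (v, b)" "\<not> lbl K (v, \<not> b)" and x: "nxt b x" "lbl K x \<noteq> lbl K (oth x)" and t: "\<not> turn (\<not> b)"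
  shows "flip_ok m V v K b"
proof -
  note x' = nxtD[OF x(1)]
  obtain u where cu: "central_face V K (F b) (v, b) u" using entryE l .
  obtain e where ce: "central_face V K (F (\<not> b)) e (v, \<not> b)" using exitE[of "\<not> b"] l by auto
  have "x \<noteq> (v, b)" using x' by auto
  then have "x = u" using centralD(10)[OF cu, of x] x x' by auto
  note U = centralD(1-9)[OF cu, folded \<open>x = u\<close>] and Ur = centralD(10)[OF cu, folded \<open>x = u\<close>]
  note E = centralD(1-9)[OF ce] and Er = centralD(10)[OF ce]
  have tb: "turn b" using x by (auto simp: turn_def)
  have l': "lbl K' (v, b)" "lbl K' (v, \<not> b)" using l t tb by (simp_all add: lbl'_v)
  have n: "\<not> nxt (\<not> b) e" using not_turn[OF t] E by blast
  have nv: "fst e \<noteq> v" using not_v E by auto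
  have ex: "e \<noteq> x" using E U by auto
  define a where "a = hue K (v, \<not> b) e"
  have p: "0 < a" using hue_v_pos nv n E by (auto simp: a_def)
  have s: "a + hue K e (v, \<not> b) = m" using hue_v_sum nv E by (auto simp: a_def)
  have sl: "slot (\<not> b) e = a" "slot (\<not> b) x = m + 1" using slot_old nv E x slot_new[of "\<not> b" x] by (auto simp: a_def)
  have 1: "pure_face V K' (F b) True"
  proof (rule pure'I)
    fix h assume h: "h \<in> halves V" "fst h \<noteq> v" "face K h = F b" "\<not> nxt b h"
    moreover have "h \<noteq> x" "h \<noteq> (v, b)" using h x by auto
    ultimately show "lbl K h = True \<and> lbl K (oth h) = True" using Ur[of h] x' hue_v_pos[of h b] by auto
  next
    fix y assume "nxt (\<not> b) y"
    then show "lbl K y = True \<and> lbl K (oth y) = True" using not_turn[OF t, of y] corner_v[of "\<not> b" y] l by simp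
  qed (use l' in simp)
  have 2: "central_face V K' (F (\<not> b)) e x"
  proof (rule central'I)
    fix h assume h: "h \<in> halves V" "fst h \<noteq> v" "face K h = F (\<not> b)" "\<not> nxt (\<not> b) h" "h \<noteq> e"
    have "hue K e h = gap m a (hue K (v, \<not> b) h)" using hue_v_gap[of e h "\<not> b"] h E nv a_def by auto
    moreover have "h \<noteq> (v, \<not> b)" using h by auto
    ultimately show "lbl K (oth h) = lbl K h \<and> (lbl K h \<longleftrightarrow> gap m (slot (\<not> b) e) (slot (\<not> b) x) < gap m (slot (\<not> b) e) (hue K (v, \<not> b) h))"
      using Er[of h] h sl p s by (auto simp: gap_def)
  next
    fix y' assume "nxt (\<not> \<not> b) y'" "y' \<noteq> x"
    then show "lbl K (oth y') = lbl K y' \<and> (lbl K y' \<longleftrightarrow> gap m (slot (\<not> b) e) (slot (\<not> b) x) < gap m (slot (\<not> b) e) (m + 1))"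
      using nxt_unique[OF x(1)] by simp
  next
    show "lbl K' (v, \<not> \<not> b) = lbl K' (v, \<not> b) \<and> (lbl K' (v, \<not> b) \<longleftrightarrow> gap m (slot (\<not> b) e) (slot (\<not> b) x) < gap m (slot (\<not> b) e) 0)"
      using l' sl p s by (auto simp: gap_def)
  qed (use E U n nv x' face'_old face'_move[OF x(1)] in auto)
  show ?thesis
    using wt_new[OF 2] wt_central[OF cu] wb_central[OF cu] wt_central[OF ce] wb_central[OF ce] sl p s 1
      new.wt_pure[OF 1] \<open>x = u\<close> x' hue_v_sum[of x b] a_def
      side_iff[of _ b] side'_iff[of _ b] l l' 2
    by (auto simp: flip_ok_def Let_def ok_face_def gap_def)
qed

text \<open>Both ends of \<open>v\<close> change circle, so \<open>v\<close> stays in the spine with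
  reversed direction. Its two faces have intervals of sizes 0 and \<open>m\<close> before and
  after.\<close>

lemma double_turn:
  assumes l: "lbl K (v, b)" "\<not> lbl K (v, \<not> b)" and x: "nxt b x" "lbl K x \<noteq> lbl K (oth x)"
    and y: "nxt (\<not> b) y" "lbl K y \<noteq> lbl K (oth y)"
  shows "flip_ok m V v K b"
proof -
  note x' = nxtD[OF x(1)] and y' = nxtD[OF y(1)]
  obtain u where cu: "central_face V K (F b) (v, b) u" using entryE l .
  obtain e where ce: "central_face V K (F (\<not> b)) e (v, \<not> b)" using exitE[of "\<not> b"] l by auto
  have "x \<noteq> (v, b)" "y \<noteq> (v, \<not> b)" using x' y' by auto
  then have xu: "x = u" and ye: "y = e"
    using centralD(10)[OF cu, of x] centralD(10)[OF ce, of y] x x' y y' by auto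
  note U = centralD(1-9)[OF cu, folded xu] and Ur = centralD(10)[OF cu, folded xu]
  note E = centralD(1-9)[OF ce, folded ye] and Er = centralD(10)[OF ce, folded ye]
  have tb: "turn b" "turn (\<not> b)" using x y by (auto simp: turn_def)
  have l': "\<not> lbl K' (v, b)" "lbl K' (v, \<not> b)" using l tb by (simp_all add: lbl'_v)
  have sl: "slot b y = m + 1" "slot (\<not> b) x = m + 1" using slot_new[OF y(1)] slot_new[of "\<not> b" x] x by auto
  have hy: "hue K y (v, \<not> b) = m" using hue_v_sum[of y "\<not> b"] y' by simp
  have 1: "central_face V K' (F b) y (v, b)"
  proof (rule central'I)
    fix h assume h: "h \<in> halves V" "fst h \<noteq> v" "face K h = F b" "\<not> nxt b h"
    moreover have "h \<noteq> x" "h \<noteq> (v, b)" using h x by auto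
    ultimately show "lbl K (oth h) = lbl K h \<and> (lbl K h \<longleftrightarrow> gap m (slot b y) (slot b (v, b)) < gap m (slot b y) (hue K (v, b) h))"
      using Ur[of h] x' hue_v_pos[of h b] hue_v_sum[of h b] sl by (auto simp: gap_def)
  next
    fix z assume "nxt (\<not> b) z" "z \<noteq> y"
    then show "lbl K (oth z) = lbl K z \<and> (lbl K z \<longleftrightarrow> gap m (slot b y) (slot b (v, b)) < gap m (slot b y) (m + 1))"
      using nxt_unique[OF y(1)] by simp
  qed (use E l' y' v_in face'_move[OF y(1)] in auto)
  have 2: "central_face V K' (F (\<not> b)) (v, \<not> b) x"
  proof (rule central'I)
    fix h assume h: "h \<in> halves V" "fst h \<noteq> v" "face K h = F (\<not> b)" "\<not> nxt (\<not> b) h"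
    moreover have "h \<noteq> y" "h \<noteq> (v, \<not> b)" using h y by auto
    moreover have "hue K y h \<le> m" using hue_le[of y h] h y' \<open>h \<noteq> y\<close> by auto
    ultimately show "lbl K (oth h) = lbl K h \<and> (lbl K h \<longleftrightarrow> gap m (slot (\<not> b) (v, \<not> b)) (slot (\<not> b) x) < gap m (slot (\<not> b) (v, \<not> b)) (hue K (v, \<not> b) h))"
      using Er[of h] hy hue_v_pos[of h "\<not> b"] hue_v_sum[of h "\<not> b"] sl by (auto simp: gap_def)
  next
    fix z assume "nxt (\<not> \<not> b) z" "z \<noteq> x"
    then show "lbl K (oth z) = lbl K z \<and> (lbl K z \<longleftrightarrow> gap m (slot (\<not> b) (v, \<not> b)) (slot (\<not> b) x) < gap m (slot (\<not> b) (v, \<not> b)) (m + 1))"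
      using nxt_unique[OF x(1)] by simp
  qed (use U l' x' v_in face'_move[OF x(1)] in auto)
  show ?thesis
    using wt_new[OF 1] wt_new[OF 2] wt_central[OF cu] wb_central[OF cu] wt_central[OF ce] wb_central[OF ce] sl
      xu ye x' y' hy hue_v_sum[of x b]
      side_iff[of _ b] side'_iff[of _ b] l l' 1 2
    by (auto simp: flip_ok_def Let_def ok_face_def gap_def)
qed

lemma turn_reflect: "flipping.turn V (reflect K) v b \<longleftrightarrow> turn b"
  unfolding flipping.turn_def[OF flipping_reflect] turn_def by simp

end

text \<open>Exchanging the halves of \<open>v\<close> and reflecting the circles reduce all
  combinations of labels and turns to the five lemmas above.\<close>

lemma (in flipping) flip_ok_flip: "flip_ok m V v K True"
proof -
  interpret R: flipping m V "reflect K" q p v by (rule flipping_reflect)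
  have R: "flip_ok m V v (reflect K) b \<longleftrightarrow> flip_ok m V v K b" for b
    by (rule flip_ok_reflect[OF coloring_axioms coloring'])
  have spine: "flip_ok m V v K b" if l: "lbl K (v, b)" "\<not> lbl K (v, \<not> b)" for b
  proof (cases "turn b")
    case True
    then obtain x where x: "nxt b x" "lbl K x \<noteq> lbl K (oth x)" by (auto simp: turn_def)
    show ?thesis
    proof (cases "turn (\<not> b)")
      case True
      then show ?thesis using double_turn[OF l x] by (auto simp: turn_def)
    next
      case False
      then show ?thesis using turn_spine[OF l x] by simp
    qed
  next
    case nb: False
    show ?thesis
    proof (cases "turn (\<not> b)")
      case True
      then obtain x where x: "nxt (\<not> b) x" "lbl K x \<noteq> lbl K (oth x)" by (auto simp: turn_def)
      then have "flip_ok m V v (reflect K) (\<not> b)"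
        using R.turn_spine[of "\<not> b" x] l nb turn_reflect by simp
      then show ?thesis using R flip_ok_swap by metis
    next
      case False
      then show ?thesis using plain_spine[OF l nb] by simp
    qed
  qed
  have side: "flip_ok m V v K b" if l: "lbl K (v, b) = lbl K (v, \<not> b)" "turn b" for b
  proof -
    obtain x where x: "nxt b x" "lbl K x \<noteq> lbl K (oth x)" using l by (auto simp: turn_def)
    show ?thesis
    proof (cases "lbl K x")
      case True
      then show ?thesis using turn_side[OF l(1) x(1)] x by simp
    next
      case False
      then have "flip_ok m V v (reflect K) b" using R.turn_side[of b x] l x by simp
      then show ?thesis using R by simp
    qed
  qed
  show ?thesis
    using spine[of True] spine[of False] side[of True] side[of False] plain_side[of True] flip_ok_swap[of m V v K True]
    by (cases "lbl K (v, True)"; cases "lbl K (v, False)"; cases "turn True"; cases "turn False") auto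
qed

text \<open>Faces not at \<open>v\<close> keep their halves, hues and labels, so both global sums
  change only by the terms in \<open>flip_ok\<close>.\<close>

theorem (in flipping) annulus_flip: "annulus m V K' p q"
proof -
  note ok' = flip_ok_flip[unfolded flip_ok_def Let_def, simplified]
  have other: "central_face V K' G e u \<longleftrightarrow> central_face V K G e u" "pure_face V K' G t \<longleftrightarrow> pure_face V K G t"
    if G: "\<And>b. G \<noteq> F b" for G e u t
  proof -
    have l: "lbl K' h = lbl K h" "lbl K' (oth h) = lbl K (oth h)" if "face K h = G" for h
      using face'_not_F(2)[of h G] that face'_eq_iff[OF G] G by auto
    have hu: "hue K' h h' = hue K h h'" if "face K h = G" "face K h' = G" for h h'
      using face'_not_F[of h G] face'_not_F[of h' G] that face'_eq_iff[OF G] G hue'_simps(7) by simp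
    show "pure_face V K' G t \<longleftrightarrow> pure_face V K G t"
      unfolding pure_face_def face'_eq_iff[OF G] using l by auto
    show "central_face V K' G e u \<longleftrightarrow> central_face V K G e u"
    proof (cases "face K e = G \<and> face K u = G")
      case True
      have "(\<forall>h\<in>halves V. face K h = G \<and> h \<noteq> e \<and> h \<noteq> u \<longrightarrow>
          lbl K' (oth h) = lbl K' h \<and> (lbl K' h \<longleftrightarrow> hue K' e u < hue K' e h)) \<longleftrightarrow>
        (\<forall>h\<in>halves V. face K h = G \<and> h \<noteq> e \<and> h \<noteq> u \<longrightarrow>
          lbl K (oth h) = lbl K h \<and> (lbl K h \<longleftrightarrow> hue K e u < hue K e h))"
        using True by (intro ball_cong refl imp_cong) (simp add: l hu)
      then show ?thesis using True l[of e] l[of u] unfolding central_face_def face'_eq_iff[OF G] by simp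
    qed (auto simp: central_face_def face'_eq_iff[OF G])
  qed
  have w: "wt V K' G = wt V K G \<and> wb V K' G = wb V K G" if G: "\<And>b. G \<noteq> F b" for G
  proof -
    have "hue K' e u = hue K e u \<and> hue K' u e = hue K u e" if "central_face V K G e u" for e u
      using face'_not_F[of e G] face'_not_F[of u G] centralD(3,4)[OF that] face'_eq_iff[OF G] G hue'_simps(7) by simp
    then show ?thesis unfolding wt_def wb_def other[OF G] by (intro conjI sum.cong) auto
  qed
  let ?N = "face K ` halves V" and ?R = "face K ` halves V - {F True, F False}"
  have split: "(\<Sum>G\<in>?N. g G) = g (F True) + g (F False) + (\<Sum>G\<in>?R. g G)" for g :: "'f \<Rightarrow> nat"
  proof -
    have s: "{F True, F False} \<subseteq> ?N" using v_in by auto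
    have "(\<Sum>G\<in>?N. g G) = (\<Sum>G\<in>?R. g G) + (\<Sum>G\<in>{F True, F False}. g G)"
      by (rule sum.subset_diff[OF s finite_N])
    then show ?thesis using F_neq[of True] by simp
  qed
  have R: "(\<Sum>G\<in>?R. wt V K' G) = (\<Sum>G\<in>?R. wt V K G)" "(\<Sum>G\<in>?R. wb V K' G) = (\<Sum>G\<in>?R. wb V K G)"
  proof -
    have "G \<noteq> F b" if "G \<in> ?R" for G b using that by (cases b) auto
    then have "wt V K' G = wt V K G \<and> wb V K' G = wb V K G" if "G \<in> ?R" for G using w that by blast
    then show "(\<Sum>G\<in>?R. wt V K' G) = (\<Sum>G\<in>?R. wt V K G)" "(\<Sum>G\<in>?R. wb V K' G) = (\<Sum>G\<in>?R. wb V K G)"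
      by (intro sum.cong refl; blast)+
  qed
  have side: "card {u \<in> V. side J t u} = card {u \<in> V - {v}. side K t u} + of_bool (side J t v)"
    if "\<And>h. fst h \<noteq> v \<Longrightarrow> lbl J h = lbl K h" for t and J :: "('a, 'f) conf"
  proof -
    have "side J t u = side K t u" if "u \<noteq> v" for u using that \<open>\<And>h. fst h \<noteq> v \<Longrightarrow> lbl J h = lbl K h\<close> by (simp add: side_def)
    then have "{u \<in> V. side J t u} = {u \<in> V - {v}. side K t u} \<union> (if side J t v then {v} else {})"
      using v_in by (intro set_eqI, rename_tac x, case_tac "x = v") auto
    then show ?thesis using finite_V by simp
  qed
  have sK: "card {u \<in> V. side K t u} = card {u \<in> V - {v}. side K t u} + of_bool (side K t v)"
    and sK': "card {u \<in> V. side K' t u} = card {u \<in> V - {v}. side K t u} + of_bool (side K' t v)" for t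
    by (rule side; simp)+
  show ?thesis
  proof unfold_locales
    fix G assume G: "G \<in> face K' ` halves V"
    show "ok_face V K' G"
    proof (cases "\<exists>b. G = F b")
      case True
      then show ?thesis using ok' by (metis (full_types))
    next
      case False
      then show ?thesis using ok[of G] G faces' other[of G] by (auto simp: ok_face_def)
    qed
  next
    show "(\<Sum>G\<in>face K' ` halves V. wt V K' G) + m * card {v \<in> V. side K' False v} = m * q"
      using wt_sum ok' unfolding faces' split R sK sK' by (simp add: algebra_simps)
    show "(\<Sum>G\<in>face K' ` halves V. wb V K' G) + m * card {v \<in> V. side K' True v} = m * p"
      using wb_sum ok' unfolding faces' split R sK sK' by (simp add: algebra_simps)
    show "0 < (\<Sum>G\<in>face K' ` halves V. wt V K' G)"
      using wt_pos ok' unfolding faces' split R by (cases "side K' False v"; cases "side K False v") auto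
    show "0 < (\<Sum>G\<in>face K' ` halves V. wb V K' G)"
      using wb_pos ok' unfolding faces' split R by (cases "side K' True v"; cases "side K True v") auto
  qed (use no_loop_flip conn' card_faces card_V faces' in auto)
qed

section \<open>Flips realize mutations\<close>

definition quiv :: "'a set \<Rightarrow> ('a, 'f) conf \<Rightarrow> 'a cquiver" where
  "quiv V K = \<lparr>verts = V, arr = (\<lambda>u w c. if u \<in> V \<and> w \<in> V \<and> u \<noteq> w
     then card {(a, b). face K (u, a) = face K (w, b) \<and> hue K (u, a) (w, b) = c} else 0)\<rparr>"

definition link :: "('a, 'f) conf \<Rightarrow> 'a \<Rightarrow> 'a \<Rightarrow> nat \<Rightarrow> bool \<Rightarrow> bool \<Rightarrow> nat" where
  "link K u w c a b = of_bool (face K (u, a) = face K (w, b) \<and> hue K (u, a) (w, b) = c)"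

definition single :: "nat \<Rightarrow> nat \<Rightarrow> nat \<Rightarrow> nat" where
  "single n a c = (if c = a then n else 0)"

lemma verts_quiv [simp]: "verts (quiv V K) = V"
  by (simp add: quiv_def)

lemma arr_quiv_0: "\<not> (u \<in> V \<and> w \<in> V \<and> u \<noteq> w) \<Longrightarrow> arr (quiv V K) u w c = 0"
  by (auto simp: quiv_def)

lemma arr_link:
  assumes "u \<in> V" "w \<in> V" "u \<noteq> w"
  shows "arr (quiv V K) u w c = link K u w c a b + link K u w c a (\<not> b) + link K u w c (\<not> a) b + link K u w c (\<not> a) (\<not> b)"
proof -
  let ?P = "\<lambda>a b. face K (u, a) = face K (w, b) \<and> hue K (u, a) (w, b) = c"
  let ?S = "{(True, True), (True, False), (False, True), (False, False)}"
  have "{(a, b). ?P a b} = ?S \<inter> {x. ?P (fst x) (snd x)}" by auto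
  then have "card {(a, b). ?P a b} = (\<Sum>x\<in>?S. of_bool (?P (fst x) (snd x)))" by (simp only: sum_of_bool_eq finite.intros of_nat_id)
  also have "\<dots> = link K u w c a b + link K u w c a (\<not> b) + link K u w c (\<not> a) b + link K u w c (\<not> a) (\<not> b)"
    by (cases a; cases b) (simp_all add: link_def)
  finally show ?thesis using assms by (simp add: quiv_def)
qed

lemma cancel_single:
  assumes "a \<le> m" shows "cancel m (single n a) = single n a"
proof
  fix c
  have "(\<Sum>t\<in>{..m} - {c}. single n a t) = (if a \<noteq> c then n else 0)"
    using assms by (simp add: single_def sum.delta)
  then show "cancel m (single n a) c = single n a c"
    unfolding cancel_def by (simp add: single_def)
qed

lemma single_zero: "single 0 a = (\<lambda>c. 0)"
  by (auto simp: single_def)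

lemma cancel_two:
  assumes "a \<le> m" "b \<le> m" "a \<noteq> b"
  shows "cancel m (\<lambda>c. single n a c + single k b c) = (\<lambda>c. single (n - k) a c + single (k - n) b c)"
proof
  fix c
  have "(\<Sum>t\<in>{..m} - {c}. single n a t + single k b t) = (if a \<noteq> c then n else 0) + (if b \<noteq> c then k else 0)"
    using assms by (simp add: single_def sum.delta sum.distrib)
  then show "cancel m (\<lambda>c. single n a c + single k b c) c = single (n - k) a c + single (k - n) b c"
    unfolding cancel_def using assms by (simp add: single_def)
qed

lemma single_add: "(\<lambda>c. single n a c + single k a c) = single (n + k) a"
  by (auto simp: single_def)

section \<open>Arrows of the quiver of a configuration\<close>

context annulus
begin

abbreviation "Q \<equiv> quiv V K"

lemma link_hue_le: "u \<in> V \<Longrightarrow> w \<in> V \<Longrightarrow> u \<noteq> w \<Longrightarrow> face K (u, a) = face K (w, b) \<Longrightarrow> hue K (u, a) (w, b) \<le> m"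
  using hue_le[of "(u, a)" "(w, b)"] by simp

text \<open>Two arcs share no polygon, one, or two; in the last case both pairs of halves have the
  same hue. This is what makes the quiver monochromatic.\<close>

lemma arr_single:
  assumes uw: "u \<in> V" "w \<in> V" "u \<noteq> w"
  obtains n a where "a \<le> m" "arr Q u w = single n a"
proof (cases "\<exists>a b. face K (u, a) = face K (w, b)")
  case True
  then obtain a b where ab: "face K (u, a) = face K (w, b)" by auto
  have n: "face K (u, a) \<noteq> face K (w, \<not> b)" "face K (u, \<not> a) \<noteq> face K (w, b)"
    using no_loop'[of w b] no_loop'[of u a] uw ab by auto
  let ?c = "hue K (u, a) (w, b)"
  have e: "hue K (u, \<not> a) (w, \<not> b) = ?c" if "face K (u, \<not> a) = face K (w, \<not> b)"
    using two_faces_hue[of w u b a] uw ab that by simp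
  have "arr Q u w c = single (1 + of_bool (face K (u, \<not> a) = face K (w, \<not> b))) ?c c" for c
    using arr_link[OF uw, of K c a b] ab n e by (auto simp: link_def single_def)
  then have "arr Q u w = single (1 + of_bool (face K (u, \<not> a) = face K (w, \<not> b))) ?c" by auto
  then show ?thesis using that link_hue_le[OF uw ab] by blast
next
  case False
  then have "arr Q u w c = 0" for c using arr_link[OF uw, of K c True True] by (simp add: link_def)
  then have "arr Q u w = single 0 0" by (auto simp: single_def)
  then show ?thesis using that by blast
qed

lemma arr_unique: "arr Q u w c \<noteq> 0 \<Longrightarrow> arr Q u w c' \<noteq> 0 \<Longrightarrow> c = c'"
  using arr_single[of u w] arr_quiv_0[of u V w K] by (metis single_def)

lemma arr_gt: "m < c \<Longrightarrow> arr Q u w c = 0"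
  using arr_single[of u w] arr_quiv_0[of u V w K] by (metis single_def not_le)

lemma link_pos: "u \<in> V \<Longrightarrow> w \<in> V \<Longrightarrow> u \<noteq> w \<Longrightarrow> face K (u, a) = face K (w, b) \<Longrightarrow> arr Q u w (hue K (u, a) (w, b)) \<noteq> 0"
  using arr_link[of u V w K "hue K (u, a) (w, b)" a b] by (simp add: link_def)

lemma unlinked: "(\<And>a b. face K (u, a) \<noteq> face K (w, b)) \<Longrightarrow> arr Q u w = single 0 0"
  by (cases "u \<in> V \<and> w \<in> V \<and> u \<noteq> w") (auto simp: single_def arr_link[of u V w K _ True True] link_def arr_quiv_0)

lemma arr_link_single:
  assumes uw: "u \<in> V" "w \<in> V" "u \<noteq> w" "face K (u, a) = face K (w, b)"
  obtains n where "arr Q u w = single n (hue K (u, a) (w, b))"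
proof -
  obtain n c where c: "arr Q u w = single n c" using arr_single[OF uw(1-3)] by metis
  then have "c = hue K (u, a) (w, b)" using link_pos[OF uw] by (auto simp: single_def split: if_splits)
  then show ?thesis using c that by blast
qed

lemma link_skew:
  assumes "u \<in> V" "w \<in> V" "u \<noteq> w" "c \<le> m"
  shows "link K u w c a b = link K w u (m - c) b a"
proof -
  have "hue K (u, a) (w, b) + hue K (w, b) (u, a) = m" if "face K (u, a) = face K (w, b)"
    using hue_sum[of "(u, a)" "(w, b)"] assms that by auto
  then show ?thesis using assms by (auto simp: link_def)
qed

lemma arr_skew: "c \<le> m \<Longrightarrow> arr Q u w c = arr Q w u (m - c)"
proof (cases "u \<in> V \<and> w \<in> V \<and> u \<noteq> w")
  case True
  assume "c \<le> m"
  then show ?thesis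
    using arr_link[of u V w K c True True] arr_link[of w V u K "m - c" True True] True link_skew[of u w c] by auto
next
  case False
  then show ?thesis using arr_quiv_0[of u V w K] arr_quiv_0[of w V u K] by auto
qed

lemma colored_quiv: "colored_quiver m Q"
  unfolding colored_quiver_def
proof (intro conjI allI impI)
  fix i j c assume "arr Q i j c \<noteq> 0"
  then show "i \<in> verts Q" "j \<in> verts Q" "c \<le> m" by (metis arr_quiv_0 verts_quiv, metis arr_quiv_0 verts_quiv, metis arr_gt not_le)
next
  fix i j c c' assume "arr Q i j c \<noteq> 0 \<and> c' \<noteq> c"
  then show "arr Q i j c' = 0" using arr_unique by metis
next
  fix i j c assume "c \<le> m"
  then show "arr Q i j c = arr Q j i (m - c)" by (rule arr_skew)
qed (simp_all add: finite_V arr_quiv_0)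

end

text \<open>Every hue towards \<open>v\<close> grows by 1 modulo \<open>m + 1\<close>. The wrap from
  \<open>m\<close> to 0 occurs exactly for an arc next to \<open>v\<close>, which at the same time
  changes to the other face; therefore the counts agree only after summing over both halves of
  \<open>v\<close>.\<close>

lemma (in flipping) arrows_at_v:
  assumes i: "i \<in> V" "i \<noteq> v" and c: "c \<le> m"
  shows "arr (quiv V K') i v c = arr (quiv V K) i v ((c + m) mod (m + 1))"
proof -
  let ?c = "(c + m) mod (m + 1)"
  have cm: "?c = (if c = 0 then m else c - 1)" using c by (auto simp: mod_if)
  have *: "link K' i v c a True + link K' i v c a False = link K i v ?c a True + link K i v ?c a False" for a
  proof (cases "\<exists>b. nxt b (i, a)")
    case True
    then obtain b where b: "nxt b (i, a)" by auto
    have f: "face K' (i, a) = F (\<not> b)" "face K (i, a) = F b" "hue K (v, b) (i, a) = 0" using face'_move[OF b] nxtD[OF b] by auto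
    then have "hue K (i, a) (v, b) = m" using hue_v_sum[of "(i, a)" b] i by simp
    moreover have "hue K' (i, a) (v, \<not> b) = 0" using hue'_simps(2)[of "(i, a)" "(i, a)" "\<not> b"] b i by simp
    ultimately have "link K' i v c a b = 0" "link K' i v c a (\<not> b) = of_bool (c = 0)"
      "link K i v ?c a b = of_bool (c = 0)" "link K i v ?c a (\<not> b) = 0"
      using f F_neq[of b] cm c by (auto simp: link_def split: if_splits)
    then show ?thesis by (cases b) auto
  next
    case False
    then have f: "face K' (i, a) = face K (i, a)" by (intro face'_other) auto
    have "link K' i v c a b = link K i v ?c a b" for b
    proof (cases "face K (i, a) = F b")
      case True
      then have "0 < hue K (v, b) (i, a)" using hue_v_pos[of "(i, a)" b] False i by auto
      then have "hue K (i, a) (v, b) < m" using hue_v_sum[of "(i, a)" b] True i by simp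
      moreover have "hue K' (i, a) (v, b) = hue K (i, a) (v, b) + 1" using hue'_simps(4)[of "(i, a)" "(i, a)" b] False i by auto
      ultimately show ?thesis using f cm c by (auto simp: link_def)
    qed (simp add: link_def f)
    then show ?thesis by simp
  qed
  show ?thesis
    using arr_link[of i V v K' c True True] arr_link[of i V v K ?c True True] i v_in *[of True] *[of False] by simp
qed

section \<open>Arrows between the other vertices\<close>

context flipping
begin

text \<open>These \<open>k\<close> are the targets of the arrows of color 0 starting at \<open>v\<close>.\<close>

definition "moved k \<longleftrightarrow> (\<exists>b c. nxt b (k, c))"

lemma arr_v_0:
  assumes "k \<in> V" "k \<noteq> v"
  shows "arr Q v k 0 \<noteq> 0 \<longleftrightarrow> moved k"
proof -
  have "link K v k 0 b c = of_bool (nxt b (k, c))" for b c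
    using assms by (auto simp: link_def next_half_def)
  then have "arr Q v k 0 = of_bool (nxt True (k, True)) + of_bool (nxt True (k, False)) + of_bool (nxt False (k, True)) + of_bool (nxt False (k, False))"
    using arr_link[of v V k K 0 True True] assms v_in by simp
  then show ?thesis unfolding moved_def by (auto simp: ex_bool_eq)
qed

lemma arr'_unmoved:
  assumes "i \<in> V" "k \<in> V" "i \<noteq> k" "i \<noteq> v" "k \<noteq> v" "\<not> moved i" "\<not> moved k"
  shows "arr (quiv V K') i k = arr Q i k"
proof
  fix c
  have n: "\<not> nxt b (i, a)" "\<not> nxt b (k, a)" for a b using assms by (auto simp: moved_def)
  have f: "face K' (i, a) = face K (i, a)" "face K' (k, a) = face K (k, a)" for a by (intro face'_other; simp add: n)+
  have "hue K' (i, a) (k, b) = hue K (i, a) (k, b)" for a b using hue'_simps(7)[of "(i, a)" "(k, b)"] n assms by simp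
  then have "link K' i k c a b = link K i k c a b" for a b by (simp add: link_def f)
  then show "arr (quiv V K') i k c = arr Q i k c"
    using arr_link[of i V k K' c True True] arr_link[of i V k K c True True] assms by simp
qed

lemma other_half:
  assumes "nxt b (k, c)" "face K (k, \<not> c) = F (\<not> b)"
  shows "nxt (\<not> b) (k, \<not> c)"
  using two_faces_hue[of k v c b] nxtD[OF assms(1)] assms v_in by (auto simp: next_half_def)

text \<open>The two arcs are next to \<open>v\<close> in opposite faces and exchange places, so they
  share neither of these faces before or after. Their other halves do not lie at \<open>v\<close>:
  they would be next to \<open>v\<close> as well, and that place is taken.\<close>

lemma arr'_both_moved:
  assumes "i \<in> V" "k \<in> V" "i \<noteq> k" "i \<noteq> v" "k \<noteq> v" "moved i" "moved k"
  shows "arr (quiv V K') i k = arr Q i k"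
proof
  fix c
  obtain b d where k: "nxt b (k, d)" using assms by (auto simp: moved_def)
  obtain b' a where "nxt b' (i, a)" using assms by (auto simp: moved_def)
  moreover from this have "b' \<noteq> b" using nxt_unique[OF k, of "(i, a)"] assms(3) by (intro notI) simp
  then have "b' = (\<not> b)" by simp
  ultimately have i: "nxt (\<not> b) (i, a)" by simp
  have fi: "face K (i, a) = F (\<not> b)" "face K' (i, a) = F b" and fk: "face K (k, d) = F b" "face K' (k, d) = F (\<not> b)"
    using nxtD[OF i] nxtD[OF k] face'_move[OF i] face'_move[OF k] by auto
  have "\<not> nxt b (i, \<not> a)" "\<not> nxt (\<not> b) (i, \<not> a)" using nxt_unique[OF k] nxt_unique[OF i] assms by auto
  then have i': "\<not> nxt e (i, \<not> a)" for e by (cases "e = b") auto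
  have "\<not> nxt b (k, \<not> d)" "\<not> nxt (\<not> b) (k, \<not> d)" using nxt_unique[OF k] nxt_unique[OF i] assms by auto
  then have k': "\<not> nxt e (k, \<not> d)" for e by (cases "e = b") auto
  have fi': "face K' (i, \<not> a) = face K (i, \<not> a)" and fk': "face K' (k, \<not> d) = face K (k, \<not> d)"
    by (intro face'_other i' k')+
  have "face K (i, \<not> a) \<noteq> F e" for e
    using other_half[of "\<not> b" i a] i i' no_loop'[of i a] fi assms by (cases "e = b") auto
  moreover have "F e \<noteq> face K (k, \<not> d)" for e
    using other_half[of b k d] k k' no_loop'[of k d] fk assms by (cases "e = b") auto
  moreover have "hue K' (i, \<not> a) (k, \<not> d) = hue K (i, \<not> a) (k, \<not> d)"
    using hue'_simps(7)[of "(i, \<not> a)" "(k, \<not> d)"] i' k' assms by simp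
  ultimately show "arr (quiv V K') i k c = arr Q i k c"
    using arr_link[of i V k K' c a d] arr_link[of i V k K c a d] assms fi fk fi' fk' F_neq[of b] by (simp add: link_def)
qed

lemma cancel_Q: "i \<in> V \<Longrightarrow> k \<in> V \<Longrightarrow> i \<noteq> k \<Longrightarrow> cancel m (arr Q i k) = arr Q i k"
  using arr_single[of i k] cancel_single by metis

lemma arr_to_v:
  assumes "i \<in> V" "i \<noteq> v"
  shows "face K (i, a) = F b \<Longrightarrow> face K (i, \<not> a) \<noteq> F (\<not> b) \<Longrightarrow> arr Q i v = single 1 (hue K (i, a) (v, b))"
    and "face K (i, a) = F b \<Longrightarrow> face K (i, \<not> a) = F (\<not> b) \<Longrightarrow> arr Q i v = single 2 (hue K (i, a) (v, b))"
    and "face K (i, a) = F b \<Longrightarrow> face K (i, \<not> a) = F (\<not> b) \<Longrightarrow> hue K (i, \<not> a) (v, \<not> b) = hue K (i, a) (v, b)"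
proof -
  show h: "hue K (i, \<not> a) (v, \<not> b) = hue K (i, a) (v, b)" if "face K (i, a) = F b" "face K (i, \<not> a) = F (\<not> b)"
    using two_faces_hue[of v i b a] assms v_in that by auto
  show "arr Q i v = single 1 (hue K (i, a) (v, b))" if "face K (i, a) = F b" "face K (i, \<not> a) \<noteq> F (\<not> b)"
  proof
    fix c
    show "arr Q i v c = single 1 (hue K (i, a) (v, b)) c"
      using arr_link[of i V v K c a b] assms v_in that F_neq[of b] no_loop'[of i a] by (auto simp: link_def single_def)
  qed
  show "arr Q i v = single 2 (hue K (i, a) (v, b))" if "face K (i, a) = F b" "face K (i, \<not> a) = F (\<not> b)"
  proof
    fix c
    show "arr Q i v c = single 2 (hue K (i, a) (v, b)) c"
      using arr_link[of i V v K c a b] assms v_in that F_neq[of b] h by (auto simp: link_def single_def)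
  qed
qed

lemma hue_next:
  assumes "nxt b x" "h \<in> halves V" "face K h = F b" "fst h \<noteq> v" "h \<noteq> x"
  shows "hue K h x = hue K h (v, b) + 1" "hue K h (v, b) < m"
proof -
  note x = nxtD[OF assms(1)]
  have "hue K (v, b) h \<noteq> 0" using hue_v_gap(1)[of h x b] assms x by auto
  then show "hue K h (v, b) < m" using hue_v_sum[of h b] assms by auto
  show "hue K h x = hue K h (v, b) + 1"
    using hue_v_gap[of h x b] assms x hue_v_sum[of h b] by (auto simp: gap_def)
qed

text \<open>\<open>k\<close> leaves \<open>F b\<close> for the other face. If \<open>i\<close> lies
  in \<open>F b\<close>, an arrow from \<open>i\<close> to \<open>k\<close> is lost whose color is
  one more than that from \<open>i\<close> to \<open>v\<close>: it is cancelled by the arrow added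
  for the path through \<open>v\<close>. If \<open>i\<close> lies in the face that \<open>k\<close>
  enters, the added arrow is the one gained. The cases keep track of multiplicities, since any two
  of \<open>i\<close>, \<open>k\<close>, \<open>v\<close> may share both faces.\<close>

lemma mutated_moved:
  assumes V: "i \<in> V" "k \<in> V" "i \<noteq> k" "i \<noteq> v" "k \<noteq> v" and im: "\<not> moved i" and k: "nxt b (k, d)"
  shows "cancel m (\<lambda>c. arr Q i k c + cancel m (\<lambda>c. arr Q i v c * arr Q v k 0) c) = arr (quiv V K') i k"
proof -
  interpret A': annulus m V K' p q by (rule annulus_flip)
  note kk = nxtD[OF k]
  have i: "\<not> nxt e (i, a)" for e a using im by (auto simp: moved_def)
  have fi: "face K' (i, a) = face K (i, a)" for a by (intro face'_other; simp add: i)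
  have fk: "face K' (k, d) = F (\<not> b)" using face'_move[OF k] .
  have hk: "hue K' (i, a) (k, d) = hue K (i, a) (v, \<not> b)" for a using hue'_simps(5)[of "(i, a)" "(k, d)" b] i k V by simp
  obtain n0 c0 where n0: "c0 \<le> m" "arr Q i k = single n0 c0" using arr_single[of i k] V by metis
  obtain n1 c1 where n1: "c1 \<le> m" "arr (quiv V K') i k = single n1 c1" using A'.arr_single[of i k] V by metis
  define s where "s a c = link K i k c a (\<not> d)" for a c
  define s' where "s' a c = link K' i k c a (\<not> d)" for a c
  have Q: "arr Q i k c = link K i k c a d + s a c + link K i k c (\<not> a) d + s (\<not> a) c" for a c
    using arr_link[of i V k K c a d] V by (simp add: s_def)
  have Q': "arr (quiv V K') i k c = link K' i k c a d + s' a c + link K' i k c (\<not> a) d + s' (\<not> a) c" for a c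
    using arr_link[of i V k K' c a d] V by (simp add: s'_def)
  have ld: "link K i k c a d = of_bool (face K (i, a) = F b \<and> hue K (i, a) (v, b) + 1 = c)" for a c
    using hue_next[OF k, of "(i, a)"] V kk by (auto simp: link_def)
  have ld': "link K' i k c a d = of_bool (face K (i, a) = F (\<not> b) \<and> hue K (i, a) (v, \<not> b) = c)" for a c
    by (auto simp: link_def fi fk hk)
  have vk: "arr Q v k 0 = 1 + of_bool (nxt (\<not> b) (k, \<not> d))"
  proof -
    have "\<not> nxt b (k, \<not> d)" "\<not> nxt (\<not> b) (k, d)" using nxt_unique[OF k] nxt_not[OF k] by auto
    moreover have "link K v k 0 e c = of_bool (nxt e (k, c))" for e c
      using V by (auto simp: link_def next_half_def)
    ultimately show ?thesis using arr_link[of v V k K 0 b d] V v_in k by simp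
  qed
  have lt: "hue K (i, a) (v, e) \<le> m" if "face K (i, a) = F e" for a e using hue_v_sum[of "(i, a)" e] V that by auto
  have cm: "cancel m (\<lambda>c. single n a c * r) = single (n * r) a" if "a \<le> m" for n a r
  proof -
    have "(\<lambda>c. single n a c * r) = single (n * r) a" by (auto simp: single_def)
    then show ?thesis using cancel_single[OF that] by simp
  qed
  show ?thesis
  proof (cases "nxt (\<not> b) (k, \<not> d)")
    \<comment> \<open>Both halves of \<open>k\<close> move, and \<open>v\<close> has two arrows of
      color 0 to \<open>k\<close>. The \<open>n * 2\<close> added arrows of color \<open>?h\<close>
      cancel the \<open>n\<close> arrows of color \<open>?h + 1\<close>, and \<open>n\<close> of
      them remain.\<close>
    case both: True
    note kk' = nxtD[OF both]
    have fk': "face K' (k, \<not> d) = F b" using face'_move[OF both] by simp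
    have hk': "hue K' (i, a) (k, \<not> d) = hue K (i, a) (v, b)" for a using hue'_simps(5)[of "(i, a)" "(k, \<not> d)" "\<not> b"] i both V by simp
    have s: "s a c = of_bool (face K (i, a) = F (\<not> b) \<and> hue K (i, a) (v, \<not> b) + 1 = c)" for a c
      using hue_next[OF both, of "(i, a)"] V kk' by (auto simp: link_def s_def)
    have s': "s' a c = of_bool (face K (i, a) = F b \<and> hue K (i, a) (v, b) = c)" for a c
      by (auto simp: link_def fi fk' hk' s'_def)
    show ?thesis
    proof (cases "\<exists>a e. face K (i, a) = F e")
      case True
      then obtain a e where a: "face K (i, a) = F e" by auto
      let ?h = "hue K (i, a) (v, e)"
      have other: "face K (i, \<not> a) \<noteq> F e" using no_loop'[of i a] V a by auto
      have hm: "?h + 1 \<le> m"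
        using hue_next(2)[OF k, of "(i, a)"] hue_next(2)[OF both, of "(i, a)"] a V by (cases "e = b") auto
      define n where "n = (1::nat) + of_bool (face K (i, \<not> a) = F (\<not> e))"
      have iv: "arr Q i v = single n ?h"
        using arr_to_v(1,2)[OF V(1,4) a] by (simp add: n_def numeral_2_eq_2)
      have sh: "face K (i, \<not> a) = F (\<not> e) \<Longrightarrow> hue K (i, \<not> a) (v, \<not> e) = ?h" using arr_to_v(3)[OF V(1,4) a] .
      have eb: "e = b \<or> e = (\<not> b)" by auto
      have 1: "arr Q i k = single n (?h + 1)"
      proof
        fix c
        have "F b \<noteq> F (\<not> b)" "F (\<not> b) \<noteq> F b" using F_neq[of b] by auto
        then show "arr Q i k c = single n (?h + 1) c"
          using Q[of c a] a other sh unfolding ld s single_def n_def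
          by (cases "e = b"; cases "face K (i, \<not> a) = F (\<not> e)") simp_all
      qed
      have 2: "arr (quiv V K') i k = single n ?h"
      proof
        fix c
        have "F b \<noteq> F (\<not> b)" "F (\<not> b) \<noteq> F b" using F_neq[of b] by auto
        then show "arr (quiv V K') i k c = single n ?h c"
          using Q'[of c a] a other sh unfolding ld' s' single_def n_def
          by (cases "e = b"; cases "face K (i, \<not> a) = F (\<not> e)") simp_all
      qed
      have "cancel m (\<lambda>c. single n (?h + 1) c + single (n * 2) ?h c) = single n ?h"
        using cancel_two[OF hm, of ?h n "n * 2"] hm by (simp add: single_zero)
      moreover have "arr Q v k 0 = 2" using vk both by simp
      moreover have "?h \<le> m" using hm by simp
      ultimately show ?thesis by (simp only: iv 1 2 cm)
    next
      case False
      then have f: "\<And>a e. face K (i, a) \<noteq> F e" by auto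
      then have "arr Q i v = single 0 0" by (rule unlinked)
      moreover have "arr Q i k = single 0 0" "arr (quiv V K') i k = single 0 0"
        using Q[of _ True] Q'[of _ True] f by (auto simp: ld ld' s s' single_def fun_eq_iff)
      ultimately show ?thesis using cancel_single[of 0 m 0] by (simp add: single_zero)
    qed
  next
    case one: False
    have kn: "\<not> nxt e (k, \<not> d)" for e using one nxt_unique[OF k, of "(k, \<not> d)"] by (cases "e = b") auto
    have fkk: "face K' (k, \<not> d) = face K (k, \<not> d)" by (intro face'_other kn)
    have ss: "s' a c = s a c" for a c
      using hue'_simps(7)[of "(i, a)" "(k, \<not> d)"] i kn V by (simp add: s_def s'_def link_def fi fkk)
    have vk1: "arr Q v k 0 = 1" using vk one by simp
    show ?thesis
    proof (cases "\<exists>a. face K (i, a) = F b")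
      case True
      then obtain a where a: "face K (i, a) = F b" by auto
      let ?h = "hue K (i, a) (v, b)"
      have hm: "?h + 1 \<le> m" using hue_next(2)[OF k, of "(i, a)"] a V by auto
      have other: "face K (i, \<not> a) \<noteq> F b" using no_loop'[of i a] V a by auto
      have Qa: "arr Q i k c = single 1 (?h + 1) c + (s a c + s (\<not> a) c)" for c
        using Q[of c a] a other by (auto simp: ld single_def)
      then have "arr Q i k (?h + 1) \<noteq> 0" by (simp add: single_def)
      then have c0: "c0 = ?h + 1" using n0 by (auto simp: single_def split: if_splits)
      show ?thesis
      proof (cases "face K (i, \<not> a) = F (\<not> b)")
        case True
        \<comment> \<open>\<open>i\<close> shares both faces with \<open>v\<close>: the one arrow of
          color \<open>?h + 1\<close> meets two added arrows of color \<open>?h\<close>, of which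
          one is left.\<close>
        have sh: "hue K (i, \<not> a) (v, \<not> b) = ?h" using arr_to_v(3)[OF V(1,4) a True] .
        have Q'a: "arr (quiv V K') i k c = single 1 ?h c + (s a c + s (\<not> a) c)" for c
          using Q'[of c a] a True sh F_neq[of b] by (auto simp: ld' ss single_def)
        then have "arr (quiv V K') i k ?h \<noteq> 0" by (simp add: single_def)
        then have c1: "c1 = ?h" using n1 by (auto simp: single_def split: if_splits)
        \<comment> \<open>An arrow counted by \<open>s\<close> is there before and after the flip,
          but \<open>?h + 1\<close> is the only color before and \<open>?h\<close> the only color
          after.\<close>
        have "s a c + s (\<not> a) c = 0" for c
          using Qa[of c] Q'a[of c] n0(2) n1(2) c0 c1 by (auto simp: single_def split: if_splits)
        then have "arr Q i k = single 1 (?h + 1)" "arr (quiv V K') i k = single 1 ?h" using Qa Q'a by auto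
        moreover have "cancel m (\<lambda>c. single 1 (?h + 1) c + single 2 ?h c) = single 1 ?h"
          using cancel_two[OF hm, of ?h 1 2] hm by (simp add: single_zero)
        ultimately show ?thesis using arr_to_v(2)[OF V(1,4) a True] cm[of ?h 2 1] hm vk1 by simp
      next
        case False
        have "face K (i, a) \<noteq> F (\<not> b)" using a F_neq[of b] by simp
        then have Q'a: "arr (quiv V K') i k c = s a c + s (\<not> a) c" for c
          using Q'[of c a] False by (auto simp: ld' ss single_def)
        \<comment> \<open>The face lost by \<open>k\<close> was shared with \<open>i\<close>; a
          further arrow can only come from a shared face away from \<open>v\<close>, and it
          survives.\<close>
        have "arr (quiv V K') i k c = single (n0 - 1) (?h + 1) c" for c
          using Qa[of c] Q'a[of c] n0(2) c0 by (auto simp: single_def split: if_splits)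
        then have Q'b: "arr (quiv V K') i k = single (n0 - 1) (?h + 1)" by auto
        have "n0 \<noteq> 0" using \<open>arr Q i k (?h + 1) \<noteq> 0\<close> n0 c0 by (auto simp: single_def)
        then have "cancel m (\<lambda>c. single n0 (?h + 1) c + single 1 ?h c) = single (n0 - 1) (?h + 1)"
          using cancel_two[OF hm, of ?h n0 1] hm by (simp add: single_zero)
        then show ?thesis using Q'b n0(2) c0 arr_to_v(1)[OF V(1,4) a False] cm[of ?h 1 1] hm vk1 by simp
      qed
    next
      case no: False
      then have no': "face K (i, a) \<noteq> F b" for a by auto
      have Qs: "arr Q i k c = s a c + s (\<not> a) c" for a c using Q[of c a] no' by (simp add: ld)
      show ?thesis
      proof (cases "\<exists>a. face K (i, a) = F (\<not> b)")
        case True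
        then obtain a where a: "face K (i, a) = F (\<not> b)" by auto
        let ?h = "hue K (i, a) (v, \<not> b)"
        have hm: "?h \<le> m" using lt[OF a] .
        have other: "face K (i, \<not> a) \<noteq> F (\<not> b)" using no_loop'[of i a] V a by auto
        have Q'a: "arr (quiv V K') i k c = single 1 ?h c + arr Q i k c" for c
          using Q'[of c a] Qs[of c a] a other by (auto simp: ld' ss single_def)
        then have "arr (quiv V K') i k ?h \<noteq> 0" by (simp add: single_def)
        then have c1: "c1 = ?h" using n1 by (auto simp: single_def split: if_splits)
        have "arr Q i k c = single (n1 - 1) ?h c" for c
          using Q'a[of c] n1(2) c1 by (auto simp: single_def split: if_splits)
        then have Qb: "arr Q i k = single (n1 - 1) ?h" by auto
        have "n1 \<noteq> 0" using \<open>arr (quiv V K') i k ?h \<noteq> 0\<close> n1 c1 by (auto simp: single_def)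
        then have "(\<lambda>c. single (n1 - 1) ?h c + single 1 ?h c) = single n1 ?h" unfolding single_add by simp
        then show ?thesis
          using Qb n1(2) c1 arr_to_v(1)[of i a "\<not> b"] V a no' cm[of ?h 1 1] hm vk1 cancel_single[OF hm, of n1] by simp
      next
        case False
        have "face K (i, a) \<noteq> F e" for a e using False no' by (cases "e = b") auto
        then have "arr Q i v = single 0 0" by (rule unlinked)
        moreover have "arr (quiv V K') i k c = arr Q i k c" for c
          using Q'[of c True] Qs[of c True] False by (auto simp: ld' ss)
        ultimately show ?thesis using cancel_single[of 0 m 0] cancel_Q V vk1 by (auto simp: single_zero)
      qed
    qed
  qed
qed

lemma moved_in: "moved k \<Longrightarrow> k \<in> V \<and> k \<noteq> v"
  using nxtD unfolding moved_def by fastforce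

lemma arr_v_0': "arr Q v k 0 \<noteq> 0 \<longleftrightarrow> moved k"
  using arr_v_0[of k] arr_quiv_0[of v V k K 0] moved_in by metis

lemma new_arrows_one:
  assumes "i \<noteq> k" "\<not> moved i"
  shows "new_arrows m Q v i k = (\<lambda>c. arr Q i v c * arr Q v k 0)"
  using assms arr_v_0'[of i] arr_gt by (auto simp: new_arrows_def fun_eq_iff not_le)

text \<open>An arrow to \<open>v\<close> from a target of color 0 has color \<open>m\<close>, so the
  paths in the two directions add equally many arrows of colors \<open>m\<close> and 0.\<close>

lemma new_arrows_both:
  assumes "i \<noteq> k" "moved i" "moved k"
  shows "cancel m (new_arrows m Q v i k) = (\<lambda>c. 0)"
proof -
  have to_v: "arr Q j v = single (arr Q v j 0) m" if "moved j" for j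
  proof -
    have "arr Q j v m = arr Q v j 0" using arr_skew[of 0 v j] by simp
    moreover have "arr Q j v c = 0" if "c \<noteq> m" for c
      using arr_unique[of j v c m] arr_v_0'[of j] \<open>moved j\<close> calculation that by auto
    ultimately show ?thesis by (auto simp: single_def fun_eq_iff)
  qed
  have "new_arrows m Q v i k = (\<lambda>c. single (arr Q v i 0 * arr Q v k 0) m c + single (arr Q v i 0 * arr Q v k 0) 0 c)"
    using assms m_pos by (auto simp: new_arrows_def to_v single_def fun_eq_iff)
  then show ?thesis using cancel_two[of m m 0] m_pos by (simp add: single_zero)
qed

lemma arrows_cancelled_moved:
  assumes "i \<in> V" "k \<in> V" "i \<noteq> k" "i \<noteq> v" "k \<noteq> v" "\<not> moved i \<or> moved k"
  shows "arrows_cancelled m Q v i k = arr (quiv V K') i k"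
proof (cases "moved k")
  case True
  then obtain b d where "nxt b (k, d)" by (auto simp: moved_def)
  show ?thesis
  proof (cases "moved i")
    case True
    then show ?thesis
      using arr'_both_moved \<open>moved k\<close> assms new_arrows_both[OF assms(3)] cancel_Q[OF assms(1-3)]
      by (simp add: arrows_cancelled_def)
  next
    case False
    then show ?thesis
      using mutated_moved[OF assms(1-5) _ \<open>nxt b (k, d)\<close>] new_arrows_one[OF assms(3)]
      by (simp add: arrows_cancelled_def)
  qed
next
  case False
  then have "new_arrows m Q v i k = single 0 0"
    using new_arrows_one[of i k] arr_v_0'[of k] assms by (simp add: single_zero)
  then show ?thesis
    using arr'_unmoved False assms cancel_Q[OF assms(1-3)] cancel_single[of 0 m 0]
    by (simp add: arrows_cancelled_def single_zero)
qed

lemma cancel_skew: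
  assumes "c \<le> m" "\<And>t. t \<le> m \<Longrightarrow> f t = g (m - t)"
  shows "cancel m f c = cancel m g (m - c)"
proof -
  have "(\<Sum>t\<in>{..m} - {c}. f t) = (\<Sum>t\<in>{..m} - {m - c}. g t)"
    using assms by (intro sum.reindex_bij_witness[of _ "\<lambda>t. m - t" "\<lambda>t. m - t"]) auto
  then show ?thesis using assms by (simp add: cancel_def)
qed

lemma arrows_cancelled_skew:
  assumes "c \<le> m"
  shows "arrows_cancelled m Q v i k c = arrows_cancelled m Q v k i (m - c)"
  unfolding arrows_cancelled_def
proof (rule cancel_skew[OF assms])
  fix t assume t: "t \<le> m"
  have "new_arrows m Q v i k t = new_arrows m Q v k i (m - t)" if "t \<le> m" for t
    using that by (auto simp: new_arrows_def)
  then have "cancel m (new_arrows m Q v i k) t = cancel m (new_arrows m Q v k i) (m - t)"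
    using t by (intro cancel_skew) auto
  then show "arr Q i k t + cancel m (new_arrows m Q v i k) t = arr Q k i (m - t) + cancel m (new_arrows m Q v k i) (m - t)"
    using arr_skew[OF t] by simp
qed

lemma cancel_0: "cancel m (\<lambda>c. 0) = (\<lambda>c. 0)"
  by (auto simp: cancel_def)

lemma arrows_cancelled_trivial:
  assumes "\<not> (i \<in> V \<and> k \<in> V \<and> i \<noteq> k)"
  shows "arrows_cancelled m Q v i k = (\<lambda>c. 0)"
proof -
  have "new_arrows m Q v i k = (\<lambda>c. 0)" "arr Q i k = (\<lambda>c. 0)"
    using assms arr_quiv_0[of _ V _ K] by (auto simp: new_arrows_def fun_eq_iff)
  then show ?thesis by (simp add: arrows_cancelled_def cancel_0)
qed

lemma arrows_cancelled_to_v: "arrows_cancelled m Q v i v = arr Q i v"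
proof (cases "i \<in> V \<and> i \<noteq> v")
  case True
  have "new_arrows m Q v i v = (\<lambda>c. 0)" using arr_quiv_0[of v V v K] by (auto simp: new_arrows_def fun_eq_iff)
  then show ?thesis using cancel_Q[of i v] True v_in by (simp add: arrows_cancelled_def cancel_0)
next
  case False
  then show ?thesis using arrows_cancelled_trivial[of i v] arr_quiv_0[of i V v K] by auto
qed

theorem mutate_quiv: "mutate m v Q = quiv V K'"
proof -
  interpret A': annulus m V K' p q by (rule annulus_flip)
  have into: "arr (mutate m v Q) i v c = arr (quiv V K') i v c" for i c
  proof (cases "i \<in> V \<and> i \<noteq> v \<and> c \<le> m")
    case True
    then show ?thesis using arrows_at_v[of i c] by (simp add: mutate_def arrows_cancelled_to_v)
  next
    case False
    then show ?thesis
      using A'.arr_gt[of c i v] arr_quiv_0[of i V v K'] arr_quiv_0[of i V v K]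
      by (auto simp: mutate_def arrows_cancelled_to_v)
  qed
  have "arr (mutate m v Q) i k c = arr (quiv V K') i k c" for i k c
  proof (cases "c \<le> m")
    case c: True
    consider "k = v" | "i = v" "k \<noteq> v" | "i \<noteq> v" "k \<noteq> v" by auto
    then show ?thesis
    proof cases
      case 1
      then show ?thesis using into by simp
    next
      case 2
      have mc: "m - (c + 1) mod (m + 1) = (m - c + m) mod (m + 1)" "(c + 1) mod (m + 1) \<le> m"
        using c by (auto simp: mod_if)
      have "arr (mutate m v Q) v k c = arrows_cancelled m Q v v k ((c + 1) mod (m + 1))"
        using 2 c by (simp add: mutate_def)
      also have "\<dots> = arrows_cancelled m Q v k v ((m - c + m) mod (m + 1))"
        using arrows_cancelled_skew[OF mc(2), of v k] mc(1) by simp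
      also have "\<dots> = arr (mutate m v Q) k v (m - c)"
      proof -
        have "\<not> m < m - c" by linarith
        then show ?thesis by (simp add: mutate_def)
      qed
      also have "\<dots> = arr (quiv V K') v k c" using into[of k "m - c"] A'.arr_skew[OF c, of v k] by simp
      finally show ?thesis using 2 by simp
    next
      case 3
      have "arrows_cancelled m Q v i k c = arr (quiv V K') i k c"
      proof (cases "i \<in> V \<and> k \<in> V \<and> i \<noteq> k")
        case True
        show ?thesis
        proof (cases "\<not> moved i \<or> moved k")
          case t: True
          then show ?thesis using arrows_cancelled_moved[of i k] True 3 by simp
        next
          \<comment> \<open>Only \<open>i\<close> is moved; the case of a moved target applies to
            the opposite arrows.\<close>
          case False
          then have "arrows_cancelled m Q v k i = arr (quiv V K') k i"
            using arrows_cancelled_moved[of k i] True 3 by auto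
          then show ?thesis using arrows_cancelled_skew[OF c, of i k] A'.arr_skew[OF c, of i k] by simp
        qed
      next
        case False
        then show ?thesis using arrows_cancelled_trivial arr_quiv_0[of i V k K'] by simp
      qed
      then show ?thesis using 3 c by (simp add: mutate_def)
    qed
  next
    case False
    then show ?thesis using A'.arr_gt[of c i k] by (simp add: mutate_def)
  qed
  then have "arr (mutate m v Q) = arr (quiv V K')" by (intro ext)
  then show ?thesis by (intro cquiver.equality) (simp_all add: mutate_def)
qed

end

text \<open>Around \<open>v\<close> the halves of the two faces at \<open>v\<close> are numbered \<open>0, \<dots>, 2 * m + 1\<close>; a flip lowers all
  these numbers by 1 modulo \<open>2 * m + 2\<close>, so \<open>m + 1\<close> flips exchange the two faces.\<close>

definition around :: "nat \<Rightarrow> 'a \<Rightarrow> ('a, 'f) conf \<Rightarrow> 'a \<times> bool \<Rightarrow> nat" where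
  "around m v K h = (if face K h = face K (v, True) then hue K (v, True) h else m + 1 + hue K (v, False) h)"

text \<open>Near \<open>v\<close>, face and hue of a half are encoded together in its number, so
  that \<open>n\<close> flips become one shift; away from \<open>v\<close> nothing changes.\<close>

definition rotated :: "nat \<Rightarrow> 'a set \<Rightarrow> 'a \<Rightarrow> ('a, 'f) conf \<Rightarrow> nat \<Rightarrow> ('a, 'f) conf \<Rightarrow> bool" where
  "rotated m V v K n J \<longleftrightarrow> (\<forall>b. face J (v, b) = face K (v, b)) \<and>
     (\<forall>h\<in>halves V. fst h \<noteq> v \<longrightarrow>
        (if \<exists>b. face K h = face K (v, b)
         then (\<exists>b. face J h = face K (v, b)) \<and> (around m v J h + n) mod (2 * m + 2) = around m v K h
         else face J h = face K h \<and>
           (\<forall>h'\<in>halves V. fst h' \<noteq> v \<and> face K h' = face K h \<longrightarrow> hue J h h' = hue K h h')))"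

lemma rotated_near:
  assumes "rotated m V v K n J" "h \<in> halves V" "fst h \<noteq> v" "\<exists>b. face K h = face K (v, b)"
  shows "\<exists>b. face J h = face K (v, b)" "(around m v J h + n) mod (2 * m + 2) = around m v K h"
  using assms(1)[unfolded rotated_def, THEN conjunct2, rule_format, OF assms(2,3)] assms(4) by (simp_all only: if_True)

lemma rotated_far:
  assumes "rotated m V v K n J" "h \<in> halves V" "fst h \<noteq> v" "\<nexists>b. face K h = face K (v, b)"
  shows "face J h = face K h" "\<forall>h'\<in>halves V. fst h' \<noteq> v \<and> face K h' = face K h \<longrightarrow> hue J h h' = hue K h h'"
  using assms(1)[unfolded rotated_def, THEN conjunct2, rule_format, OF assms(2,3), unfolded if_not_P[OF assms(4)]]
  by (rule conjunct1, rule conjunct2)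

section \<open>Repeated flips at one arc\<close>

context flipping
begin

lemma around_less: "h \<in> halves V \<Longrightarrow> fst h \<noteq> v \<Longrightarrow> face K h = F b \<Longrightarrow> around m v K h < 2 * m + 2"
  using hue_v_sum[of h b] F_neq[of b] by (cases b) (auto simp: around_def)

lemma around_flip:
  assumes h: "h \<in> halves V" "fst h \<noteq> v" "face K h = F b"
  shows "(around m v K' h + 1) mod (2 * m + 2) = around m v K h" "\<exists>b. face K' h = F b"
proof -
  have TF: "F True \<noteq> F False" "F False \<noteq> F True" using F_neq[of True] by auto
  have le: "hue K (v, b) h \<le> m" using hue_v_sum h by fastforce
  have "(around m v K' h + 1) mod (2 * m + 2) = around m v K h \<and> (\<exists>b. face K' h = F b)"
  proof (cases "nxt b h")
    case True
    then have f: "face K' h = F (\<not> b)" "hue K (v, b) h = 0" using face'_move nxtD[of b h] by auto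
    have "hue K' (v, \<not> b) h = m" using hue'_simps(1)[of h h "\<not> b"] True h by simp
    then show ?thesis using f h TF by (cases b) (auto simp: around_def mult_2)
  next
    case False
    have nb: "\<not> nxt (\<not> b) h" using nxtD[of "\<not> b" h] h F_neq[of b] by auto
    then have f: "face K' h = F b" using False h face'_other[of h] by (cases b) auto
    have "hue K' (v, b) h = hue K (v, b) h - 1" "0 < hue K (v, b) h"
      using hue'_simps(3)[of h h b] nb h hue_v_pos[of h b] False by auto
    then show ?thesis using f h TF le by (cases b) (auto simp: around_def)
  qed
  then show "(around m v K' h + 1) mod (2 * m + 2) = around m v K h" "\<exists>b. face K' h = F b" by auto
qed

lemma rotated_step: "rotated m V v K 1 K'"
proof -
  have "face K' h = face K h \<and> (\<forall>h'\<in>halves V. fst h' \<noteq> v \<and> face K h' = face K h \<longrightarrow> hue K' h h' = hue K h h')"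
    if h: "h \<in> halves V" "fst h \<noteq> v" "\<nexists>b. face K h = F b" for h
  proof -
    have n: "\<not> nxt b k" if "face K k = face K h" for b k using nxtD[of b k] h that by auto
    then have "face K' h = face K h" by (intro face'_other) auto
    then show ?thesis using hue'_simps(7)[of h] n h by auto
  qed
  then show ?thesis using around_flip unfolding rotated_def by auto
qed

end

lemma rotated_trans:
  assumes "rotated m V v K n J" "rotated m V v J 1 L"
  shows "rotated m V v K (Suc n) L"
  unfolding rotated_def
proof (intro conjI ballI impI allI)
  show "face L (v, b) = face K (v, b)" for b using assms by (simp add: rotated_def)
  have fJ: "face J (v, b) = face K (v, b)" for b using assms by (simp add: rotated_def)
  fix h assume h: "h \<in> halves V" "fst h \<noteq> v"
  show "if \<exists>b. face K h = face K (v, b)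
        then (\<exists>b. face L h = face K (v, b)) \<and> (around m v L h + Suc n) mod (2 * m + 2) = around m v K h
        else face L h = face K h \<and>
          (\<forall>h'\<in>halves V. fst h' \<noteq> v \<and> face K h' = face K h \<longrightarrow> hue L h h' = hue K h h')"
  proof (cases "\<exists>b. face K h = face K (v, b)")
    case True
    then have 1: "\<exists>b. face J h = face J (v, b)" "(around m v J h + n) mod (2 * m + 2) = around m v K h"
      using rotated_near[OF assms(1) h] unfolding fJ by auto
    have 2: "\<exists>b. face L h = face J (v, b)" "(around m v L h + 1) mod (2 * m + 2) = around m v J h"
      using rotated_near[OF assms(2) h 1(1)] by auto
    have "(around m v L h + Suc n) mod (2 * m + 2) = ((around m v L h + 1) mod (2 * m + 2) + n) mod (2 * m + 2)"
      unfolding mod_add_left_eq by simp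
    then show ?thesis using True 1 2 fJ by simp
  next
    case False
    then have 1: "face J h = face K h" "\<forall>h'\<in>halves V. fst h' \<noteq> v \<and> face K h' = face K h \<longrightarrow> hue J h h' = hue K h h'"
      using rotated_far[OF assms(1) h False] by auto
    then have nJ: "\<nexists>b. face J h = face J (v, b)" using False fJ by simp
    then have 2: "face L h = face J h" "\<forall>h'\<in>halves V. fst h' \<noteq> v \<and> face J h' = face J h \<longrightarrow> hue L h h' = hue J h h'"
      using rotated_far[OF assms(2) h nJ] by auto
    have "hue L h h' = hue K h h'" if "h' \<in> halves V" "fst h' \<noteq> v" "face K h' = face K h" for h'
    proof -
      have "face J h' = face K h'" using rotated_far(1)[OF assms(1) that(1,2)] that False by auto
      then show ?thesis using 1 2 that by simp
    qed
    then show ?thesis using False 1 2 by simp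
  qed
qed

lemma (in flipping) rotated_iterate:
  "annulus m V ((flip m V v ^^ n) K) p q \<and> (0 < n \<longrightarrow> rotated m V v K n ((flip m V v ^^ n) K))"
proof (induction n)
  case 0
  then show ?case using annulus_axioms by simp
next
  case (Suc n)
  then interpret J: flipping m V "(flip m V v ^^ n) K" p q v
    using v_in by (simp add: flipping_def flipping_axioms_def)
  show ?case
  proof (cases "n = 0")
    case True
    then show ?thesis using annulus_flip rotated_step by simp
  next
    case False
    then have "rotated m V v K (Suc n) J.K'" using Suc J.rotated_step by (intro rotated_trans) auto
    then show ?thesis using J.annulus_flip by simp
  qed
qed

text \<open>The configuration need not return: after \<open>m + 1\<close> flips the two faces at
  \<open>v\<close> have exchanged their halves, with the same hues. The quiver does not see this,
  since arrow counts sum over both halves of \<open>v\<close>.\<close>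

lemma (in flipping) period: "quiv V ((flip m V v ^^ (m + 1)) K) = quiv V K"
proof -
  let ?J = "(flip m V v ^^ (m + 1)) K"
  interpret J: annulus m V ?J p q using rotated_iterate[of "m + 1"] by simp
  interpret J: flipping m V ?J p q v by unfold_locales (rule v_in)
  have rot: "rotated m V v K (m + 1) ?J" using rotated_iterate[of "m + 1"] by simp
  have FJ: "face ?J (v, b) = F b" for b using rot by (simp add: rotated_def)
  have TF: "F True \<noteq> F False" "F False \<noteq> F True" using F_neq[of True] by auto
  have swap: "face ?J h = F (\<not> b) \<and> hue ?J (v, \<not> b) h = hue K (v, b) h"
    if h: "h \<in> halves V" "fst h \<noteq> v" "face K h = F b" for h b
  proof -
    have e: "\<exists>c. face ?J h = F c" "(around m v ?J h + (m + 1)) mod (2 * m + 2) = around m v K h"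
      using rotated_near[OF rot h(1,2)] h(3) by blast+
    then obtain c where c: "face ?J h = F c" by auto
    have "around m v ?J h < 2 * m + 2" using J.around_less[of h c] h c FJ by simp
    then have *: "around m v K h = (if around m v ?J h < m + 1 then around m v ?J h + (m + 1) else around m v ?J h - (m + 1))"
      unfolding e(2)[symmetric] by (auto simp: mod_if)
    have le: "hue K (v, b) h \<le> m" "hue ?J (v, c) h \<le> m"
      using hue_v_sum[of h b] J.hue_v_sum[of h c] h c FJ by auto
    show ?thesis
      using * h c le TF FJ by (cases b; cases c) (auto simp: around_def split: if_splits)
  qed
  have stay: "face ?J h = face K h" "\<And>h'. h' \<in> halves V \<Longrightarrow> fst h' \<noteq> v \<Longrightarrow> face K h' = face K h \<Longrightarrow> hue ?J h h' = hue K h h'"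
    if h: "h \<in> halves V" "fst h \<noteq> v" "\<nexists>b. face K h = F b" for h
    using rotated_far[OF rot h] by auto
  have link1: "link ?J u w c a b = link K u w c a b" if uw: "u \<in> V" "w \<in> V" "u \<noteq> w" "u \<noteq> v" "w \<noteq> v" for u w c a b
  proof -
    have fe: "face ?J (u, a) = face ?J (w, b) \<longleftrightarrow> face K (u, a) = face K (w, b)"
    proof (cases "\<exists>d. face K (u, a) = F d")
      case True
      then obtain d where d: "face K (u, a) = F d" by auto
      show ?thesis
      proof (cases "\<exists>d. face K (w, b) = F d")
        case True
        then obtain d' where "face K (w, b) = F d'" by auto
        then show ?thesis using swap[of "(u, a)" d] swap[of "(w, b)" d'] d uw TF by (cases d; cases d') auto
      next
        case False
        then have s: "face ?J (u, a) = F (\<not> d)" "face ?J (w, b) = face K (w, b)"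
          using swap[of "(u, a)" d] stay(1)[of "(w, b)"] d uw by auto
        have "F e \<noteq> face K (w, b)" for e using False by metis
        then show ?thesis unfolding s d by simp
      qed
    next
      case no: False
      show ?thesis
      proof (cases "\<exists>d. face K (w, b) = F d")
        case True
        then obtain d' where "face K (w, b) = F d'" by auto
        then have s: "face ?J (w, b) = F (\<not> d')" "face ?J (u, a) = face K (u, a)" "face K (w, b) = F d'"
          using swap[of "(w, b)" d'] stay(1)[of "(u, a)"] no uw by auto
        have "face K (u, a) \<noteq> F e" for e using no by metis
        then show ?thesis unfolding s by simp
      next
        case False
        then show ?thesis using stay(1)[of "(u, a)"] stay(1)[of "(w, b)"] no uw by simp
      qed
    qed
    have "hue ?J (u, a) (w, b) = hue K (u, a) (w, b)" if eq: "face K (u, a) = face K (w, b)"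
    proof (cases "\<exists>d. face K (u, a) = F d")
      case True
      then obtain d where d: "face K (u, a) = F d" by auto
      have "hue ?J (u, a) (w, b) = gap m (hue ?J (v, \<not> d) (u, a)) (hue ?J (v, \<not> d) (w, b))"
        using swap[of "(u, a)" d] swap[of "(w, b)" d] d eq uw FJ by (intro J.hue_v_gap(2)) auto
      also have "\<dots> = gap m (hue K (v, d) (u, a)) (hue K (v, d) (w, b))"
        using swap[of "(u, a)" d] swap[of "(w, b)" d] d eq uw by simp
      also have "\<dots> = hue K (u, a) (w, b)"
        using hue_v_gap(2)[of "(u, a)" "(w, b)" d] d eq uw by simp
      finally show ?thesis .
    next
      case False
      show ?thesis by (rule stay(2)[OF _ _ False]) (simp_all add: uw eq[symmetric])
    qed
    then show ?thesis using fe by (auto simp: link_def)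
  qed
  have link2: "link ?J u v c a b = link K u v c a (\<not> b)" if u: "u \<in> V" "u \<noteq> v" for u c a b
  proof (cases "\<exists>d. face K (u, a) = F d")
    case True
    then obtain d where d: "face K (u, a) = F d" by auto
    have "hue ?J (u, a) (v, \<not> d) = hue K (u, a) (v, d)"
      using swap[of "(u, a)" d] d u FJ hue_v_sum[of "(u, a)" d] J.hue_v_sum[of "(u, a)" "\<not> d"] by simp
    then show ?thesis using swap[of "(u, a)" d] d u FJ TF by (cases b; cases d) (auto simp: link_def)
  next
    case False
    then show ?thesis using stay(1)[of "(u, a)"] u FJ by (auto simp: link_def)
  qed
  have to_v: "arr (quiv V ?J) u v c = arr (quiv V K) u v c" if "u \<in> V" "u \<noteq> v" for u c
  proof -
    have "arr (quiv V ?J) u v c = link ?J u v c True True + link ?J u v c True (\<not> True)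
        + link ?J u v c (\<not> True) True + link ?J u v c (\<not> True) (\<not> True)"
      by (rule arr_link) (use that v_in in auto)
    also have "\<dots> = link K u v c True False + link K u v c True True + link K u v c False False + link K u v c False True"
      unfolding link2[OF that] by simp
    also have "\<dots> = arr (quiv V K) u v c"
      using arr_link[of u V v K c True True] that v_in by simp
    finally show ?thesis .
  qed
  have "arr (quiv V ?J) u w c = arr (quiv V K) u w c" for u w c
  proof (cases "u \<in> V \<and> w \<in> V \<and> u \<noteq> w")
    case True
    consider "w = v" | "u = v" | "u \<noteq> v" "w \<noteq> v" by auto
    then show ?thesis
    proof cases
      case 1
      then show ?thesis using to_v True by simp
    next
      case 2
      show ?thesis
      proof (cases "c \<le> m")
        case c: True
        have "w \<noteq> v" using 2 True by auto
        then show ?thesis using to_v[of w "m - c"] 2 True arr_skew[OF c, of u w] J.arr_skew[OF c, of u w] by simp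
      next
        case False
        then show ?thesis using arr_gt J.arr_gt by simp
      qed
    next
      case 3
      then show ?thesis
        using arr_link[of u V w ?J c True True] arr_link[of u V w K c True True] True link1[of u w c] by simp
    qed
  next
    case False
    then show ?thesis using arr_quiv_0 by metis
  qed
  then have "arr (quiv V ?J) = arr (quiv V K)" by (intro ext)
  then show ?thesis by (intro cquiver.equality) simp_all
qed

definition flips :: "nat \<Rightarrow> 'a set \<Rightarrow> ('a, 'f) conf \<Rightarrow> ('a, 'f) conf \<Rightarrow> bool" where
  "flips m V = (\<lambda>K J. \<exists>v\<in>V. J = flip m V v K)\<^sup>*\<^sup>*"

lemma obtained_trans: "obtained_by_mutations m P Q \<Longrightarrow> obtained_by_mutations m Q R \<Longrightarrow> obtained_by_mutations m P R"
  unfolding obtained_by_mutations_def by (rule rtranclp_trans)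

text \<open>A flip is undone by \<open>m\<close> further flips at the same arc, which complete the
  period.\<close>

lemma (in flipping) obtained_flip:
  "obtained_by_mutations m (quiv V K) (quiv V K')" "obtained_by_mutations m (quiv V K') (quiv V K)"
proof -
  have iter: "obtained_by_mutations m (quiv V K') (quiv V ((flip m V v ^^ n) K'))" for n
  proof (induction n)
    case 0
    then show ?case by (simp add: obtained_by_mutations_def)
  next
    case (Suc n)
    have "(flip m V v ^^ n) K' = (flip m V v ^^ Suc n) K" by (simp add: funpow_swap1)
    then interpret J: flipping m V "(flip m V v ^^ n) K'" p q v
      using v_in rotated_iterate[of "Suc n"] by (simp add: flipping_def flipping_axioms_def)
    have "quiv V ((flip m V v ^^ Suc n) K') = mutate m v (quiv V ((flip m V v ^^ n) K'))"
      using J.mutate_quiv by simp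
    then have "obtained_by_mutations m (quiv V ((flip m V v ^^ n) K')) (quiv V ((flip m V v ^^ Suc n) K'))"
      using v_in unfolding obtained_by_mutations_def by (intro r_into_rtranclp bexI[of _ v]) simp_all
    then show ?case using Suc obtained_trans by blast
  qed
  have "(flip m V v ^^ m) K' = (flip m V v ^^ (m + 1)) K" by (simp add: funpow_swap1)
  then show "obtained_by_mutations m (quiv V K') (quiv V K)" using iter[of m] period by simp
  show "obtained_by_mutations m (quiv V K) (quiv V K')"
    using mutate_quiv v_in unfolding obtained_by_mutations_def by (metis (mono_tags, lifting) r_into_rtranclp verts_quiv)
qed

lemma flips_annulus:
  assumes "flips m V K J" "annulus m V K p q"
  shows "annulus m V J p q \<and> obtained_by_mutations m (quiv V K) (quiv V J) \<and> obtained_by_mutations m (quiv V J) (quiv V K)"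
  using assms(1) unfolding flips_def
proof (induction rule: rtranclp_induct)
  case base
  then show ?case using assms(2) by (simp add: obtained_by_mutations_def)
next
  case (step J L)
  then obtain v where v: "v \<in> V" "L = flip m V v J" by auto
  then interpret flipping m V J p q v using step by (simp add: flipping_def flipping_axioms_def)
  show ?case using step v annulus_flip obtained_flip obtained_trans by metis
qed

lemma obtained_annulus:
  fixes K :: "('a, 'f) conf"
  assumes "obtained_by_mutations m (quiv V K) R" "annulus m V K p q"
  shows "\<exists>J :: ('a, 'f) conf. annulus m V J p q \<and> R = quiv V J"
  using assms(1) unfolding obtained_by_mutations_def
proof (induction rule: rtranclp_induct)
  case base
  then show ?case using assms(2) by auto
next
  case (step R S)
  then obtain J where J: "annulus m V (J :: ('a, 'f) conf) p q" "R = quiv V J" by auto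
  obtain v where v: "v \<in> verts R" "S = mutate m v R" using step by auto
  then interpret flipping m V J p q v using J by (simp add: flipping_def flipping_axioms_def)
  show ?case using annulus_flip mutate_quiv v J by auto
qed

section \<open>Flipping to a monotone ring\<close>

text \<open>The iterates of an injective self-map of a finite set return to the starting point; the
  list is the orbit up to the first return.\<close>

lemma orbit_list:
  assumes fin: "finite S" and f: "f ` S \<subseteq> S" "inj_on f S" and x: "x \<in> S"
  obtains xs where "xs \<noteq> []" "distinct xs" "set xs \<subseteq> S" "xs ! 0 = x"
    "\<And>i. i < length xs \<Longrightarrow> f (xs ! i) = xs ! (Suc i mod length xs)"
proof -
  have in_S: "(f ^^ n) y \<in> S" if "y \<in> S" for n y using that f by (induction n) auto
  have inj: "inj_on (f ^^ n) S" for n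
  proof (induction n)
    case (Suc n)
    have "inj_on (f \<circ> (f ^^ n)) S" using in_S f(2) by (intro comp_inj_on[OF Suc]) (auto elim: inj_on_subset)
    then show ?case by (simp add: o_def)
  qed simp
  have "\<not> inj_on (\<lambda>n. (f ^^ n) x) (UNIV :: nat set)"
  proof
    assume "inj_on (\<lambda>n. (f ^^ n) x) (UNIV :: nat set)"
    then have "finite (UNIV :: nat set)" using in_S[OF x] fin by (metis finite_imageD finite_subset image_subsetI)
    then show False by simp
  qed
  then obtain i j where ij: "i < j" "(f ^^ i) x = (f ^^ j) x"
    unfolding inj_on_def by (metis nat_neq_iff)
  \<comment> \<open>Injectivity of the iterates cancels the common initial segment, so the
    repetition occurs at \<open>x\<close> itself.\<close>
  have "(f ^^ i) ((f ^^ (j - i)) x) = (f ^^ i) x"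
    using ij by (simp add: funpow_add[symmetric, THEN fun_cong, unfolded o_apply])
  then have ex: "0 < j - i \<and> (f ^^ (j - i)) x = x"
    using inj[of i] x in_S[OF x] ij(1) by (auto simp: inj_on_def)
  define n where "n = (LEAST n. 0 < n \<and> (f ^^ n) x = x)"
  have n: "0 < n" "(f ^^ n) x = x" unfolding n_def using LeastI[of "\<lambda>n. 0 < n \<and> (f ^^ n) x = x", OF ex] by auto
  have least: "(f ^^ k) x \<noteq> x" if "0 < k" "k < n" for k
    using not_less_Least[of k "\<lambda>n. 0 < n \<and> (f ^^ n) x = x"] that unfolding n_def by auto
  define xs where "xs = map (\<lambda>i. (f ^^ i) x) [0..<n]"
  have l: "length xs = n" and nth: "\<And>i. i < n \<Longrightarrow> xs ! i = (f ^^ i) x" by (auto simp: xs_def)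
  have diff: "(f ^^ a) x \<noteq> (f ^^ b) x" if "a < b" "b < n" for a b
  proof
    assume eq: "(f ^^ a) x = (f ^^ b) x"
    have "(f ^^ b) x = (f ^^ a) ((f ^^ (b - a)) x)"
      using that by (simp add: funpow_add[symmetric, THEN fun_cong, unfolded o_apply])
    then have "(f ^^ (b - a)) x = x" using eq inj[of a] x in_S[OF x] by (auto simp: inj_on_def)
    then show False using least[of "b - a"] that by auto
  qed
  show ?thesis
  proof
    show "xs \<noteq> []" using l n by auto
    show "distinct xs"
      unfolding distinct_conv_nth l
    proof (intro allI impI)
      fix a b assume "a < n" "b < n" "a \<noteq> b"
      then show "xs ! a \<noteq> xs ! b" using diff[of a b] diff[of b a] nth by (cases "a < b") auto
    qed
    show "set xs \<subseteq> S" using in_S[OF x] by (auto simp: xs_def)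
    show "xs ! 0 = x" using nth n by simp
    fix i assume "i < length xs"
    then show "f (xs ! i) = xs ! (Suc i mod length xs)"
    proof -
      assume i: "i < length xs"
      have "f (xs ! i) = (f ^^ Suc i) x" using nth[of i] i l by simp
      moreover have "xs ! (Suc i mod length xs) = (f ^^ Suc i) x"
      proof (cases "Suc i = n")
        case True
        then have "xs ! (Suc i mod length xs) = x" using nth[of 0] n l by simp
        then show ?thesis using n(2) unfolding True by simp
      next
        case False
        then show ?thesis using nth[of "Suc i"] i l by simp
      qed
      ultimately show ?thesis by simp
    qed
  qed
qed

section \<open>The spine as a cyclic list\<close>

context annulus
begin

definition entry :: "'a \<Rightarrow> 'a \<times> bool" where "entry v = (v, \<not> exit_half v)"
definition exit :: "'a \<Rightarrow> 'a \<times> bool" where "exit v = (v, exit_half v)"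

lemma spine_V: "v \<in> spine V K \<Longrightarrow> v \<in> V"
  by (simp add: spine_def)

lemma entry_simps [simp]: "fst (entry v) = v" "fst (exit v) = v" "oth (entry v) = exit v" "oth (exit v) = entry v"
  "entry v \<in> halves V \<longleftrightarrow> v \<in> V" "exit v \<in> halves V \<longleftrightarrow> v \<in> V"
  by (simp_all add: entry_def exit_def)

lemma entry_lbl: "v \<in> spine V K \<Longrightarrow> lbl K (entry v) \<and> \<not> lbl K (exit v)"
  using exit_half by (auto simp: entry_def exit_def)

lemma half_cases: "fst h = v \<Longrightarrow> h = entry v \<or> h = exit v"
  by (cases h) (auto simp: entry_def exit_def)

lemma entry_neq: "entry v \<noteq> exit w"
  by (cases "v = w") (auto simp: entry_def exit_def)

lemma central_entry:
  assumes "central_face V K F e u"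
  shows "e = entry (fst e)" "u = exit (fst u)" "fst e \<in> spine V K" "fst u \<in> spine V K"
proof -
  show s: "fst e \<in> spine V K" "fst u \<in> spine V K" using central_in_spine[OF assms] by auto
  have "lbl K e" "\<not> lbl K u" using assms unfolding central_face_def by blast+
  then show "e = entry (fst e)" "u = exit (fst u)"
    using half_cases[of e "fst e"] half_cases[of u "fst u"] entry_lbl[OF s(1)] entry_lbl[OF s(2)] by auto
qed

lemma entry_central:
  assumes "v \<in> spine V K"
  obtains w where "w \<in> spine V K" "central_face V K (face K (entry v)) (entry v) (exit w)"
proof -
  obtain e u where c: "central_face V K (face K (entry v)) e u" "entry v = e \<or> entry v = u"
    by (rule spine_central[of "entry v"]) (use assms spine_V in auto)
  have "entry v = e" using c central_entry(2)[OF c(1)] entry_neq by metis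
  then show ?thesis using c central_entry[OF c(1)] that by metis
qed

definition next_spine :: "'a \<Rightarrow> 'a" where
  "next_spine v = (SOME w. w \<in> spine V K \<and> central_face V K (face K (entry v)) (entry v) (exit w))"

lemma next_spine:
  assumes "v \<in> spine V K"
  shows "next_spine v \<in> spine V K" "central_face V K (face K (entry v)) (entry v) (exit (next_spine v))"
proof -
  have "\<exists>w. w \<in> spine V K \<and> central_face V K (face K (entry v)) (entry v) (exit w)"
    using entry_central[OF assms] by blast
  then have "next_spine v \<in> spine V K \<and> central_face V K (face K (entry v)) (entry v) (exit (next_spine v))"
    unfolding next_spine_def by (rule someI_ex)
  then show "next_spine v \<in> spine V K" "central_face V K (face K (entry v)) (entry v) (exit (next_spine v))" by auto
qed

lemma central_exit_face: "central_face V K F e u \<Longrightarrow> face K e = F \<and> face K u = F"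
  by (simp add: central_face_def)

lemma next_spine_inj: "inj_on next_spine (spine V K)"
proof (rule inj_onI)
  fix v w assume vw: "v \<in> spine V K" "w \<in> spine V K" "next_spine v = next_spine w"
  have "face K (entry v) = face K (entry w)"
    using next_spine(2)[OF vw(1)] next_spine(2)[OF vw(2)] vw(3) central_exit_face by metis
  then have "entry v = entry w" using next_spine(2)[OF vw(1)] next_spine(2)[OF vw(2)] central_unique by metis
  then show "v = w" by (metis entry_simps(1))
qed

definition spine_list :: "'a list \<Rightarrow> bool" where
  "spine_list xs \<longleftrightarrow> distinct xs \<and> set xs = spine V K \<and> 2 \<le> length xs \<and>
     (\<forall>i<length xs. central_face V K (face K (entry (xs ! i))) (entry (xs ! i)) (exit (cyc_next xs i)))"

text \<open>Passing from a spine arc through the central face at its entry to the exit of the next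
  one is injective. An orbit is a closed trail, hence the whole spine; it has more than one element
  because no arc has the same face on both sides.\<close>

lemma exists_spine_list: obtains xs where "spine_list xs"
proof -
  obtain F e u where c: "central_face V K F e u" using exists_central by blast
  have fin: "finite (spine V K)" using finite_V by (auto simp: spine_def)
  obtain xs where xs: "xs \<noteq> []" "distinct xs" "set xs \<subseteq> spine V K"
    "\<And>i. i < length xs \<Longrightarrow> next_spine (xs ! i) = xs ! (Suc i mod length xs)"
    by (rule orbit_list[OF fin _ next_spine_inj central_entry(3)[OF c]]) (use next_spine in auto)
  have ce: "central_face V K (face K (entry (xs ! i))) (entry (xs ! i)) (exit (cyc_next xs i))" if "i < length xs" for i
    using next_spine(2)[of "xs ! i"] xs that unfolding cyc_next_def by (metis nth_mem subset_iff)
  have "set xs = spine V K"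
  proof (rule trail_spine[of xs "\<lambda>i. exit_half (xs ! i)"])
    show "set xs \<subseteq> V" using xs spine_V by auto
    fix i assume i: "i < length xs"
    then show "face K (xs ! i, \<not> exit_half (xs ! i)) = face K (xs ! (Suc i mod length xs), exit_half (xs ! (Suc i mod length xs)))"
      using central_exit_face[OF ce[OF i]] by (simp add: entry_def exit_def cyc_next_def)
  qed (use xs in auto)
  moreover have "2 \<le> length xs"
  proof (rule ccontr)
    assume "\<not> 2 \<le> length xs"
    moreover have "length xs \<noteq> 0" using xs(1) by simp
    ultimately have l: "length xs = 1" by linarith
    then have "face K (entry (xs ! 0)) = face K (exit (xs ! 0))"
      using central_exit_face[OF ce[of 0]] by (simp add: cyc_next_def)
    moreover have "xs ! 0 \<in> V" using l xs spine_V by (metis length_greater_0_conv nth_mem subset_iff)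
    ultimately show False using no_loop'[of "xs ! 0" "exit_half (xs ! 0)"] by (simp add: entry_def exit_def)
  qed
  ultimately show ?thesis using that[of xs] xs(2) ce by (simp add: spine_list_def)
qed

lemma spine_list_faces:
  assumes "spine_list xs" "i < length xs" "j < length xs" "face K (entry (xs ! i)) = face K (entry (xs ! j))"
  shows "i = j"
proof -
  have "entry (xs ! i) = entry (xs ! j)"
    using assms central_unique unfolding spine_list_def by metis
  then have "xs ! i = xs ! j" by (metis entry_simps(1))
  then show ?thesis using assms by (simp add: spine_list_def nth_eq_iff_index_eq)
qed

lemma central_index:
  assumes xs: "spine_list xs" and c: "central_face V K F e u"
  obtains i where "i < length xs" "e = entry (xs ! i)" "u = exit (cyc_next xs i)" "F = face K (entry (xs ! i))"
proof -
  have "fst e \<in> set xs" using central_entry(3)[OF c] xs by (simp add: spine_list_def)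
  then obtain i where i: "i < length xs" "xs ! i = fst e" by (auto simp: in_set_conv_nth)
  then have e: "e = entry (xs ! i)" using central_entry(1)[OF c] by simp
  then have F: "F = face K (entry (xs ! i))" using central_exit_face[OF c] by simp
  have "central_face V K F (entry (xs ! i)) (exit (cyc_next xs i))" using xs i(1) unfolding F spine_list_def by blast
  then show ?thesis using that i e F central_unique[OF c] by metis
qed

lemma wt_spine_list:
  assumes xs: "spine_list xs"
  shows "(\<Sum>F\<in>face K ` halves V. wt V K F) = (\<Sum>i<length xs. hue K (entry (xs ! i)) (exit (cyc_next xs i)))"
    and "(\<Sum>F\<in>face K ` halves V. wb V K F) = (\<Sum>i<length xs. hue K (exit (cyc_next xs i)) (entry (xs ! i)))"
proof -
  let ?F = "\<lambda>i. face K (entry (xs ! i))"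
  have inj: "inj_on ?F {..<length xs}" using spine_list_faces[OF xs] by (auto simp: inj_on_def)
  have ce: "central_face V K (?F i) (entry (xs ! i)) (exit (cyc_next xs i))" if "i < length xs" for i
    using xs that by (simp add: spine_list_def)
  have sub: "?F ` {..<length xs} \<subseteq> face K ` halves V"
  proof
    fix F assume "F \<in> ?F ` {..<length xs}"
    then obtain i where i: "i < length xs" "F = ?F i" by auto
    then have "xs ! i \<in> spine V K" using xs nth_mem unfolding spine_list_def by metis
    then show "F \<in> face K ` halves V" using i spine_V by auto
  qed
  have z: "wt V K F = 0 \<and> wb V K F = 0" if "F \<notin> ?F ` {..<length xs}" for F
  proof -
    have "\<not> central_face V K F e u" for e u using central_index[OF xs, of F e u] that by blast
    then have "{(e, u). central_face V K F e u} = {}" by auto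
    then show ?thesis by (simp only: wt_def wb_def sum.empty simp_thms)
  qed
  have "(\<Sum>F\<in>face K ` halves V. g F) = (\<Sum>i<length xs. g (?F i))" if "\<And>F. F \<notin> ?F ` {..<length xs} \<Longrightarrow> g F = 0" for g :: "'f \<Rightarrow> nat"
  proof -
    have "(\<Sum>F\<in>face K ` halves V. g F) = (\<Sum>F\<in>?F ` {..<length xs}. g F)"
      using sub that finite_N by (intro sum.mono_neutral_right) auto
    then show ?thesis by (simp add: sum.reindex[OF inj])
  qed
  note S = this[of "wt V K"] this[of "wb V K"]
  show "(\<Sum>F\<in>face K ` halves V. wt V K F) = (\<Sum>i<length xs. hue K (entry (xs ! i)) (exit (cyc_next xs i)))"
    using S(1) z wt_central[OF ce] by simp
  show "(\<Sum>F\<in>face K ` halves V. wb V K F) = (\<Sum>i<length xs. hue K (exit (cyc_next xs i)) (entry (xs ! i)))"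
    using S(2) z wb_central[OF ce] by simp
qed

text \<open>Otherwise all arcs at central faces belong to the spine. Then faces linked to a central
  one are central, so all faces are central, and no arc is left outside the spine.\<close>

lemma exists_peripheral:
  assumes "spine V K \<noteq> V"
  obtains v b e u where "v \<in> V" "v \<notin> spine V K" "central_face V K (face K (v, b)) e u"
proof -
  have "\<exists>v b e u. v \<in> V \<and> v \<notin> spine V K \<and> central_face V K (face K (v, b)) e u"
  proof (rule ccontr)
    assume no: "\<not> ?thesis"
    obtain w where w: "w \<in> V" "w \<notin> spine V K" using assms by (auto simp: spine_def)
    obtain F e u where F: "F \<in> face K ` halves V" "central_face V K F e u" using exists_central by blast
    have "\<exists>e u. central_face V K G e u" if "linked (face K) V F G" for G
      using that
    proof (induction rule: rtranclp_induct)
      case base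
      then show ?case using F by blast
    next
      case (step G G')
      then obtain x d where x: "x \<in> V" "G = face K (x, d)" "G' = face K (x, \<not> d)" by (auto simp: adj_def)
      then have "x \<in> spine V K" using step no by blast
      then show ?case using spine_central[of "(x, \<not> d)"] x by (metis fst_conv in_halves(1))
    qed
    then have "\<exists>e u. central_face V K (face K (w, True)) e u" using conn F(1) w face_in by (metis in_halves(1))
    then show False using no w by blast
  qed
  then show ?thesis using that by blast
qed

end

lemma (in flipping) spine_flip: "v \<notin> spine V K \<Longrightarrow> turn b \<Longrightarrow> \<not> turn (\<not> b) \<Longrightarrow> spine V K' = insert v (spine V K)"
  and spine_flip_same: "\<not> turn True \<Longrightarrow> \<not> turn False \<Longrightarrow> spine V K' = spine V K"
proof -
  have o: "u \<in> spine V K' \<longleftrightarrow> u \<in> spine V K" if "u \<noteq> v" for u using that by (simp add: spine_def)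
  show "spine V K' = insert v (spine V K)" if "v \<notin> spine V K" "turn b" "\<not> turn (\<not> b)"
  proof -
    have "v \<in> spine V K'" using that v_in by (cases b) (auto simp: spine_def lbl'_v)
    then show ?thesis using o by (intro set_eqI, rename_tac x, case_tac "x = v") auto
  qed
  show "spine V K' = spine V K" if "\<not> turn True" "\<not> turn False"
  proof -
    have "v \<in> spine V K' \<longleftrightarrow> v \<in> spine V K" using that v_in by (simp add: spine_def lbl'_v)
    then show ?thesis using o by (intro set_eqI, rename_tac x, case_tac "x = v") auto
  qed
qed

text \<open>Each flip brings \<open>v\<close> one edge closer to the arc \<open>t\<close> joining
  the circles, until such an arc is next to \<open>v\<close> and the next flip puts \<open>v\<close>
  into the spine. The face on the other side of \<open>v\<close> is pure, so the other end never
  turns.\<close>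

lemma grow_spine:
  assumes "annulus m V K p q" "v \<in> V" "v \<notin> spine V K" "t \<in> halves V" "face K t = face K (v, b)" "fst t \<in> spine V K"
  shows "\<exists>J. flips m V K J \<and> annulus m V J p q \<and> card (spine V J) = card (spine V K) + 1"
  using assms
proof (induction "hue K (v, b) t" arbitrary: K rule: less_induct)
  case less
  then interpret flipping m V K p q v by (simp add: flipping_def flipping_axioms_def)
  have fin: "finite (spine V K)" using finite_V by (auto simp: spine_def)
  have one: "flips m V K K'" using v_in unfolding flips_def by (intro r_into_rtranclp) auto
  have tv: "fst t \<noteq> v" using less.prems by auto
  have tl: "lbl K t \<noteq> lbl K (oth t)" using spine_lbl[of "fst t" "snd t"] less.prems by (simp add: oth_def)
  obtain e u where "central_face V K (face K (v, b)) e u" using spine_central[of t] less.prems by metis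
  then obtain s where P: "pure_face V K (F (\<not> b)) s" using not_two_central less.prems by blast
  then have nt: "\<not> turn (\<not> b)" using nxtD by (auto simp: turn_def pure_face_def)
  show ?case
  proof (cases "turn b")
    case True
    then have "card (spine V K') = card (spine V K) + 1"
      using spine_flip[OF less.prems(3) True nt] less.prems fin by simp
    then show ?thesis using one annulus_flip by blast
  next
    case False
    have nx: "\<not> nxt b t" using False tl by (auto simp: turn_def)
    have nx': "\<not> nxt (\<not> b) t" using nxtD[of "\<not> b" t] less.prems F_neq[of b] by auto
    have sp: "spine V K' = spine V K" using spine_flip_same False nt by (cases b) auto
    have ft: "face K' t = F b" using face'_old less.prems nx by blast
    have "hue K' (v, b) t = hue K (v, b) t - 1" using hue'_simps(3)[of t t b] tv nx' by simp
    moreover have "0 < hue K (v, b) t" using hue_v_pos less.prems tv nx by blast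
    ultimately have "\<exists>J. flips m V K' J \<and> annulus m V J p q \<and> card (spine V J) = card (spine V K') + 1"
      using less.prems sp ft by (intro less.hyps annulus_flip) auto
    then show ?thesis using one sp unfolding flips_def by (metis (no_types, lifting) rtranclp_trans)
  qed
qed

lemma flips_trans: "flips m V K J \<Longrightarrow> flips m V J L \<Longrightarrow> flips m V K L"
  unfolding flips_def by (rule rtranclp_trans)

lemma all_spine:
  assumes "annulus m V K p q"
  shows "\<exists>J. flips m V K J \<and> annulus m V J p q \<and> spine V J = V"
  using assms
proof (induction "card V - card (spine V K)" arbitrary: K rule: less_induct)
  case less
  then interpret annulus m V K p q by simp
  show ?case
  proof (cases "spine V K = V")
    case True
    then show ?thesis using annulus_axioms by (auto simp: flips_def)
  next
    case False
    obtain v b e u where v: "v \<in> V" "v \<notin> spine V K" "central_face V K (face K (v, b)) e u"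
      using exists_peripheral[OF False] .
    have "e \<in> halves V" "face K e = face K (v, b)" "fst e \<in> spine V K"
      using v(3) central_in_spine[OF v(3)] unfolding central_face_def by blast+
    then obtain J where J: "flips m V K J" "annulus m V J p q" "card (spine V J) = card (spine V K) + 1"
      using grow_spine[OF annulus_axioms v(1,2)] by blast
    have "card (spine V J) \<le> card V" using finite_V by (intro card_mono) (auto simp: spine_def)
    then have "card V - card (spine V J) < card V - card (spine V K)" using J(3) by simp
    then obtain L where "flips m V J L" "annulus m V L p q" "spine V L = V" using less.hyps[OF _ J(2)] by blast
    then show ?thesis using flips_trans[OF J(1)] by blast
  qed
qed

lemma (in annulus) spine_list_length:
  assumes "spine V K = V" "spine_list xs"
  shows "length xs = p + q"
  using assms card_V by (metis distinct_card spine_list_def)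

section \<open>Sorting the colors along the ring\<close>

context flipping
begin

lemma slide:
  assumes sp: "spine V K = V" and n: "\<And>b x. \<not> nxt b x"
  shows "face K' = face K" "lbl K' = lbl K" "spine V K' = V"
    "central_face V K' F' e u \<longleftrightarrow> central_face V K F' e u"
    "fst h' \<noteq> v \<Longrightarrow> hue K' (v, b) h' = hue K (v, b) h' - 1"
    "fst h \<noteq> v \<Longrightarrow> hue K' h (v, b) = hue K h (v, b) + 1"
    "fst h \<noteq> v \<Longrightarrow> fst h' \<noteq> v \<Longrightarrow> hue K' h h' = hue K h h'"
proof -
  have t: "\<not> turn b" for b using n by (simp add: turn_def)
  show f: "face K' = face K" using face'_other n by (intro ext) auto
  show l: "lbl K' = lbl K"
  proof
    fix h show "lbl K' h = lbl K h"
    proof (cases "fst h = v")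
      case True
      then have "h = (v, snd h)" by (cases h) auto
      then show ?thesis using lbl'_v[of "snd h"] t by metis
    qed simp
  qed
  show "spine V K' = V" using sp l by (simp add: spine_def)
  have no: "lbl K (oth h) \<noteq> lbl K h" if "h \<in> halves V" for h
    using spine_lbl[of "fst h" "snd h"] sp that by (simp add: oth_def halves_fst)
  show "central_face V K' F' e u \<longleftrightarrow> central_face V K F' e u"
    unfolding central_face_def f l using no by blast
  show "fst h' \<noteq> v \<Longrightarrow> hue K' (v, b) h' = hue K (v, b) h' - 1" "fst h \<noteq> v \<Longrightarrow> hue K' h (v, b) = hue K h (v, b) + 1"
    "fst h \<noteq> v \<Longrightarrow> fst h' \<noteq> v \<Longrightarrow> hue K' h h' = hue K h h'"
    using hue'_simps(3)[of h' h' b] hue'_simps(4)[of h h b] hue'_simps(7)[of h h'] n by auto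
qed

end

definition ring_color :: "('a, 'f) conf \<Rightarrow> 'a list \<Rightarrow> nat \<Rightarrow> nat" where
  "ring_color K xs i = hue K (annulus.entry K (xs ! i)) (annulus.exit K (cyc_next xs i))"

text \<open>If all arcs lie on the spine, a central face has only two arcs, and the bounds on the
  colors say that neither neighbor is next to the arc \<open>xs ! j\<close>. A flip then moves no
  other arc and transfers one unit of color from index \<open>j\<close> to
  \<open>j - 1\<close>.\<close>

lemma slide_ring:
  assumes "annulus m V K p q" "spine V K = V" "annulus.spine_list V K xs" and j: "1 \<le> j" "j < length xs"
    and c: "ring_color K xs (j - 1) < m" "0 < ring_color K xs j"
  defines "J \<equiv> flip m V (xs ! j) K"
  shows "annulus m V J p q" "spine V J = V" "annulus.spine_list V J xs" "flips m V K J"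
    "i < length xs \<Longrightarrow> ring_color J xs i =
      (if i = j then ring_color K xs i - 1 else if i = j - 1 then ring_color K xs i + 1 else ring_color K xs i)"
proof -
  interpret annulus m V K p q by fact
  have xs: "distinct xs" "set xs = V" "2 \<le> length xs"
    "\<And>i. i < length xs \<Longrightarrow> central_face V K (face K (entry (xs ! i))) (entry (xs ! i)) (exit (cyc_next xs i))"
    using assms(2,3) by (auto simp: spine_list_def)
  have vj: "xs ! j \<in> V" using xs j by auto
  interpret flipping m V K p q "xs ! j" by unfold_locales (rule vj)
  have J: "J = K'" by (simp add: J_def)
  have cj: "cyc_next xs (j - 1) = xs ! j" using j by (simp add: cyc_next_def)
  have only: "h = entry (xs ! i) \<or> h = exit (cyc_next xs i)" if "h \<in> halves V" "face K h = face K (entry (xs ! i))" "i < length xs" for h i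
    using central_not_in_other[OF xs(4)[OF that(3)] that(1,2)] assms(2) that by (simp add: halves_fst)
  have nx: "\<not> next_half V K (entry (xs ! j)) x" for x
    using only[of x j] j c(2) by (auto simp: next_half_def ring_color_def)
  have nx': "\<not> next_half V K (exit (xs ! j)) x" for x
  proof
    assume x: "next_half V K (exit (xs ! j)) x"
    have f: "face K (exit (xs ! j)) = face K (entry (xs ! (j - 1)))"
      using central_exit_face[OF xs(4)[of "j - 1"]] j cj by simp
    have "x = entry (xs ! (j - 1))" using only[of x "j - 1"] x f cj j by (auto simp: next_half_def)
    then have "hue K (entry (xs ! (j - 1))) (exit (xs ! j)) = m"
      using x hue_sum[of x "exit (xs ! j)"] vj by (auto simp: next_half_def)
    then show False using c(1) cj by (simp add: ring_color_def)
  qed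
  have n: "\<not> nxt b x" for b x
    using nx nx' by (cases "b = exit_half (xs ! j)") (auto simp: entry_def exit_def)
  note S = slide[OF assms(2) n]
  interpret A': annulus m V K' p q by (rule annulus_flip)
  have ee: "A'.entry = entry" "A'.exit = exit" "A'.exit_half = exit_half"
    by (simp_all add: fun_eq_iff A'.entry_def entry_def A'.exit_def exit_def A'.exit_half_def exit_half_def S(2))
  show "annulus m V J p q" using annulus_flip J by simp
  show "spine V J = V" using S(3) J by simp
  have "A'.spine_list xs"
    using xs S(3) unfolding A'.spine_list_def ee S(4) S(1) by simp
  then show "annulus.spine_list V J xs" using J by simp
  show "flips m V K J" unfolding flips_def J_def using vj by (intro r_into_rtranclp) auto
  assume i: "i < length xs"
  have ri: "ring_color J xs i = hue K' (entry (xs ! i)) (exit (cyc_next xs i))" by (simp add: ring_color_def J ee)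
  have si: "cyc_next xs i = xs ! j \<longleftrightarrow> i = j - 1"
  proof -
    have "xs ! (Suc i mod length xs) = xs ! j \<longleftrightarrow> Suc i mod length xs = j"
      using i j xs(1) by (intro nth_eq_iff_index_eq mod_less_divisor) auto
    also have "\<dots> \<longleftrightarrow> i = j - 1" using i j by (auto simp: mod_Suc)
    finally show ?thesis by (simp add: cyc_next_def)
  qed
  have ei: "xs ! i = xs ! j \<longleftrightarrow> i = j" using i j xs(1) by (simp add: nth_eq_iff_index_eq)
  consider "i = j" | "i = j - 1" | "i \<noteq> j" "i \<noteq> j - 1" by auto
  then show "ring_color J xs i =
      (if i = j then ring_color K xs i - 1 else if i = j - 1 then ring_color K xs i + 1 else ring_color K xs i)"
  proof cases
    case 1
    then have "cyc_next xs i \<noteq> xs ! j" using si j by auto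
    then show ?thesis using 1 ri S(5)[of "exit (cyc_next xs i)" "\<not> exit_half (xs ! j)"] by (simp add: ring_color_def entry_def)
  next
    case 2
    then have "xs ! i \<noteq> xs ! j" "i \<noteq> j" using ei j by auto
    then show ?thesis using 2 si ri S(6)[of "entry (xs ! i)" "exit_half (xs ! j)"] by (simp add: ring_color_def exit_def)
  next
    case 3
    then show ?thesis using si ei ri S(7)[of "entry (xs ! i)" "exit (cyc_next xs i)"] by (simp add: ring_color_def)
  qed
qed

text \<open>A unit of color moves to a smaller index, so the sum of index times color drops by 1.
  When no such move is possible, each color is 0 or preceded by the full color
  \<open>m\<close>.\<close>

lemma sort_ring:
  assumes "annulus m V K p q" "spine V K = V" "annulus.spine_list V K xs"
  shows "\<exists>J. flips m V K J \<and> annulus m V J p q \<and> spine V J = V \<and> annulus.spine_list V J xs \<and>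
    (\<forall>j. 1 \<le> j \<and> j < length xs \<longrightarrow> m \<le> ring_color J xs (j - 1) \<or> ring_color J xs j = 0)"
  using assms
proof (induction "\<Sum>i<length xs. i * ring_color K xs i" arbitrary: K rule: less_induct)
  case less
  show ?case
  proof (cases "\<forall>j. 1 \<le> j \<and> j < length xs \<longrightarrow> m \<le> ring_color K xs (j - 1) \<or> ring_color K xs j = 0")
    case True
    then show ?thesis using less.prems by (auto simp: flips_def)
  next
    case False
    then obtain j where j: "1 \<le> j" "j < length xs" "ring_color K xs (j - 1) < m" "0 < ring_color K xs j" by auto
    let ?J = "flip m V (xs ! j) K"
    note S = slide_ring[OF less.prems j]
    have split: "(\<Sum>i<length xs. i * g i) = (\<Sum>i\<in>{..<length xs} - {j, j - 1}. i * g i) + (j * g j + (j - 1) * g (j - 1))" for g :: "nat \<Rightarrow> nat"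
    proof -
      have "(\<Sum>i<length xs. i * g i) = (\<Sum>i\<in>{..<length xs} - {j, j - 1}. i * g i) + (\<Sum>i\<in>{j, j - 1}. i * g i)"
        using j by (intro sum.subset_diff) auto
      then show ?thesis using j by simp
    qed
    have "(\<Sum>i\<in>{..<length xs} - {j, j - 1}. i * ring_color ?J xs i) = (\<Sum>i\<in>{..<length xs} - {j, j - 1}. i * ring_color K xs i)"
      using S(5) by (intro sum.cong) auto
    moreover have "j * ring_color ?J xs j + (j - 1) * ring_color ?J xs (j - 1) < j * ring_color K xs j + (j - 1) * ring_color K xs (j - 1)"
    proof -
      obtain c where c: "ring_color K xs j = Suc c" using j by (cases "ring_color K xs j") auto
      obtain k where "j = Suc k" using j by (cases j) auto
      then show ?thesis using S(5)[of j] S(5)[of "j - 1"] j c by simp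
    qed
    ultimately have "(\<Sum>i<length xs. i * ring_color ?J xs i) < (\<Sum>i<length xs. i * ring_color K xs i)"
      unfolding split by simp
    then obtain L where "flips m V ?J L" "annulus m V L p q \<and> spine V L = V \<and> annulus.spine_list V L xs \<and>
      (\<forall>j. 1 \<le> j \<and> j < length xs \<longrightarrow> m \<le> ring_color L xs (j - 1) \<or> ring_color L xs j = 0)"
      using less.hyps[OF _ S(1-3)] by blast
    then show ?thesis using flips_trans[OF S(4)] by blast
  qed
qed

text \<open>Before a positive color all colors equal \<open>m\<close>. With \<open>j\<close> the
  last index of positive color, the sum is \<open>m * j + c j\<close> with \<open>0 < c j\<close>
  and \<open>c j \<le> m\<close>; being \<open>m * q\<close>, it forces \<open>q = Suc j\<close> and
  \<open>c j = m\<close>.\<close>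

lemma sorted_colors:
  fixes c :: "nat \<Rightarrow> nat"
  assumes le: "\<And>i. i < n \<Longrightarrow> c i \<le> m" and s: "\<And>j. 1 \<le> j \<Longrightarrow> j < n \<Longrightarrow> m \<le> c (j - 1) \<or> c j = 0"
    and sum: "(\<Sum>i<n. c i) = m * q" and m: "1 \<le> m" and i: "i < n"
  shows "c i = (if i < q then m else 0)"
proof -
  have up: "c k = m" if "k < j" "j < n" "0 < c j" for k j
    using that
  proof (induction "j - k" arbitrary: k)
    case (Suc d)
    have "c (Suc k) \<noteq> 0"
    proof (cases "Suc k = j")
      case False
      then have "c (Suc k) = m" using Suc by (intro Suc.hyps) auto
      then show ?thesis using m by simp
    qed (use Suc in auto)
    then have "m \<le> c k" using s[of "Suc k"] Suc.prems by auto
    then show ?case using le[of k] Suc.prems by simp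
  qed simp
  show ?thesis
  proof (cases "\<exists>j<n. 0 < c j")
    case True
    define j where "j = Max {j. j < n \<and> 0 < c j}"
    have "j \<in> {j. j < n \<and> 0 < c j}" unfolding j_def using True by (intro Max_in) auto
    then have j: "j < n" "0 < c j" by auto
    have z: "c k = 0" if "j < k" "k < n" for k
    proof (rule ccontr)
      assume "c k \<noteq> 0"
      then have "k \<le> j" unfolding j_def using that by (intro Max_ge) auto
      then show False using that by simp
    qed
    have "(\<Sum>i<n. c i) = (\<Sum>i<Suc j. c i)"
      using j z by (intro sum.mono_neutral_right) auto
    also have "\<dots> = m * j + c j" using up[OF _ j] by simp
    finally have e: "m * q = m * j + c j" using sum by simp
    have "m * q \<le> m * Suc j" "m * j < m * q" using e le[OF j(1)] j by auto
    then have "q = Suc j" using m by (simp del: mult_Suc_right)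
    then have "c j = m" using e by simp
    then show ?thesis using up[OF _ j] z i \<open>q = Suc j\<close> by (cases "i < j"; cases "i = j") auto
  next
    case False
    then have "m * q = 0" using sum by simp
    then show ?thesis using False i m by auto
  qed
qed

context annulus
begin

text \<open>For a spine of two arcs both summands can be nonzero, which yields the double
  arrow.\<close>

lemma arr_ring:
  assumes xs: "spine_list xs" and ij: "i < length xs" "j < length xs" "i \<noteq> j"
  shows "arr Q (xs ! i) (xs ! j) c =
    of_bool (j = Suc i mod length xs \<and> ring_color K xs i = c) + of_bool (i = Suc j mod length xs \<and> m - ring_color K xs j = c)"
proof -
  have x: "distinct xs" "set xs = spine V K" using xs by (auto simp: spine_list_def)
  have ce: "central_face V K (face K (entry (xs ! i))) (entry (xs ! i)) (exit (xs ! (Suc i mod length xs)))" if "i < length xs" for i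
    using xs that by (auto simp: spine_list_def cyc_next_def)
  have sp': "xs ! i \<in> spine V K" "xs ! j \<in> spine V K" using x ij nth_mem by metis+
  then have V: "xs ! i \<in> V" "xs ! j \<in> V" "xs ! i \<noteq> xs ! j" using x ij spine_V by (auto simp: nth_eq_iff_index_eq)
  have len: "length xs > 0" using ij by auto
  have ee: "face K (entry (xs ! i)) \<noteq> face K (entry (xs ! j))" using spine_list_faces[OF xs] ij by auto
  have xx: "face K (exit (xs ! i)) \<noteq> face K (exit (xs ! j))"
  proof
    assume eq: "face K (exit (xs ! i)) = face K (exit (xs ! j))"
    obtain e u where c: "central_face V K (face K (exit (xs ! i))) e u"
      by (rule spine_central[of "exit (xs ! i)"]) (use sp' V in simp_all)
    have "exit (xs ! i) = u" "exit (xs ! j) = u"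
      using central_not_in_other[OF c, of "exit (xs ! i)"] central_not_in_other[OF c, of "exit (xs ! j)"]
        central_entry(1)[OF c] entry_neq sp' V eq by (metis entry_simps)+
    then show False using V by (metis entry_simps(2))
  qed
  have ex: "face K (entry (xs ! a)) = face K (exit (xs ! b)) \<longleftrightarrow> b = Suc a mod length xs" if "a < length xs" "b < length xs" for a b
  proof
    assume eq: "face K (entry (xs ! a)) = face K (exit (xs ! b))"
    have sp: "xs ! b \<in> spine V K" using x that nth_mem by metis
    then have b: "xs ! b \<in> V" by (rule spine_V)
    have "exit (xs ! b) = entry (xs ! a) \<or> exit (xs ! b) = exit (xs ! (Suc a mod length xs))"
      using central_not_in_other[OF ce[OF that(1)], of "exit (xs ! b)"] eq b sp by simp
    then have "xs ! b = xs ! (Suc a mod length xs)" using entry_neq by (metis entry_simps(2))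
    then show "b = Suc a mod length xs" using x that len by (simp add: nth_eq_iff_index_eq)
  next
    assume "b = Suc a mod length xs"
    then show "face K (entry (xs ! a)) = face K (exit (xs ! b))" using central_exit_face[OF ce[OF that(1)]] by simp
  qed
  have l: "link K (xs ! i) (xs ! j) c (\<not> exit_half (xs ! i)) (exit_half (xs ! j)) = of_bool (j = Suc i mod length xs \<and> ring_color K xs i = c)"
    using ex[OF ij(1,2)] by (auto simp: link_def ring_color_def entry_def exit_def cyc_next_def)
  have l': "link K (xs ! i) (xs ! j) c (exit_half (xs ! i)) (\<not> exit_half (xs ! j)) = of_bool (i = Suc j mod length xs \<and> m - ring_color K xs j = c)"
  proof (cases "i = Suc j mod length xs")
    case True
    then have "hue K (exit (xs ! i)) (entry (xs ! j)) = m - ring_color K xs j"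
      using ex[OF ij(2,1)] hue_sum[of "exit (xs ! i)" "entry (xs ! j)"] V entry_neq[of "xs ! j" "xs ! i"]
      by (simp add: ring_color_def cyc_next_def)
    then show ?thesis using ex[OF ij(2,1)] True by (simp add: link_def entry_def exit_def)
  next
    case False
    then show ?thesis using ex[OF ij(2,1)] by (auto simp: link_def entry_def exit_def)
  qed
  show ?thesis
    using arr_link[OF V, of K c "\<not> exit_half (xs ! i)" "exit_half (xs ! j)"] l l' ee xx
    by (simp add: link_def entry_def exit_def)
qed

end

lemma reach_ring:
  assumes "annulus m V K p q"
  obtains J xs where "flips m V K J" "annulus m V J p q" "distinct xs" "set xs = V" "length xs = p + q"
    "\<And>i j c. i < p + q \<Longrightarrow> j < p + q \<Longrightarrow> i \<noteq> j \<Longrightarrow> arr (quiv V J) (xs ! i) (xs ! j) c =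
      of_bool (j = Suc i mod (p + q) \<and> (if i < q then m else 0) = c) + of_bool (i = Suc j mod (p + q) \<and> m - (if j < q then m else 0) = c)"
proof -
  obtain L where L: "flips m V K L" "annulus m V L p q" "spine V L = V" using all_spine[OF assms] by blast
  obtain xs where xs: "annulus.spine_list V L xs" using annulus.exists_spine_list[OF L(2)] by blast
  obtain J where "flips m V L J \<and> annulus m V J p q \<and> spine V J = V \<and> annulus.spine_list V J xs \<and>
    (\<forall>j. 1 \<le> j \<and> j < length xs \<longrightarrow> m \<le> ring_color J xs (j - 1) \<or> ring_color J xs j = 0)"
    using sort_ring[OF L(2,3) xs] by (rule exE)
  then have J: "flips m V L J" "annulus m V J p q" "spine V J = V" "annulus.spine_list V J xs"
      "\<And>j. 1 \<le> j \<Longrightarrow> j < length xs \<Longrightarrow> m \<le> ring_color J xs (j - 1) \<or> ring_color J xs j = 0"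
    by simp_all
  interpret annulus m V J p q by fact
  have len: "length xs = p + q" using spine_list_length J by simp
  have x: "distinct xs" "set xs = V" "\<And>i. i < length xs \<Longrightarrow> central_face V J (face J (entry (xs ! i))) (entry (xs ! i)) (exit (cyc_next xs i))"
    using J(3,4) by (auto simp: spine_list_def)
  have "{v \<in> V. side J False v} = {}" using J(3) by (auto simp: side_def spine_def)
  then have "card {v \<in> V. side J False v} = 0" by (simp only: card.empty)
  then have sum: "(\<Sum>i<length xs. ring_color J xs i) = m * q"
    using wt_sum wt_spine_list(1)[OF J(4)] by (simp add: ring_color_def)
  have le: "ring_color J xs i \<le> m" if "i < length xs" for i
    using x(3)[OF that] hue_le[of "entry (xs ! i)" "exit (cyc_next xs i)"] entry_neq unfolding ring_color_def central_face_def by metis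
  have col: "ring_color J xs i = (if i < q then m else 0)" if "i < p + q" for i
    by (rule sorted_colors[of "length xs"]) (use le J(5) sum m_pos that len in auto)
  show ?thesis
  proof
    show "flips m V K J" using flips_trans L(1) J(1) by metis
    fix i j c assume ij: "i < p + q" "j < p + q" "i \<noteq> j"
    then show "arr (quiv V J) (xs ! i) (xs ! j) c =
      of_bool (j = Suc i mod (p + q) \<and> (if i < q then m else 0) = c) + of_bool (i = Suc j mod (p + q) \<and> m - (if j < q then m else 0) = c)"
      using arr_ring[OF J(4), of i j c] len col[of i] col[of j] by simp
  qed (use x len J in auto)
qed

text \<open>The position in \<open>A_tilde m p q\<close> of the \<open>i\<close>-th arc of a cycle whose first \<open>q\<close> colors are \<open>m\<close>.\<close>

definition ring_pos :: "nat \<Rightarrow> nat \<Rightarrow> nat \<Rightarrow> nat" where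
  "ring_pos p q i = (if i < q then p + i + 1 else i - q + 1)"

definition ring_arr :: "nat \<Rightarrow> nat \<Rightarrow> nat \<Rightarrow> nat \<Rightarrow> nat \<Rightarrow> nat \<Rightarrow> nat" where
  "ring_arr m p q i j c = of_bool (j = Suc i mod (p + q) \<and> (if i < q then m else 0) = c) +
     of_bool (i = Suc j mod (p + q) \<and> m - (if j < q then m else 0) = c)"

lemma ring_pos_bij:
  assumes "1 \<le> p" "1 \<le> q"
  shows "bij_betw (ring_pos p q) {..<p + q} {1..p + q}"
  by (rule bij_betw_byWitness[of _ "\<lambda>k. if k \<le> p then k + q - 1 else k - p - 1"])
    (use assms in \<open>auto simp: ring_pos_def\<close>)

lemma A_tilde_arrows_ring:
  assumes "1 \<le> p" "1 \<le> q" "i < p + q" "j < p + q"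
  shows "A_tilde_arrows p q (ring_pos p q i) (ring_pos p q j) =
    of_bool (j = Suc i mod (p + q) \<and> q \<le> i) + of_bool (i = Suc j mod (p + q) \<and> j < q)"
proof -
  have 1: "(1 \<le> ring_pos p q i \<and> ring_pos p q i \<le> p \<and> ring_pos p q j = ring_pos p q i + 1) \<longleftrightarrow> (j = Suc i mod (p + q) \<and> q \<le> i)"
    using assms by (auto simp: ring_pos_def mod_Suc)
  have 2: "(ring_pos p q i = 1 \<and> ring_pos p q j = p + q \<or>
      p + 1 \<le> ring_pos p q j \<and> ring_pos p q j < p + q \<and> ring_pos p q i = ring_pos p q j + 1) \<longleftrightarrow>
      (i = Suc j mod (p + q) \<and> j < q)"
    using assms by (auto simp: ring_pos_def mod_Suc)
  show ?thesis unfolding A_tilde_arrows_def 1 2 by simp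
qed

lemma ring_A_tilde:
  assumes "1 \<le> p" "1 \<le> q" "i < p + q" "j < p + q" "i \<noteq> j" "1 \<le> m"
  shows "ring_arr m p q i j c = arr (A_tilde m p q) (ring_pos p q i) (ring_pos p q j) c"
  unfolding A_tilde_def ring_arr_def
  using assms(5,6) by (simp add: A_tilde_arrows_ring[OF assms(1-4)] A_tilde_arrows_ring[OF assms(1,2,4,3)])

lemma ring_A_tilde_loop:
  assumes "1 \<le> p" "1 \<le> q" "i < p + q"
  shows "arr (A_tilde m p q) (ring_pos p q i) (ring_pos p q i) c = 0"
  unfolding A_tilde_def using assms by (simp add: A_tilde_arrows_ring) (auto simp: mod_Suc)

lemma ring_iso:
  assumes pq: "1 \<le> p" "1 \<le> q" "1 \<le> m" and xs: "distinct xs" "set xs = verts R" "length xs = p + q"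
    and arr: "\<And>i j c. i < p + q \<Longrightarrow> j < p + q \<Longrightarrow> i \<noteq> j \<Longrightarrow> arr R (xs ! i) (xs ! j) c = ring_arr m p q i j c"
    and loop: "\<And>x c. arr R x x c = 0"
  shows "quiver_iso R (A_tilde m p q)"
proof -
  define ix where "ix = inv_into {..<p + q} (\<lambda>i. xs ! i)"
  have b: "bij_betw (\<lambda>i. xs ! i) {..<p + q} (verts R)"
    using bij_betw_nth[OF xs(1), of "{..<p + q}" "verts R"] xs by simp
  then have ix: "bij_betw ix (verts R) {..<p + q}" unfolding ix_def by (rule bij_betw_inv_into)
  have xi: "xs ! ix x = x" "ix x < p + q" if "x \<in> verts R" for x
    using b ix that unfolding ix_def by (auto simp: bij_betw_def f_inv_into_f)
  have "bij_betw (ring_pos p q \<circ> ix) (verts R) (verts (A_tilde m p q))"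
    using bij_betw_trans[OF ix ring_pos_bij[OF pq(1,2)]] by (simp add: A_tilde_def)
  moreover have "arr R x y c = arr (A_tilde m p q) ((ring_pos p q \<circ> ix) x) ((ring_pos p q \<circ> ix) y) c"
    if "x \<in> verts R" "y \<in> verts R" for x y c
  proof (cases "x = y")
    case True
    then show ?thesis using loop ring_A_tilde_loop[OF pq(1,2), of "ix x"] xi that by simp
  next
    case False
    then have "ix x \<noteq> ix y" using xi(1)[OF that(1)] xi(1)[OF that(2)] by auto
    then show ?thesis using arr[of "ix x" "ix y" c] xi that ring_A_tilde[OF pq(1,2) _ _ _ pq(3)] by simp
  qed
  ultimately show ?thesis unfolding quiver_iso_def by blast
qed

section \<open>The configuration of \<open>A_tilde\<close>\<close>

definition prev :: "nat \<Rightarrow> nat \<Rightarrow> nat" where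
  "prev n i = (if i = 0 then n - 1 else i - 1)"

text \<open>The \<open>i\<close>-th arc separates face \<open>i\<close> from its predecessor, and
  face \<open>i\<close> contains just the \<open>True\<close> half of the \<open>i\<close>-th arc
  and the \<open>False\<close> half of the next one. So a hue only depends on the number of the
  face, which is read off the \<open>True\<close> half of the pair.\<close>

definition ring_conf :: "nat \<Rightarrow> nat \<Rightarrow> nat \<Rightarrow> ('a \<Rightarrow> nat) \<Rightarrow> ('a, nat) conf" where
  "ring_conf m p q ix = \<lparr>
     face = (\<lambda>h. if snd h then ix (fst h) else prev (p + q) (ix (fst h))),
     hue = (\<lambda>h h'. if snd h then (if ix (fst h) < q then m else 0) else m - (if ix (fst h') < q then m else 0)),
     lbl = snd\<rparr>"

locale ring =
  fixes m p q :: nat and V :: "'a set" and ix :: "'a \<Rightarrow> nat"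
  assumes pos: "1 \<le> m" "1 \<le> p" "1 \<le> q" and fin: "finite V" and ix: "bij_betw ix V {..<p + q}"
begin

abbreviation "K \<equiv> ring_conf m p q ix"

lemma ix_less: "v \<in> V \<Longrightarrow> ix v < p + q" and ix_inj: "v \<in> V \<Longrightarrow> w \<in> V \<Longrightarrow> ix v = ix w \<Longrightarrow> v = w"
  using ix by (auto simp: bij_betw_def inj_on_def)

lemma ix_surj: "i < p + q \<Longrightarrow> \<exists>v\<in>V. ix v = i"
proof -
  assume "i < p + q"
  then have "i \<in> ix ` V" using ix by (simp add: bij_betw_def)
  then show ?thesis by auto
qed

lemma prev_inj: "i < p + q \<Longrightarrow> j < p + q \<Longrightarrow> prev (p + q) i = prev (p + q) j \<Longrightarrow> i = j"
  by (auto simp: prev_def split: if_splits)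

lemma prev_iff: "i < p + q \<Longrightarrow> j < p + q \<Longrightarrow> j = prev (p + q) i \<longleftrightarrow> i = Suc j mod (p + q)"
  by (auto simp: prev_def mod_Suc)

lemma prev_less: "prev (p + q) i < p + q" if "i < p + q"
  using that by (auto simp: prev_def)

lemma face_K: "face K (v, b) = (if b then ix v else prev (p + q) (ix v))"
  and hue_K: "hue K (v, b) (w, d) = (if b then (if ix v < q then m else 0) else m - (if ix w < q then m else 0))"
  and lbl_K: "lbl K (v, b) = b"
  by (simp_all add: ring_conf_def)

lemma same_face:
  assumes "v \<in> V" "w \<in> V" "face K (v, b) = face K (w, b)"
  shows "v = w"
  using assms ix_inj prev_inj ix_less by (cases b) (auto simp: face_K)

lemma faces_K: "face K ` halves V = {..<p + q}"
proof
  show "face K ` halves V \<subseteq> {..<p + q}"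
    using ix_less prev_less by (auto simp: halves_def face_K)
  show "{..<p + q} \<subseteq> face K ` halves V"
  proof
    fix i assume "i \<in> {..<p + q}"
    then obtain v where "v \<in> V" "ix v = i" using ix_surj by auto
    then show "i \<in> face K ` halves V" by (intro image_eqI[of _ _ "(v, True)"]) (auto simp: face_K)
  qed
qed

lemma central_K:
  assumes i: "i < p + q"
  obtains v w where "v \<in> V" "w \<in> V" "ix v = i" "prev (p + q) (ix w) = i" "central_face V K i (v, True) (w, False)"
proof -
  obtain v where v: "v \<in> V" "ix v = i" using ix_surj i by auto
  have less: "Suc i mod (p + q) < p + q" using i by (intro mod_less_divisor) auto
  then obtain w where w: "w \<in> V" "ix w = Suc i mod (p + q)" using ix_surj by blast
  then have pw: "prev (p + q) (ix w) = i" using prev_iff[of "ix w" i] less i by simp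
  have "h = (v, True) \<or> h = (w, False)" if "h \<in> halves V" "face K h = i" for h
    using that v w pw same_face[of "fst h" v True] same_face[of "fst h" w False]
    by (cases h, rename_tac x b, case_tac b) (auto simp: face_K)
  then have "central_face V K i (v, True) (w, False)"
    unfolding central_face_def using v w pw by (auto simp: face_K lbl_K)
  then show ?thesis using that v w pw by blast
qed

lemma coloring_K: "coloring m V K"
proof unfold_locales
  fix h h' assume h: "h \<in> halves V" "h' \<in> halves V" "face K h = face K h'" "h \<noteq> h'"
  obtain v b w d where vw: "h = (v, b)" "h' = (w, d)" by (cases h; cases h') auto
  then have "d = (\<not> b)" using same_face[of v w b] h by (cases "d = b") auto
  then show "hue K h h' + hue K h' h = m" using vw by (auto simp: hue_K)
next
  fix h h' k assume h: "h \<in> halves V" "h' \<in> halves V" "k \<in> halves V" "face K h = face K h'" "face K h' = face K k"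
    "h \<noteq> h'" "h' \<noteq> k" "k \<noteq> h"
  have ne: "snd x \<noteq> snd y" if "x \<in> halves V" "y \<in> halves V" "face K x = face K y" "x \<noteq> y" for x y
  proof
    assume "snd x = snd y"
    then have "face K (fst x, snd x) = face K (fst y, snd x)" using that(3) \<open>snd x = snd y\<close> by (cases x; cases y) simp
    then have "fst x = fst y" using same_face[of "fst x" "fst y" "snd x"] that by (simp add: halves_fst)
    then show False using that \<open>snd x = snd y\<close> by (simp add: prod_eq_iff)
  qed
  have "face K k = face K h" using h(4,5) by simp
  then have "snd h \<noteq> snd h'" "snd h' \<noteq> snd k" "snd k \<noteq> snd h"
    using ne[OF h(1,2,4,6)] ne[OF h(2,3,5,7)] ne[OF h(3,1) _ h(8)] by auto
  then show "hue K h h' + hue K h' k + hue K k h = m - 1 \<or> hue K h h' + hue K h' k + hue K k h = 2 * m + 1"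
    by (cases "snd h"; cases "snd h'"; cases "snd k") simp_all
qed (use pos fin in auto)

lemma annulus_K: "annulus m V K p q"
proof -
  interpret coloring m V K by (rule coloring_K)
  have wt: "wt V K i = (if i < q then m else 0) \<and> wb V K i = m - (if i < q then m else 0)" if i: "i < p + q" for i
  proof -
    obtain v w where vw: "ix v = i" "central_face V K i (v, True) (w, False)" using central_K[OF i] by metis
    then show ?thesis using wt_central[OF vw(2)] wb_central[OF vw(2)] by (simp add: hue_K)
  qed
  have split: "{..<p + q} = {..<q} \<union> {q..<p + q}" "{..<q} \<inter> {q..<p + q} = {}" by auto
  have S: "(\<Sum>F\<in>face K ` halves V. wt V K F) = m * q"
  proof -
    have "(\<Sum>F<p + q. wt V K F) = (\<Sum>F<p + q. if F < q then m else 0)" using wt by (intro sum.cong) auto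
    also have "\<dots> = (\<Sum>F<q. m)" by (intro sum.mono_neutral_cong_right) auto
    finally show ?thesis by (simp add: faces_K)
  qed
  have B: "(\<Sum>F\<in>face K ` halves V. wb V K F) = m * p"
  proof -
    have "(\<Sum>F<p + q. wb V K F) = (\<Sum>F<p + q. if F < q then 0 else m)" using wt by (intro sum.cong) auto
    also have "\<dots> = (\<Sum>F\<in>{q..<p + q}. m)" by (intro sum.mono_neutral_cong_right) auto
    finally show ?thesis by (simp add: faces_K)
  qed
  have none: "\<not> side K t v" for t v by (auto simp: side_def lbl_K)
  have down: "linked (face K) V 0 i" if "i < p + q" for i
    using that
  proof (induction i)
    case (Suc i)
    obtain v where v: "v \<in> V" "ix v = Suc i" using ix_surj Suc.prems by auto
    have "linked (face K) V (face K (v, False)) (face K (v, True))" using v by (intro linked_edge)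
    then have "linked (face K) V i (Suc i)" using v by (simp add: face_K prev_def)
    then show ?case using Suc by simp
  qed simp
  show ?thesis
  proof unfold_locales
    fix v assume v: "v \<in> V"
    then have "ix v < p + q" by (rule ix_less)
    then have "prev (p + q) (ix v) \<noteq> ix v" using pos by (auto simp: prev_def)
    then show "face K (v, True) \<noteq> face K (v, False)" by (simp add: face_K)
  next
    fix a b assume "a \<in> face K ` halves V" "b \<in> face K ` halves V"
    then show "linked (face K) V a b" using down linked_sym[OF down] by (auto simp: faces_K intro: rtranclp_trans)
  next
    show "card (face K ` halves V) = card V" "card V = p + q" using faces_K bij_betw_same_card[OF ix] by auto
  next
    fix F assume "F \<in> face K ` halves V"
    then show "ok_face V K F" using central_K[of F] unfolding faces_K ok_face_def by blast
  qed (use S B none pos in auto)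
qed

lemma arr_K:
  assumes "v \<in> V" "w \<in> V" "v \<noteq> w"
  shows "arr (quiv V K) v w c = ring_arr m p q (ix v) (ix w) c"
proof -
  have n: "ix v \<noteq> ix w" "prev (p + q) (ix v) \<noteq> prev (p + q) (ix w)"
    using assms ix_inj[of v w] prev_inj[of "ix v" "ix w"] ix_less by auto
  have "link K v w c True False = of_bool (ix w = Suc (ix v) mod (p + q) \<and> (if ix v < q then m else 0) = c)"
    using prev_iff[of "ix w" "ix v"] ix_less assms by (simp add: link_def face_K hue_K)
  moreover have "link K v w c False True = of_bool (ix v = Suc (ix w) mod (p + q) \<and> m - (if ix w < q then m else 0) = c)"
    using prev_iff[of "ix v" "ix w"] ix_less assms by (auto simp: link_def face_K hue_K)
  moreover have "link K v w c True True = 0" "link K v w c False False = 0" using n by (simp_all add: link_def face_K)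
  ultimately show ?thesis using arr_link[OF assms, of K c True True] by (simp add: ring_arr_def)
qed

end

lemma A_tilde_conf:
  assumes pos: "1 \<le> m" "1 \<le> p" "1 \<le> q" and R: "colored_quiver m R" and iso: "quiver_iso R (A_tilde m p q)"
  obtains K :: "('a, nat) conf" where "annulus m (verts R) K p q" "(R :: 'a cquiver) = quiv (verts R) K"
proof -
  obtain f where f: "bij_betw f (verts R) (verts (A_tilde m p q))"
    "\<And>i j c. i \<in> verts R \<Longrightarrow> j \<in> verts R \<Longrightarrow> arr R i j c = arr (A_tilde m p q) (f i) (f j) c"
    using iso unfolding quiver_iso_def by blast
  have f': "bij_betw f (verts R) {1..p + q}" using f(1) by (simp add: A_tilde_def)
  note g = ring_pos_bij[OF pos(2,3)]
  let ?g = "inv_into {..<p + q} (ring_pos p q)"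
  have ix: "bij_betw (?g \<circ> f) (verts R) {..<p + q}"
    by (rule bij_betw_trans[OF f' bij_betw_inv_into[OF g]])
  have fin: "finite (verts R)" using R by (simp add: colored_quiver_def)
  interpret ring m p q "verts R" "?g \<circ> f" using pos fin ix by unfold_locales
  have pos_ix: "ring_pos p q ((?g \<circ> f) v) = f v" if "v \<in> verts R" for v
    using that f' g by (auto simp: bij_betw_def intro!: f_inv_into_f)
  have "arr R v w c = arr (quiv (verts R) K) v w c" for v w c
  proof (cases "v \<in> verts R \<and> w \<in> verts R \<and> v \<noteq> w")
    case True
    then have "(?g \<circ> f) v \<noteq> (?g \<circ> f) w" using ix_inj by blast
    then have "ring_arr m p q ((?g \<circ> f) v) ((?g \<circ> f) w) c = arr (A_tilde m p q) (f v) (f w) c"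
      using ring_A_tilde[OF pos(2,3) ix_less ix_less _ pos(1), of v w c] True pos_ix by simp
    then show ?thesis using True f(2) arr_K by simp
  next
    case False
    then have "arr R v w c = 0" using R unfolding colored_quiver_def by metis
    then show ?thesis using False arr_quiv_0[of v "verts R" w K c] by simp
  qed
  then have "arr R = arr (quiv (verts R) K)" by (intro ext)
  then have "R = quiv (verts R) K" by (intro cquiver.equality) simp_all
  then show ?thesis using that annulus_K by blast
qed

section \<open>The quiver of a configuration lies in the class\<close>

text \<open>The arcs bounding a polygon; they form the cliques of the quiver.\<close>

definition fv :: "'a set \<Rightarrow> ('a, 'f) conf \<Rightarrow> 'f \<Rightarrow> 'a set" where
  "fv V K F = {u \<in> V. \<exists>b. face K (u, b) = F}"

lemma card3_iff: "card {x, y, z} = 3 \<longleftrightarrow> x \<noteq> y \<and> y \<noteq> z \<and> z \<noteq> x"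
  by (auto simp: card_insert_if)

section \<open>Cliques and cycles in terms of polygons\<close>

context annulus
begin

lemma neighbor_iff: "neighbor Q u w \<longleftrightarrow> u \<in> V \<and> w \<in> V \<and> u \<noteq> w \<and> (\<exists>a b. face K (u, a) = face K (w, b))"
proof (cases "u \<in> V \<and> w \<in> V \<and> u \<noteq> w")
  case True
  have "(\<exists>c. arr Q u w c \<noteq> 0) \<longleftrightarrow> (\<exists>a b. face K (u, a) = face K (w, b))"
  proof
    assume "\<exists>c. arr Q u w c \<noteq> 0"
    then show "\<exists>a b. face K (u, a) = face K (w, b)" using unlinked[of u w] by (metis single_zero)
  qed (use True link_pos[of u w] in blast)
  then show ?thesis using True by (simp add: neighbor_def)
next
  case False
  then show ?thesis using arr_quiv_0[of u V w K] by (auto simp: neighbor_def)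
qed

lemma neighbor_sym: "neighbor Q u w \<Longrightarrow> neighbor Q w u"
  by (auto simp: neighbor_iff) metis

lemma color_link:
  assumes "u \<in> V" "w \<in> V" "u \<noteq> w" "face K (u, a) = face K (w, b)"
  shows "color Q u w = hue K (u, a) (w, b)"
  unfolding color_def using link_pos[OF assms] arr_unique[of u w] by (intro the_equality) auto

lemma mult_0: "(\<And>a b. face K (u, a) \<noteq> face K (w, b)) \<Longrightarrow> mult m Q u w = 0"
  by (simp add: mult_def unlinked single_def)

lemma mult_link:
  assumes uw: "u \<in> V" "w \<in> V" "u \<noteq> w" "face K (u, a) = face K (w, b)"
  shows "mult m Q u w = 1 + of_bool (face K (u, \<not> a) = face K (w, \<not> b))"
    and "arr Q u w = single (mult m Q u w) (hue K (u, a) (w, b))"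
proof -
  let ?h = "hue K (u, a) (w, b)"
  obtain n where n: "arr Q u w = single n ?h" using arr_link_single[OF uw] .
  have hm: "?h \<le> m" using link_hue_le[OF uw] .
  have m: "mult m Q u w = n" using hm by (simp add: mult_def n single_def)
  then show "arr Q u w = single (mult m Q u w) ?h" using n by simp
  have ne: "face K (u, a) \<noteq> face K (w, \<not> b)" "face K (u, \<not> a) \<noteq> face K (w, b)"
    using no_loop'[of w b] no_loop'[of u a] uw by auto
  have "n = arr Q u w ?h" by (simp add: n single_def)
  also have "\<dots> = 1 + of_bool (face K (u, \<not> a) = face K (w, \<not> b) \<and> hue K (u, \<not> a) (w, \<not> b) = ?h)"
    using arr_link[OF uw(1-3), of K ?h a b] ne uw(4) by (simp add: link_def)
  finally show "mult m Q u w = 1 + of_bool (face K (u, \<not> a) = face K (w, \<not> b))"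
    using m two_faces_hue[of w u b a] uw by auto
qed

lemma mult_le: "u \<in> V \<Longrightarrow> w \<in> V \<Longrightarrow> u \<noteq> w \<Longrightarrow> {u, w} \<noteq> spine V K \<Longrightarrow> mult m Q u w \<le> 1"
  using mult_link(1)[of u w] mult_0[of u w] two_faces[of u w] by (cases "\<exists>a b. face K (u, a) = face K (w, b)") fastforce+

lemma mult_2: "u \<in> V \<Longrightarrow> w \<in> V \<Longrightarrow> u \<noteq> w \<Longrightarrow> mult m Q u w = 2 \<Longrightarrow> spine V K = {u, w}"
  using mult_le[of u w] by auto

lemma mult_pos: "u \<in> V \<Longrightarrow> w \<in> V \<Longrightarrow> u \<noteq> w \<Longrightarrow> mult m Q u w \<noteq> 0 \<Longrightarrow> neighbor Q u w"
  using mult_0[of u w] neighbor_iff by auto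

lemma fv_I: "u \<in> V \<Longrightarrow> u \<in> fv V K (face K (u, b))"
  by (auto simp: fv_def)

lemma finite_fv: "finite (fv V K F)"
  using finite_V by (simp add: fv_def)

lemma clique_fv: "clique Q (fv V K F)"
  unfolding clique_def by (auto simp: fv_def neighbor_iff) metis

text \<open>The halves in a polygon occupy distinct positions among
  \<open>0, \<dots>, m + 1\<close>.\<close>

lemma card_fv: "card (fv V K F) \<le> m + 2"
proof (cases "fv V K F = {}")
  case False
  then obtain u b where u: "u \<in> V" "face K (u, b) = F" by (auto simp: fv_def)
  let ?H = "{h \<in> halves V. face K h = F}"
  have inj: "inj_on (place (u, b)) ?H"
    using place_props(1)[of "(u, b)"] u by (intro inj_onI) (metis (mono_tags, lifting) in_halves(1) mem_Collect_eq)
  have "place (u, b) h \<le> m + 1" if h: "h \<in> ?H" for h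
    using hue_sum[of "(u, b)" h] u h by (cases "h = (u, b)") (auto simp: place_def)
  then have "place (u, b) ` ?H \<subseteq> {..m + 1}" by auto
  then have "card ?H \<le> card {..m + 1}" using card_inj_on_le[OF inj] by blast
  moreover have "fv V K F = fst ` ?H" unfolding fv_def by force
  moreover have "finite ?H" using finite_V by (simp add: halves_def)
  ultimately show ?thesis using card_image_le[of ?H fst] by simp
qed simp

lemma clique_pair: "x \<in> fv V K F \<Longrightarrow> y \<in> fv V K F \<Longrightarrow> x \<noteq> y \<Longrightarrow> neighbor Q x y"
  using clique_fv by (auto simp: clique_def)

lemma neighbors_fv: "v \<in> V \<Longrightarrow> fv V K (face K (v, b)) \<union> fv V K (face K (v, \<not> b)) = insert v (neighbors Q v)"
proof
  assume v: "v \<in> V"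
  show "fv V K (face K (v, b)) \<union> fv V K (face K (v, \<not> b)) \<subseteq> insert v (neighbors Q v)"
    using v by (auto simp: fv_def neighbors_def neighbor_iff) metis+
  show "insert v (neighbors Q v) \<subseteq> fv V K (face K (v, b)) \<union> fv V K (face K (v, \<not> b))"
  proof
    fix u assume u: "u \<in> insert v (neighbors Q v)"
    show "u \<in> fv V K (face K (v, b)) \<union> fv V K (face K (v, \<not> b))"
    proof (cases "u = v")
      case False
      then obtain a c where "u \<in> V" "face K (v, a) = face K (u, c)" using u by (auto simp: neighbors_def neighbor_iff)
      then show ?thesis by (cases "a = b") (auto simp: fv_def)
    qed (use v in \<open>auto simp: fv_def\<close>)
  qed
qed

lemma both_faces:
  assumes "v \<in> V" "u \<in> fv V K (face K (v, b))" "u \<in> fv V K (face K (v, \<not> b))" "u \<noteq> v"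
  shows "spine V K = {u, v}"
proof -
  obtain a c where ac: "u \<in> V" "face K (u, a) = face K (v, b)" "face K (u, c) = face K (v, \<not> b)" using assms by (auto simp: fv_def)
  then have "c = (\<not> a)" using no_loop'[OF assms(1), of b] by (cases "c = a") auto
  then show ?thesis using two_faces[of u v a b] ac assms by auto
qed

text \<open>Neighbors \<open>u\<close> and \<open>w\<close> on different sides of \<open>v\<close>
  share a third polygon, so that the three arcs form a closed trail.\<close>

lemma opposite_faces:
  assumes "v \<in> V" "u \<in> fv V K (face K (v, b))" "w \<in> fv V K (face K (v, \<not> b))" "u \<noteq> v" "w \<noteq> v" "neighbor Q u w"
    and ne: "spine V K \<noteq> {u, v}" "spine V K \<noteq> {w, v}"
  shows "spine V K = {u, v, w} \<and> card {u, v, w} = 3"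
proof -
  obtain a where a: "u \<in> V" "face K (u, a) = face K (v, b)" using assms by (auto simp: fv_def)
  obtain c where c: "w \<in> V" "face K (w, c) = face K (v, \<not> b)" using assms by (auto simp: fv_def)
  obtain a' c' where n: "u \<noteq> w" "face K (u, a') = face K (w, c')" using assms(6) by (auto simp: neighbor_iff)
  have "a' \<noteq> a"
  proof
    assume "a' = a"
    then have "w \<in> fv V K (face K (v, b))" using n a c by (auto simp: fv_def)
    then show False using both_faces[of v w b] assms by auto
  qed
  moreover have "c' \<noteq> c"
  proof
    assume "c' = c"
    then have "u \<in> fv V K (face K (v, \<not> b))" using n a c by (auto simp: fv_def)
    then show False using both_faces[of v u b] assms by auto
  qed
  ultimately have e: "a' = (\<not> a)" "c' = (\<not> c)" by auto
  have "card {u, v, w} = 3" using n assms by (auto simp: card3_iff)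
  moreover have "spine V K = {v, w, u}"
    by (rule triangle_faces[of v w u b c a']) (use assms n a c e in \<open>auto simp: card3_iff\<close>)
  ultimately show ?thesis by auto
qed

lemma card_faces_vertex:
  assumes "v \<in> V"
  shows "card (fv V K (face K (v, b))) + card (fv V K (face K (v, \<not> b))) =
    card (neighbors Q v) + 1 + card (fv V K (face K (v, b)) \<inter> fv V K (face K (v, \<not> b)))"
proof -
  have "card (insert v (neighbors Q v)) = card (neighbors Q v) + 1"
    using finite_V by (subst card_insert_disjoint) (auto simp: neighbors_def neighbor_iff)
  then show ?thesis
    using card_Un_Int[OF finite_fv finite_fv, of "face K (v, b)" "face K (v, \<not> b)"] neighbors_fv[OF assms, of b] by simp
qed

text \<open>The two polygons at \<open>v\<close> serve as cliques. They meet in a second arc only if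
  that arc and \<open>v\<close> form the whole spine, which is exactly the case of two central
  vertices.\<close>

lemma vertex_cliques_fv:
  assumes v: "v \<in> V" and S: "S = spine V K" "2 \<le> card S"
  shows "vertex_cliques m Q S v (fv V K (face K (v, b))) (fv V K (face K (v, \<not> b)))"
proof -
  let ?C = "fv V K (face K (v, b))" and ?B = "fv V K (face K (v, \<not> b))"
  have v_in: "v \<in> ?C" "v \<in> ?B" using fv_I[OF v] by auto
  have pos: "1 \<le> card ?C" "1 \<le> card ?B" using v_in finite_fv by (auto simp: Suc_le_eq card_gt_0_iff)
  have cap: "?C \<inter> ?B = (if card S \<ge> 3 \<or> v \<notin> S then {v} else S)"
  proof (cases "card S \<ge> 3 \<or> v \<notin> S")
    case True
    have "spine V K \<noteq> {u, v}" if "u \<noteq> v" for u using True S that by auto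
    then show ?thesis using True v_in both_faces[OF v, of _ b] by auto
  next
    case False
    then obtain u where u: "S = {u, v}" "u \<noteq> v" using S by (metis card_2_iff insert_absorb2 insert_commute insert_iff le_antisym not_less_eq_eq numeral_2_eq_2 numeral_3_eq_3 singletonD)
    have "v \<in> spine V K" "u \<in> spine V K" using u S by auto
    have "u \<in> fv V K (face K (v, c))" for c
    proof -
      obtain e x where c: "central_face V K (face K (v, c)) e x" "(v, c) = e \<or> (v, c) = x"
        by (rule spine_central[of "(v, c)"]) (use v \<open>v \<in> spine V K\<close> in auto)
      have f: "fst e \<in> {u, v}" "fst x \<in> {u, v}" using central_in_spine[OF c(1)] S u by auto
      have h: "e \<in> halves V" "x \<in> halves V" "face K e = face K (v, c)" "face K x = face K (v, c)" "e \<noteq> x"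
        using c(1) unfolding central_face_def by auto
      have nv: "h = (v, c)" if "fst h = v" "face K h = face K (v, c)" for h
        using that no_loop'[OF v, of c] by (cases h, rename_tac a d, case_tac "d = c") auto
      have "\<not> (fst e = v \<and> fst x = v)" using nv[of e] nv[of x] h by metis
      then have "fst e = u \<or> fst x = u" using f by blast
      moreover have "fst h \<in> fv V K (face K (v, c))" if "h \<in> halves V" "face K h = face K (v, c)" for h
        using that fv_I[of "fst h" "snd h"] by (simp add: halves_fst)
      ultimately show ?thesis using h by metis
    qed
    then have "u \<in> ?C \<inter> ?B" by auto
    moreover have "w = u" if w: "w \<in> ?C \<inter> ?B" "w \<noteq> v" for w
    proof -
      have "{u, v} = {w, v}" using both_faces[OF v, of w b] w u(1) S(1) by simp
      then show ?thesis using w(2) u(2) by blast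
    qed
    ultimately have "?C \<inter> ?B = {u, v}" using v_in by blast
    then show ?thesis using False u(1) by simp
  qed
  have opp: "card S = 3 \<and> {u, v, w} = S"
    if "u \<in> ?C - {v}" "w \<in> ?B - {v}" "neighbor Q u w" "spine V K \<noteq> {u, v}" "spine V K \<noteq> {w, v}" for u w
    using opposite_faces[OF v, of u b w] that S by auto
  have "if card S \<ge> 3 \<or> v \<notin> S
      then ?C \<inter> ?B = {v} \<and> card (neighbors Q v) + 2 = card ?C + card ?B \<and>
           (\<forall>u\<in>?C - {v}. \<forall>w\<in>?B - {v}. neighbor Q u w \<longrightarrow> card S = 3 \<and> {u, v, w} = S)
      else ?C \<inter> ?B = S \<and> card (neighbors Q v) + 3 = card ?C + card ?B \<and>
           (\<forall>u\<in>?C - S. \<forall>w\<in>?B - S. \<not> neighbor Q u w)"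
  proof (cases "card S \<ge> 3 \<or> v \<notin> S")
    case True
    have "spine V K \<noteq> {u, v}" if "u \<noteq> v" for u using True S that by auto
    then show ?thesis using True cap card_faces_vertex[OF v, of b] opp by auto
  next
    case False
    then have c2: "card S = 2" using S by simp
    have "\<not> neighbor Q u w" if "u \<in> ?C - S" "w \<in> ?B - S" for u w
    proof
      assume "neighbor Q u w"
      moreover have "u \<noteq> v" "w \<noteq> v" "spine V K \<noteq> {u, v}" "spine V K \<noteq> {w, v}" using that False S by auto
      ultimately show False using opp[of u w] that c2 by auto
    qed
    then show ?thesis using False cap card_faces_vertex[OF v, of b] c2 by simp
  qed
  then show ?thesis
    using pos card_fv clique_fv v_in neighbors_fv[OF v, of b] unfolding vertex_cliques_def by blast
qed

text \<open>Each pair shares a polygon. If some arc uses the same half for both of its neighbors,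
  all three lie in one polygon; otherwise the arcs form a closed trail.\<close>

lemma triangle_cases:
  assumes "x \<in> V" "y \<in> V" "z \<in> V" "neighbor Q x y" "neighbor Q y z" "neighbor Q z x"
  obtains F a b c where "face K (x, a) = F" "face K (y, b) = F" "face K (z, c) = F" | "spine V K = {x, y, z}"
proof -
  obtain a b where ab: "face K (x, a) = face K (y, b)" using assms by (auto simp: neighbor_iff)
  obtain b' c where bc: "face K (y, b') = face K (z, c)" using assms by (auto simp: neighbor_iff)
  obtain c' a' where ca: "face K (z, c') = face K (x, a')" using assms by (auto simp: neighbor_iff)
  have d: "card {x, y, z} = 3" using assms by (auto simp: neighbor_iff card3_iff)
  consider "b' = b" | "c' = c" | "a' = a" | "b' = (\<not> b)" "c' = (\<not> c)" "a' = (\<not> a)" by auto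
  then show ?thesis
  proof cases
    case 4
    then have "spine V K = {x, y, z}" using triangle_faces[of x y z "\<not> a" b c] assms d ab bc ca by auto
    then show ?thesis by (rule that(2))
  next
    case 1
    show ?thesis by (rule that(1)[of a "face K (y, b)" b c]) (use 1 ab bc in auto)
  next
    case 2
    show ?thesis by (rule that(1)[of a' "face K (z, c)" b' c]) (use 2 ca bc in auto)
  next
    case 3
    show ?thesis by (rule that(1)[of a "face K (x, a)" b c']) (use 3 ca ab in auto)
  qed
qed

lemma triangle_face_color:
  assumes "card {x, y, z} = 3" "x \<in> V" "y \<in> V" "z \<in> V" "face K (x, a) = F" "face K (y, b) = F" "face K (z, c) = F"
  shows "triangle_color Q x y z = hue K (x, a) (y, b) + hue K (y, b) (z, c) + hue K (z, c) (x, a)"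
    and "admissible m Q x y z"
proof -
  have d: "x \<noteq> y" "y \<noteq> z" "z \<noteq> x" using assms(1) by (auto simp: card3_iff)
  show t: "triangle_color Q x y z = hue K (x, a) (y, b) + hue K (y, b) (z, c) + hue K (z, c) (x, a)"
    unfolding triangle_color_def using color_link[of x y a b] color_link[of y z b c] color_link[of z x c a] assms d by simp
  show "admissible m Q x y z"
    unfolding admissible_def t using hue_tri[of "(x, a)" "(y, b)" "(z, c)"] assms d by auto
qed

text \<open>If every arc of the cycle uses different halves towards its two neighbors, the cycle is
  a closed trail and hence the spine. Otherwise two neighbors of some arc lie in a common polygon
  and are adjacent, which is possible in an induced cycle only for length 3.\<close>

lemma induced_cycle_cases:
  assumes ys: "induces_cycle m Q ys"
  obtains "set ys = spine V K" | F a b c where "length ys = 3" "face K (ys ! 0, a) = F" "face K (ys ! 1, b) = F" "face K (ys ! 2, c) = F"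
proof -
  let ?k = "length ys"
  have k: "3 \<le> ?k" "distinct ys" "set ys \<subseteq> V" and mu: "\<And>i j. i < ?k \<Longrightarrow> j < ?k \<Longrightarrow>
      mult m Q (ys ! i) (ys ! j) = (if j = Suc i mod ?k \<or> i = Suc j mod ?k then 1 else 0)"
    using ys by (auto simp: induces_cycle_def)
  have V: "ys ! i \<in> V" if "i < ?k" for i using k that by auto
  have nb: "neighbor Q (ys ! i) (ys ! (Suc i mod ?k))" if i: "i < ?k" for i
  proof (rule mult_pos)
    have s: "Suc i mod ?k < ?k" using i by (intro mod_less_divisor) auto
    then show "ys ! i \<in> V" "ys ! (Suc i mod ?k) \<in> V" using V i by auto
    have "i \<noteq> Suc i mod ?k" using k i by (auto simp: mod_Suc)
    then show "ys ! i \<noteq> ys ! (Suc i mod ?k)" using s i k by (simp add: nth_eq_iff_index_eq)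
    show "mult m Q (ys ! i) (ys ! (Suc i mod ?k)) \<noteq> 0" using mu[OF i s] by simp
  qed
  have "\<forall>i. \<exists>a b. i < ?k \<longrightarrow> face K (ys ! i, a) = face K (ys ! (Suc i mod ?k), b)"
    using nb by (auto simp: neighbor_iff)
  then obtain A B where AB: "\<And>i. i < ?k \<Longrightarrow> face K (ys ! i, A i) = face K (ys ! (Suc i mod ?k), B i)" by metis
  define p where "p i = (if i = 0 then ?k - 1 else i - 1)" for i
  have p: "p i < ?k" "Suc (p i) mod ?k = i" if "i < ?k" for i using that k by (auto simp: p_def)
  show ?thesis
  proof (cases "\<exists>i<?k. A i = B (p i)")
    case True
    then obtain i where i: "i < ?k" "A i = B (p i)" by auto
    let ?j = "Suc i mod ?k"
    have j: "?j < ?k" using i by (intro mod_less_divisor) auto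
    have f: "face K (ys ! p i, A (p i)) = face K (ys ! i, A i)" "face K (ys ! ?j, B i) = face K (ys ! i, A i)"
      using AB[OF p(1)[OF i(1)]] AB[OF i(1)] p(2)[OF i(1)] i by auto
    have pj: "p i \<noteq> ?j" "p i \<noteq> i" "?j \<noteq> i" using i k by (auto simp: p_def mod_Suc split: if_splits)
    then have "ys ! p i \<noteq> ys ! ?j" using p(1)[OF i(1)] j k by (simp add: nth_eq_iff_index_eq)
    then have "mult m Q (ys ! p i) (ys ! ?j) \<noteq> 0"
      using mult_link(1)[of "ys ! p i" "ys ! ?j" "A (p i)" "B i"] V p(1)[OF i(1)] j f by simp
    then have "?j = Suc (p i) mod ?k \<or> p i = Suc ?j mod ?k" using mu[OF p(1)[OF i(1)] j] by (auto split: if_splits)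
    then have "p i = Suc ?j mod ?k" using p(2)[OF i(1)] pj by simp
    then have k3: "?k = 3" using i k by (auto simp: p_def mod_Suc split: if_splits)
    have all: "\<exists>a. face K (ys ! n, a) = face K (ys ! i, A i)" if "n < 3" for n
    proof -
      have "n = i \<or> n = ?j \<or> n = p i" using that i k3 by (auto simp: p_def mod_Suc split: if_splits)
      then show ?thesis using f by auto
    qed
    obtain a where a: "face K (ys ! 0, a) = face K (ys ! i, A i)" using all[of 0] by auto
    obtain b where b: "face K (ys ! 1, b) = face K (ys ! i, A i)" using all[of 1] by auto
    obtain c where c: "face K (ys ! 2, c) = face K (ys ! i, A i)" using all[of 2] by auto
    show ?thesis using that(2)[OF k3 a b c] .
  next
    case False
    have "set ys = spine V K"
    proof (rule trail_spine[of ys "\<lambda>i. B (p i)"])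
      fix i assume i: "i < ?k"
      have j: "Suc i mod ?k < ?k" using i by (intro mod_less_divisor) auto
      have "p (Suc i mod ?k) = i" using i by (auto simp: p_def mod_Suc)
      moreover have "A i = (\<not> B (p i))" using False i by auto
      ultimately show "face K (ys ! i, \<not> B (p i)) = face K (ys ! (Suc i mod ?k), B (p (Suc i mod ?k)))"
        using AB[OF i] by simp
    qed (use k in auto)
    then show ?thesis by (rule that(1))
  qed
qed

text \<open>This gives uniqueness of the set of central vertices: a triangle inside one polygon has
  color sum \<open>m - 1\<close> or \<open>2 * m + 1\<close>, and neither equals \<open>m\<close> or
  \<open>2 * m\<close>.\<close>

lemma central_cycle_spine:
  assumes "central_cycle m Q ys h"
  shows "set ys = spine V K"
proof (cases "length ys = 2")
  case True
  then have "distinct ys" "set ys \<subseteq> V" "mult m Q (ys ! 0) (ys ! 1) = 2" using assms by (auto simp: central_cycle_def)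
  moreover obtain x y where "ys = [x, y]" using True by (metis (no_types, opaque_lifting) One_nat_def Suc_1 length_0_conv length_Suc_conv)
  ultimately show ?thesis using mult_2[of x y] by auto
next
  case False
  then have ys: "induces_cycle m Q ys" and ce: "central m Q ys h" using assms by (auto simp: central_cycle_def)
  show ?thesis
  proof (cases rule: induced_cycle_cases[OF ys])
    case (2 F a b c)
    have d: "distinct ys" "set ys \<subseteq> V" using ys by (auto simp: induces_cycle_def)
    obtain x y z where ysx: "ys = [x, y, z]" using 2(1) by (auto simp: length_Suc_conv numeral_3_eq_3)
    have "admissible m Q x y z"
      using triangle_face_color(2)[of x y z a F b c] 2 d ysx by (auto simp: card3_iff)
    moreover have "(\<Sum>i<length ys. color Q (ys ! i) (cyc_next ys i)) = triangle_color Q x y z"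
    proof -
      have "{..<length ys} = {0, 1, 2}" using ysx by auto
      then show ?thesis using ysx by (simp add: cyc_next_def triangle_color_def)
    qed
    ultimately have "h * m = m - 1 \<or> h * m = 2 * m + 1" and h: "0 < h" "h < 3"
      using ce 2(1) by (auto simp: central_def admissible_def)
    have False
    proof (cases "h = 1")
      case True
      then show False using \<open>h * m = m - 1 \<or> h * m = 2 * m + 1\<close> m_pos by simp
    next
      case False
      then have "h = 2" using h by linarith
      then have "2 * m = m - 1 \<or> 2 * m = 2 * m + 1" using \<open>h * m = m - 1 \<or> h * m = 2 * m + 1\<close> by simp
      then show False using m_pos by linarith
    qed
    then show ?thesis ..
  qed
qed

end

section \<open>The central cycle and its boundary cliques\<close>

context annulus
begin

lemma spine_faces_of:
  assumes xs: "spine_list xs" and i: "i < length xs"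
  shows "h \<in> halves V \<Longrightarrow> face K h = face K (entry (xs ! i)) \<Longrightarrow> fst h \<in> spine V K \<Longrightarrow>
      h = entry (xs ! i) \<or> h = exit (cyc_next xs i)"
    and "face K (exit (cyc_next xs i)) = face K (entry (xs ! i))"
    and "xs ! i \<in> spine V K" "cyc_next xs i \<in> spine V K" "xs ! i \<noteq> cyc_next xs i"
proof -
  have c: "central_face V K (face K (entry (xs ! i))) (entry (xs ! i)) (exit (cyc_next xs i))"
    using xs i by (simp add: spine_list_def)
  show "h \<in> halves V \<Longrightarrow> face K h = face K (entry (xs ! i)) \<Longrightarrow> fst h \<in> spine V K \<Longrightarrow>
      h = entry (xs ! i) \<or> h = exit (cyc_next xs i)" by (rule central_not_in_other[OF c])
  show f: "face K (exit (cyc_next xs i)) = face K (entry (xs ! i))" using central_exit_face[OF c] by simp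
  show s: "xs ! i \<in> spine V K" "cyc_next xs i \<in> spine V K" using central_entry(3,4)[OF c] by simp_all
  show "xs ! i \<noteq> cyc_next xs i"
  proof
    assume eq: "xs ! i = cyc_next xs i"
    have "face K (xs ! i, exit_half (xs ! i)) = face K (xs ! i, \<not> exit_half (xs ! i))"
      using f eq by (simp add: entry_def exit_def)
    then show False using no_loop'[OF spine_V[OF s(1)]] by metis
  qed
qed

definition disc :: "'a list \<Rightarrow> nat \<Rightarrow> 'a set" where
  "disc xs i = fv V K (face K (entry (xs ! i)))"

lemma disc_ends:
  assumes "spine_list xs" "i < length xs"
  shows "xs ! i \<in> disc xs i" "cyc_next xs i \<in> disc xs i"
  using spine_faces_of(2-4)[OF assms] spine_V
  by (auto simp: disc_def fv_def entry_def exit_def)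

lemma disc_spine:
  assumes "spine_list xs" "i < length xs" "w \<in> disc xs i" "w \<in> spine V K"
  shows "w = xs ! i \<or> w = cyc_next xs i"
proof -
  obtain b where b: "w \<in> V" "face K (w, b) = face K (entry (xs ! i))" using assms by (auto simp: disc_def fv_def)
  then have "(w, b) = entry (xs ! i) \<or> (w, b) = exit (cyc_next xs i)"
    using spine_faces_of(1)[OF assms(1,2), of "(w, b)"] assms(4) by simp
  then show ?thesis by (metis entry_simps(1,2) fst_conv)
qed

lemma neighbor_next:
  assumes "spine_list xs" "i < length xs"
  shows "neighbor Q (xs ! i) (cyc_next xs i)"
  by (rule clique_pair[of _ "face K (entry (xs ! i))"])
    (use disc_ends[OF assms] spine_faces_of(5)[OF assms] in \<open>auto simp: disc_def\<close>)

lemma spine_card: "spine_list xs \<Longrightarrow> card (spine V K) = length xs"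
  unfolding spine_list_def by (metis distinct_card)

lemma spine_cycle_sum:
  assumes xs: "spine_list xs"
  shows "(\<Sum>i<length xs. color Q (xs ! i) (cyc_next xs i)) = (\<Sum>F\<in>face K ` halves V. wt V K F)"
    and "m * length xs = (\<Sum>F\<in>face K ` halves V. wt V K F) + (\<Sum>F\<in>face K ` halves V. wb V K F)"
proof -
  have "color Q (xs ! i) (cyc_next xs i) = hue K (entry (xs ! i)) (exit (cyc_next xs i)) \<and>
      hue K (entry (xs ! i)) (exit (cyc_next xs i)) + hue K (exit (cyc_next xs i)) (entry (xs ! i)) = m"
    if i: "i < length xs" for i
    using color_link[of "xs ! i" "cyc_next xs i" "\<not> exit_half (xs ! i)" "exit_half (cyc_next xs i)"]
      hue_sum[of "entry (xs ! i)" "exit (cyc_next xs i)"] spine_faces_of(2-5)[OF xs i] spine_V entry_neq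
    by (simp add: entry_def exit_def)
  then show "(\<Sum>i<length xs. color Q (xs ! i) (cyc_next xs i)) = (\<Sum>F\<in>face K ` halves V. wt V K F)"
    and "m * length xs = (\<Sum>F\<in>face K ` halves V. wt V K F) + (\<Sum>F\<in>face K ` halves V. wb V K F)"
    unfolding wt_spine_list[OF xs] sum.distrib[symmetric] by simp_all
qed

definition nQ :: nat where "nQ = card {v \<in> V. side K False v}"
definition nP :: nat where "nP = card {v \<in> V. side K True v}"

text \<open>Dividing \<open>wt_sum\<close> by \<open>m\<close> identifies the color sum of the
  central cycle as \<open>h * m\<close> with \<open>h = q - nQ\<close>. The formula for
  \<open>p\<close> then follows by counting the arcs: those of the spine and those on either
  side.\<close>

lemma counts:
  assumes xs: "spine_list xs"
  shows "(\<Sum>F\<in>face K ` halves V. wt V K F) = (q - nQ) * m" "0 < q - nQ" "q - nQ < length xs"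
    "p = length xs - (q - nQ) + nP" "q = (q - nQ) + nQ"
proof -
  let ?S = "\<Sum>F\<in>face K ` halves V. wt V K F"
  have S: "?S = m * (q - nQ)" using wt_sum unfolding nQ_def diff_mult_distrib2 by simp
  then show "?S = (q - nQ) * m" by simp
  show h: "0 < q - nQ" using wt_pos S by (cases "q - nQ") auto
  then show "q = (q - nQ) + nQ" by simp
  have "m * length xs = ?S + (\<Sum>F\<in>face K ` halves V. wb V K F)" by (rule spine_cycle_sum(2)[OF xs])
  then have "m * (q - nQ) < m * length xs" using S wb_pos by simp
  then show l: "q - nQ < length xs" by simp
  have "V = spine V K \<union> {v \<in> V. side K True v} \<union> {v \<in> V. side K False v}"
    by (auto simp: spine_def side_def)
  then have "card V = card (spine V K \<union> {v \<in> V. side K True v} \<union> {v \<in> V. side K False v})" by simp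
  also have "\<dots> = card (spine V K) + nP + nQ"
    unfolding nP_def nQ_def using finite_V
    by (subst card_Un_disjoint, auto simp: spine_def side_def)+
  finally have "p + q = length xs + nP + nQ" using card_V spine_card[OF xs] by simp
  then show "p = length xs - (q - nQ) + nP" using h l by linarith
qed

lemma mult_spine:
  assumes xs: "spine_list xs" and ij: "i < length xs" "j < length xs" "i \<noteq> j"
  shows "mult m Q (xs ! i) (xs ! j) = of_bool (j = Suc i mod length xs) + of_bool (i = Suc j mod length xs)"
proof -
  have le: "ring_color K xs i \<le> m" if "i < length xs" for i
    using hue_le[of "entry (xs ! i)" "exit (cyc_next xs i)"] spine_faces_of(2-4)[OF xs that] spine_V entry_neq
    by (simp add: ring_color_def)
  have one: "(\<Sum>c\<le>m. of_bool (P \<and> a = c)) = (of_bool P :: nat)" if "a \<le> m" for a P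
    using that by (cases P) (simp_all add: of_bool_def)
  show ?thesis
    unfolding mult_def arr_ring[OF xs ij] sum.distrib using one le ij by simp
qed

lemma mult_same: "mult m Q x x = 0"
  by (simp add: mult_def arr_quiv_0)

lemma induces_cycle_spine:
  assumes xs: "spine_list xs" and l: "3 \<le> length xs"
  shows "induces_cycle m Q xs"
  unfolding induces_cycle_def
proof (intro conjI allI impI)
  show "distinct xs" "set xs \<subseteq> verts Q" using xs spine_V by (auto simp: spine_list_def)
  fix i j assume ij: "i < length xs" "j < length xs"
  show "mult m Q (xs ! i) (xs ! j) = (if j = Suc i mod length xs \<or> i = Suc j mod length xs then 1 else 0)"
  proof (cases "i = j")
    case True
    have "j \<noteq> Suc j mod length xs" using ij l by (auto simp: mod_Suc)
    then show ?thesis using True by (simp add: mult_same)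
  next
    case False
    have "\<not> (j = Suc i mod length xs \<and> i = Suc j mod length xs)" using ij l by (auto simp: mod_Suc split: if_splits)
    then show ?thesis using mult_spine[OF xs ij False] by auto
  qed
qed (rule l)

lemma central_cycle_xs:
  assumes xs: "spine_list xs"
  shows "central_cycle m Q xs (q - nQ)"
proof -
  have l2: "2 \<le> length xs" and d: "distinct xs" "set xs \<subseteq> V" using xs spine_V by (auto simp: spine_list_def)
  have "central m Q xs (q - nQ)"
    unfolding central_def using counts[OF xs] spine_cycle_sum(1)[OF xs] by simp
  moreover have "mult m Q (xs ! 0) (xs ! 1) = 2" if "length xs = 2" using mult_spine[OF xs, of 0 1] that by simp
  ultimately show ?thesis using l2 d induces_cycle_spine[OF xs] by (auto simp: central_cycle_def)
qed

lemma hole_iff: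
  assumes xs: "spine_list xs"
  shows "hole m Q S \<longleftrightarrow> 4 \<le> length xs \<and> S = set xs"
proof
  assume h: "hole m Q S"
  then obtain ys where ys: "4 \<le> card S" "set ys = S" "induces_cycle m Q ys" by (auto simp: hole_def)
  then have "length ys \<noteq> 3" using card_length[of ys] by auto
  then have "S = spine V K" using induced_cycle_cases[OF ys(3)] ys(2) by metis
  then show "4 \<le> length xs \<and> S = set xs" using ys xs spine_card[OF xs] by (simp add: spine_list_def)
next
  assume "4 \<le> length xs \<and> S = set xs"
  then show "hole m Q S"
    using induces_cycle_spine[OF xs] spine_card[OF xs] xs by (auto simp: hole_def spine_list_def)
qed

text \<open>By \<open>triangle_cases\<close> the three arcs either close up to the spine or lie in
  one polygon. That polygon is the central face between \<open>xs ! i\<close> and its successor: on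
  the other side of \<open>xs ! i\<close> the two arcs would share both faces and the spine would
  have only two elements.\<close>

lemma near_disc:
  assumes xs: "spine_list xs" and i: "i < length xs" and l: "3 \<le> length xs"
    and w: "neighbor Q w (xs ! i)" "neighbor Q w (cyc_next xs i)"
  shows "w \<in> disc xs i \<or> spine V K = {w, xs ! i, cyc_next xs i}"
proof -
  have V: "w \<in> V" "xs ! i \<in> V" "cyc_next xs i \<in> V" "w \<noteq> xs ! i" using w by (auto simp: neighbor_iff)
  show ?thesis
  proof (cases rule: triangle_cases[OF V(2) V(3) V(1) neighbor_next[OF xs i] neighbor_sym[OF w(2)] w(1)])
    case (1 F a b c)
    have "xs ! i \<in> spine V K" using spine_faces_of(3)[OF xs i] .
    have "a = (\<not> exit_half (xs ! i))"
    proof (rule ccontr)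
      assume "a \<noteq> (\<not> exit_half (xs ! i))"
      then have Fx: "F = face K (exit (xs ! i))" using 1 by (simp add: exit_def)
      have "b = exit_half (cyc_next xs i) \<or> b = (\<not> exit_half (cyc_next xs i))" by auto
      then show False
      proof
        assume "b = exit_half (cyc_next xs i)"
        then have "F = face K (entry (xs ! i))" using 1 spine_faces_of(2)[OF xs i] by (simp add: exit_def)
        then show False using Fx no_loop'[OF V(2), of "exit_half (xs ! i)"] by (simp add: entry_def exit_def)
      next
        assume "b = (\<not> exit_half (cyc_next xs i))"
        then have "face K (xs ! i, a) = face K (cyc_next xs i, b)" "face K (xs ! i, \<not> a) = face K (cyc_next xs i, \<not> b)"
          using 1 \<open>a \<noteq> (\<not> exit_half (xs ! i))\<close> spine_faces_of(2)[OF xs i] by (auto simp: entry_def exit_def)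
        then have "spine V K = {xs ! i, cyc_next xs i}"
          using two_faces V spine_faces_of(5)[OF xs i] by blast
        then have "card (spine V K) \<le> 2" by (simp add: card_insert_if)
        then show False using spine_card[OF xs] l by simp
      qed
    qed
    then have "w \<in> disc xs i" using 1 V by (auto simp: disc_def fv_def entry_def)
    then show ?thesis ..
  next
    case 2
    then show ?thesis by auto
  qed
qed

text \<open>An arc off the spine has a central face on at most one side.\<close>

lemma disc_faces_distinct:
  assumes xs: "spine_list xs" and ij: "i < length xs" "j < length xs" "w \<in> disc xs i" "w \<in> disc xs j" "w \<notin> spine V K"
  shows "i = j"
proof -
  obtain a b where ab: "w \<in> V" "face K (w, a) = face K (entry (xs ! i))" "face K (w, b) = face K (entry (xs ! j))"
    using ij by (auto simp: disc_def fv_def)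
  have c: "central_face V K (face K (w, a)) (entry (xs ! i)) (exit (cyc_next xs i))"
    "central_face V K (face K (w, b)) (entry (xs ! j)) (exit (cyc_next xs j))"
    using xs ij ab by (simp_all add: spine_list_def)
  have "b = a"
  proof (rule ccontr)
    assume "b \<noteq> a"
    then have "b = (\<not> a)" by auto
    then obtain t where "pure_face V K (face K (w, b)) t" using not_two_central[OF ab(1) ij(5) c(1)] by auto
    then show False using pure_not_central c(2) by blast
  qed
  then show ?thesis using spine_list_faces[OF xs ij(1,2)] ab by simp
qed

text \<open>The polygon is the largest clique through the two consecutive spine arcs, so it is the
  unique maximal one.\<close>

lemma boundary_candidate_disc:
  assumes xs: "spine_list xs" and i: "i < length xs" and l: "3 \<le> length xs"
  shows "boundary_candidate Q xs i (disc xs i)"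
    and "boundary_candidate Q xs i C \<Longrightarrow> C \<subseteq> disc xs i"
proof -
  have "disc xs i \<noteq> set xs" if l3: "length xs = 3"
  proof
    assume "disc xs i = set xs"
    then have "set xs \<subseteq> {xs ! i, cyc_next xs i}" using disc_spine[OF xs i] xs by (auto simp: spine_list_def)
    then have "card (set xs) \<le> card {xs ! i, cyc_next xs i}" by (intro card_mono) auto
    also have "\<dots> \<le> 2" by (simp add: card_insert_if)
    finally show False using l3 spine_card[OF xs] xs by (simp add: spine_list_def)
  qed
  then show "boundary_candidate Q xs i (disc xs i)"
    using disc_ends[OF xs i] clique_fv by (auto simp: boundary_candidate_def disc_def)
  assume C: "boundary_candidate Q xs i C"
  then have cl: "clique Q C" "xs ! i \<in> C" "cyc_next xs i \<in> C" and not: "\<not> (length xs = 3 \<and> C = set xs)"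
    by (auto simp: boundary_candidate_def)
  show "C \<subseteq> disc xs i"
  proof
    fix w assume w: "w \<in> C"
    show "w \<in> disc xs i"
    proof (cases "w = xs ! i \<or> w = cyc_next xs i")
      case True
      then show ?thesis using disc_ends[OF xs i] by auto
    next
      case False
      then have "neighbor Q w (xs ! i)" "neighbor Q w (cyc_next xs i)" using cl w by (auto simp: clique_def)
      then have "w \<in> disc xs i \<or> spine V K = {w, xs ! i, cyc_next xs i}" by (rule near_disc[OF xs i l])
      then show ?thesis
      proof
        \<comment> \<open>This case is impossible: the spine has three arcs and all belong to
          \<open>C\<close>, so \<open>C\<close> has a further member. It neighbors all of the spine
          and would lie in every central polygon.\<close>
        assume sp: "spine V K = {w, xs ! i, cyc_next xs i}"
        then have "card (spine V K) \<le> 3" by (simp add: card_insert_if)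
        then have l3: "length xs = 3" using spine_card[OF xs] l by simp
        have "set xs \<subseteq> C" using sp xs w cl by (auto simp: spine_list_def)
        then obtain z where z: "z \<in> C" "z \<notin> spine V K" using not l3 xs by (auto simp: spine_list_def)
        have all: "z \<in> disc xs j" if j: "j < length xs" for j
        proof -
          have "xs ! j \<in> C" "cyc_next xs j \<in> C" "xs ! j \<noteq> z" "cyc_next xs j \<noteq> z"
            using spine_faces_of(3,4)[OF xs j] z \<open>set xs \<subseteq> C\<close> xs by (auto simp: spine_list_def)
          then have "neighbor Q z (xs ! j)" "neighbor Q z (cyc_next xs j)" using cl(1) z by (auto simp: clique_def)
          then show ?thesis using near_disc[OF xs j l] z by auto
        qed
        have "0 < length xs" "1 < length xs" using l by linarith+
        then show ?thesis using disc_faces_distinct[OF xs, of 0 1 z] all[of 0] all[of 1] z by simp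
      qed
    qed
  qed
qed

lemma boundary_cliques_disc:
  assumes xs: "spine_list xs"
  shows "boundary_cliques m Q xs (disc xs)"
proof (cases "length xs = 2")
  case True
  have S: "set xs = spine V K" "2 \<le> card (set xs)" using xs True spine_card[OF xs] by (auto simp: spine_list_def)
  have "vertex_cliques m Q (set xs) v (disc xs 0) (disc xs 1)" if v: "v \<in> set xs" for v
  proof -
    have n: "cyc_next xs 0 = xs ! 1" "cyc_next xs 1 = xs ! 0" using True by (auto simp: cyc_next_def)
    have f: "face K (exit (xs ! 1)) = face K (entry (xs ! 0))" "face K (exit (xs ! 0)) = face K (entry (xs ! 1))"
      using spine_faces_of(2)[OF xs, of 0] spine_faces_of(2)[OF xs, of 1] True n by auto
    have "v = xs ! 0 \<or> v = xs ! 1" using v True by (auto simp: in_set_conv_nth less_2_cases_iff)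
    moreover have "v \<in> V" using v S spine_V by auto
    ultimately show ?thesis
    proof (elim disjE)
      assume "v = xs ! 0"
      then show ?thesis using vertex_cliques_fv[OF \<open>v \<in> V\<close> S, of "\<not> exit_half v"] f
        by (simp add: disc_def entry_def exit_def)
    next
      assume "v = xs ! 1"
      then show ?thesis using vertex_cliques_fv[OF \<open>v \<in> V\<close> S, of "exit_half v"] f
        by (simp add: disc_def entry_def exit_def)
    qed
  qed
  then show ?thesis using True by (simp add: boundary_cliques_def)
next
  case False
  then have l: "3 \<le> length xs" using xs by (auto simp: spine_list_def)
  have mx: "max_boundary_clique Q xs i C \<longleftrightarrow> C = disc xs i" if "i < length xs" for i C
    using boundary_candidate_disc[OF xs that l] unfolding max_boundary_clique_def by blast
  then show ?thesis using False card_fv by (auto simp: boundary_cliques_def disc_def)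
qed

lemma triangles_admissible:
  assumes xs: "spine_list xs" and t: "triangle Q x y z" and n: "\<not> (length xs = 3 \<and> {x, y, z} = set xs)"
  shows "admissible m Q x y z"
proof -
  have d: "card {x, y, z} = 3" "x \<in> V" "y \<in> V" "z \<in> V" "neighbor Q x y" "neighbor Q y z" "neighbor Q z x"
    using t by (auto simp: triangle_def clique_def card3_iff)
  show ?thesis
  proof (cases rule: triangle_cases[OF d(2-7)])
    case (1 F a b c)
    then show ?thesis using triangle_face_color(2)[OF d(1-4)] by blast
  next
    case 2
    then have "length xs = 3" "set xs = {x, y, z}" using spine_card[OF xs] d xs by (auto simp: spine_list_def)
    then show ?thesis using n by auto
  qed
qed

end

section \<open>The quivers attached to the peripheral vertices\<close>

context annulus
begin

definition rest :: "'a list \<Rightarrow> 'a cquiver" where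
  "rest xs = remove_boundary Q xs (disc xs)"

lemma verts_rest: "spine_list xs \<Longrightarrow> verts (rest xs) = V - spine V K"
  by (simp add: rest_def remove_boundary_def induced_def spine_list_def)

lemma arr_rest: "spine_list xs \<Longrightarrow> arr (rest xs) u v c =
    (if u \<in> V - spine V K \<and> v \<in> V - spine V K \<and> \<not> (\<exists>i<length xs. u \<in> disc xs i \<and> v \<in> disc xs i) then arr Q u v c else 0)"
proof -
  assume xs: "spine_list xs"
  then have s: "set xs = spine V K" by (simp add: spine_list_def)
  show ?thesis
    by (cases "\<exists>i<length xs. u \<in> disc xs i \<and> v \<in> disc xs i")
      (simp add: rest_def remove_boundary_def induced_def s, auto simp: rest_def remove_boundary_def induced_def s)
qed

lemma central_disc:
  assumes xs: "spine_list xs" and c: "central_face V K (face K (u, a)) e x" and u: "u \<in> V"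
  obtains i where "i < length xs" "u \<in> disc xs i" "face K (entry (xs ! i)) = face K (u, a)"
proof -
  obtain i where "i < length xs" "face K (u, a) = face K (entry (xs ! i))" using central_index[OF xs c] .
  moreover from this have "u \<in> disc xs i" using u unfolding disc_def fv_def by (intro CollectI conjI exI[of _ a]) simp_all
  ultimately show ?thesis using that[of i] by simp
qed

lemma pure_no_spine: "pure_face V K (face K (u, a)) t \<Longrightarrow> u \<in> V \<Longrightarrow> u \<notin> spine V K"
  using spine_lbl[of u a] by (auto simp: pure_face_def)

text \<open>Boundary cliques are the central polygons, so the arrows that remain come from pure
  ones. Nothing else is lost: two arcs sharing a pure polygon and a central one would share both
  faces and form the spine.\<close>

lemma neighbor_rest:
  assumes xs: "spine_list xs"
  shows "neighbor (rest xs) u v \<longleftrightarrow> u \<in> V \<and> v \<in> V \<and> u \<noteq> v \<and>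
    (\<exists>a b t. face K (u, a) = face K (v, b) \<and> pure_face V K (face K (u, a)) t)"
proof
  assume "neighbor (rest xs) u v"
  then have n: "u \<in> V - spine V K" "v \<in> V - spine V K" "\<not> (\<exists>i<length xs. u \<in> disc xs i \<and> v \<in> disc xs i)" "neighbor Q u v"
    unfolding neighbor_def arr_rest[OF xs] by (auto split: if_splits)
  then obtain a b where ab: "u \<noteq> v" "face K (u, a) = face K (v, b)" by (auto simp: neighbor_iff)
  have "\<not> central_face V K (face K (u, a)) e x" for e x
  proof
    assume c: "central_face V K (face K (u, a)) e x"
    obtain i where "i < length xs" "u \<in> disc xs i" "face K (entry (xs ! i)) = face K (u, a)"
      using central_disc[OF xs c] n by auto
    moreover have "v \<in> disc xs i" using calculation ab n by (auto simp: disc_def fv_def)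
    ultimately show False using n(3) by blast
  qed
  then obtain t where "pure_face V K (face K (u, a)) t" using faceE[of "(u, a)"] n by (metis DiffD1 in_halves(1))
  then show "u \<in> V \<and> v \<in> V \<and> u \<noteq> v \<and> (\<exists>a b t. face K (u, a) = face K (v, b) \<and> pure_face V K (face K (u, a)) t)"
    using n ab by blast
next
  assume "u \<in> V \<and> v \<in> V \<and> u \<noteq> v \<and> (\<exists>a b t. face K (u, a) = face K (v, b) \<and> pure_face V K (face K (u, a)) t)"
  then obtain a b t where ab: "u \<in> V" "v \<in> V" "u \<noteq> v" "face K (u, a) = face K (v, b)" "pure_face V K (face K (u, a)) t" by blast
  have s: "u \<notin> spine V K" "v \<notin> spine V K" using pure_no_spine[of u a t] pure_no_spine[of v b t] ab by auto
  have "\<not> (u \<in> disc xs i \<and> v \<in> disc xs i)" if i: "i < length xs" for i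
  proof
    assume d: "u \<in> disc xs i \<and> v \<in> disc xs i"
    then obtain a' b' where f: "face K (u, a') = face K (entry (xs ! i))" "face K (v, b') = face K (entry (xs ! i))"
      by (auto simp: disc_def fv_def)
    have "central_face V K (face K (entry (xs ! i))) (entry (xs ! i)) (exit (cyc_next xs i))"
      using xs i by (simp add: spine_list_def)
    then have ne: "face K (entry (xs ! i)) \<noteq> face K (u, a)" using pure_not_central[OF ab(5)] by metis
    have "a' \<noteq> a" using f(1) ne by (intro notI) simp
    moreover have "b' \<noteq> b" using f(2) ne ab(4) by (intro notI) simp
    ultimately
    have "a' = (\<not> a)" "b' = (\<not> b)" by auto
    then have "spine V K = {u, v}" using two_faces[of u v a b] ab f by simp
    then show False using s by auto
  qed
  moreover have "neighbor Q u v" using ab by (auto simp: neighbor_iff)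
  ultimately show "neighbor (rest xs) u v"
    unfolding neighbor_def arr_rest[OF xs] using ab s by auto
qed

abbreviation path :: "'a list \<Rightarrow> 'a \<Rightarrow> 'a \<Rightarrow> bool" where
  "path xs \<equiv> (neighbor (rest xs))\<^sup>*\<^sup>*"

lemma neighbor_rest_sym: "spine_list xs \<Longrightarrow> neighbor (rest xs) u v \<Longrightarrow> neighbor (rest xs) v u"
  by (simp add: neighbor_rest) metis

lemma path_sym: "spine_list xs \<Longrightarrow> path xs u v \<Longrightarrow> path xs v u"
  by (rotate_tac 1, induction rule: rtranclp_induct)
    (auto intro: converse_rtranclp_into_rtranclp neighbor_rest_sym)

text \<open>All arcs of a pure polygon carry its label, so the circle is constant along a
  path.\<close>

lemma path_stays:
  assumes xs: "spine_list xs" and "path xs u v" and u: "u \<in> V - spine V K"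
  shows "v \<in> V - spine V K \<and> (\<forall>b b'. lbl K (u, b) = lbl K (v, b'))"
  using assms(2)
proof (induction rule: rtranclp_induct)
  case base
  then show ?case using u not_spine_lbl[of u] by auto
next
  case (step v w)
  obtain a b t where ab: "v \<in> V" "w \<in> V" "face K (v, a) = face K (w, b)" "pure_face V K (face K (v, a)) t"
    using step(2) unfolding neighbor_rest[OF xs] by blast
  then have s: "w \<notin> spine V K" using pure_no_spine[of w b t] by auto
  have "lbl K (v, a) = t" "lbl K (w, b) = t" using ab by (auto simp: pure_face_def)
  then have "lbl K (u, x) = lbl K (w, y)" for x y
  proof -
    have "lbl K (u, x) = lbl K (v, a)" using step(3) by blast
    also have "\<dots> = lbl K (w, b)" using \<open>lbl K (v, a) = t\<close> \<open>lbl K (w, b) = t\<close> by simp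
    also have "\<dots> = lbl K (w, y)" by (rule not_spine_lbl[OF ab(2) s])
    finally show ?thesis .
  qed
  then show ?case using s ab(2) by blast
qed

definition outer :: "'a set" where
  "outer = {w \<in> V - spine V K. \<exists>b e u. central_face V K (face K (w, b)) e u}"

lemma peripheral_at_iff:
  assumes xs: "spine_list xs" and i: "i < length xs"
  shows "peripheral_at xs (disc xs) i = {w \<in> disc xs i. w \<notin> spine V K}"
  using disc_spine[OF xs i] spine_faces_of(3,4)[OF xs i] by (auto simp: peripheral_at_def)

lemma disc_V: "disc xs i \<subseteq> V"
  by (auto simp: disc_def fv_def)

lemma outer_iff:
  assumes xs: "spine_list xs"
  shows "peripheral xs (disc xs) = outer"
proof
  show "peripheral xs (disc xs) \<subseteq> outer"
  proof
    fix w assume "w \<in> peripheral xs (disc xs)"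
    then obtain i where i: "i < length xs" "w \<in> disc xs i" "w \<notin> spine V K"
      using peripheral_at_iff[OF xs] by (auto simp: peripheral_def)
    then obtain b where "w \<in> V" "face K (w, b) = face K (entry (xs ! i))" by (auto simp: disc_def fv_def)
    moreover have "central_face V K (face K (entry (xs ! i))) (entry (xs ! i)) (exit (cyc_next xs i))"
      using xs i by (simp add: spine_list_def)
    ultimately show "w \<in> outer" using i unfolding outer_def by auto metis
  qed
  show "outer \<subseteq> peripheral xs (disc xs)"
  proof
    fix w assume "w \<in> outer"
    then obtain b e u where w: "w \<in> V" "w \<notin> spine V K" "central_face V K (face K (w, b)) e u" by (auto simp: outer_def)
    obtain i where "i < length xs" "w \<in> disc xs i" using central_disc[OF xs w(3,1)] .
    then show "w \<in> peripheral xs (disc xs)" using w peripheral_at_iff[OF xs] by (auto simp: peripheral_def)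
  qed
qed

lemma outer_disc:
  assumes xs: "spine_list xs"
  shows "w \<in> outer \<longleftrightarrow> (\<exists>i<length xs. w \<in> disc xs i \<and> w \<notin> spine V K)"
  unfolding outer_iff[OF xs, symmetric] peripheral_def using peripheral_at_iff[OF xs] by auto

text \<open>Walk in the dual graph from a central face to a face of \<open>v\<close>. As long as the
  faces reached are pure, the arc just crossed is off the spine and is joined to \<open>v\<close> by
  sharing such a face.\<close>

lemma path_outer:
  assumes xs: "spine_list xs" and v: "v \<in> V - spine V K"
  shows "\<exists>w\<in>outer. path xs v w"
proof -
  obtain F0 e u where F0: "F0 \<in> face K ` halves V" "central_face V K F0 e u" using exists_central by blast
  have "\<forall>v\<in>V - spine V K. \<forall>b. face K (v, b) = F \<longrightarrow> (\<exists>w\<in>outer. path xs v w)" if "linked (face K) V F0 F" for F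
    using that
  proof (induction rule: rtranclp_induct)
    case base
    then show ?case using F0 unfolding outer_def by blast
  next
    case (step F F')
    obtain x d where x: "x \<in> V" "F = face K (x, d)" "F' = face K (x, \<not> d)" using step(2) by (auto simp: adj_def)
    show ?case
    proof (intro ballI allI impI)
      fix v b assume v: "v \<in> V - spine V K" and f: "face K (v, b) = F'"
      show "\<exists>w\<in>outer. path xs v w"
      proof (cases "\<exists>e u. central_face V K F' e u")
        case True
        then show ?thesis using v f unfolding outer_def by blast
      next
        case False
        then obtain t where t: "pure_face V K F' t" using faceE[of "(v, b)"] v f by (metis DiffD1 in_halves(1))
        have "x \<notin> spine V K" using pure_no_spine[of x "\<not> d" t] t x by simp
        then obtain w where w: "w \<in> outer" "path xs x w" using step(3) x by blast
        show ?thesis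
        proof (cases "v = x")
          case False
          then have "neighbor (rest xs) v x" unfolding neighbor_rest[OF xs]
            using v x f t by (intro conjI exI[of _ b] exI[of _ "\<not> d"] exI[of _ t]) auto
          then show ?thesis using w by (meson converse_rtranclp_into_rtranclp)
        qed (use w in blast)
      qed
    qed
  qed
  moreover have "linked (face K) V F0 (face K (v, True))" using conn F0(1) face_in v by (metis DiffD1 in_halves(1))
  ultimately show ?thesis using v by blast
qed

text \<open>All faces on the far side of \<open>w\<close> are separated from the spine by \<open>w\<close>, which is a bridge.\<close>

lemma outer_unique:
  assumes xs: "spine_list xs" and w: "w \<in> outer" "w' \<in> outer" "path xs w w'"
  shows "w' = w"
proof -
  obtain b e u where w1: "w \<in> V" "w \<notin> spine V K" and c: "central_face V K (face K (w, b)) e u"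
    using w(1) by (auto simp: outer_def)
  \<comment> \<open>The faces on the far side of \<open>w\<close>, away from its central
    face.\<close>
  define A where "A = {G. linked (face K) (V - {w}) (face K (w, \<not> b)) G}"
  have no: "face K (w, b) \<notin> A"
  proof
    assume "face K (w, b) \<in> A"
    then have "linked (face K) (V - {w}) (face K (w, \<not> b)) (face K (w, \<not> \<not> b))" by (simp add: A_def)
    then show False using bridge[OF spine_circulation w1(1)] w1(2) by blast
  qed
  have noc: "G \<notin> A" if "central_face V K G e' u'" for G e' u'
  proof
    assume "G \<in> A"
    have "linked (face K) (spine V K) (face K e') (face K e)"
      using spine_ends_linked[of e' e] central_in_spine[OF that] central_in_spine[OF c] that c unfolding central_face_def by blast
    then have "linked (face K) (V - {w}) G (face K (w, b))"
      using w1(2) that c by (auto elim!: linked_mono simp: central_face_def spine_def)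
    with \<open>G \<in> A\<close> have "face K (w, b) \<in> A" unfolding A_def mem_Collect_eq by (rule rtranclp_trans)
    then show False using no by simp
  qed
  have far: "v = w \<or> (\<forall>d. face K (v, d) \<in> A)" if "path xs w v" for v
    using that
  proof (induction rule: rtranclp_induct)
    case (step v z)
    obtain a d t where ad: "v \<in> V" "z \<in> V" "face K (v, a) = face K (z, d)" "pure_face V K (face K (v, a)) t"
      using step(2) unfolding neighbor_rest[OF xs] by blast
    have in_A: "face K (v, a) \<in> A"
    proof (cases "v = w")
      case True
      then have "a \<noteq> b" using ad(4) c pure_not_central by blast
      then have "a = (\<not> b)" by auto
      then show ?thesis using True by (simp add: A_def)
    qed (use step(3) in auto)
    show ?case
    proof (cases "z = w")
      case False
      have "face K (z, d') \<in> A" for d'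
      proof -
        have "linked (face K) (V - {w}) (face K (z, d)) (face K (z, d'))" using False ad by (intro linked_edge) auto
        with in_A show ?thesis unfolding A_def mem_Collect_eq ad(3) by (rule rtranclp_trans)
      qed
      then show ?thesis by simp
    qed simp
  qed simp
  obtain b' e' u' where "central_face V K (face K (w', b')) e' u'" using w(2) by (auto simp: outer_def)
  then show ?thesis using far[OF w(3)] noc by blast
qed

lemma component_iff: "spine_list xs \<Longrightarrow> component (rest xs) w = {u \<in> V - spine V K. path xs w u}"
  by (simp add: component_def verts_rest)

lemma outer_V: "w \<in> outer \<Longrightarrow> w \<in> V - spine V K"
  by (simp add: outer_def)

text \<open>A peripheral arc on the circle \<open>True\<close> comes after \<open>?u\<close> when
  counted from \<open>?e\<close>, so that the three edges are in cyclic order and leave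
  \<open>m - 1\<close> others; on the circle \<open>False\<close> the order is reversed.\<close>

lemma triangle_color_outer:
  assumes xs: "spine_list xs" and i: "i < length xs" and w: "w \<in> disc xs i" "w \<notin> spine V K"
  shows "triangle_color Q (xs ! i) (cyc_next xs i) w = (if side K True w then m - 1 else 2 * m + 1)"
proof -
  let ?e = "entry (xs ! i)" and ?u = "exit (cyc_next xs i)"
  obtain b where b: "w \<in> V" "face K (w, b) = face K ?e" using w by (auto simp: disc_def fv_def)
  have c: "central_face V K (face K ?e) ?e ?u" using xs i by (simp add: spine_list_def)
  note C = centralD[OF c]
  have ne: "(w, b) \<noteq> ?e" "(w, b) \<noteq> ?u" using w spine_faces_of(3,4)[OF xs i] by (metis entry_simps(1) fst_conv, metis entry_simps(2) fst_conv)
  have l: "lbl K (w, b) \<longleftrightarrow> hue K ?e ?u < hue K ?e (w, b)" "side K True w \<longleftrightarrow> lbl K (w, b)"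
    using C(10)[of "(w, b)"] b ne by (auto simp: side_def) (cases b; simp)+
  have sp: "xs ! i \<in> V" "cyc_next xs i \<in> V" "w \<noteq> xs ! i" "w \<noteq> cyc_next xs i"
    using spine_faces_of(3,4)[OF xs i] spine_V w by auto
  have d3: "card {xs ! i, cyc_next xs i, w} = 3" using spine_faces_of(5)[OF xs i] sp by (auto simp: card3_iff)
  have "triangle_color Q (xs ! i) (cyc_next xs i) w = hue K ?e ?u + hue K ?u (w, b) + hue K (w, b) ?e"
    using triangle_face_color(1)[OF d3 sp(1,2) b(1), of "\<not> exit_half (xs ! i)" "face K ?e" "exit_half (cyc_next xs i)" b]
      C(4) b by (simp add: entry_def exit_def)
  moreover have "hue K ?u (w, b) = gap m (place ?e ?u) (place ?e (w, b))" "place ?e ?u \<noteq> place ?e (w, b)"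
    using place_props(1,3)[of ?e ?u "(w, b)"] C(1-4) b ne by auto
  moreover have "hue K ?e (w, b) + hue K (w, b) ?e = m" "hue K ?e ?u \<le> m"
    using hue_sum[of ?e "(w, b)"] hue_le[of ?e ?u] C(1-4,9) b ne by auto
  ultimately show ?thesis using l ne C(9) by (auto simp: place_def gap_def split: if_splits)
qed

lemma peripheral_of_color_iff:
  assumes xs: "spine_list xs" and t: "s = (if t then m - 1 else 2 * m + 1)"
  shows "peripheral_of_color Q xs (disc xs) s = {w \<in> outer. side K t w}"
proof -
  have ne: "m - 1 \<noteq> 2 * m + 1" "2 * m + 1 \<noteq> m - 1" by auto
  have sd: "side K t w \<longleftrightarrow> (side K True w \<longleftrightarrow> t)" if "w \<in> V - spine V K" for w
    using not_spine_lbl[of w True False] that by (cases t) (auto simp: side_def)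
  have *: "triangle_color Q (xs ! i) (cyc_next xs i) w = s \<longleftrightarrow> side K t w"
    if "i < length xs" "w \<in> disc xs i" "w \<notin> spine V K" for i w
  proof -
    have "w \<in> V - spine V K" using that disc_V by auto
    then show ?thesis using triangle_color_outer[OF xs that] sd[of w] t ne by (cases t) auto
  qed
  show ?thesis
  proof (rule set_eqI)
    fix w
    have "w \<in> peripheral_of_color Q xs (disc xs) s \<longleftrightarrow>
        (\<exists>i<length xs. (w \<in> disc xs i \<and> w \<notin> spine V K) \<and> triangle_color Q (xs ! i) (cyc_next xs i) w = s)"
      unfolding peripheral_of_color_def using peripheral_at_iff[OF xs] by auto
    also have "\<dots> \<longleftrightarrow> (\<exists>i<length xs. (w \<in> disc xs i \<and> w \<notin> spine V K) \<and> side K t w)" using * by blast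
    also have "\<dots> \<longleftrightarrow> w \<in> {w \<in> outer. side K t w}" unfolding mem_Collect_eq outer_disc[OF xs] by blast
    finally show "w \<in> peripheral_of_color Q xs (disc xs) s \<longleftrightarrow> w \<in> {w \<in> outer. side K t w}" .
  qed
qed

text \<open>Every arc off the spine belongs to exactly one component of a peripheral arc, and labels
  are constant on components.\<close>

lemma sum_components:
  assumes xs: "spine_list xs"
  shows "(\<Sum>w\<in>{w \<in> outer. side K t w}. card (component (rest xs) w)) = card {v \<in> V. side K t v}"
proof -
  let ?W = "{w \<in> outer. side K t w}"
  have fin: "finite ?W" using finite_V by (auto simp: outer_def)
  have same: "side K t u \<longleftrightarrow> side K t v" if "path xs u v" "u \<in> V - spine V K" for u v
    using path_stays[OF xs that] unfolding side_def by metis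
  have "{v \<in> V. side K t v} = (\<Union>w\<in>?W. component (rest xs) w)"
  proof
    show "{v \<in> V. side K t v} \<subseteq> (\<Union>w\<in>?W. component (rest xs) w)"
    proof
      fix v assume v: "v \<in> {v \<in> V. side K t v}"
      then have v': "v \<in> V - spine V K" by (auto simp: side_def spine_def)
      then obtain w where w: "w \<in> outer" "path xs v w" using path_outer[OF xs] by blast
      then show "v \<in> (\<Union>w\<in>?W. component (rest xs) w)"
        using same[OF w(2) v'] v v' path_sym[OF xs w(2)] by (auto simp: component_iff[OF xs])
    qed
    show "(\<Union>w\<in>?W. component (rest xs) w) \<subseteq> {v \<in> V. side K t v}"
      using same outer_V by (auto simp: component_iff[OF xs])
  qed
  moreover have "card (\<Union>w\<in>?W. component (rest xs) w) = (\<Sum>w\<in>?W. card (component (rest xs) w))"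
  proof (rule card_UN_disjoint[OF fin])
    show "\<forall>w\<in>?W. finite (component (rest xs) w)" using finite_V by (auto simp: component_iff[OF xs])
    show "\<forall>w\<in>?W. \<forall>w'\<in>?W. w \<noteq> w' \<longrightarrow> component (rest xs) w \<inter> component (rest xs) w' = {}"
    proof (intro ballI impI)
      fix w w' assume w: "w \<in> ?W" "w' \<in> ?W" "w \<noteq> w'"
      show "component (rest xs) w \<inter> component (rest xs) w' = {}"
      proof (rule ccontr)
        assume "component (rest xs) w \<inter> component (rest xs) w' \<noteq> {}"
        then obtain v where "path xs w v" "path xs w' v" by (auto simp: component_iff[OF xs])
        then have "path xs w w'" using path_sym[OF xs] by (meson rtranclp_trans)
        then show False using outer_unique[OF xs] w by blast
      qed
    qed
  qed
  ultimately show ?thesis by simp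
qed

lemma component_class_A:
  assumes xs: "spine_list xs" and w: "w \<in> outer"
  shows "induced (rest xs) (component (rest xs) w) \<in> class_A m (card (component (rest xs) w))"
proof -
  let ?X = "component (rest xs) w"
  let ?P = "induced (rest xs) ?X"
  have X: "u \<in> ?X \<longleftrightarrow> u \<in> V - spine V K \<and> path xs w u" for u by (simp add: component_iff[OF xs])
  have XV: "?X \<subseteq> V - spine V K" using X by auto
  have wX: "w \<in> ?X" using outer_V[OF w] X by auto
  have only: "u = w" if "u \<in> ?X" "u \<in> outer" for u using outer_unique[OF xs w that(2)] X that by blast
  have arrP: "arr ?P u v c = (if u \<in> ?X \<and> v \<in> ?X then arr Q u v c else 0)" for u v c
  proof (cases "u \<in> ?X \<and> v \<in> ?X")
    case True
    \<comment> \<open>A boundary clique could remove an arrow only between two peripheral arcs, and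
      the component contains just one.\<close>
    have "arr Q u v c = 0" if i: "i < length xs" "u \<in> disc xs i" "v \<in> disc xs i" for i
    proof -
      have "u \<in> outer" "v \<in> outer" using i True XV outer_disc[OF xs] by auto
      then have "u = v" using only True by metis
      then show ?thesis by (simp add: arr_quiv_0)
    qed
    then show ?thesis using True XV by (auto simp: induced_def arr_rest[OF xs])
  qed (auto simp: induced_def)
  have vP: "verts ?P = ?X" by (simp add: induced_def)
  have nP: "neighbor ?P u v \<longleftrightarrow> u \<in> ?X \<and> v \<in> ?X \<and> neighbor Q u v" for u v
    by (auto simp: neighbor_def arrP)
  have mP: "mult m ?P u v = (if u \<in> ?X \<and> v \<in> ?X then mult m Q u v else 0)" for u v
    by (cases "u \<in> ?X \<and> v \<in> ?X") (simp add: mult_def arrP, simp only: mult_def arrP if_False sum.neutral_const)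
  have cP: "color ?P u v = color Q u v" if "u \<in> ?X" "v \<in> ?X" for u v
    using that by (simp add: color_def arrP)
  have colored: "colored_quiver m ?P"
  proof -
    have fin: "finite ?X" using XV finite_V by (auto intro: finite_subset)
    show ?thesis
      unfolding colored_quiver_def vP
    proof (intro conjI allI impI)
      fix i j c assume "arr ?P i j c \<noteq> 0"
      then show "i \<in> ?X" "j \<in> ?X" "c \<le> m" using arr_gt[of c i j] by (auto simp: arrP not_less[symmetric] split: if_splits)
    next
      fix i j c c' assume "arr ?P i j c \<noteq> 0 \<and> c' \<noteq> c"
      then show "arr ?P i j c' = 0" using arr_unique[of i j c c'] by (auto simp: arrP split: if_splits)
    next
      fix i j c assume "c \<le> m"
      then show "arr ?P i j c = arr ?P j i (m - c)" using arr_skew[of c i j] by (simp add: arrP)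
    next
      fix i c show "arr ?P i i c = 0" by (simp add: arrP arr_quiv_0)
    qed (rule fin)
  qed
  have reach: "(neighbor ?P)\<^sup>*\<^sup>* w u" if "path xs w u" for u
    using that
  proof (induction rule: rtranclp_induct)
    case (step u v)
    have pv: "path xs w v" using step(1,2) by (rule rtranclp.rtrancl_into_rtrancl)
    have u: "u \<in> ?X" "v \<in> ?X"
      using path_stays[OF xs step(1) outer_V[OF w]] path_stays[OF xs pv outer_V[OF w]] step(1) pv X by blast+
    have "neighbor Q u v" using step(2) unfolding neighbor_rest[OF xs] neighbor_iff by blast
    then have "neighbor ?P u v" using u nP by simp
    then show ?case using step(3) by (rule rtranclp.rtrancl_into_rtrancl[rotated])
  qed simp
  have symP: "symp (neighbor ?P)" using neighbor_sym nP by (auto simp: symp_def)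
  have connected: "connected_quiver ?P"
    unfolding connected_quiver_def vP
  proof (intro conjI ballI)
    fix u v assume "u \<in> ?X" "v \<in> ?X"
    then have "(neighbor ?P)\<^sup>*\<^sup>* w u" "(neighbor ?P)\<^sup>*\<^sup>* w v" using reach X by auto
    then show "(neighbor ?P)\<^sup>*\<^sup>* u v" using symp_rtranclp[OF symP] by (meson rtranclp_trans sympD)
  qed (use wX in auto)
  have simpleP: "simple m ?P"
    unfolding simple_def vP mP
  proof (intro ballI impI)
    fix u v assume uv: "u \<in> ?X" "v \<in> ?X" "u \<noteq> v"
    then have "{u, v} \<noteq> spine V K" using XV by auto
    then show "(if u \<in> ?X \<and> v \<in> ?X then mult m Q u v else 0) \<le> 1" using mult_le[of u v] uv XV by auto
  qed
  have "\<not> hole m ?P S" for S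
  proof
    assume h: "hole m ?P S"
    then obtain ys where ys: "4 \<le> card S" "set ys = S" "induces_cycle m ?P ys" by (auto simp: hole_def)
    have sub: "S \<subseteq> ?X" using ys by (auto simp: induces_cycle_def vP)
    have "mult m Q (ys ! i) (ys ! j) = mult m ?P (ys ! i) (ys ! j)" if "i < length ys" "j < length ys" for i j
    proof -
      have "ys ! i \<in> ?X" "ys ! j \<in> ?X" using sub ys(2) nth_mem[OF that(1)] nth_mem[OF that(2)] by blast+
      then show ?thesis by (simp add: mP)
    qed
    moreover have "set ys \<subseteq> V" using ys(2) sub XV by blast
    ultimately have "induces_cycle m Q ys" using ys(3) unfolding induces_cycle_def by simp
    then have "hole m Q S" using ys by (auto simp: hole_def)
    then have "S = spine V K" using hole_iff[OF xs] xs by (simp add: spine_list_def)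
    then have "S = {}" using sub XV by auto
    then show False using ys by simp
  qed
  moreover have "admissible m ?P x y z" if t: "triangle ?P x y z" for x y z
  proof -
    have in_X: "x \<in> ?X" "y \<in> ?X" "z \<in> ?X" using t by (auto simp: triangle_def clique_def vP)
    have "triangle Q x y z" using t XV by (auto simp: triangle_def clique_def vP nP)
    moreover have "{x, y, z} \<noteq> set xs" using in_X XV xs by (auto simp: spine_list_def)
    ultimately have "admissible m Q x y z" using triangles_admissible[OF xs] by blast
    then show ?thesis using in_X by (simp add: admissible_def triangle_color_def cP)
  qed
  moreover have "\<exists>C B. clique ?P C \<and> clique ?P B \<and> card C \<le> m + 2 \<and> card B \<le> m + 2 \<and>
           C \<inter> B = {v} \<and> card C + card B = card (neighbors ?P v) + 2 \<and>
           (\<forall>u\<in>C - {v}. \<forall>w\<in>B - {v}. \<not> neighbor ?P u w)" if v: "v \<in> ?X" for v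
  proof -
    have vV: "v \<in> V" "v \<notin> spine V K" using v XV by auto
    \<comment> \<open>The cliques at \<open>v\<close> are again its polygons, except that a central
      polygon, which occurs only at \<open>w\<close>, shrinks to \<open>{v}\<close>.\<close>
    define cf where "cf b = (if \<exists>t. pure_face V K (face K (v, b)) t then fv V K (face K (v, b)) else {v})" for b
    have sub: "cf b \<subseteq> ?X" for b
    proof (cases "\<exists>t. pure_face V K (face K (v, b)) t")
      case True
      then obtain t where t: "pure_face V K (face K (v, b)) t" by auto
      show ?thesis
      proof
        fix u assume "u \<in> cf b"
        then obtain a where a: "u \<in> V" "face K (u, a) = face K (v, b)" using True by (auto simp: cf_def fv_def)
        show "u \<in> ?X"
        proof (cases "u = v")
          case False
          then have "neighbor (rest xs) v u" unfolding neighbor_rest[OF xs] using a vV t by metis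
          then have "path xs w u" using v X by (meson rtranclp.rtrancl_into_rtrancl)
          moreover have "u \<notin> spine V K" using pure_no_spine[of u a t] a t by simp
          ultimately show ?thesis using X a by simp
        qed (use v in simp)
      qed
    qed (use v in \<open>simp add: cf_def\<close>)
    have vcf: "v \<in> cf b" for b using vV by (auto simp: cf_def fv_def)
    have sub': "cf b \<subseteq> fv V K (face K (v, b))" for b using vV by (auto simp: cf_def fv_def)
    have cl: "clique ?P (cf b)" for b
      using sub[of b] sub'[of b] clique_fv[of "face K (v, b)"] unfolding clique_def vP nP by blast
    have card: "card (cf b) \<le> m + 2" for b using card_mono[OF finite_fv sub'[of b]] card_fv le_trans by blast
    have ns: "spine V K \<noteq> {u, v}" for u using vV by auto
    have cap: "cf True \<inter> cf False = {v}"
      using vcf both_faces[OF vV(1), of _ True] sub'[of True] sub'[of False] ns by auto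
    have nb: "neighbors ?P v = (cf True \<union> cf False) - {v}"
    proof
      show "neighbors ?P v \<subseteq> (cf True \<union> cf False) - {v}"
      proof
        fix u assume u: "u \<in> neighbors ?P v"
        then have uX: "u \<in> ?X" "neighbor Q v u" by (auto simp: neighbors_def vP nP)
        then have "neighbor (rest xs) v u"
          using arrP[of v u] v unfolding neighbor_def by (auto simp: induced_def)
        then obtain a t where "u \<noteq> v" "u \<in> fv V K (face K (v, a))" "pure_face V K (face K (v, a)) t"
          unfolding neighbor_rest[OF xs] by (auto simp: fv_def) metis
        then show "u \<in> (cf True \<union> cf False) - {v}" by (cases a) (auto simp: cf_def)
      qed
      show "(cf True \<union> cf False) - {v} \<subseteq> neighbors ?P v"
        using sub clique_pair[of v "face K (v, True)"] clique_pair[of v "face K (v, False)"] sub' fv_I[OF vV(1)] v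
        by (auto simp: neighbors_def vP nP) blast+
    qed
    have fin: "finite (cf b)" for b using finite_subset[OF sub' finite_fv] .
    have "card (cf True) + card (cf False) = card (cf True \<union> cf False) + 1"
      using card_Un_Int[OF fin fin, of True False] cap by simp
    moreover have "cf True \<union> cf False = insert v (neighbors ?P v)" using nb vcf by auto
    moreover have "card (insert v (neighbors ?P v)) = card (neighbors ?P v) + 1"
      using nb fin by (subst card_insert_disjoint) auto
    ultimately have cc: "card (cf True) + card (cf False) = card (neighbors ?P v) + 2" by simp
    have "\<not> neighbor ?P u z" if uz: "u \<in> cf True - {v}" "z \<in> cf False - {v}" for u z
    proof
      assume "neighbor ?P u z"
      then have "neighbor Q u z" using nP by simp
      moreover have "u \<in> fv V K (face K (v, True))" "z \<in> fv V K (face K (v, \<not> True))" using uz sub' by auto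
      ultimately have "spine V K = {u, v, z}" using opposite_faces[OF vV(1), of u True z] uz ns by auto
      then show False using vV by auto
    qed
    then show ?thesis using cl card cap cc by (intro exI[of _ "cf True"] exI[of _ "cf False"]) auto
  qed
  ultimately show ?thesis
    unfolding class_A_def using colored connected simpleP vP by auto
qed

lemma decomposition_disc:
  assumes xs: "spine_list xs"
  shows "decomposition m p q Q xs (q - nQ) (disc xs)"
proof -
  have R: "remove_boundary Q xs (disc xs) = rest xs" by (simp add: rest_def)
  have 1: "\<exists>!i. i < length xs \<and> w \<in> disc xs i" if w: "w \<in> outer" for w
  proof -
    obtain i where "i < length xs" "w \<in> disc xs i"
      using w outer_disc[OF xs] by blast
    then show ?thesis using disc_faces_distinct[OF xs] outer_V[OF w] by blast
  qed
  have 2: "verts (rest xs) = (\<Union>w\<in>outer. component (rest xs) w)"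
  proof
    show "verts (rest xs) \<subseteq> (\<Union>w\<in>outer. component (rest xs) w)"
    proof
      fix v assume "v \<in> verts (rest xs)"
      then have v: "v \<in> V - spine V K" by (simp add: verts_rest[OF xs])
      then obtain w where "w \<in> outer" "path xs v w" using path_outer[OF xs] by blast
      then show "v \<in> (\<Union>w\<in>outer. component (rest xs) w)" using path_sym[OF xs] v by (auto simp: component_iff[OF xs])
    qed
  qed (auto simp: component_def)
  have 3: "w \<in> component (rest xs) w" if "w \<in> outer" for w using outer_V[OF that] by (simp add: component_iff[OF xs])
  have 4: "component (rest xs) w \<inter> component (rest xs) w' = {}" if w: "w \<in> outer" "w' \<in> outer" "w \<noteq> w'" for w w'
  proof (rule ccontr)
    assume "component (rest xs) w \<inter> component (rest xs) w' \<noteq> {}"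
    then obtain v where "path xs w v" "path xs w' v" by (auto simp: component_iff[OF xs])
    then have "path xs w w'" using path_sym[OF xs] by (meson rtranclp_trans)
    then show False using outer_unique[OF xs] w by blast
  qed
  have P: "(\<Sum>w\<in>peripheral_of_color Q xs (disc xs) (m - 1). card (component (rest xs) w)) = nP"
    unfolding nP_def sum_components[OF xs, symmetric] by (subst peripheral_of_color_iff[OF xs, of _ True]) simp_all
  have N: "(\<Sum>w\<in>peripheral_of_color Q xs (disc xs) (2 * m + 1). card (component (rest xs) w)) = nQ"
    unfolding nQ_def sum_components[OF xs, symmetric] by (subst peripheral_of_color_iff[OF xs, of _ False]) simp_all
  show ?thesis
    unfolding decomposition_def Let_def R outer_iff[OF xs] P N
    by (intro conjI ballI impI) (use 1 2 3 4 component_class_A[OF xs] counts(4,5)[OF xs] in blast)+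
qed

theorem quiv_in_class: "Q \<in> class_A_tilde m p q"
proof -
  obtain xs where xs: "spine_list xs" using exists_spine_list .
  have S: "set xs = spine V K" "2 \<le> card (set xs)" "2 \<le> length xs" using xs spine_card[OF xs] by (auto simp: spine_list_def)
  have reach: "(neighbor Q)\<^sup>*\<^sup>* u v" if "u \<in> V" "v \<in> V" for u v
  proof -
    have "\<forall>v b. v \<in> V \<and> face K (v, b) = F \<longrightarrow> (neighbor Q)\<^sup>*\<^sup>* u v" if "linked (face K) V (face K (u, True)) F" for F
      using that
    proof (induction rule: rtranclp_induct)
      case base
      show ?case
      proof (intro allI impI)
        fix v b assume v: "v \<in> V \<and> face K (v, b) = face K (u, True)"
        show "(neighbor Q)\<^sup>*\<^sup>* u v"
        proof (cases "u = v")
          case False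
          then have "neighbor Q u v" using v \<open>u \<in> V\<close> unfolding neighbor_iff by metis
          then show ?thesis by blast
        qed simp
      qed
    next
      case (step F F')
      obtain x d where x: "x \<in> V" "F = face K (x, d)" "F' = face K (x, \<not> d)" using step(2) by (auto simp: adj_def)
      have ux: "(neighbor Q)\<^sup>*\<^sup>* u x" using step(3) x by blast
      show ?case
      proof (intro allI impI)
        fix v b assume v: "v \<in> V \<and> face K (v, b) = F'"
        show "(neighbor Q)\<^sup>*\<^sup>* u v"
        proof (cases "x = v")
          case False
          then have "neighbor Q x v" using v x unfolding neighbor_iff by metis
          then show ?thesis using ux by (rule rtranclp.rtrancl_into_rtrancl[rotated])
        qed (use ux in simp)
      qed
    qed
    then show ?thesis using conn[of "face K (u, True)" "face K (v, True)"] that face_in by (metis in_halves(1))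
  qed
  have connQ: "connected_quiver Q" using V_nonempty reach by (simp add: connected_quiver_def)
  have uniq: "\<exists>!S. \<exists>xs h. set xs = S \<and> central_cycle m Q xs h"
    using central_cycle_xs[OF xs] central_cycle_spine S(1) by metis
  have simp: "if length xs = 2
         then (\<exists>c\<le>m. arr Q (xs ! 0) (xs ! 1) c = 2 \<and> arr Q (xs ! 1) (xs ! 0) (m - c) = 2) \<and>
              (\<forall>u\<in>verts Q. \<forall>v\<in>verts Q. u \<noteq> v \<and> {u, v} \<noteq> set xs \<longrightarrow> mult m Q u v \<le> 1)
         else simple m Q"
  proof (cases "length xs = 2")
    case True
    have m2: "mult m Q (xs ! 0) (xs ! 1) = 2" using central_cycle_xs[OF xs] True by (auto simp: central_cycle_def)
    have V: "xs ! 0 \<in> V" "xs ! 1 \<in> V" "xs ! 0 \<noteq> xs ! 1"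
      using spine_faces_of(3-5)[OF xs, of 0] spine_V True by (auto simp: cyc_next_def)
    obtain n c where c: "c \<le> m" "arr Q (xs ! 0) (xs ! 1) = single n c" using arr_single[OF V] .
    then have "n = 2" using m2 by (simp add: mult_def single_def)
    then have "arr Q (xs ! 0) (xs ! 1) c = 2" using c by (simp add: single_def)
    moreover from this have "arr Q (xs ! 1) (xs ! 0) (m - c) = 2" using arr_skew[OF c(1)] by metis
    ultimately show ?thesis using True c(1) mult_le S(1) by auto
  next
    case False
    have "mult m Q u v \<le> 1" if "u \<in> V" "v \<in> V" "u \<noteq> v" for u v
    proof -
      have "card {u, v} = 2" using that by simp
      then have "{u, v} \<noteq> spine V K" using spine_card[OF xs] False by auto
      then show ?thesis using mult_le that by blast
    qed
    then show ?thesis using False by (simp add: simple_def)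
  qed
  have cliques: "\<exists>C B. vertex_cliques m Q (set xs) v C B" if "v \<in> V" for v
    using vertex_cliques_fv[OF that S(1,2), of True] by blast
  show ?thesis
    unfolding class_A_tilde_def mem_Collect_eq
    using colored_quiv connQ card_V uniq
  proof (intro conjI exI[of _ xs] exI[of _ "q - nQ"] exI[of _ "disc xs"] allI ballI impI)
    show "central_cycle m Q xs (q - nQ)" by (rule central_cycle_xs[OF xs])
    show "if length xs = 2
         then (\<exists>c\<le>m. arr Q (xs ! 0) (xs ! 1) c = 2 \<and> arr Q (xs ! 1) (xs ! 0) (m - c) = 2) \<and>
              (\<forall>u\<in>verts Q. \<forall>v\<in>verts Q. u \<noteq> v \<and> {u, v} \<noteq> set xs \<longrightarrow> mult m Q u v \<le> 1)
         else simple m Q" by (rule simp)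
    show "hole m Q S \<longleftrightarrow> 4 \<le> length xs \<and> S = set xs" for S by (rule hole_iff[OF xs])
    show "\<exists>C B. vertex_cliques m Q (set xs) v C B" if "v \<in> verts Q" for v using cliques that by simp
    show "boundary_cliques m Q xs (disc xs)" by (rule boundary_cliques_disc[OF xs])
    show "admissible m Q x y z" if "triangle Q x y z \<and> \<not> (length xs = 3 \<and> {x, y, z} = set xs)" for x y z
      using triangles_admissible[OF xs] that by blast
    show "decomposition m p q Q xs (q - nQ) (disc xs)" by (rule decomposition_disc[OF xs])
  qed (simp_all add: colored_quiv connQ card_V uniq)
qed

end

section \<open>Configurations of the quivers in the class\<close>

locale tilde =
  fixes m p q :: nat and Q :: "'a cquiver" and xs :: "'a list" and h :: nat and D :: "nat \<Rightarrow> 'a set"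
  assumes m_pos: "1 \<le> m" and pq_pos: "1 \<le> p" "1 \<le> q"
    and colored: "colored_quiver m Q" and connected: "connected_quiver Q" and card_V: "card (verts Q) = p + q"
    and central_xs: "central_cycle m Q xs h"
    and simp_xs: "if length xs = 2
         then (\<exists>c\<le>m. arr Q (xs ! 0) (xs ! 1) c = 2 \<and> arr Q (xs ! 1) (xs ! 0) (m - c) = 2) \<and>
              (\<forall>u\<in>verts Q. \<forall>v\<in>verts Q. u \<noteq> v \<and> {u, v} \<noteq> set xs \<longrightarrow> mult m Q u v \<le> 1)
         else simple m Q"
    and holes: "\<And>S. hole m Q S \<longleftrightarrow> length xs \<ge> 4 \<and> S = set xs"
    and cliques: "\<And>v. v \<in> verts Q \<Longrightarrow> card (neighbors Q v) \<ge> 1 \<Longrightarrow> \<exists>C B. vertex_cliques m Q (set xs) v C B"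
    and boundary: "boundary_cliques m Q xs D"
    and triangles: "\<And>x y z. triangle Q x y z \<Longrightarrow> \<not> (length xs = 3 \<and> {x, y, z} = set xs) \<Longrightarrow> admissible m Q x y z"
    and decomp: "decomposition m p q Q xs h D"
begin

abbreviation "V \<equiv> verts Q"
abbreviation "S \<equiv> set xs"
abbreviation "l \<equiv> length xs"
abbreviation "R \<equiv> remove_boundary Q xs D"
abbreviation "W \<equiv> peripheral xs D"
abbreviation "nbr \<equiv> neighbor Q"

lemma finite_V: "finite V"
  using colored by (simp add: colored_quiver_def)

lemma nbrD: "nbr u v \<Longrightarrow> u \<in> V \<and> v \<in> V \<and> u \<noteq> v"
  using colored unfolding colored_quiver_def neighbor_def by metis

lemma arr_skew: "c \<le> m \<Longrightarrow> arr Q u v c = arr Q v u (m - c)"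
  using colored unfolding colored_quiver_def by blast

lemma arr_le: "arr Q u v c \<noteq> 0 \<Longrightarrow> c \<le> m"
  using colored unfolding colored_quiver_def by blast

lemma arr_unique: "arr Q u v c \<noteq> 0 \<Longrightarrow> arr Q u v c' \<noteq> 0 \<Longrightarrow> c = c'"
  using colored unfolding colored_quiver_def by metis

lemma nbr_sym: "nbr u v \<Longrightarrow> nbr v u"
  using arr_skew arr_le unfolding neighbor_def by metis

lemma arr_color: "nbr u v \<Longrightarrow> arr Q u v (color Q u v) \<noteq> 0"
  unfolding color_def neighbor_def by (rule theI') (use arr_unique in blast)

lemma color_eq: "arr Q u v c \<noteq> 0 \<Longrightarrow> color Q u v = c"
  unfolding color_def by (rule the_equality) (use arr_unique in auto)

lemma color_le: "nbr u v \<Longrightarrow> color Q u v \<le> m"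
  using arr_color arr_le by blast

lemma color_sum: "nbr u v \<Longrightarrow> color Q u v + color Q v u = m"
proof -
  assume n: "nbr u v"
  have "arr Q v u (m - color Q u v) \<noteq> 0" using arr_color[OF n] arr_skew[OF color_le[OF n], of u v] by simp
  then have "color Q v u = m - color Q u v" by (rule color_eq)
  then show ?thesis using color_le[OF n] by simp
qed

lemma arr_mult: "arr Q u v c = (if nbr u v \<and> c = color Q u v then mult m Q u v else 0)"
proof (cases "nbr u v")
  case True
  have z: "arr Q u v t = 0" if "t \<noteq> color Q u v" for t using that color_eq[of u v t] by auto
  have "mult m Q u v = (\<Sum>t\<in>{color Q u v}. arr Q u v t)"
    unfolding mult_def using color_le[OF True] z by (intro sum.mono_neutral_right) auto
  then show ?thesis using True z by auto
next
  case False
  then show ?thesis by (simp add: neighbor_def)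
qed

lemma mult_nbr: "mult m Q u v \<noteq> 0 \<longleftrightarrow> nbr u v"
proof
  assume "nbr u v"
  then show "mult m Q u v \<noteq> 0" using arr_mult[of u v "color Q u v"] arr_color[of u v] by simp
next
  assume "mult m Q u v \<noteq> 0"
  then show "nbr u v" by (auto simp: mult_def neighbor_def)
qed

lemma xs: "distinct xs" "S \<subseteq> V" "2 \<le> l" "0 < h" "h < l"
  and xs_sum: "(\<Sum>i<l. color Q (xs ! i) (cyc_next xs i)) = h * m"
  using central_xs by (auto simp: central_cycle_def central_def induces_cycle_def split: if_splits)

lemma card_S: "card S = l"
  using xs(1) by (rule distinct_card)

lemma mult_one: "nbr u v \<Longrightarrow> \<not> (l = 2 \<and> {u, v} = S) \<Longrightarrow> mult m Q u v = 1"
proof -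
  assume n: "nbr u v" "\<not> (l = 2 \<and> {u, v} = S)"
  then have "mult m Q u v \<le> 1" using simp_xs nbrD[OF n(1)] by (auto simp: simple_def split: if_splits)
  then show ?thesis using mult_nbr[of u v] n(1) by linarith
qed

lemma mult_S: "l = 2 \<Longrightarrow> u \<in> S \<Longrightarrow> v \<in> S \<Longrightarrow> u \<noteq> v \<Longrightarrow> mult m Q u v = 2"
proof -
  assume l: "l = 2" and uv: "u \<in> S" "v \<in> S" "u \<noteq> v"
  obtain c where c: "arr Q (xs ! 0) (xs ! 1) c = 2" "arr Q (xs ! 1) (xs ! 0) (m - c) = 2" using simp_xs l by auto
  have "(u = xs ! 0 \<and> v = xs ! 1) \<or> (u = xs ! 1 \<and> v = xs ! 0)"
    using uv l by (auto simp: in_set_conv_nth less_2_cases_iff)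
  then show ?thesis using c arr_mult[of "xs ! 0" "xs ! 1" c] arr_mult[of "xs ! 1" "xs ! 0" "m - c"] by (auto split: if_splits)
qed

lemma cyc_xs: "3 \<le> l \<Longrightarrow> induces_cycle m Q xs"
  using central_xs by (auto simp: central_cycle_def split: if_splits)

lemma nbr_S:
  assumes "3 \<le> l" "i < l" "j < l"
  shows "nbr (xs ! i) (xs ! j) \<longleftrightarrow> j = Suc i mod l \<or> i = Suc j mod l"
proof -
  have "mult m Q (xs ! i) (xs ! j) = (if j = Suc i mod l \<or> i = Suc j mod l then 1 else 0)"
    using cyc_xs[OF assms(1)] assms by (simp add: induces_cycle_def)
  then show ?thesis using mult_nbr[of "xs ! i" "xs ! j"] by (metis zero_neq_one)
qed

lemma nbr_next: "i < l \<Longrightarrow> nbr (xs ! i) (cyc_next xs i)"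
proof (cases "3 \<le> l")
  case True
  assume i: "i < l"
  then have "Suc i mod l < l" by (intro mod_less_divisor) auto
  then show ?thesis using nbr_S[OF True i] by (simp add: cyc_next_def)
next
  case False
  assume i: "i < l"
  have l2: "l = 2" using xs False by linarith
  have "cyc_next xs i \<in> S" "xs ! i \<in> S" "cyc_next xs i \<noteq> xs ! i"
    using i l2 xs(1) by (auto simp: cyc_next_def nth_eq_iff_index_eq less_2_cases_iff)
  then have "mult m Q (xs ! i) (cyc_next xs i) = 2" using mult_S[OF l2] by metis
  then show ?thesis using mult_nbr[of "xs ! i" "cyc_next xs i"] by simp
qed

lemma has_nbr: "v \<in> V \<Longrightarrow> card (neighbors Q v) \<ge> 1"
proof -
  assume v: "v \<in> V"
  have "V \<noteq> {v}" using card_V pq_pos by auto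
  then obtain u where u: "u \<in> V" "u \<noteq> v" using v by auto
  then have "nbr\<^sup>*\<^sup>* v u" using connected v by (simp add: connected_quiver_def)
  then obtain w where "nbr v w" using u by (metis converse_rtranclpE)
  then have "w \<in> neighbors Q v" using nbrD by (auto simp: neighbors_def)
  moreover have "finite (neighbors Q v)" using finite_V by (auto simp: neighbors_def)
  ultimately show ?thesis by (auto simp: Suc_le_eq card_gt_0_iff)
qed

lemma obtain_cliques: "v \<in> V \<Longrightarrow> \<exists>C B. vertex_cliques m Q S v C B"
  using cliques has_nbr by blast

lemma clique_nbr: "clique Q C \<Longrightarrow> u \<in> C \<Longrightarrow> v \<in> C \<Longrightarrow> u \<noteq> v \<Longrightarrow> nbr u v"
  by (simp add: clique_def)

text \<open>The central triangle extends to no larger clique: the colors of the four triangles would not add up.\<close>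

lemma no_K4:
  assumes l3: "l = 3" and C: "clique Q C" "S \<subseteq> C" and z: "z \<in> C" "z \<notin> S"
  shows False
proof -
  obtain x y w where xyw: "xs = [x, y, w]" using l3 by (auto simp: length_Suc_conv numeral_3_eq_3)
  have d: "x \<noteq> y" "y \<noteq> w" "x \<noteq> w" "z \<noteq> x" "z \<noteq> y" "z \<noteq> w" using xs(1) z xyw by auto
  have S: "S = {x, y, w}" using xyw by auto
  have inC: "x \<in> C" "y \<in> C" "w \<in> C" using C S by auto
  have cl: "clique Q {a, b, z}" if "a \<in> C" "b \<in> C" for a b using C(1) that z by (auto simp: clique_def)
  have adm: "admissible m Q a b z" if "a \<in> C" "b \<in> C" "a \<noteq> b" "a \<noteq> z" "b \<noteq> z" for a b
  proof (rule triangles)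
    show "triangle Q a b z" using cl[OF that(1,2)] that by (auto simp: triangle_def card_insert_if)
    show "\<not> (l = 3 \<and> {a, b, z} = S)" using z by auto
  qed
  have a: "admissible m Q x y z" "admissible m Q y w z" "admissible m Q w x z" using adm inC d by auto
  have n: "nbr x z" "nbr y z" "nbr w z" using clique_nbr[OF C(1)] inC z d by auto
  have "(\<Sum>i<l. color Q (xs ! i) (cyc_next xs i)) = color Q x y + color Q y w + color Q w x"
  proof -
    have "{..<l} = {0, 1, 2}" using l3 by auto
    then show ?thesis using xyw by (simp add: cyc_next_def)
  qed
  then have s: "color Q x y + color Q y w + color Q w x = h * m" using xs_sum by simp
  have "h = 1 \<or> h = 2" using xs(4,5) l3 by linarith
  then have "h * m = m \<or> h * m = 2 * m" by auto
  moreover have "color Q x y + color Q y z + color Q z x = m - 1 \<or> color Q x y + color Q y z + color Q z x = 2 * m + 1"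
    "color Q y w + color Q w z + color Q z y = m - 1 \<or> color Q y w + color Q w z + color Q z y = 2 * m + 1"
    "color Q w x + color Q x z + color Q z w = m - 1 \<or> color Q w x + color Q x z + color Q z w = 2 * m + 1"
    using a unfolding admissible_def triangle_color_def by blast+
  moreover note s color_sum[OF n(1)] color_sum[OF n(2)] color_sum[OF n(3)] m_pos
  \<comment> \<open>In the sum over the three triangles at \<open>z\<close>, the colors at
    \<open>z\<close> pair up to \<open>3 * m\<close>, so the total is \<open>4 * m\<close> or
    \<open>5 * m\<close>. Admissible triangles give \<open>3 * m - 3\<close>,
    \<open>4 * m - 1\<close>, \<open>5 * m + 1\<close> or \<open>6 * m + 3\<close>.\<close>
  ultimately show False by (elim disjE) linarith+
qed

text \<open>A form of the clique condition that is uniform in \<open>l\<close>. The last conjunct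
  goes beyond \<open>vertex_cliques\<close>: for \<open>l = 3\<close> that condition also admits the
  central triangle as a clique at a central vertex, although it is not a polygon.\<close>

definition good :: "'a \<Rightarrow> 'a set \<Rightarrow> 'a set \<Rightarrow> bool" where
  "good v C B \<longleftrightarrow> clique Q C \<and> clique Q B \<and> v \<in> C \<and> v \<in> B \<and> C \<union> B = insert v (neighbors Q v) \<and>
     C \<inter> B = (if l = 2 \<and> v \<in> S then S else {v}) \<and>
     (\<forall>u\<in>C - B. \<forall>w\<in>B - C. nbr u w \<longrightarrow> l = 3 \<and> {u, v, w} = S) \<and>
     (l = 3 \<longrightarrow> \<not> S \<subseteq> C \<and> \<not> S \<subseteq> B)"

lemma good_swap: "good v C B \<Longrightarrow> good v B C"
proof -
  assume g: "good v C B"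
  have "l = 3 \<and> {w, v, u} = S" if "w \<in> B - C" "u \<in> C - B" "nbr w u" for u w
  proof -
    have "l = 3 \<and> {u, v, w} = S" using g that nbr_sym unfolding good_def by blast
    moreover have "{u, v, w} = {w, v, u}" by auto
    ultimately show ?thesis by simp
  qed
  then show ?thesis using g unfolding good_def by (simp add: Un_commute Int_commute)
qed

definition split_at :: "'a \<Rightarrow> 'a set \<Rightarrow> 'a set \<Rightarrow> bool" where
  "split_at v C B \<longleftrightarrow> clique Q C \<and> clique Q B \<and> v \<in> C \<and> v \<in> B \<and> C \<union> B = insert v (neighbors Q v) \<and>
     C \<inter> B = {v} \<and> (\<forall>u\<in>C - {v}. \<forall>w\<in>B - {v}. nbr u w \<longrightarrow> l = 3 \<and> {u, v, w} = S)"

lemma split_atI: "vertex_cliques m Q S v C B \<Longrightarrow> 3 \<le> l \<or> v \<notin> S \<Longrightarrow> split_at v C B"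
  unfolding vertex_cliques_def split_at_def card_S by simp

lemma split_at_swap: "split_at v C B \<Longrightarrow> split_at v B C"
proof -
  assume g: "split_at v C B"
  have "l = 3 \<and> {w, v, u} = S" if "w \<in> B - {v}" "u \<in> C - {v}" "nbr w u" for u w
  proof -
    have "l = 3 \<and> {u, v, w} = S" using g that nbr_sym unfolding split_at_def by blast
    moreover have "{u, v, w} = {w, v, u}" by auto
    ultimately show ?thesis by simp
  qed
  then show ?thesis using g unfolding split_at_def by (simp add: Un_commute Int_commute)
qed

lemma split_at_good:
  assumes s: "split_at v C B" and n: "\<not> (l = 2 \<and> v \<in> S)" "l = 3 \<Longrightarrow> \<not> S \<subseteq> C \<and> \<not> S \<subseteq> B"
  shows "good v C B"
proof -
  have cap: "C \<inter> B = {v}" using s by (simp add: split_at_def)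
  then have "l = 3 \<and> {u, v, w} = S" if "u \<in> C - B" "w \<in> B - C" "nbr u w" for u w
    using s that unfolding split_at_def by blast
  moreover have "(if l = 2 \<and> v \<in> S then S else {v}) = {v}" using n(1) by auto
  ultimately show ?thesis using s n(2) unfolding good_def split_at_def by simp
qed

text \<open>A clique at a vertex outside the central triangle cannot contain the triangle, by
  \<open>no_K4\<close>.\<close>

lemma good_outside:
  assumes v: "v \<notin> S" and s: "split_at v C B"
  shows "good v C B"
  using no_K4[of C v] no_K4[of B v] v s by (intro split_at_good[OF s]) (auto simp: split_at_def)

lemma max_candidate:
  assumes l: "3 \<le> l" and i: "i < l" and C: "boundary_candidate Q xs i C"
    and sub: "\<And>C'. boundary_candidate Q xs i C' \<Longrightarrow> C' \<subseteq> C"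
  shows "D i = C"
proof -
  have "max_boundary_clique Q xs i (D i)" using boundary l i by (auto simp: boundary_cliques_def)
  then have "boundary_candidate Q xs i (D i)" "\<not> D i \<subset> C" using C by (auto simp: max_boundary_clique_def)
  then show ?thesis using sub by blast
qed

text \<open>A shortest path outside \<open>S\<close> from a neighbor of \<open>a\<close> to a
  neighbor of \<open>b\<close>, closed up by the edge between \<open>a\<close> and \<open>b\<close>,
  is an induced cycle. Since \<open>a\<close> and \<open>b\<close> have no common neighbor outside
  \<open>S\<close>, it has at least four vertices and is a hole, which does not exist for
  \<open>l = 3\<close>.\<close>

lemma path_hole:
  assumes l: "l = 3" and ab: "a \<in> S" "b \<in> S" "a \<noteq> b" "nbr a b"
    and z: "z \<in> V - S" "nbr z a" and w: "w \<in> V - S" "nbr w b"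
    and path: "(\<lambda>u v. nbr u v \<and> u \<notin> S \<and> v \<notin> S)\<^sup>*\<^sup>* z w"
    and no: "\<And>u. u \<notin> S \<Longrightarrow> nbr u a \<Longrightarrow> \<not> nbr u b"
  shows False
proof -
  let ?E = "\<lambda>u v. nbr u v \<and> u \<notin> S \<and> v \<notin> S"
  \<comment> \<open>The length is minimized over the end points as well, so that only the first
    vertex of the path neighbors \<open>a\<close> and only the last one neighbors
    \<open>b\<close>.\<close>
  let ?P = "\<lambda>n. \<exists>z w. z \<in> V - S \<and> nbr z a \<and> w \<in> V - S \<and> nbr w b \<and> (?E ^^ n) z w"
  obtain n0 where "(?E ^^ n0) z w" using path unfolding rtranclp_power by blast
  then have "\<exists>n. ?P n" using z w by blast
  then obtain n where Pn: "?P n" and least: "\<And>k. k < n \<Longrightarrow> \<not> ?P k"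
  proof -
    assume ex: "\<exists>n. ?P n" and *: "\<And>n. ?P n \<Longrightarrow> (\<And>k. k < n \<Longrightarrow> \<not> ?P k) \<Longrightarrow> thesis"
    show thesis by (rule *[OF LeastI_ex[OF ex]]) (rule not_less_Least)
  qed
  then obtain z w where zw: "z \<in> V - S" "nbr z a" "w \<in> V - S" "nbr w b" "(?E ^^ n) z w" by blast
  then obtain f where f: "f 0 = z" "f n = w" "\<And>i. i < n \<Longrightarrow> ?E (f i) (f (Suc i))"
    unfolding relpowp_fun_conv by blast
  have fV: "f i \<in> V - S" if "i \<le> n" for i
  proof (cases "i = n")
    case False
    then have "?E (f i) (f (Suc i))" using f(3) that by simp
    then show ?thesis using nbrD by blast
  qed (use f zw in simp)
  have seg: "(?E ^^ (j - i)) (f i) (f j)" if "i \<le> j" "j \<le> n" for i j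
    unfolding relpowp_fun_conv using f(3) that by (intro exI[of _ "\<lambda>k. f (i + k)"]) auto
  have na: "\<not> nbr (f i) a" if "0 < i" "i \<le> n" for i
  proof
    assume "nbr (f i) a"
    then have "?P (n - i)" using fV[OF that(2)] zw seg[OF that(2) order_refl] f(2) by blast
    then show False using least[of "n - i"] that by simp
  qed
  have nb: "\<not> nbr (f i) b" if "i < n" for i
  proof
    assume "nbr (f i) b"
    moreover have "(?E ^^ i) z (f i)" using seg[of 0 i] that f(1) by simp
    moreover have "f i \<in> V - S" using fV[of i] that by simp
    ultimately show False using zw(1,2) least[OF that] by blast
  qed
  \<comment> \<open>A repetition or a chord would shorten the path.\<close>
  have short: "j \<le> Suc i" if ij: "i < j" "j \<le> n" "f i = f j \<or> nbr (f i) (f j)" for i j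
  proof (rule ccontr)
    assume "\<not> j \<le> Suc i"
    then have j: "Suc i < j" by simp
    have "(?E ^^ i) z (f i)" "(?E ^^ (n - j)) (f j) w" using seg[of 0 i] seg[of j n] ij f by auto
    note ends = this
    obtain k where k: "k \<le> Suc 0" "(?E ^^ k) (f i) (f j)"
    proof (cases "f i = f j")
      case True
      then show ?thesis using that[of 0] by simp
    next
      case False
      then show ?thesis using that[of "Suc 0"] ij fV[of i] fV[of j] by auto
    qed
    have "(?E ^^ (i + k + (n - j))) z w"
      unfolding relpowp_add using ends k(2) by (intro relcomppI)
    moreover have "i + k + (n - j) < n" using j ij k(1) by linarith
    ultimately show False using least[of "i + k + (n - j)"] zw(1-4) by blast
  qed
  have n0: "0 < n" using no[of z] zw f by (cases n) auto
  have inj: "f i \<noteq> f j" if "i < j" "j \<le> n" for i j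
  proof
    assume eq: "f i = f j"
    then have "j = Suc i" using short[OF that] that by simp
    then show False using f(3)[of i] that eq nbrD by auto
  qed
  \<comment> \<open>The cycle is \<open>a\<close>, then \<open>f 0, \<dots>, f n\<close>, then
    \<open>b\<close>.\<close>
  define g where "g i = (if i = 0 then a else if i \<le> n + 1 then f (i - 1) else b)" for i
  define ys where "ys = map g [0..<n + 3]"
  have len: "length ys = n + 3" and nth: "\<And>i. i < n + 3 \<Longrightarrow> ys ! i = g i" by (auto simp: ys_def)
  have aS: "a \<noteq> f i" "b \<noteq> f i" if "i \<le> n" for i using fV[OF that] ab by auto
  have gi: "g i \<noteq> g j" if ij: "i < j" "j < n + 3" for i j
  proof -
    consider "i = 0" "j = n + 2" | "i = 0" "j \<le> n + 1" | "0 < i" "j \<le> n + 1" | "0 < i" "j = n + 2" using ij by linarith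
    then show ?thesis
    proof cases
      case 2
      then show ?thesis using ij aS(1)[of "j - 1"] by (simp add: g_def)
    next
      case 3
      then show ?thesis using ij inj[of "i - 1" "j - 1"] by (simp add: g_def)
    next
      case 4
      then have "i - 1 \<le> n" using ij by linarith
      then show ?thesis using 4 ij aS(2)[of "i - 1"] by (auto simp: g_def)
    qed (use ab in \<open>simp add: g_def\<close>)
  qed
  have gn: "nbr (g i) (g j) \<longleftrightarrow> j = Suc i \<or> (i = 0 \<and> j = n + 2)" if ij: "i < j" "j < n + 3" for i j
  proof -
    consider "i = 0" "j = n + 2" | "i = 0" "0 < j" "j \<le> n + 1" | "0 < i" "j \<le> n + 1" | "0 < i" "j = n + 2" using ij by linarith
    then show ?thesis
    proof cases
      case 1
      then show ?thesis using ab by (simp add: g_def)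
    next
      case 2
      then have g: "g i = a" "g j = f (j - 1)" by (auto simp: g_def)
      show ?thesis
      proof (cases "j = 1")
        case True
        then show ?thesis using g 2 zw f(1) nbr_sym by auto
      next
        case False
        then have "0 < j - 1" "j - 1 \<le> n" using 2 by linarith+
        then have "\<not> nbr a (f (j - 1))" using na[of "j - 1"] nbr_sym by blast
        then show ?thesis using g 2 False by auto
      qed
    next
      case 3
      then have g: "g i = f (i - 1)" "g j = f (j - 1)" using ij by (auto simp: g_def)
      have "nbr (f (i - 1)) (f (j - 1)) \<longleftrightarrow> j = Suc i"
      proof
        assume "nbr (f (i - 1)) (f (j - 1))"
        then have "j - 1 \<le> Suc (i - 1)" using short[of "i - 1" "j - 1"] 3 ij by auto
        then show "j = Suc i" using 3 ij by linarith
      next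
        assume "j = Suc i"
        then show "nbr (f (i - 1)) (f (j - 1))" using f(3)[of "i - 1"] 3 ij by simp
      qed
      then show ?thesis using g 3 by auto
    next
      case 4
      then have g: "g i = f (i - 1)" "g j = b" using ij by (auto simp: g_def)
      show ?thesis
      proof (cases "i = n + 1")
        case True
        then show ?thesis using g 4 zw f(2) by simp
      next
        case False
        then show ?thesis using g 4 nb[of "i - 1"] ij by auto
      qed
    qed
  qed
  have ind: "induces_cycle m Q ys"
    unfolding induces_cycle_def len
  proof (intro conjI allI impI)
    show "distinct ys" unfolding distinct_conv_nth len using nth gi by (metis nat_neq_iff)
    show "set ys \<subseteq> V"
    proof
      fix y assume "y \<in> set ys"
      then obtain i where "i < n + 3" "y = g i" using nth len by (metis in_set_conv_nth)
      then show "y \<in> V" using ab xs(2) fV[of "i - 1"] by (auto simp: g_def)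
    qed
    fix i j assume ij: "i < n + 3" "j < n + 3"
    have m1: "mult m Q (ys ! i) (ys ! j) = of_bool (nbr (g i) (g j))"
      using mult_one[of "g i" "g j"] mult_nbr[of "g i" "g j"] nth ij l by auto
    have "nbr (g i) (g j) \<longleftrightarrow> j = Suc i mod (n + 3) \<or> i = Suc j mod (n + 3)"
    proof (cases i j rule: linorder_cases)
      case less
      then show ?thesis using gn[OF less ij(2)] ij by (auto simp: mod_Suc)
    next
      case equal
      then have "\<not> nbr (g i) (g j)" using nbrD by blast
      moreover have "j \<noteq> Suc j mod (n + 3)" using ij by (auto simp: mod_Suc)
      ultimately show ?thesis using equal by auto
    next
      case greater
      have "nbr (g i) (g j) \<longleftrightarrow> nbr (g j) (g i)" using nbr_sym by blast
      then show ?thesis using gn[OF greater ij(1)] ij greater by (auto simp: mod_Suc)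
    qed
    then show "mult m Q (ys ! i) (ys ! j) = (if j = Suc i mod (n + 3) \<or> i = Suc j mod (n + 3) then 1 else 0)"
      using m1 by simp
  qed simp
  moreover have "card (set ys) = n + 3" using ind distinct_card[of ys] len by (simp add: induces_cycle_def)
  ultimately have "hole m Q (set ys)" using n0 by (auto simp: hole_def)
  then show False using holes l by simp
qed

definition prv :: "nat \<Rightarrow> nat" where
  "prv i = (i + l - 1) mod l"

lemma l_pos: "0 < l"
  using xs(3) by linarith

lemma next_lt: "Suc i mod l < l"
  using l_pos by simp

lemma prv_lt: "prv i < l"
  using l_pos by (simp add: prv_def)

lemma next_prv: "i < l \<Longrightarrow> Suc (prv i) mod l = i"
  using l_pos by (cases i) (auto simp: prv_def mod_Suc)

lemma prv_next: "i < l \<Longrightarrow> prv (Suc i mod l) = i"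
  using l_pos by (auto simp: prv_def mod_Suc)

lemma prv_eq: "i < l \<Longrightarrow> prv i = (if i = 0 then l - 1 else i - 1)"
proof (cases i)
  case (Suc j)
  assume "i < l"
  then have "prv i = (j + l) mod l" "j < l" using Suc by (auto simp: prv_def)
  then show ?thesis using Suc by simp
qed (use l_pos in \<open>simp add: prv_def\<close>)

lemma cyc_prv: "i < l \<Longrightarrow> cyc_next xs (prv i) = xs ! i"
  by (simp add: cyc_next_def next_prv)

lemma next_in_S: "cyc_next xs i \<in> S"
  using next_lt by (simp add: cyc_next_def)

lemma prv_next_neq: "3 \<le> l \<Longrightarrow> i < l \<Longrightarrow> xs ! prv i \<noteq> cyc_next xs i"
proof -
  assume "3 \<le> l" "i < l"
  then have "prv i \<noteq> Suc i mod l" by (auto simp: prv_eq mod_Suc)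
  then show ?thesis using xs(1) next_lt[of i] prv_lt[of i] by (simp add: cyc_next_def nth_eq_iff_index_eq)
qed

lemma three_S: "l = 3 \<Longrightarrow> i < l \<Longrightarrow> S = {xs ! prv i, xs ! i, cyc_next xs i}"
proof -
  assume l: "l = 3" and i: "i < l"
  then obtain x y w where "xs = [x, y, w]" by (auto simp: length_Suc_conv numeral_3_eq_3)
  moreover have "i = 0 \<or> i = 1 \<or> i = 2" using i l by auto
  moreover have "xs ! prv i = xs ! (if i = 0 then l - 1 else i - 1)" using i prv_eq by simp
  ultimately show ?thesis by (auto simp: cyc_next_def)
qed

lemma split_outside: "split_at v C B \<Longrightarrow> u \<in> C \<Longrightarrow> u \<noteq> v \<Longrightarrow> w \<in> B \<Longrightarrow> w \<noteq> v \<Longrightarrow> nbr u w \<Longrightarrow> l = 3 \<and> {u, v, w} = S"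
proof -
  assume s: "split_at v C B" and "u \<in> C" "u \<noteq> v" "w \<in> B" "w \<noteq> v" "nbr u w"
  then have "u \<in> C - {v}" "w \<in> B - {v}" by auto
  moreover have "\<forall>u\<in>C - {v}. \<forall>w\<in>B - {v}. nbr u w \<longrightarrow> l = 3 \<and> {u, v, w} = S"
    using s unfolding split_at_def by (elim conjE)
  ultimately show ?thesis using \<open>nbr u w\<close> by blast
qed

lemma split_nbr: "split_at v C B \<Longrightarrow> nbr u v \<Longrightarrow> u \<in> C \<or> u \<in> B"
proof -
  assume s: "split_at v C B" and u: "nbr u v"
  have "u \<in> neighbors Q v" using nbrD[OF u] nbr_sym[OF u] by (simp add: neighbors_def)
  moreover have "C \<union> B = insert v (neighbors Q v)" using s by (simp only: split_at_def)
  ultimately show ?thesis by blast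
qed

text \<open>A vertex of another clique through \<open>v\<close> and \<open>n\<close> that is not in
  \<open>C\<close> lies in \<open>B\<close> and neighbors \<open>n\<close>. This happens only for
  the central triangle, and by \<open>no_K4\<close> no larger clique contains that triangle.\<close>

lemma boundary_split:
  assumes l: "3 \<le> l" and j: "j < l" and e: "{xs ! j, cyc_next xs j} = {v, n}" and s: "split_at v C B"
    and n: "n \<in> C" and S: "\<not> (l = 3 \<and> S \<subseteq> C)"
  shows "D j = C"
proof (rule max_candidate[OF l j])
  have C: "clique Q C" "v \<in> C" using s by (auto simp: split_at_def)
  then show "boundary_candidate Q xs j C" unfolding boundary_candidate_def e using n S by blast
  fix C' assume C': "boundary_candidate Q xs j C'"
  then have "clique Q C'" "{v, n} \<subseteq> C'" "\<not> (l = 3 \<and> C' = S)" unfolding boundary_candidate_def e by blast+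
  then have c: "clique Q C'" "v \<in> C'" "n \<in> C'" "\<not> (l = 3 \<and> C' = S)" by blast+
  have vn: "v \<noteq> n" using nbr_next[OF j] nbrD e by (metis doubleton_eq_iff)
  show "C' \<subseteq> C"
  proof
    fix x assume x: "x \<in> C'"
    show "x \<in> C"
    proof (rule ccontr)
      assume xC: "x \<notin> C"
      then have d: "x \<noteq> v" "x \<noteq> n" using C n by auto
      have xn: "nbr x v" "nbr n x" using clique_nbr[OF c(1) x c(2) d(1)] clique_nbr[OF c(1) c(3) x] d(2) by auto
      then have "x \<in> B" using split_nbr[OF s xn(1)] xC by simp
      then have l3: "l = 3" and S': "{n, v, x} = S" using split_outside[OF s n vn[symmetric] _ d(1) xn(2)] by simp_all
      have "{n, v, x} \<subseteq> C'" using c(2,3) x by simp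
      then have SC: "S \<subseteq> C'" unfolding S' .
      then have "C' \<noteq> S" using c(4) l3 by simp
      then obtain y where "y \<in> C'" "y \<notin> S" using SC by blast
      then show False by (rule no_K4[OF l3 c(1) SC])
    qed
  qed
qed

lemma R_nbr: "neighbor R u w \<Longrightarrow> nbr u w \<and> u \<in> V - S \<and> w \<in> V - S"
  using nbrD[of u w] unfolding neighbor_def remove_boundary_def induced_def by (auto split: if_splits)

lemma R_decomp: "verts R = (\<Union>w\<in>W. component R w)"
  "w \<in> W \<Longrightarrow> w \<in> component R w"
  "w \<in> W \<Longrightarrow> w' \<in> W \<Longrightarrow> w \<noteq> w' \<Longrightarrow> component R w \<inter> component R w' = {}"
  "w \<in> W \<Longrightarrow> \<exists>!i. i < l \<and> w \<in> D i"
  using decomp unfolding decomposition_def Let_def by blast+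

lemma verts_R: "verts R = V - S"
  by (simp add: remove_boundary_def induced_def)

lemma W_outside: "w \<in> W \<Longrightarrow> w \<in> V - S"
  using R_decomp(1,2) verts_R by blast

lemma D_clique: "i < l \<Longrightarrow> clique Q (D i) \<and> xs ! i \<in> D i \<and> cyc_next xs i \<in> D i"
proof (cases "l = 2")
  case True
  assume i: "i < l"
  have v: "vertex_cliques m Q S (xs ! i) (D 0) (D 1)" using boundary True i by (auto simp: boundary_cliques_def)
  have "i = 0 \<or> i = 1" using i True by auto
  moreover have "clique Q (D 0)" "clique Q (D 1)" using v by (auto simp: vertex_cliques_def)
  moreover have "D 0 \<inter> D 1 = S" using v i True card_S by (simp add: vertex_cliques_def)
  moreover have "xs ! i \<in> S" "cyc_next xs i \<in> S" using i next_in_S by auto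
  ultimately show ?thesis by (cases "i = 0") auto
next
  case False
  assume "i < l"
  then have "max_boundary_clique Q xs i (D i)" using boundary False by (auto simp: boundary_cliques_def)
  then show ?thesis by (auto simp: max_boundary_clique_def boundary_candidate_def)
qed

text \<open>Suppose the central triangle is one of the cliques at \<open>?v\<close>. Then no vertex
  outside \<open>S\<close> neighbors both \<open>?v\<close> and another central vertex. A further
  neighbor \<open>z\<close> of \<open>?v\<close> is connected outside \<open>S\<close> to a
  peripheral vertex \<open>w\<close>, whose boundary clique must belong to the edge opposite to
  \<open>?v\<close>. This is the situation of \<open>path_hole\<close>.\<close>

lemma corner_alone:
  assumes l: "l = 3" and i: "i < l" and s: "split_at (xs ! i) S B"
  shows "B = {xs ! i}"
proof (rule ccontr)
  let ?v = "xs ! i" let ?n = "cyc_next xs i"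
  assume "B \<noteq> {?v}"
  then obtain z where z: "z \<in> B" "z \<noteq> ?v" using s by (auto simp: split_at_def)
  have cap: "S \<inter> B = {?v}" using s by (simp add: split_at_def)
  then have zS: "z \<notin> S" using z by blast
  have zV: "z \<in> V" and zv: "nbr z ?v" using s z by (auto simp: split_at_def clique_def)
  have n: "?n \<in> S" "?n \<noteq> ?v" "nbr ?v ?n" using next_in_S nbr_next[OF i] nbrD[OF nbr_next[OF i]] by auto
  have sep: "\<not> nbr u e" if "u \<notin> S" "nbr u ?v" "e \<in> S" "e \<noteq> ?v" for u e
  proof
    assume "nbr u e"
    moreover have "u \<in> B" using split_nbr[OF s that(2)] that(1) by blast
    moreover have "u \<noteq> ?v" using that(1) i by auto
    ultimately have "{e, ?v, u} = S" using split_outside[OF s that(3,4)] nbr_sym by blast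
    then show False using that(1) by blast
  qed
  obtain w where w: "w \<in> W" "z \<in> component R w" using R_decomp(1) verts_R zV zS by blast
  have wS: "w \<in> V - S" by (rule W_outside[OF w(1)])
  obtain j where j: "j < l" "w \<in> D j" using w(1) by (auto simp: peripheral_def peripheral_at_def)
  have nw: "nbr w (xs ! j)" "nbr w (cyc_next xs j)"
    using clique_nbr[of "D j" w] D_clique[OF j(1)] j wS next_in_S by force+
  have d: "cyc_next xs j \<noteq> xs ! j" using nbrD[OF nbr_next[OF j(1)]] by auto
  have v: "?v \<noteq> xs ! j" using sep[of w "cyc_next xs j"] nw wS next_in_S d by auto
  have v': "?v \<noteq> cyc_next xs j" using sep[of w "xs ! j"] nw wS j(1) d by auto
  have "?n = xs ! j \<or> ?n = cyc_next xs j"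
  proof -
    have "{xs ! j, cyc_next xs j} \<subseteq> S - {?v}" using v v' j(1) next_in_S by auto
    moreover have "card (S - {?v}) = 2" using card_S l i by (simp add: card_Diff_singleton)
    moreover have "card {xs ! j, cyc_next xs j} = 2" using d by simp
    ultimately have "{xs ! j, cyc_next xs j} = S - {?v}" by (intro card_subset_eq) auto
    then show ?thesis using n by blast
  qed
  then have wn: "nbr w ?n" using nw by auto
  have "(neighbor R)\<^sup>*\<^sup>* w z" using w(2) by (simp add: component_def)
  then have path: "(\<lambda>u v. nbr u v \<and> u \<notin> S \<and> v \<notin> S)\<^sup>*\<^sup>* z w"
  proof (induction rule: rtranclp_induct)
    case (step y x)
    have "nbr x y \<and> x \<notin> S \<and> y \<notin> S" using R_nbr[OF step(2)] nbr_sym by blast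
    then show ?case using step(3) by (rule converse_rtranclp_into_rtranclp)
  qed simp
  show False
    by (rule path_hole[OF l _ n(1) _ n(3) _ zv wS wn path]) (use i n sep zV zS in auto)
qed

text \<open>If the clique condition was met by choosing the central triangle, \<open>?v\<close> has
  no other neighbors, and the two edges at \<open>?v\<close> can be taken as its cliques
  instead.\<close>

lemma central_split:
  assumes l: "3 \<le> l" and i: "i < l"
  obtains C B where "split_at (xs ! i) C B" "cyc_next xs i \<in> C" "xs ! prv i \<in> B" "l = 3 \<Longrightarrow> \<not> S \<subseteq> C \<and> \<not> S \<subseteq> B"
proof -
  let ?v = "xs ! i" let ?n = "cyc_next xs i" let ?r = "xs ! prv i"
  have n: "nbr ?n ?v" and r: "nbr ?r ?v"
    using nbr_next[OF i] nbr_sym nbr_next[OF prv_lt, of i] cyc_prv[OF i] by auto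
  have d: "?n \<noteq> ?v" "?r \<noteq> ?v" "?r \<noteq> ?n" using n r nbrD prv_next_neq[OF l i] by auto
  have "xs ! i \<in> V" using xs(2) i by auto
  then obtain C0 B0 where "vertex_cliques m Q S ?v C0 B0" using obtain_cliques by blast
  then have s0: "split_at ?v C0 B0" using l by (intro split_atI) auto
  obtain C B where s: "split_at ?v C B" and nC: "?n \<in> C"
    using split_nbr[OF s0 n] s0 split_at_swap[OF s0] by blast
  have cap: "C \<inter> B = {?v}" and cl: "clique Q C" "clique Q B" "?v \<in> C" using s by (auto simp: split_at_def)
  show thesis
  proof (cases "?r \<in> C")
    case False
    then have "?r \<in> B" using split_nbr[OF s r] by blast
    moreover have "\<not> S \<subseteq> C" using False nth_mem[OF prv_lt[of i]] by blast
    moreover have "\<not> S \<subseteq> B" using nC cap d(1) next_in_S by blast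
    ultimately show thesis using that[OF s nC] by blast
  next
    case True
    have "nbr ?n ?r" using clique_nbr[OF cl(1) nC True] d by auto
    then have l3: "l = 3"
      using nbr_S[OF l next_lt prv_lt, of i i] l i unfolding cyc_next_def
      by (auto simp: prv_eq mod_Suc split: if_splits)
    have SC: "S \<subseteq> C" using three_S[OF l3 i] nC True cl(3) by simp
    then have CS: "C = S" using no_K4[OF l3 cl(1)] by blast
    then have B: "B = {?v}" using corner_alone[OF l3 i] s by simp
    have un: "C \<union> B = insert ?v (neighbors Q ?v)" using s by (simp add: split_at_def)
    have S: "S = {?r, ?v, ?n}" by (rule three_S[OF l3 i])
    have V: "{?r, ?v, ?n} \<subseteq> V" using S xs(2) by simp
    have "split_at ?v {?v, ?n} {?v, ?r}"
      unfolding split_at_def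
    proof (intro conjI)
      show "clique Q {?v, ?n}" "clique Q {?v, ?r}" using V n r nbr_sym by (auto simp: clique_def)
      show "{?v, ?n} \<union> {?v, ?r} = insert ?v (neighbors Q ?v)" using un CS B S by auto
      show "{?v, ?n} \<inter> {?v, ?r} = {?v}" using d by auto
      show "\<forall>u\<in>{?v, ?n} - {?v}. \<forall>w\<in>{?v, ?r} - {?v}. nbr u w \<longrightarrow> l = 3 \<and> {u, ?v, w} = S" using l3 S by auto
    qed auto
    then show thesis using that[of "{?v, ?n}" "{?v, ?r}"] S d by auto
  qed
qed

lemma good_central:
  assumes i: "i < l"
  shows "good (xs ! i) (D i) (D (prv i))"
proof (cases "l = 2")
  case True
  have v: "vertex_cliques m Q S (xs ! i) (D 0) (D 1)" using boundary True i by (auto simp: boundary_cliques_def)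
  have c: "card S = 2" using True card_S by simp
  have "good (xs ! i) (D 0) (D 1)"
    unfolding good_def
  proof (intro conjI)
    have "D 0 \<inter> D 1 = S" "\<forall>u\<in>D 0 - S. \<forall>w\<in>D 1 - S. \<not> nbr u w"
      using v c i unfolding vertex_cliques_def by simp_all
    then show "D 0 \<inter> D 1 = (if l = 2 \<and> xs ! i \<in> S then S else {xs ! i})"
      "\<forall>u\<in>D 0 - D 1. \<forall>w\<in>D 1 - D 0. nbr u w \<longrightarrow> l = 3 \<and> {u, xs ! i, w} = S"
      using True i by auto
  qed (use v True in \<open>auto simp: vertex_cliques_def\<close>)
  moreover have "i = 0 \<and> prv i = 1 \<or> i = 1 \<and> prv i = 0" using i True by (auto simp: prv_def less_2_cases_iff)
  ultimately show ?thesis using good_swap by auto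
next
  case False
  then have l: "3 \<le> l" using xs(3) by linarith
  obtain C B where s: "split_at (xs ! i) C B" "cyc_next xs i \<in> C" "xs ! prv i \<in> B" and S: "l = 3 \<Longrightarrow> \<not> S \<subseteq> C \<and> \<not> S \<subseteq> B"
    using central_split[OF l i] by blast
  have "D i = C" by (rule boundary_split[OF l i _ s(1,2)]) (use S in auto)
  moreover have "D (prv i) = B"
    by (rule boundary_split[OF l prv_lt _ split_at_swap[OF s(1)] s(3)]) (use S cyc_prv[OF i] in auto)
  ultimately show ?thesis using split_at_good[OF s(1)] S False by simp
qed

text \<open>Central vertices get their halves from the direction of the central cycle,
  \<open>True\<close> towards the next arrow and \<open>False\<close> towards the previous one; for
  the others the order of the two cliques is arbitrary.\<close>

lemma obtain_cl:
  obtains cl where "\<And>i. i < l \<Longrightarrow> cl (xs ! i, True) = D i" "\<And>i. i < l \<Longrightarrow> cl (xs ! i, False) = D (prv i)"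
    "\<And>v. v \<in> V \<Longrightarrow> good v (cl (v, True)) (cl (v, False))"
proof -
  have "\<exists>c. good v (fst c) (snd c)" if v: "v \<in> V - S" for v
  proof -
    obtain C B where "vertex_cliques m Q S v C B" using obtain_cliques v by blast
    then have "good v C B" using v by (intro good_outside split_atI) auto
    then show ?thesis by (intro exI[of _ "(C, B)"]) simp
  qed
  then obtain c where c: "\<And>v. v \<in> V - S \<Longrightarrow> good v (fst (c v)) (snd (c v))" by metis
  define ix where "ix v = (THE i. i < l \<and> xs ! i = v)" for v
  have ix: "ix (xs ! i) = i" if "i < l" for i
    unfolding ix_def using that xs(1) by (intro the_equality) (auto simp: nth_eq_iff_index_eq)
  define cl where "cl h = (if fst h \<in> S then if snd h then D (ix (fst h)) else D (prv (ix (fst h)))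
      else if snd h then fst (c (fst h)) else snd (c (fst h)))" for h
  have a: "cl (xs ! i, True) = D i" "cl (xs ! i, False) = D (prv i)" if "i < l" for i
    using that ix by (auto simp: cl_def)
  have "good v (cl (v, True)) (cl (v, False))" if v: "v \<in> V" for v
  proof (cases "v \<in> S")
    case True
    then obtain i where "i < l" "v = xs ! i" by (auto simp: in_set_conv_nth)
    then show ?thesis using a good_central by simp
  next
    case False
    then show ?thesis using c v by (simp add: cl_def)
  qed
  then show thesis using a that by blast
qed

end

section \<open>Polygons from cliques\<close>

locale tilde_cliques = tilde +
  fixes cl :: "'a \<times> bool \<Rightarrow> 'a set"
  assumes cl_True: "\<And>i. i < length xs \<Longrightarrow> cl (xs ! i, True) = D i"
    and cl_False: "\<And>i. i < length xs \<Longrightarrow> cl (xs ! i, False) = D (prv i)"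
    and cl_good: "\<And>v. v \<in> verts Q \<Longrightarrow> good v (cl (v, True)) (cl (v, False))"
begin

lemma good_cl: "v \<in> V \<Longrightarrow> good v (cl (v, b)) (cl (v, \<not> b))"
  using cl_good[of v] good_swap[of v] by (cases b) auto

lemma goodD:
  assumes "good v C B"
  shows "clique Q C" "v \<in> C" "C \<union> B = insert v (neighbors Q v)" "C \<inter> B = (if l = 2 \<and> v \<in> S then S else {v})"
    "\<forall>u\<in>C - B. \<forall>w\<in>B - C. nbr u w \<longrightarrow> l = 3 \<and> {u, v, w} = S" "l = 3 \<longrightarrow> \<not> S \<subseteq> C"
  using assms unfolding good_def by (elim conjE; simp)+

lemma clique_cl: "v \<in> V \<Longrightarrow> clique Q (cl (v, b))"
  by (rule goodD(1)[OF good_cl])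

lemma self_cl: "v \<in> V \<Longrightarrow> v \<in> cl (v, b)"
  by (rule goodD(2)[OF good_cl])

lemma not_S_cl: "v \<in> V \<Longrightarrow> l = 3 \<Longrightarrow> \<not> S \<subseteq> cl (v, b)"
  using goodD(6)[OF good_cl, of v b] by blast

lemma cap_cl: "v \<in> V \<Longrightarrow> cl (v, b) \<inter> cl (v, \<not> b) = (if l = 2 \<and> v \<in> S then S else {v})"
  by (rule goodD(4)[OF good_cl])

lemma cl_V: "v \<in> V \<Longrightarrow> u \<in> cl (v, b) \<Longrightarrow> u \<in> V"
  using clique_cl[of v b] by (auto simp: clique_def)

lemma cl_nbr: "v \<in> V \<Longrightarrow> u \<in> cl (v, b) \<Longrightarrow> w \<in> cl (v, b) \<Longrightarrow> u \<noteq> w \<Longrightarrow> nbr u w"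
  using clique_nbr[OF clique_cl] by blast

lemma nbr_cl: "nbr v u \<Longrightarrow> u \<in> cl (v, b) \<or> u \<in> cl (v, \<not> b)"
proof -
  assume n: "nbr v u"
  then have "u \<in> neighbors Q v" "v \<in> V" using nbrD[OF n] by (auto simp: neighbors_def)
  moreover from this have "cl (v, b) \<union> cl (v, \<not> b) = insert v (neighbors Q v)"
    using goodD(3)[OF good_cl] by blast
  ultimately show ?thesis by blast
qed

lemma cl_sep:
  assumes "v \<in> V" "u \<in> cl (v, b)" "u \<notin> cl (v, \<not> b)" "w \<in> cl (v, \<not> b)" "w \<notin> cl (v, b)" "nbr u w"
  shows "l = 3" "{u, v, w} = S"
proof -
  have "\<forall>u\<in>cl (v, b) - cl (v, \<not> b). \<forall>w\<in>cl (v, \<not> b) - cl (v, b). nbr u w \<longrightarrow> l = 3 \<and> {u, v, w} = S"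
    by (rule goodD(5)[OF good_cl[OF assms(1)]])
  then show "l = 3" "{u, v, w} = S" using assms by blast+
qed

lemma cl_both: "v \<in> V \<Longrightarrow> u \<in> cl (v, b) \<Longrightarrow> u \<in> cl (v, \<not> b) \<Longrightarrow> u \<noteq> v \<Longrightarrow> l = 2 \<and> v \<in> S \<and> u \<in> S"
  using cap_cl[of v b] by (auto split: if_splits)

text \<open>A vertex of \<open>cl (v, b)\<close> missing in \<open>cl (u, d)\<close> would lie on
  the other side of \<open>u\<close> and neighbor \<open>v\<close>, so it would form the central
  triangle with \<open>u\<close> and \<open>v\<close> inside \<open>cl (v, b)\<close>. Applied in
  both directions, this shows that neighbors agree on their common clique.\<close>

lemma cl_subset:
  assumes v: "v \<in> V" and uv: "u \<noteq> v" "u \<in> cl (v, b)" "v \<in> cl (u, d)" and n: "\<not> (l = 2 \<and> u \<in> S \<and> v \<in> S)"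
  shows "cl (v, b) \<subseteq> cl (u, d)"
proof
  fix x assume x: "x \<in> cl (v, b)"
  have u: "u \<in> V" using cl_V[OF v uv(2)] .
  show "x \<in> cl (u, d)"
  proof (rule ccontr)
    assume xd: "x \<notin> cl (u, d)"
    then have d: "x \<noteq> u" "x \<noteq> v" using uv(3) self_cl[OF u] by auto
    have ux: "nbr u x" "nbr v x" using cl_nbr[OF v uv(2) x] cl_nbr[OF v self_cl[OF v] x] d by auto
    have x': "x \<in> cl (u, \<not> d)" using nbr_cl[OF ux(1), of d] xd by simp
    have v': "v \<notin> cl (u, \<not> d)" using cl_both[OF u uv(3)] uv(1) n by blast
    have l: "l = 3" and S: "{v, u, x} = S" using cl_sep[OF u uv(3) v' x' xd ux(2)] by simp_all
    have "{v, u, x} \<subseteq> cl (v, b)" using x uv self_cl[OF v] by simp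
    then show False using not_S_cl[OF v l] unfolding S by simp
  qed
qed

lemma central_cases2: "l = 2 \<Longrightarrow> v \<in> S \<Longrightarrow> v = xs ! 0 \<or> v = xs ! 1"
  by (auto simp: in_set_conv_nth less_2_cases_iff)

lemma xs_01: "xs ! 0 \<noteq> xs ! 1"
proof -
  have "0 < l" "1 < l" using xs(3) by linarith+
  then show ?thesis using nth_eq_iff_index_eq[OF xs(1), of 0 1] by simp
qed

lemma cl_pair: "l = 2 \<Longrightarrow> v \<in> S \<Longrightarrow> u \<in> S \<Longrightarrow> u \<noteq> v \<Longrightarrow> cl (u, \<not> b) = cl (v, b)"
proof -
  assume l: "l = 2" and "v \<in> S" "u \<in> S" "u \<noteq> v"
  then have "v = xs ! 0 \<and> u = xs ! 1 \<or> v = xs ! 1 \<and> u = xs ! 0" using central_cases2 by metis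
  moreover have "prv 0 = 1" "prv 1 = 0" using l by (simp_all add: prv_def)
  moreover have "0 < l" "1 < l" using l by simp_all
  ultimately show ?thesis using cl_True[of 0] cl_True[of 1] cl_False[of 0] cl_False[of 1] by (cases b) auto
qed

text \<open>The second component separates the two boundary cliques of a double edge when neither has peripheral
  vertices.\<close>

definition fc :: "'a \<times> bool \<Rightarrow> 'a set \<times> bool" where
  "fc e = (cl e, l = 2 \<and> cl e = S \<and> (fst e = xs ! 0) \<noteq> snd e)"

lemma fc_cl: "fc e = fc e' \<Longrightarrow> cl e = cl e'"
  by (simp add: fc_def)

lemma fc_pair: "l = 2 \<Longrightarrow> v \<in> S \<Longrightarrow> u \<in> S \<Longrightarrow> u \<noteq> v \<Longrightarrow> fc (u, \<not> b) = fc (v, b)"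
proof -
  assume a: "l = 2" "v \<in> S" "u \<in> S" "u \<noteq> v"
  have "(u = xs ! 0) = (v \<noteq> xs ! 0)" using a central_cases2[of u] central_cases2[of v] by blast
  then show ?thesis using cl_pair[OF a, of b] by (auto simp: fc_def)
qed

lemma fc_match: "v \<in> V \<Longrightarrow> u \<in> cl (v, b) \<Longrightarrow> u \<noteq> v \<Longrightarrow> \<exists>d. fc (u, d) = fc (v, b)"
proof -
  assume a: "v \<in> V" "u \<in> cl (v, b)" "u \<noteq> v"
  show ?thesis
  proof (cases "l = 2 \<and> u \<in> S \<and> v \<in> S")
    case True
    then show ?thesis using fc_pair[of v u b] a(3) by blast
  next
    case False
    have u: "u \<in> V" using cl_V[OF a(1,2)] .
    have n: "nbr u v" using cl_nbr[OF a(1,2) self_cl[OF a(1)] a(3)] .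
    obtain d where d: "v \<in> cl (u, d)" using nbr_cl[OF n] by blast
    have "cl (v, b) \<subseteq> cl (u, d)" using cl_subset[OF a(1,3,2) d] False by blast
    moreover have "cl (u, d) \<subseteq> cl (v, b)" using cl_subset[OF u a(3)[symmetric] d a(2)] False by blast
    ultimately have "cl (u, d) = cl (v, b)" by simp
    moreover have "\<not> (l = 2 \<and> cl (v, b) = S)" using False a(2) self_cl[OF a(1), of b] by auto
    ultimately have "fc (u, d) = fc (v, b)" by (auto simp: fc_def)
    then show ?thesis ..
  qed
qed

text \<open>If the two cliques at \<open>v\<close> coincide, they equal their intersection. It is
  not \<open>{v}\<close>, since \<open>v\<close> has a neighbor; the case of a bare double arrow is
  excluded by the second component of \<open>fc\<close>.\<close>

lemma fc_loop: "v \<in> V \<Longrightarrow> fc (v, b) \<noteq> fc (v, \<not> b)"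
proof
  assume v: "v \<in> V" and eq: "fc (v, b) = fc (v, \<not> b)"
  from eq have "cl (v, b) = cl (v, \<not> b)" by (rule fc_cl)
  then have c: "cl (v, b) = (if l = 2 \<and> v \<in> S then S else {v})" using cap_cl[OF v, of b] by simp
  obtain u where u: "nbr v u"
    using has_nbr[OF v] unfolding neighbors_def by (metis (no_types, lifting) card.empty empty_Collect_eq not_one_le_zero)
  have "u \<in> cl (v, b)" using nbr_cl[OF u, of b] \<open>cl (v, b) = cl (v, \<not> b)\<close> by simp
  then have "cl (v, b) \<noteq> {v}" using nbrD[OF u] by auto
  then have "l = 2" "cl (v, b) = S" using c by (auto split: if_splits)
  then show False using eq by (auto simp: fc_def)
qed

lemma fc_nbr: "v \<in> V \<Longrightarrow> u \<in> V \<Longrightarrow> u \<noteq> v \<Longrightarrow> fc (v, b) = fc (u, d) \<Longrightarrow> nbr v u"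
  using cl_nbr[of v v b u] self_cl[of v b] self_cl[of u d] fc_cl[of "(v, b)" "(u, d)"] by auto

lemma nbr_fc: "nbr v u \<Longrightarrow> \<exists>b d. fc (v, b) = fc (u, d)"
proof -
  assume n: "nbr v u"
  obtain b where "u \<in> cl (v, b)" using nbr_cl[OF n] by blast
  then show ?thesis using fc_match[of v u b] nbrD[OF n] by metis
qed

lemma fc_double:
  assumes "v \<in> V" "u \<in> V" "u \<noteq> v" "fc (v, b) = fc (u, d)" "fc (v, \<not> b) = fc (u, d')"
  shows "l = 2 \<and> v \<in> S \<and> u \<in> S"
  using cl_both[of v u b] self_cl[of u] fc_cl[OF assms(4)] fc_cl[OF assms(5)] assms(1,2,3) by metis

lemma fc_complement: "v \<in> V \<Longrightarrow> u \<in> V \<Longrightarrow> fc (v, b) = fc (u, d) \<Longrightarrow> fc (v, b') = fc (u, d') \<Longrightarrow> b = b' \<longleftrightarrow> d = d'"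
  using fc_loop[of v b] fc_loop[of u d] by (cases "b = b'"; cases "d = d'") auto

text \<open>Central arcs are oriented along the central cycle. Any other arc takes the circle from
  the peripheral vertex of its component, with color sum \<open>m - 1\<close> meaning
  \<open>True\<close>, in accordance with \<open>triangle_color_outer\<close>.\<close>

definition class_conf :: "('a, 'a set \<times> bool) conf" where
  "class_conf = \<lparr>face = fc, hue = (\<lambda>e e'. color Q (fst e) (fst e')),
     lbl = (\<lambda>e. if fst e \<in> S then snd e else \<exists>w\<in>peripheral_of_color Q xs D (m - 1). fst e \<in> component R w)\<rparr>"

abbreviation "K \<equiv> class_conf"

lemma conf_simps [simp]: "face K = fc" "hue K e e' = color Q (fst e) (fst e')"
  by (simp_all add: class_conf_def)

lemma lbl_S: "v \<in> S \<Longrightarrow> lbl K (v, b) = b"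
  by (simp add: class_conf_def)

lemma lbl_outside: "v \<notin> S \<Longrightarrow> lbl K (v, b) \<longleftrightarrow> (\<exists>w\<in>peripheral_of_color Q xs D (m - 1). v \<in> component R w)"
  by (simp add: class_conf_def)

lemma quiv_conf: "Q = quiv V K"
proof -
  have "arr Q u w c = arr (quiv V K) u w c" for u w c
  proof (cases "u \<in> V \<and> w \<in> V \<and> u \<noteq> w")
    case True
    let ?P = "{(a, b). fc (u, a) = fc (w, b)}"
    have a: "arr (quiv V K) u w c = (if c = color Q u w then card ?P else 0)"
      using True by (auto simp: quiv_def)
    have "card ?P = mult m Q u w" if n: "nbr u w"
    proof (cases "l = 2 \<and> u \<in> S \<and> w \<in> S")
      case two: True
      have "?P = {(True, False), (False, True)}"
      proof -
        have p: "fc (u, \<not> b) = fc (w, b)" for b using fc_pair[of w u b] two True by blast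
        have "fc (u, a) = fc (w, b) \<longleftrightarrow> a = (\<not> b)" for a b
          using p[of b] fc_loop[of u a] True by (cases "a = (\<not> b)") auto
        then show ?thesis by auto
      qed
      then show ?thesis using mult_S[of u w] two True by simp
    next
      case False
      obtain a b where ab: "fc (u, a) = fc (w, b)" using nbr_fc[OF n] by blast
      have "(a', b') = (a, b)" if "fc (u, a') = fc (w, b')" for a' b'
      proof (rule ccontr)
        assume "(a', b') \<noteq> (a, b)"
        then have "a' = (\<not> a)" using fc_complement[of u w a b a' b'] ab that True by auto
        then have "l = 2 \<and> u \<in> S \<and> w \<in> S" using fc_double[of u w a b b'] ab that True by auto
        then show False using False by blast
      qed
      note u = this
      have "fc (u, a') = fc (w, b') \<longleftrightarrow> a' = a \<and> b' = b" for a' b' using u[of a' b'] ab by blast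
      then have "?P = {(a, b)}" by simp
      moreover have "mult m Q u w = 1" by (rule mult_one[OF n]) (use False in auto)
      ultimately show ?thesis by simp
    qed
    moreover have "?P = {}" if n: "\<not> nbr u w" using fc_nbr[of u w] n True by auto
    ultimately show ?thesis using a arr_mult[of u w c] by auto
  next
    case False
    then have "\<not> nbr u w" using nbrD[of u w] by blast
    then show ?thesis using False arr_mult[of u w c] by (auto simp: quiv_def)
  qed
  then have "arr Q = arr (quiv V K)" by blast
  then show ?thesis by (simp add: quiv_def)
qed

lemma fc_fst: "e \<in> halves V \<Longrightarrow> e' \<in> halves V \<Longrightarrow> fc e = fc e' \<Longrightarrow> e \<noteq> e' \<Longrightarrow> nbr (fst e) (fst e')"
proof -
  assume a: "e \<in> halves V" "e' \<in> halves V" "fc e = fc e'" "e \<noteq> e'"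
  obtain v b u d where e: "e = (v, b)" "e' = (u, d)" by (cases e, cases e')
  have "u \<noteq> v"
  proof
    assume "u = v"
    then have "d = (\<not> b)" using a(4) e by auto
    then show False using fc_loop[of v b] a e \<open>u = v\<close> by auto
  qed
  then show ?thesis using fc_nbr[of v u b d] a e by auto
qed

text \<open>Halves in one face belong to one clique, which does not contain the central triangle; so
  each of its triangles is admissible.\<close>

lemma coloring_conf: "coloring m V K"
proof
  show "1 \<le> m" "finite V" by (rule m_pos, rule finite_V)
  fix e e' assume e: "e \<in> halves V" "e' \<in> halves V" "face K e = face K e'" "e \<noteq> e'"
  show "hue K e e' + hue K e' e = m" using color_sum fc_fst e by simp
next
  fix e e' k assume e: "e \<in> halves V" "e' \<in> halves V" "k \<in> halves V" "face K e = face K e'" "face K e' = face K k"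
    "e \<noteq> e'" "e' \<noteq> k" "k \<noteq> e"
  let ?x = "fst e" let ?y = "fst e'" let ?z = "fst k"
  have n: "nbr ?x ?y" "nbr ?y ?z" "nbr ?z ?x" using fc_fst[of e e'] fc_fst[of e' k] fc_fst[of k e] e by auto
  have d: "?x \<noteq> ?y" "?y \<noteq> ?z" "?z \<noteq> ?x" using nbrD[OF n(1)] nbrD[OF n(2)] nbrD[OF n(3)] by auto
  have V: "?x \<in> V" "?y \<in> V" "?z \<in> V" using e by (auto simp: halves_fst)
  have c: "cl e' = cl e" "cl k = cl e" using fc_cl[of e e'] fc_cl[of e' k] e by auto
  have "?x \<in> cl e" "?y \<in> cl e" "?z \<in> cl e" using self_cl[OF V(1), of "snd e"] self_cl[OF V(2), of "snd e'"] self_cl[OF V(3), of "snd k"] c by auto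
  then have sub: "{?x, ?y, ?z} \<subseteq> cl e" by simp
  have "triangle Q ?x ?y ?z" using d V n nbr_sym by (auto simp: triangle_def clique_def)
  moreover have "\<not> (l = 3 \<and> {?x, ?y, ?z} = S)"
  proof
    assume S: "l = 3 \<and> {?x, ?y, ?z} = S"
    have "S \<subseteq> cl e" using sub unfolding conjunct2[OF S] .
    then show False using not_S_cl[OF V(1), of "snd e"] S by simp
  qed
  ultimately have "admissible m Q ?x ?y ?z" by (rule triangles)
  then show "hue K e e' + hue K e' k + hue K k e = m - 1 \<or> hue K e e' + hue K e' k + hue K k e = 2 * m + 1"
    by (simp add: admissible_def triangle_color_def)
qed

definition cf :: "nat \<Rightarrow> 'a set \<times> bool" where
  "cf i = fc (xs ! i, True)"

lemma xs_V: "i < l \<Longrightarrow> xs ! i \<in> V"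
  using xs(2) by auto

lemma cf_prv: "i < l \<Longrightarrow> fc (xs ! i, False) = cf (prv i)"
proof -
  assume i: "i < l"
  have c: "cl (xs ! i, False) = cl (xs ! prv i, True)" using cl_False[OF i] cl_True[OF prv_lt] by simp
  have "(xs ! i = xs ! 0) = (xs ! prv i \<noteq> xs ! 0)" if l: "l = 2"
  proof -
    have "i = 0 \<and> prv i = 1 \<or> i = 1 \<and> prv i = 0" using i l by (auto simp: prv_eq)
    then show ?thesis using xs_01 by auto
  qed
  then show ?thesis using c by (auto simp: fc_def cf_def)
qed

lemma cf_next: "i < l \<Longrightarrow> fc (cyc_next xs i, False) = cf i"
  using cf_prv[OF next_lt[of i]] prv_next[of i] by (simp add: cyc_next_def)

text \<open>Equal faces make the two central vertices neighbors, hence consecutive on the cycle;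
  then one of them would have the same face on both sides.\<close>

lemma cf_inj: "i < l \<Longrightarrow> j < l \<Longrightarrow> cf i = cf j \<Longrightarrow> i = j"
proof (rule ccontr)
  assume ij: "i < l" "j < l" "cf i = cf j" "i \<noteq> j"
  have adj: False if "i' < l" "cf i' = cf (Suc i' mod l)" for i'
    using fc_loop[OF xs_V[OF next_lt], of i' False] cf_next[OF that(1)] that(2) by (simp add: cf_def cyc_next_def)
  have d: "xs ! j \<noteq> xs ! i" using ij xs(1) by (simp add: nth_eq_iff_index_eq)
  have "nbr (xs ! i) (xs ! j)" using fc_nbr[OF xs_V xs_V d] ij by (simp add: cf_def)
  then have "j = Suc i mod l \<or> i = Suc j mod l"
  proof (cases "3 \<le> l")
    case False
    then have "l = 2" using xs(3) by linarith
    then show ?thesis using ij by (auto simp: less_2_cases_iff)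
  qed (use nbr_S ij in blast)
  then show False using adj[of i] adj[of j] ij by auto
qed

lemma fc_S: "e \<in> halves V \<Longrightarrow> fst e \<in> S \<Longrightarrow> \<exists>i<l. fc e = cf i \<and> (e = (xs ! i, True) \<or> e = (cyc_next xs i, False))"
proof -
  assume e: "e \<in> halves V" "fst e \<in> S"
  then obtain j where j: "j < l" "fst e = xs ! j" by (auto simp: in_set_conv_nth)
  show ?thesis
  proof (cases "snd e")
    case True
    then have "e = (xs ! j, True)" using j by (simp add: prod_eq_iff)
    then show ?thesis using j(1) by (auto simp: cf_def)
  next
    case False
    then have "e = (xs ! j, False)" using j by (simp add: prod_eq_iff)
    then show ?thesis using j(1) cf_prv[OF j(1)] cyc_prv[OF j(1)] prv_lt[of j] by auto
  qed
qed

end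

section \<open>Labels and the single cycle of the dual graph\<close>

context tilde_cliques
begin

lemma R_edge: "nbr u v \<Longrightarrow> u \<notin> S \<Longrightarrow> v \<notin> S \<Longrightarrow> (\<And>i. i < l \<Longrightarrow> \<not> (u \<in> D i \<and> v \<in> D i)) \<Longrightarrow> neighbor R u v"
  using nbrD[of u v] by (auto simp: neighbor_def remove_boundary_def induced_def)

lemma lbl_R: "neighbor R u v \<Longrightarrow> lbl K (u, b) = lbl K (v, d)"
proof -
  assume n: "neighbor R u v"
  have o: "u \<in> V - S" "v \<in> V - S" using R_nbr[OF n] by auto
  have n': "neighbor R v u"
    using n R_nbr[OF n] nbr_sym[of u v] by (auto simp: neighbor_def remove_boundary_def induced_def split: if_splits)
  have "v \<in> component R w \<longleftrightarrow> u \<in> component R w" for w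
    using o n n' verts_R by (auto simp: component_def intro: rtranclp.rtrancl_into_rtrancl)
  then show ?thesis using o by (simp add: lbl_outside)
qed

text \<open>All vertices at such a face are outside \<open>S\<close>. Two of them lie in no common
  boundary clique, as they would then share two faces. So their arrows survive in \<open>R\<close>,
  and they are in the same component with the same label.\<close>

lemma pure_conf:
  assumes v: "v \<in> V" and no: "\<And>i. i < l \<Longrightarrow> fc (v, b) \<noteq> cf i"
  shows "pure_face V K (fc (v, b)) (lbl K (v, b))"
proof -
  have out: "fst e \<notin> S" if "e \<in> halves V" "fc e = fc (v, b)" for e
    using fc_S[OF that(1)] that(2) no by auto
  have vS: "v \<notin> S" using out[of "(v, b)"] v by simp
  have "lbl K (u, d') = lbl K (v, b)" if u: "u \<in> V" "fc (u, d) = fc (v, b)" for u d d'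
  proof (cases "u = v")
    case True
    then show ?thesis using vS by (simp add: lbl_outside)
  next
    case False
    have uS: "u \<notin> S" using out[of "(u, d)"] u by simp
    have n: "nbr u v" using fc_nbr[of u v d b] u v False by auto
    have "\<not> (u \<in> D i \<and> v \<in> D i)" if i: "i < l" for i
    proof
      assume D: "u \<in> D i \<and> v \<in> D i"
      have x: "xs ! i \<in> V" "u \<noteq> xs ! i" "v \<noteq> xs ! i" using xs_V[OF i] uS vS i by auto
      obtain d1 where d1: "fc (u, d1) = cf i"
        using fc_match[OF x(1), of u True] D x cl_True[OF i] by (auto simp: cf_def)
      obtain d2 where d2: "fc (v, d2) = cf i"
        using fc_match[OF x(1), of v True] D x cl_True[OF i] by (auto simp: cf_def)
      have "d2 \<noteq> b"
      proof
        assume "d2 = b"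
        then show False using d2 no[OF i] by simp
      qed
      then have "d2 = (\<not> b)" by (cases b) simp_all
      then have "l = 2 \<and> v \<in> S \<and> u \<in> S" using fc_double[OF v u(1) False, of b d d1] u d1 d2 by auto
      then show False using vS by blast
    qed
    then show ?thesis using lbl_R[OF R_edge[OF n uS vS]] by blast
  qed
  then show ?thesis unfolding pure_face_def conf_simps
    by (metis halves_fst oth_def surjective_pairing)
qed

lemma peripheral_color:
  assumes i: "i < l" and w: "w \<in> peripheral_at xs D i"
  shows "w \<in> peripheral_of_color Q xs D s \<longleftrightarrow> triangle_color Q (xs ! i) (cyc_next xs i) w = s"
proof
  have W: "w \<in> W" using i w by (auto simp: peripheral_def)
  have wD: "w \<in> D i" using w by (simp add: peripheral_at_def)
  assume "w \<in> peripheral_of_color Q xs D s"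
  then obtain j where j: "j < l" "w \<in> peripheral_at xs D j" "triangle_color Q (xs ! j) (cyc_next xs j) w = s"
    unfolding peripheral_of_color_def by blast
  then have "w \<in> D j" by (simp add: peripheral_at_def)
  then have "j = i" using R_decomp(4)[OF W] i j(1) wD by blast
  then show "triangle_color Q (xs ! i) (cyc_next xs i) w = s" using j(3) by simp
qed (use i w in \<open>unfold peripheral_of_color_def, blast\<close>)

lemma peripheral_admissible:
  assumes i: "i < l" and w: "w \<in> peripheral_at xs D i"
  shows "triangle_color Q (xs ! i) (cyc_next xs i) w = m - 1 \<or> triangle_color Q (xs ! i) (cyc_next xs i) w = 2 * m + 1"
proof -
  let ?a = "xs ! i" let ?n = "cyc_next xs i"
  have w': "w \<in> D i" "w \<noteq> ?a" "w \<noteq> ?n" using w by (auto simp: peripheral_at_def)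
  have W: "w \<in> W" using i w by (auto simp: peripheral_def)
  have d: "?a \<noteq> ?n" using nbrD[OF nbr_next[OF i]] by blast
  have "triangle Q ?a ?n w"
    using d D_clique[OF i] w' by (auto simp: triangle_def clique_def card_insert_if)
  moreover have "\<not> (l = 3 \<and> {?a, ?n, w} = S)" using W_outside[OF W] by blast
  ultimately have "admissible m Q ?a ?n w" by (rule triangles)
  then show ?thesis by (simp add: admissible_def)
qed

lemma lbl_component:
  assumes w: "w \<in> W" "v \<in> component R w"
  shows "lbl K (v, b) \<longleftrightarrow> w \<in> peripheral_of_color Q xs D (m - 1)"
proof -
  have "v \<notin> S" using w verts_R by (auto simp: component_def)
  moreover have "w' = w" if "w' \<in> peripheral_of_color Q xs D (m - 1)" "v \<in> component R w'" for w'
  proof -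
    have "w' \<in> W" using that(1) by (auto simp: peripheral_of_color_def peripheral_def)
    then show ?thesis using R_decomp(3)[OF _ w(1), of w'] that(2) w(2) by blast
  qed
  ultimately show ?thesis using lbl_outside w(2) by blast
qed

text \<open>The color sum of the triangle tells on which side of the next central arc
  \<open>w\<close> lies when counted from \<open>xs ! i\<close>.\<close>

lemma peripheral_cf:
  assumes i: "i < l" and w: "w \<in> D i" "w \<notin> S"
  shows "lbl K (w, b) \<longleftrightarrow> color Q (xs ! i) (cyc_next xs i) < color Q (xs ! i) w"
proof -
  let ?a = "xs ! i" let ?n = "cyc_next xs i"
  have d: "w \<noteq> ?a" "w \<noteq> ?n" using w(2) i next_in_S by auto
  have at: "w \<in> peripheral_at xs D i" using w d by (simp add: peripheral_at_def)
  then have W: "w \<in> W" using i by (auto simp: peripheral_def)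
  have L: "lbl K (w, b) \<longleftrightarrow> triangle_color Q ?a ?n w = m - 1"
    using lbl_component[OF W R_decomp(2)[OF W]] peripheral_color[OF i at] by simp
  have cD: "clique Q (D i)" "?a \<in> D i" "?n \<in> D i" using D_clique[OF i] by auto
  have n: "nbr ?a w" "nbr ?n w" using clique_nbr[OF cD(1)] cD w d by auto
  show ?thesis using peripheral_admissible[OF i at]
  proof
    assume t: "triangle_color Q ?a ?n w = m - 1"
    then have "color Q ?a ?n < color Q ?a w"
      using color_sum[OF n(1)] m_pos unfolding triangle_color_def by linarith
    then show ?thesis using L t by simp
  next
    assume t: "triangle_color Q ?a ?n w = 2 * m + 1"
    then have "\<not> color Q ?a ?n < color Q ?a w"
      using color_sum[OF n(1)] color_le[OF n(2)] unfolding triangle_color_def by linarith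
    then show ?thesis using L t by simp
  qed
qed

lemma central_conf:
  assumes i: "i < l"
  shows "central_face V K (cf i) (xs ! i, True) (cyc_next xs i, False)"
proof -
  have V: "xs ! i \<in> V" "cyc_next xs i \<in> V" "xs ! i \<in> S" "cyc_next xs i \<in> S" using xs_V[OF i] next_in_S xs(2) i by auto
  have "lbl K (oth e) = lbl K e \<and> (lbl K e \<longleftrightarrow> color Q (xs ! i) (cyc_next xs i) < color Q (xs ! i) (fst e))"
    if e: "e \<in> halves V" "fc e = cf i" "e \<noteq> (xs ! i, True)" "e \<noteq> (cyc_next xs i, False)" for e
  proof -
    have eS: "fst e \<notin> S"
    proof
      assume "fst e \<in> S"
      then obtain j where j: "j < l" "fc e = cf j" "e = (xs ! j, True) \<or> e = (cyc_next xs j, False)" using fc_S[OF e(1)] by blast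
      from j(2) e(2) have "cf j = cf i" by simp
      then have "j = i" by (rule cf_inj[OF j(1) i])
      then show False using j e by blast
    qed
    have eV: "fst e \<in> V" using e(1) by (simp add: halves_fst)
    have "cl e = D i" using fc_cl[of e "(xs ! i, True)"] e(2) cl_True[OF i] by (simp add: cf_def)
    then have "fst e \<in> D i" using self_cl[OF eV, of "snd e"] by simp
    from peripheral_cf[OF i this eS]
    have "lbl K (fst e, b) \<longleftrightarrow> color Q (xs ! i) (cyc_next xs i) < color Q (xs ! i) (fst e)" for b .
    from this[of "snd e"] this[of "\<not> snd e"] show ?thesis unfolding oth_def by simp
  qed
  then show ?thesis unfolding central_face_def conf_simps
    using V lbl_S cf_next[OF i] by (simp add: cf_def)
qed

lemma linked_fc:
  assumes "u \<in> V" "v \<in> V"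
  shows "linked fc V (fc (u, b)) (fc (v, d))"
proof -
  have "nbr\<^sup>*\<^sup>* u v" using connected assms by (simp add: connected_quiver_def)
  then show ?thesis using assms(2)
  proof (induction arbitrary: d rule: rtranclp_induct)
    case base
    then show ?case using linked_edge[of u V] by auto
  next
    case (step y z)
    have y: "y \<in> V" using nbrD[OF step(2)] by simp
    obtain a c where ac: "fc (y, a) = fc (z, c)" using nbr_fc[OF step(2)] by blast
    have "linked fc V (fc (u, b)) (fc (y, a))" by (rule step(3)[OF y])
    also have "linked fc V (fc (y, a)) (fc (z, d))" using linked_edge[of z V fc c d] step(4) ac by simp
    finally (rtranclp_trans) show ?case .
  qed
qed

text \<open>A cycle of the dual graph with distinct arcs and distinct faces is central. For
  \<open>k = 2\<close> two vertices share two faces and form the double edge. For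
  \<open>k = 3\<close> two neighbors lie on different sides of the third vertex, which only the
  central triangle permits. For \<open>4 \<le> k\<close> the arcs form a hole.\<close>

lemma closed_walk:
  fixes e :: "nat \<Rightarrow> 'a" and c :: "nat \<Rightarrow> 'a set \<times> bool"
  assumes k: "2 \<le> k" and inj: "inj_on e {..<k}" "inj_on c {..<k}" and eV: "\<And>j. j < k \<Longrightarrow> e j \<in> V"
    and walk: "\<And>j. j < k \<Longrightarrow> \<exists>d. fc (e j, d) = c j \<and> fc (e j, \<not> d) = c (Suc j mod k)"
  shows "S \<subseteq> e ` {..<k}"
proof -
  have sl: "Suc j mod k < k" for j using k by simp
  have faces: "fc (e j, d) = c j \<or> fc (e j, d) = c (Suc j mod k)" if j: "j < k" for j d
  proof -
    obtain d' where d': "fc (e j, d') = c j" "fc (e j, \<not> d') = c (Suc j mod k)" using walk[OF j] by blast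
    then show ?thesis by (cases "d = d'") auto
  qed
  have at: "\<exists>d. fc (e j, d) = c j" "\<exists>d. fc (e j, d) = c (Suc j mod k)" if "j < k" for j using walk[OF that] by blast+
  have c_eq: "c i = c j \<longleftrightarrow> i = j" if "i < k" "j < k" for i j using inj(2) that by (auto simp: inj_on_def)
  have e_eq: "e i = e j \<longleftrightarrow> i = j" if "i < k" "j < k" for i j using inj(1) that by (auto simp: inj_on_def)
  have suc_eq: "Suc i mod k = Suc j mod k \<longleftrightarrow> i = j" if "i < k" "j < k" for i j
    using that by (auto simp: mod_Suc split: if_splits)
  have n: "nbr (e i) (e j) \<longleftrightarrow> j = Suc i mod k \<or> i = Suc j mod k" if ij: "i < k" "j < k" "i \<noteq> j" for i j
  proof
    assume "nbr (e i) (e j)"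
    then obtain a b where ab: "fc (e i, a) = fc (e j, b)" using nbr_fc by blast
    show "j = Suc i mod k \<or> i = Suc j mod k"
      using faces[OF ij(1), of a] faces[OF ij(2), of b] ab c_eq[OF ij(1,2)] c_eq[OF ij(1) sl, of j]
        c_eq[OF ij(2) sl, of i] c_eq[OF sl sl, of i j] suc_eq[OF ij(1,2)] ij(3) by metis
  next
    assume "j = Suc i mod k \<or> i = Suc j mod k"
    then obtain a b where "fc (e i, a) = fc (e j, b)" using at ij by metis
    then show "nbr (e i) (e j)" using fc_nbr[OF eV eV] ij e_eq by metis
  qed
  have double: "(i = Suc j mod k \<and> j = Suc i mod k)" if ij: "i < k" "j < k" "i \<noteq> j" and l: "l = 2" "e i \<in> S" "e j \<in> S" for i j
  proof -
    have d: "e j \<noteq> e i" using e_eq ij by simp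
    have "\<exists>b. fc (e j, b) = fc (e i, a)" for a using fc_pair[OF l d] by blast
    then have "\<exists>b. fc (e j, b) = c i" "\<exists>b. fc (e j, b) = c (Suc i mod k)" using at[OF ij(1)] by metis+
    then have "c i = c j \<or> c i = c (Suc j mod k)" "c (Suc i mod k) = c j \<or> c (Suc i mod k) = c (Suc j mod k)"
      using faces[OF ij(2)] by metis+
    then show ?thesis using c_eq[OF ij(1,2)] c_eq[OF ij(1) sl, of j] c_eq[OF sl ij(2), of i] c_eq[OF sl sl, of i j] suc_eq[OF ij(1,2)] ij(3) by auto
  qed
  consider "k = 2" | "k = 3" | "4 \<le> k" using k by linarith
  then show ?thesis
  proof cases
    case 1
    have V: "e 0 \<in> V" "e 1 \<in> V" "e 1 \<noteq> e 0" using eV[of 0] eV[of 1] e_eq[of 0 1] 1 by auto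
    obtain d where d: "fc (e 0, d) = c 0" "fc (e 0, \<not> d) = c 1" using walk[of 0] 1 by auto
    obtain d' where d': "fc (e 1, d') = c 1" "fc (e 1, \<not> d') = c 0" using walk[of 1] 1 by (auto simp: numeral_2_eq_2)
    have S: "l = 2 \<and> e 0 \<in> S \<and> e 1 \<in> S" using fc_double[OF V, of d "\<not> d'" d'] d d' by simp
    then have "S = {e 0, e 1}" using V(3) card_S by (intro card_seteq[symmetric]) auto
    then show ?thesis using 1 by (auto simp: lessThan_Suc numeral_2_eq_2)
  next
    case 2
    have V: "e 0 \<in> V" "e 1 \<in> V" "e 2 \<in> V" using eV[of 0] eV[of 1] eV[of 2] 2 by auto
    have d: "e 0 \<noteq> e 1" "e 2 \<noteq> e 1" "e 0 \<noteq> e 2" using e_eq[of 0 1] e_eq[of 2 1] e_eq[of 0 2] 2 by auto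
    have m3: "Suc 0 mod 3 = (1::nat)" "Suc 1 mod 3 = (2::nat)" "Suc 2 mod 3 = (0::nat)" by auto
    have s1: "Suc 1 mod k = 2" and k1: "1 < k" using 2 by simp_all
    obtain b where b: "fc (e 1, b) = c 1" "fc (e 1, \<not> b) = c 2" using walk[OF k1] unfolding s1 by blast
    have "\<exists>d. fc (e 0, d) = c 1" using at(2)[of 0] 2 m3 by auto
    then have "e 0 \<in> cl (e 1, b)" using b(1) self_cl[OF V(1)] fc_cl by metis
    moreover have "\<exists>d. fc (e 2, d) = c 2" using at(1)[of 2] 2 by auto
    then have "e 2 \<in> cl (e 1, \<not> b)" using b(2) self_cl[OF V(3)] fc_cl by metis
    moreover have "\<not> (l = 2 \<and> e 1 \<in> S \<and> e 0 \<in> S)" "\<not> (l = 2 \<and> e 1 \<in> S \<and> e 2 \<in> S)"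
      using double[of 0 1] double[of 2 1] 2 by auto
    then have "e 0 \<notin> cl (e 1, \<not> b)" "e 2 \<notin> cl (e 1, b)"
      using cl_both[OF V(2), of "e 0" b] cl_both[OF V(2), of "e 2" b] d calculation by blast+
    moreover have "nbr (e 0) (e 2)"
    proof -
      have "0 < k" "2 < k" "(0::nat) \<noteq> 2" "0 = Suc 2 mod k" using 2 by simp_all
      then show ?thesis using n by blast
    qed
    ultimately have S: "{e 0, e 1, e 2} = S" using cl_sep(2)[OF V(2)] by blast
    have "{e 0, e 1, e 2} \<subseteq> e ` {..<k}" using 2 by simp
    then show ?thesis unfolding S .
  next
    case 3
    let ?ys = "map e [0..<k]"
    have "induces_cycle m Q ?ys"
      unfolding induces_cycle_def
    proof (intro conjI allI impI)
      show "3 \<le> length ?ys" "distinct ?ys" "set ?ys \<subseteq> V"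
        using 3 inj(1) eV by (auto simp: distinct_map atLeast0LessThan)
      fix i j assume "i < length ?ys" "j < length ?ys"
      then have ij: "i < k" "j < k" by auto
      have ns: "i \<noteq> Suc i mod k" using ij 3 by (auto simp: mod_Suc)
      have "mult m Q (e i) (e j) = (if j = Suc i mod k \<or> i = Suc j mod k then 1 else 0)"
      proof (cases "i = j")
        case True
        then have "\<not> nbr (e i) (e j)" using nbrD by blast
        then show ?thesis using True ns mult_nbr by auto
      next
        case False
        have "mult m Q (e i) (e j) = 1" if "nbr (e i) (e j)"
        proof (rule mult_one[OF that], rule notI)
          assume S: "l = 2 \<and> {e i, e j} = S"
          have "e i \<in> {e i, e j}" "e j \<in> {e i, e j}" by simp_all
          then have "e i \<in> S" "e j \<in> S" unfolding conjunct2[OF S] .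
          note d = double[OF ij False conjunct1[OF S] this]
          have s: "Suc j mod k = (if Suc j = k then 0 else Suc j)" "Suc i mod k = (if Suc i = k then 0 else Suc i)"
            using ij by (simp_all add: mod_Suc)
          have "i = 0 \<and> Suc j = k \<or> i = Suc j" "j = 0 \<and> Suc i = k \<or> j = Suc i"
            using conjunct1[OF d] conjunct2[OF d] unfolding s by metis+
          then show False using 3 by linarith
        qed
        then show ?thesis using n[OF ij False] mult_nbr[of "e i" "e j"] by auto
      qed
      then show "mult m Q (?ys ! i) (?ys ! j) = (if j = Suc i mod length ?ys \<or> i = Suc j mod length ?ys then 1 else 0)"
        using ij by simp
    qed
    moreover have "card (set ?ys) = k" using inj(1) by (simp add: card_image atLeast0LessThan)
    ultimately have "hole m Q (set ?ys)" unfolding hole_def using 3 by (intro conjI exI[of _ ?ys] refl) (simp_all only:)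
    then have S: "set ?ys = S" using holes by blast
    have "set ?ys \<subseteq> e ` {..<k}" by (simp add: atLeast0LessThan)
    then show ?thesis unfolding S .
  qed
qed

lemma dual_fc: "dual_graph fc V (fc ` halves V)"
proof
  show "finite V" by (rule finite_V)
  show "fc ` halves V = fc ` (V \<times> UNIV)" by (simp add: halves_def)
  show "V \<noteq> {}" using card_V pq_pos by auto
  fix a b assume "a \<in> fc ` halves V" "b \<in> fc ` halves V"
  then show "linked fc V a b" using linked_fc by (auto simp: halves_def)
qed

end

text \<open>A shortest path repeats no node.\<close>

lemma simple_path:
  assumes "linked en T a b"
  obtains n f where "f 0 = a" "f n = b" "\<And>i. i < n \<Longrightarrow> adj en T (f i) (f (Suc i))" "inj_on f {..n}"
proof -
  define n where "n = (LEAST n. (adj en T ^^ n) a b)"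
  have ex: "\<exists>n. (adj en T ^^ n) a b" using assms by (simp add: rtranclp_power)
  have n: "(adj en T ^^ n) a b" unfolding n_def by (rule LeastI_ex[OF ex])
  have least: "n \<le> k" if "(adj en T ^^ k) a b" for k unfolding n_def using that by (rule Least_le)
  obtain f where f: "f 0 = a" "f n = b" "\<And>i. i < n \<Longrightarrow> adj en T (f i) (f (Suc i))"
    using n unfolding relpowp_fun_conv by blast
  have seg: "(adj en T ^^ (j - i)) (f i) (f j)" if "i \<le> j" "j \<le> n" for i j
    unfolding relpowp_fun_conv using f(3) that by (intro exI[of _ "\<lambda>k. f (i + k)"]) auto
  have "f i \<noteq> f j" if "i < j" "j \<le> n" for i j
  proof
    assume eq: "f i = f j"
    have "(adj en T ^^ i) a (f i)" "(adj en T ^^ (n - j)) (f i) b" using seg[of 0 i] seg[of j n] that f eq by auto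
    then have "(adj en T ^^ (i + (n - j))) a b" unfolding relpowp_add by blast
    then show False using least[of "i + (n - j)"] that by linarith
  qed
  then have "inj_on f {..n}" by (metis atMost_iff inj_onI nat_neq_iff)
  then show thesis using that f by blast
qed

context tilde_cliques
begin

text \<open>The rest of the central cycle links the two faces of its first arc.\<close>

lemma detour: "linked fc (V - {xs ! 0}) (fc (xs ! 0, True)) (fc (xs ! 0, False))"
proof -
  let ?E = "V - {xs ! 0}"
  have "i < l \<Longrightarrow> linked fc ?E (cf 0) (cf i)" for i
  proof (induction i)
    case (Suc i)
    have "xs ! Suc i \<noteq> xs ! 0" using nth_eq_iff_index_eq[OF xs(1) Suc.prems, of 0] l_pos by simp
    then have "linked fc ?E (fc (xs ! Suc i, False)) (fc (xs ! Suc i, True))"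
      using xs_V[OF Suc.prems] by (intro linked_edge) simp
    moreover have "fc (xs ! Suc i, False) = cf i" using cf_prv[OF Suc.prems] Suc.prems by (simp add: prv_eq)
    ultimately have "linked fc ?E (cf i) (cf (Suc i))" by (simp add: cf_def)
    then show ?case using Suc.IH Suc.prems by (meson Suc_lessD rtranclp_trans)
  qed simp
  from this[OF prv_lt[of 0]] show ?thesis using cf_prv[of 0] l_pos by (simp add: cf_def)
qed

lemma linked_detour: "a \<in> fc ` halves V \<Longrightarrow> b \<in> fc ` halves V \<Longrightarrow> linked fc (V - {xs ! 0}) a b"
  using dual_graph.conn[OF dual_fc] detour linked_remove[of fc V "xs ! 0" True] by simp

lemma central_0: "xs ! 0 \<in> V" "xs ! 0 \<in> S"
  using xs_V[of 0] l_pos by auto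

text \<open>One arc of the central cycle can be removed without disconnecting the dual
  graph.\<close>

lemma card_faces_le: "card (fc ` halves V) \<le> card V"
proof -
  interpret dual_graph fc V "fc ` halves V" by (rule dual_fc)
  have "card (fc ` halves V) \<le> card (V - {xs ! 0}) + 1"
    using linked_detour by (intro card_N_le) auto
  also have "\<dots> = card V" using card_Suc_Diff1[OF finite_V central_0(1)] by simp
  finally show ?thesis .
qed

text \<open>Take a spanning tree that avoids the central arc \<open>xs ! 0\<close>. Any other arc
  outside the tree would close a cycle with a tree path, and by \<open>closed_walk\<close> this
  cycle contains all central arcs, among them \<open>xs ! 0\<close>. So the tree uses all arcs but
  one.\<close>

lemma card_faces_ge: "card V \<le> card (fc ` halves V)"
proof -
  interpret dual_graph fc V "fc ` halves V" by (rule dual_fc)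
  let ?N = "fc ` halves V"
  have r: "cf 0 \<in> ?N" using xs_V[of 0] l_pos by (auto simp: cf_def)
  note z = central_0
  let ?E = "V - {xs ! 0}"
  have lE: "linked fc ?E (cf 0) a" if "a \<in> ?N" for a by (rule linked_detour[OF r that])
  obtain T where T: "T \<subseteq> ?E" "card T + 1 = card ?N" "\<And>a. a \<in> ?N \<Longrightarrow> linked fc T (cf 0) a"
  proof (rule spanning_tree[OF finite_N r lE])
    show "fc (e, d) \<in> ?N" if "e \<in> ?E" for e d using end_in_N that by blast
  qed blast+
  have "?E \<subseteq> T"
  proof (rule ccontr)
    assume "\<not> ?E \<subseteq> T"
    then obtain e where e: "e \<in> V" "e \<noteq> xs ! 0" "e \<notin> T" by blast
    have "linked fc T (fc (e, True)) (fc (e, False))"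
      using linked_sym[OF T(3)[OF end_in_N[OF e(1), of True]]] T(3)[OF end_in_N[OF e(1), of False]] by (rule rtranclp_trans)
    then obtain n f where f: "f 0 = fc (e, True)" "f n = fc (e, False)" "\<And>i. i < n \<Longrightarrow> adj fc T (f i) (f (Suc i))" "inj_on f {..n}"
      by (rule simple_path) blast
    have "\<exists>y\<in>T. \<exists>d. f i = fc (y, d) \<and> f (Suc i) = fc (y, \<not> d)" if "i < n" for i
      using f(3)[OF that] by (simp add: adj_def)
    then obtain y where y: "\<And>i. i < n \<Longrightarrow> y i \<in> T \<and> (\<exists>d. f i = fc (y i, d) \<and> f (Suc i) = fc (y i, \<not> d))"
      by metis
    have n: "n \<noteq> 0" using f(1,2) fc_loop[OF e(1), of True] by (intro notI) simp
    have feq: "f i = f j \<longleftrightarrow> i = j" if "i \<le> n" "j \<le> n" for i j using f(4) that by (auto simp: inj_on_def)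
    have yinj: "y i \<noteq> y j" if ij: "i < j" "j < n" for i j
    proof
      assume eq: "y i = y j"
      obtain d where d: "f i = fc (y i, d)" using y[of i] ij by auto
      obtain d' where d': "f j = fc (y j, d')" "f (Suc j) = fc (y j, \<not> d')" using y[of j] ij by auto
      have "f i = f j \<or> f i = f (Suc j)" using d d' eq by (cases "d = d'") auto
      then show False using feq[of i j] feq[of i "Suc j"] ij by auto
    qed
    define g where "g j = (if j < n then y j else e)" for j
    have gT: "g j \<in> T \<longleftrightarrow> j < n" for j using y e(3) by (simp add: g_def)
    \<comment> \<open>The tree path between the two faces of \<open>e\<close>, closed up by
      \<open>e\<close> as its last arc.\<close>
    have "S \<subseteq> g ` {..<Suc n}"
    proof (rule closed_walk[where c = f])
      show "2 \<le> Suc n" using n by simp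
      show "inj_on f {..<Suc n}" using f(4) by (simp add: lessThan_Suc_atMost)
      show "inj_on g {..<Suc n}"
      proof (rule inj_onI)
        fix i j assume ij: "i \<in> {..<Suc n}" "j \<in> {..<Suc n}" and eq: "g i = g j"
        show "i = j"
        proof (cases "i < n \<and> j < n")
          case True
          then show ?thesis using yinj[of i j] yinj[of j i] eq by (auto simp: g_def intro: linorder_cases)
        next
          case False
          then show ?thesis using gT[of i] gT[of j] eq ij by auto
        qed
      qed
      fix j assume j: "j < Suc n"
      show "g j \<in> V" using y[of j] T(1) e(1) by (auto simp: g_def)
      show "\<exists>d. fc (g j, d) = f j \<and> fc (g j, \<not> d) = f (Suc j mod Suc n)"
      proof (cases "j < n")
        case True
        then show ?thesis using y[of j] by (auto simp: g_def)
      next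
        case False
        then have "j = n" using j by simp
        then show ?thesis using f(1,2) by (intro exI[of _ False]) (simp add: g_def)
      qed
    qed
    then obtain j where "xs ! 0 = g j" using z(2) by blast
    then show False using y[of j] T(1) e(2) by (auto simp: g_def split: if_splits)
  qed
  then have "T = ?E" using T(1) by blast
  moreover have "card ?E + 1 = card V" using card_Suc_Diff1[OF finite_V z(1)] by simp
  ultimately show ?thesis using T(2) by simp
qed

lemma sum_central:
  assumes c: "\<And>i. i < l \<Longrightarrow> F (cf i) = (w i :: nat)" and z: "\<And>G t. pure_face V K G t \<Longrightarrow> F G = 0"
  shows "(\<Sum>G\<in>face K ` halves V. F G) = (\<Sum>i<l. w i)"
proof -
  have "(\<Sum>G\<in>face K ` halves V. F G) = (\<Sum>G\<in>cf ` {..<l}. F G)"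
  proof (rule sum.mono_neutral_right)
    show "finite (face K ` halves V)" using finite_V by (simp add: halves_def)
    show "cf ` {..<l} \<subseteq> face K ` halves V" using xs_V by (auto simp: cf_def)
    show "\<forall>G\<in>face K ` halves V - cf ` {..<l}. F G = 0"
    proof
      fix G assume G: "G \<in> face K ` halves V - cf ` {..<l}"
      then obtain v b where v: "v \<in> V" "G = fc (v, b)" by (auto simp: halves_def)
      then have "pure_face V K G (lbl K (v, b))" using pure_conf[of v b] G by auto
      then show "F G = 0" by (rule z)
    qed
  qed
  also have "\<dots> = (\<Sum>i<l. F (cf i))" using cf_inj by (subst sum.reindex) (auto simp: inj_on_def)
  also have "\<dots> = (\<Sum>i<l. w i)" using c by simp
  finally show ?thesis .
qed

lemma side_out: "side K t v \<longleftrightarrow> v \<notin> S \<and> lbl K (v, True) = t"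
  by (cases "v \<in> S") (auto simp: side_def lbl_S lbl_outside)

text \<open>The components are disjoint and exhaust the vertices off the central cycle, so counting
  arcs by label amounts to adding the sizes of the components with that label.\<close>

lemma card_side:
  assumes "P \<subseteq> W" and side: "\<And>w v. w \<in> W \<Longrightarrow> v \<in> component R w \<Longrightarrow> lbl K (v, True) = t \<longleftrightarrow> w \<in> P"
  shows "card {v \<in> V. side K t v} = (\<Sum>w\<in>P. card (component R w))"
proof -
  have "{v \<in> V. side K t v} = (\<Union>w\<in>P. component R w)"
  proof (rule set_eqI)
    fix v
    have "v \<in> V \<and> side K t v \<longleftrightarrow> v \<in> verts R \<and> lbl K (v, True) = t" unfolding side_out verts_R by blast
    also have "\<dots> \<longleftrightarrow> (\<exists>w\<in>P. v \<in> component R w)" unfolding R_decomp(1) using side assms(1) by blast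
    finally show "v \<in> {v \<in> V. side K t v} \<longleftrightarrow> v \<in> (\<Union>w\<in>P. component R w)" by simp
  qed
  moreover have "finite W"
  proof (rule finite_subset)
    show "W \<subseteq> V" using W_outside by blast
  qed (rule finite_V)
  moreover have "finite (component R w)" for w
  proof (rule finite_subset)
    show "component R w \<subseteq> V" using verts_R by (auto simp: component_def)
  qed (rule finite_V)
  moreover have "component R w \<inter> component R w' = {}" if "w \<in> P" "w' \<in> P" "w \<noteq> w'" for w w'
    using R_decomp(3) assms(1) that by blast
  ultimately show ?thesis
    using assms(1) by (simp add: card_UN_disjoint finite_subset)
qed

abbreviation "Wp \<equiv> peripheral_of_color Q xs D (m - 1)"
abbreviation "Wq \<equiv> peripheral_of_color Q xs D (2 * m + 1)"

lemma Wp_sub: "Wp \<subseteq> W" "Wq \<subseteq> W"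
  by (auto simp: peripheral_of_color_def peripheral_def)

lemma Wq: "w \<in> W \<Longrightarrow> w \<in> Wq \<longleftrightarrow> w \<notin> Wp"
proof -
  assume "w \<in> W"
  then obtain i where i: "i < l" "w \<in> peripheral_at xs D i" by (auto simp: peripheral_def)
  show ?thesis using peripheral_color[OF i] peripheral_admissible[OF i] m_pos by auto
qed

lemma pq: "p = l - h + (\<Sum>w\<in>Wp. card (component R w))" "q = h + (\<Sum>w\<in>Wq. card (component R w))"
  using decomp unfolding decomposition_def Let_def by blast+

theorem annulus_conf: "annulus m V K p q"
proof -
  interpret coloring m V K by (rule coloring_conf)
  have wt: "(\<Sum>F\<in>face K ` halves V. wt V K F) = h * m"
    using sum_central[of "wt V K" "\<lambda>i. color Q (xs ! i) (cyc_next xs i)"] wt_central[OF central_conf] wt_pure(1) xs_sum by simp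
  have "(\<Sum>F\<in>face K ` halves V. wb V K F) = (\<Sum>i<l. color Q (cyc_next xs i) (xs ! i))"
    using wb_central[OF central_conf] wt_pure(2) by (intro sum_central) auto
  moreover have "(\<Sum>i<l. color Q (cyc_next xs i) (xs ! i)) + (\<Sum>i<l. color Q (xs ! i) (cyc_next xs i)) = l * m"
    using color_sum[OF nbr_next] by (simp add: sum.distrib[symmetric] add.commute)
  ultimately have "(\<Sum>F\<in>face K ` halves V. wb V K F) + h * m = l * m" using xs_sum by simp
  then have wb: "(\<Sum>F\<in>face K ` halves V. wb V K F) = (l - h) * m" by (simp add: diff_mult_distrib)
  have P: "card {v \<in> V. side K True v} = (\<Sum>w\<in>Wp. card (component R w))"
    using lbl_component by (intro card_side Wp_sub) auto
  have Q: "card {v \<in> V. side K False v} = (\<Sum>w\<in>Wq. card (component R w))"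
    using lbl_component Wq by (intro card_side Wp_sub) auto
  show ?thesis
  proof
    show "face K (v, True) \<noteq> face K (v, False)" if "v \<in> V" for v using fc_loop[OF that, of True] by simp
    show "linked (face K) V a b" if "a \<in> face K ` halves V" "b \<in> face K ` halves V" for a b
      using dual_fc that dual_graph.conn[of fc V "fc ` halves V"] by simp
    show "card (face K ` halves V) = card V" using card_faces_le card_faces_ge by simp
    show "ok_face V K F" if F: "F \<in> face K ` halves V" for F
    proof -
      obtain e where e: "e \<in> halves V" "F = face K e" using F by blast
      obtain v b where "e = (v, b)" by (cases e)
      with e have v: "v \<in> V" "F = fc (v, b)" by simp_all
      show ?thesis
      proof (cases "\<exists>i<l. F = cf i")
        case True
        then show ?thesis using central_conf unfolding ok_face_def by blast
      next
        case False
        then show ?thesis using pure_conf[of v b] v unfolding ok_face_def by blast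
      qed
    qed
    show "card V = p + q" by (rule card_V)
    show "(\<Sum>F\<in>face K ` halves V. wt V K F) + m * card {v \<in> V. side K False v} = m * q"
      unfolding wt Q pq(2) by (simp add: algebra_simps)
    show "(\<Sum>F\<in>face K ` halves V. wb V K F) + m * card {v \<in> V. side K True v} = m * p"
      unfolding wb P pq(1) by (simp add: algebra_simps)
    show "0 < (\<Sum>F\<in>face K ` halves V. wt V K F)" unfolding wt using xs(4) m_pos by simp
    show "0 < (\<Sum>F\<in>face K ` halves V. wb V K F)" unfolding wb using xs(5) m_pos by simp
  qed
qed

end

lemma class_A_tilde_conf:
  fixes Q :: "'a cquiver"
  assumes "1 \<le> m" "1 \<le> p" "1 \<le> q" "Q \<in> class_A_tilde m p q"
  obtains K :: "('a, 'a set \<times> bool) conf" where "annulus m (verts Q) K p q" "Q = quiv (verts Q) K"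
proof -
  have c: "colored_quiver m Q" "connected_quiver Q" "card (verts Q) = p + q"
    using assms(4) by (simp_all add: class_A_tilde_def)
  obtain xs h D where d: "central_cycle m Q xs h"
    "if length xs = 2
     then (\<exists>c\<le>m. arr Q (xs ! 0) (xs ! 1) c = 2 \<and> arr Q (xs ! 1) (xs ! 0) (m - c) = 2) \<and>
          (\<forall>u\<in>verts Q. \<forall>v\<in>verts Q. u \<noteq> v \<and> {u, v} \<noteq> set xs \<longrightarrow> mult m Q u v \<le> 1)
     else simple m Q"
    "\<forall>S. hole m Q S \<longleftrightarrow> length xs \<ge> 4 \<and> S = set xs"
    "\<forall>v\<in>verts Q. card (neighbors Q v) \<ge> 1 \<longrightarrow> (\<exists>C B. vertex_cliques m Q (set xs) v C B)"
    "boundary_cliques m Q xs D"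
    "\<forall>x y z. triangle Q x y z \<and> \<not> (length xs = 3 \<and> {x, y, z} = set xs) \<longrightarrow> admissible m Q x y z"
    "decomposition m p q Q xs h D"
    using assms(4) unfolding class_A_tilde_def mem_Collect_eq by (elim conjE exE) (rule that; assumption)
  have "tilde m p q Q xs h D"
  proof (rule tilde.intro[OF assms(1-3) c d(1,2) spec[OF d(3)] _ d(5) _ d(7)])
    show "\<exists>C B. vertex_cliques m Q (set xs) v C B" if "v \<in> verts Q" "1 \<le> card (neighbors Q v)" for v
      using d(4) that by blast
    show "admissible m Q x y z" if "triangle Q x y z" "\<not> (length xs = 3 \<and> {x, y, z} = set xs)" for x y z
      using d(6)[rule_format, OF conjI[OF that]] .
  qed
  then interpret tilde m p q Q xs h D .
  obtain cl where "\<And>i. i < l \<Longrightarrow> cl (xs ! i, True) = D i" "\<And>i. i < l \<Longrightarrow> cl (xs ! i, False) = D (prv i)"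
    "\<And>v. v \<in> V \<Longrightarrow> good v (cl (v, True)) (cl (v, False))"
    by (rule obtain_cl) blast
  then interpret tilde_cliques m p q Q xs h D cl by unfold_locales
  show thesis by (rule that[OF annulus_conf quiv_conf])
qed

theorem theoremA:
  fixes Q :: "'a cquiver" and m p q :: nat
  assumes "m \<ge> 1" and "p \<ge> 1" and "q \<ge> 1"
    and "colored_quiver m Q" and "connected_quiver Q"
  shows "(\<exists>R :: 'a cquiver. colored_quiver m R \<and> quiver_iso R (A_tilde m p q) \<and>
            mutation_equivalent m Q R) \<longleftrightarrow>
         Q \<in> class_A_tilde m p q"
proof
  assume "\<exists>R :: 'a cquiver. colored_quiver m R \<and> quiver_iso R (A_tilde m p q) \<and> mutation_equivalent m Q R"
  then obtain R :: "'a cquiver" where R: "colored_quiver m R" "quiver_iso R (A_tilde m p q)" "obtained_by_mutations m R Q"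
    by (auto simp: mutation_equivalent_def)
  obtain K :: "('a, nat) conf" where K: "annulus m (verts R) K p q" "R = quiv (verts R) K"
    by (rule A_tilde_conf[OF assms(1-3) R(1,2)])
  have "obtained_by_mutations m (quiv (verts R) K) Q" using R(3) unfolding K(2)[symmetric] .
  then obtain J :: "('a, nat) conf" where "annulus m (verts R) J p q" "Q = quiv (verts R) J"
    using obtained_annulus[OF _ K(1)] by blast
  then show "Q \<in> class_A_tilde m p q" using annulus.quiv_in_class by simp
next
  assume "Q \<in> class_A_tilde m p q"
  then obtain K :: "('a, 'a set \<times> bool) conf" where K: "annulus m (verts Q) K p q" "Q = quiv (verts Q) K"
    by (rule class_A_tilde_conf[OF assms(1-3)])
  obtain J xs where J: "flips m (verts Q) K J" "annulus m (verts Q) J p q" "distinct xs" "set xs = verts Q" "length xs = p + q"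
    and arr: "\<And>i j c. i < p + q \<Longrightarrow> j < p + q \<Longrightarrow> i \<noteq> j \<Longrightarrow> arr (quiv (verts Q) J) (xs ! i) (xs ! j) c =
      of_bool (j = Suc i mod (p + q) \<and> (if i < q then m else 0) = c) +
      of_bool (i = Suc j mod (p + q) \<and> m - (if j < q then m else 0) = c)"
    using reach_ring[OF K(1)] by blast
  let ?R = "quiv (verts Q) J"
  have "quiver_iso ?R (A_tilde m p q)"
  proof (rule ring_iso[OF assms(2,3,1) J(3) _ J(5)])
    show "set xs = verts ?R" using J(4) by simp
    show "arr ?R (xs ! i) (xs ! j) c = ring_arr m p q i j c" if "i < p + q" "j < p + q" "i \<noteq> j" for i j c
      unfolding ring_arr_def by (rule arr[OF that])
    show "arr ?R x x c = 0" for x c by (rule arr_quiv_0) simp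
  qed
  moreover have "mutation_equivalent m Q ?R"
    using flips_annulus[OF J(1) K(1)] unfolding mutation_equivalent_def K(2)[symmetric] by blast
  moreover have "colored_quiver m ?R" by (rule annulus.colored_quiv[OF J(2)])
  ultimately show "\<exists>R :: 'a cquiver. colored_quiver m R \<and> quiver_iso R (A_tilde m p q) \<and> mutation_equivalent m Q R"
    by blast
qed

end
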